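(* Let $M\in \mathrm{Sp}(2,\mathbb{Z})=\mathrm{SL}(2,\mathbb{Z})$ have eigenvalues $\lambda,\lambda^{-1}$ with $\lambda>1$. There is a neighborhood $U$ of $0$ in $\mathbb{T}^2$ (depending on $M$) such that for every $\nu\in C^\infty(\mathbb{T}^2)$ supported in $U$ and equal to $0$ near the origin, $$\sup_{\mu\in\mathrm{Spec}(\mathrm{Op}_N(\nu)\widehat M_N)}|\mu|=O(h^\infty),\qquad h=\frac1{2\pi N},$$ as $N\to\infty$ through even integers, where $\mathrm{Op}_N(\nu)\widehat M_N$ acts on $H_N$. That is, for every $n\in\mathbb{N}$ there is $C_n$ such that the left side is at most $C_nh^n$ for all even $N$.
   Context: $\mathbb{T}^2=\mathbb{R}^2/\mathbb{Z}^2$. For $N\in\mathbb{N}$ and $h=\frac1{2\pi N}$, $H_N\subset\mathcal S'(\mathbb{R})$ is the $N$-dimensional Hilbert space with orthonormal basis (by definition) $Q_n=\frac1{\sqrt N}\sum_{k\in\mathbb{Z}}\delta_{x=k+\frac nN}$, $n=0,\dots,N-1$. For a symbol $a$ on $\mathbb{R}^2$ the Weyl quantization is $(\mathrm{Op}_h(a)u)(x)=\frac1{2\pi h}\iint e^{\frac ih(x-y)\xi}a(\frac{x+y}2,\xi)u(y)\,dy\,d\xi$, extended to tempered distributions. For $a\in C^\infty(\mathbb{T}^2)$ with doubly periodic lift $\tilde a$ to $\mathbb{R}^2$, $\mathrm{Op}_N(a)=\mathrm{Op}_h(\tilde a)|_{H_N}:H_N\to H_N$. For $M\in \mathrm{Sp}(2,\mathbb{R})$,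 a semiclassical metaplectic operator $\widehat M$ is a unitary operator on $L^2(\mathbb{R})$ (extended to $\mathcal S'(\mathbb{R})$) satisfying $\mathrm{Op}_h(a)\widehat M=\widehat M\,\mathrm{Op}_h(a\circ M)$ for symbols $a$ with bounded derivatives; it is determined by $M$ up to a unimodular constant (which is irrelevant here). For $M\in \mathrm{Sp}(2,\mathbb{Z})$ and $N$ even, $\widehat M_N=\widehat M|_{H_N}$, which is a unitary map of $H_N$. *)

theory Defs
  imports "HOL-Analysis.Analysis"
begin

section \<open>Smooth functions\<close>

text \<open>
  Iterated derivatives on the line, and iterated directional derivatives on a Euclidean space.
  The library derivatives are total functions, so smoothness asks that each iterated derivative
  be differentiable everywhere (hence continuous).
\<close>

definition nth_deriv :: "nat \<Rightarrow> (real \<Rightarrow> complex) \<Rightarrow> real \<Rightarrow> complex" where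
  "nth_deriv l f = ((\<lambda>g x. vector_derivative g (at x)) ^^ l) f"

primrec partials :: "'a::euclidean_space list \<Rightarrow> ('a \<Rightarrow> complex) \<Rightarrow> 'a \<Rightarrow> complex" where
  "partials [] f = f"
| "partials (v # vs) f = (\<lambda>p. frechet_derivative (partials vs f) (at p) v)"

definition smooth :: "('a::euclidean_space \<Rightarrow> complex) \<Rightarrow> bool" where
  "smooth f \<longleftrightarrow> (\<forall>vs. set vs \<subseteq> Basis \<longrightarrow> (\<forall>p. partials vs f differentiable (at p)))"

text \<open>The order zero derivative is included, so these symbols are themselves bounded.\<close>

definition bounded_symbol :: "('a::euclidean_space \<Rightarrow> complex) \<Rightarrow> bool" where
  "bounded_symbol f \<longleftrightarrow>
     smooth f \<and> (\<forall>vs. set vs \<subseteq> Basis \<longrightarrow> bounded (range (partials vs f)))"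

section \<open>Schwartz functions and tempered distributions\<close>

definition schwartz :: "(real \<Rightarrow> complex) set" where
  "schwartz = {f. (\<forall>l x. nth_deriv l f differentiable (at x)) \<and>
                  (\<forall>j l. bounded (range (\<lambda>x. x ^ j *\<^sub>R nth_deriv l f x)))}"

definition schwartz_seminorm :: "nat \<Rightarrow> nat \<Rightarrow> (real \<Rightarrow> complex) \<Rightarrow> real" where
  "schwartz_seminorm j l f = (SUP x. norm (x ^ j *\<^sub>R nth_deriv l f x))"

text \<open>
  A tempered distribution is a functional on all functions which vanishes, by convention, on
  arguments that are not Schwartz functions; equality of distributions is then equality of
  functions. The topology of pointwise convergence on the function space
  (\<^theory>\<open>HOL-Analysis.Function_Topology\<close>) induces the weak-* topology.
\<close>

type_synonym functional = "(real \<Rightarrow> complex) \<Rightarrow> complex"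

definition tempered :: "functional set" where
  "tempered = {u.
     (\<forall>\<phi>. \<phi> \<notin> schwartz \<longrightarrow> u \<phi> = 0) \<and>
     (\<forall>\<phi>\<in>schwartz. \<forall>\<psi>\<in>schwartz. \<forall>c. u (\<lambda>x. c * \<phi> x + \<psi> x) = c * u \<phi> + u \<psi>) \<and>
     (\<exists>C m. \<forall>\<phi>\<in>schwartz. cmod (u \<phi>) \<le> C * (\<Sum>j\<le>m. \<Sum>l\<le>m. schwartz_seminorm j l \<phi>))}"

definition square_integrable :: "(real \<Rightarrow> complex) set" where
  "square_integrable =
     {f. f \<in> borel_measurable lborel \<and> integrable lborel (\<lambda>x. (cmod (f x))\<^sup>2)}"

definition l2_inner :: "(real \<Rightarrow> complex) \<Rightarrow> (real \<Rightarrow> complex) \<Rightarrow> complex" where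
  "l2_inner f g = (LINT x|lborel. f x * cnj (g x))"

text \<open>The embedding of \<open>L\<^sup>2\<close> into the tempered distributions.\<close>

definition regular :: "(real \<Rightarrow> complex) \<Rightarrow> functional" where
  "regular f = (\<lambda>\<phi>. if \<phi> \<in> schwartz then (LINT x|lborel. f x * \<phi> x) else 0)"

section \<open>Weyl quantization\<close>

text \<open>
  Phase space is \<^typ>\<open>real^2\<close>, with first component the position and second component the
  frequency. The double integral is the iterated one: for a Schwartz function \<open>u\<close> and a bounded
  symbol the inner integral is rapidly decaying in \<open>\<xi>\<close>, so both integrals converge absolutely.
\<close>

definition weyl :: "real \<Rightarrow> (real^2 \<Rightarrow> complex) \<Rightarrow> (real \<Rightarrow> complex) \<Rightarrow> real \<Rightarrow> complex" where
  "weyl h a u x = complex_of_real (1 / (2 * pi * h)) *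
     (LINT \<xi>|lborel. LINT y|lborel.
        exp (\<i> / complex_of_real h * complex_of_real ((x - y) * \<xi>)) *
        a (vector [(x + y) / 2, \<xi>]) * u y)"

text \<open>
  Extension to tempered distributions by duality. Exchanging \<open>x\<close> and \<open>y\<close> in the integral kernel
  amounts to replacing \<open>\<xi>\<close> by \<open>-\<xi>\<close>, so the transpose, for the bilinear pairing, of the
  quantization of \<open>a(x, \<xi>)\<close> is the quantization of \<open>a(x, -\<xi>)\<close>.
\<close>

definition weyl_dist :: "real \<Rightarrow> (real^2 \<Rightarrow> complex) \<Rightarrow> functional \<Rightarrow> functional" where
  "weyl_dist h a u =
     (\<lambda>\<phi>. if \<phi> \<in> schwartz then u (weyl h (\<lambda>p. a (vector [p $ 1, - (p $ 2)])) \<phi>) else 0)"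

section \<open>Metaplectic operators\<close>

text \<open>
  The operator is given by its action on tempered distributions. Since \<open>L\<^sup>2\<close> is weak-* dense
  there, weak-* continuity makes \<open>W\<close> the unique continuous extension of its restriction to
  \<open>L\<^sup>2\<close>, and the second group of conditions says that this restriction is unitary.
\<close>

definition metaplectic :: "real \<Rightarrow> real^2^2 \<Rightarrow> (functional \<Rightarrow> functional) \<Rightarrow> bool" where
  "metaplectic h M W \<longleftrightarrow>
     (W \<in> tempered \<rightarrow> tempered \<and>
      (\<forall>u\<in>tempered. \<forall>v\<in>tempered. \<forall>c. W (\<lambda>\<phi>. c * u \<phi> + v \<phi>) = (\<lambda>\<phi>. c * W u \<phi> + W v \<phi>)) \<and>
      continuous_on tempered W) \<and>
     (W ` regular ` square_integrable = regular ` square_integrable \<and>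
      (\<forall>f\<in>square_integrable. \<forall>g\<in>square_integrable.
       \<forall>f'\<in>square_integrable. \<forall>g'\<in>square_integrable.
         W (regular f) = regular f' \<longrightarrow> W (regular g) = regular g' \<longrightarrow>
         l2_inner f' g' = l2_inner f g)) \<and>
     (\<forall>a. bounded_symbol a \<longrightarrow>
        (\<forall>u\<in>tempered. weyl_dist h a (W u) = W (weyl_dist h (\<lambda>p. a (M *v p)) u)))"

section \<open>The torus\<close>

definition lattice_equiv :: "real^2 \<Rightarrow> real^2 \<Rightarrow> bool" where
  "lattice_equiv p q \<longleftrightarrow> (\<forall>i. p $ i - q $ i \<in> \<int>)"

lemma equivp_lattice_equiv: "equivp lattice_equiv"
proof (rule equivpI)
  show "reflp lattice_equiv"
    by (simp add: reflp_def lattice_equiv_def)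
  show "symp lattice_equiv"
    unfolding symp_def lattice_equiv_def by (metis Ints_minus minus_diff_eq)
  show "transp lattice_equiv"
  proof (rule transpI)
    fix p q r assume "lattice_equiv p q" "lattice_equiv q r"
    then have "p $ i - r $ i \<in> \<int>" for i
      using Ints_add[of "p $ i - q $ i" "q $ i - r $ i"] by (simp add: lattice_equiv_def)
    then show "lattice_equiv p r"
      by (simp add: lattice_equiv_def)
  qed
qed

quotient_type torus = "real^2" / lattice_equiv
  morphisms rep_torus to_torus
  by (rule equivp_lattice_equiv)

instantiation torus :: topological_space
begin

definition open_torus :: "torus set \<Rightarrow> bool" where
  "open_torus U \<longleftrightarrow> open (to_torus -` U)"

instance
proof
  show "open (UNIV :: torus set)"
    by (simp add: open_torus_def)
  show "open (S \<inter> T)" if "open S" "open T" for S T :: "torus set"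
    using that by (auto simp: open_torus_def vimage_Int)
  show "open (\<Union>K)" if "\<forall>S\<in>K. open S" for K :: "torus set set"
    using that by (auto simp: open_torus_def vimage_Union)
qed

end

definition smooth_torus :: "(torus \<Rightarrow> complex) \<Rightarrow> bool" where
  "smooth_torus \<nu> \<longleftrightarrow> smooth (\<nu> \<circ> to_torus)"

section \<open>Quantization of the torus\<close>

definition planck :: "nat \<Rightarrow> real" where
  "planck N = 1 / (2 * pi * real N)"

definition dirac_comb :: "nat \<Rightarrow> nat \<Rightarrow> functional" where
  "dirac_comb N n = (\<lambda>\<phi>. if \<phi> \<in> schwartz
     then complex_of_real (1 / sqrt (real N)) *
            (\<Sum>\<^sub>\<infinity>k\<in>(UNIV::int set). \<phi> (real_of_int k + real n / real N))
     else 0)"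

definition torus_states :: "nat \<Rightarrow> functional set" where
  "torus_states N = {u. \<exists>c. u = (\<lambda>\<phi>. \<Sum>n<N. c n * dirac_comb N n \<phi>)}"

definition torus_op :: "nat \<Rightarrow> (torus \<Rightarrow> complex) \<Rightarrow> functional \<Rightarrow> functional" where
  "torus_op N \<nu> = weyl_dist (planck N) (\<nu> \<circ> to_torus)"

definition spectrum_on :: "functional set \<Rightarrow> (functional \<Rightarrow> functional) \<Rightarrow> complex set" where
  "spectrum_on H T = {\<mu>. \<not> bij_betw (\<lambda>u. \<lambda>\<phi>. T u \<phi> - \<mu> * u \<phi>) H H}"

section \<open>Integer matrices\<close>

definition real_matrix :: "int^'n^'m \<Rightarrow> real^'n^'m" where
  "real_matrix M = (\<chi> i j. real_of_int (M $ i $ j))"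

definition matrix_eigenvalue :: "real^'n^'n \<Rightarrow> real \<Rightarrow> bool" where
  "matrix_eigenvalue A l \<longleftrightarrow> (\<exists>v. v \<noteq> 0 \<and> A *v v = l *\<^sub>R v)"

end

theory Submission
  imports Defs "HOL-Library.Function_Algebras"
begin

text \<open>
  Write \<open>A\<close> for the quantization of \<open>\<nu>\<close> and \<open>W\<close> for the metaplectic operator. Conjugation by \<open>W\<close>
  composes symbols with \<open>M\<close>, so \<open>(A W)\<^sup>K\<close> is the product of the quantizations of
  \<open>\<nu>, \<nu> \<circ> M\<^sup>-\<^sup>1, \<dots>, \<nu> \<circ> M\<^sup>-\<^sup>(\<^sup>K\<^sup>-\<^sup>1\<^sup>)\<close>, followed by \<open>W\<^sup>K\<close>. An orbit of the
  hyperbolic map that spends a long time in a small neighbourhood of the fixed point is very close to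
  the fixed point at half time, where \<open>\<nu>\<close> vanishes. For \<open>K\<close> large, depending on \<open>\<nu>\<close>, the \<open>K\<close> supports
  therefore have no point in common (\<open>orbit_leaves_support\<close>), and a product of quantizations of
  symbols without common support is \<open>O(h\<^sup>\<infinity>)\<close>. If \<open>\<mu>\<close> is an eigenvalue, \<open>\<bar>\<mu>\<bar>\<^sup>K\<close> is at most the norm of the
  product times the norm of \<open>W\<^sup>K\<close>; this gives the claim once \<open>W\<close> is bounded on torus states.

  The composition of quantizations is handled exactly, through Fourier series. The character with
  frequency \<open>k\<close> quantizes to a phase space translation; on torus states, the quantization of \<open>\<nu>\<close> is the
  sum of these translations weighted with the Fourier coefficients of \<open>\<nu>\<close> (\<open>torus_op_series\<close>). Products
  of translations are translations up to a factor \<open>exp (\<pi> \<i> \<theta> / N)\<close>, where \<open>\<theta>\<close> is an integer quadratic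
  form in the frequencies. Thus \<open>\<mu>\<^sup>K u\<close> is a sum over \<open>K\<close>-tuples of frequencies
  (\<open>eigenvector_expansion\<close>), in which the exponential is expanded in powers of \<open>1 / N\<close>. A power of
  \<open>\<theta>\<close> is a polynomial in the frequencies, and multiplying Fourier coefficients by polynomials
  differentiates the factors. Every term of the expansion is hence a sum of products of derivatives of the
  factors, which vanishes identically because the supports have no common point
  (\<open>negligible_phase_power\<close>, \<open>negligible_bounded\<close>); only the remainder is left
  (\<open>phase_sum_small\<close>).

  Of \<open>W\<close> only characteristic properties are known, and two consequences are needed. First, \<open>W\<close> maps
  torus states to torus states. For even \<open>N\<close>, the translations by the period lattice fix every torus state, and
  conjugation by \<open>W\<close> permutes them; conversely a tempered distribution fixed by them is a torus state
  (\<open>invariant_distribution_is_state\<close>). Secondly, \<open>W\<close> does not increase the norm of a torus state, with no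
  loss in \<open>N\<close> (\<open>metaplectic_contraction\<close>). Only unitarity on \<open>L\<^sup>2\<close> is known, and torus states are not
  in \<open>L\<^sup>2\<close>. But the mean square, over all phase space translates of a fixed Schwartz function \<open>\<phi>\<close>, of the
  pairing with a torus state is the product of the two squared norms (\<open>mean_zak\<close>). Weak-* continuity
  provides a transpose of \<open>W\<close>, which moves it from the state to \<open>\<phi>\<close>, where it is controlled in \<open>L\<^sup>2\<close>; the
  translation parameter is transformed by an integer matrix of determinant one, which preserves means over the
  torus (\<open>preserves_mean_unimodular\<close>).

  The analysis on the line rests on the uniqueness of Fourier coefficients of continuous periodic functions.
  It yields Poisson summation, and Fourier inversion follows from Poisson summation applied to all
  modulations of a function.
\<close>

lemmas integral_cmult = Henstock_Kurzweil_Integration.integral_mult_right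

section \<open>Unconditional sums of functions\<close>

text \<open>
  Sums over frequencies and lattice points are unordered. Their convergence always comes from a
  numerical majorant.
\<close>

lemma dominated_summable:
  fixes f :: "'i \<Rightarrow> 'b::banach"
  assumes "B summable_on I" and "\<And>i. i \<in> I \<Longrightarrow> norm (f i) \<le> B i"
  shows "(\<lambda>i. norm (f i)) summable_on I" and "f summable_on I"
    and "norm (infsum f I) \<le> infsum B I"
proof -
  show s: "(\<lambda>i. norm (f i)) summable_on I"
    by (rule Infinite_Sum.abs_summable_on_comparison_test'[OF assms])
  then show "f summable_on I" by (rule Infinite_Sum.abs_summable_summable)
  have "norm (infsum f I) \<le> (\<Sum>\<^sub>\<infinity>i\<in>I. norm (f i))" by (rule norm_infsum_bound[OF s])
  also have "\<dots> \<le> infsum B I" by (rule infsum_mono[OF s assms(1)]) (rule assms(2))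
  finally show "norm (infsum f I) \<le> infsum B I" .
qed

lemma continuous_on_infsum:
  fixes f :: "'i \<Rightarrow> 'a::topological_space \<Rightarrow> 'b::banach"
  assumes "\<And>i. continuous_on S (f i)" and "\<And>i x. x \<in> S \<Longrightarrow> norm (f i x) \<le> b i"
    and "b summable_on I"
  shows "continuous_on S (\<lambda>x. \<Sum>\<^sub>\<infinity>i\<in>I. f i x)"
proof (rule uniform_limit_theorem)
  show "uniform_limit S (\<lambda>X y. \<Sum>i\<in>X. f i y) (\<lambda>x. \<Sum>\<^sub>\<infinity>i\<in>I. f i x) (finite_subsets_at_top I)"
    by (rule Weierstrass_m_test_general) (use assms in auto)
  show "\<forall>\<^sub>F X in finite_subsets_at_top I. continuous_on S (\<lambda>y. \<Sum>i\<in>X. f i y)"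
    by (intro always_eventually allI continuous_on_sum assms)
qed auto

lemma integral_infsum_interval:
  fixes f :: "'i \<Rightarrow> real \<Rightarrow> complex"
  assumes "\<And>i. continuous_on {a..b} (f i)" and "\<And>i x. x \<in> {a..b} \<Longrightarrow> norm (f i x) \<le> B i"
    and "B summable_on I"
  shows "((\<lambda>i. integral {a..b} (f i)) has_sum integral {a..b} (\<lambda>x. \<Sum>\<^sub>\<infinity>i\<in>I. f i x)) I"
proof -
  have ul: "uniform_limit {a..b} (\<lambda>X y. \<Sum>i\<in>X. f i y) (\<lambda>x. \<Sum>\<^sub>\<infinity>i\<in>I. f i x)
      (finite_subsets_at_top I)"
    by (rule Weierstrass_m_test_general) (use assms in auto)
  obtain P J where PJ: "\<And>X. ((\<lambda>y. \<Sum>i\<in>X. f i y) has_integral P X) {a..b}"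
    "((\<lambda>x. \<Sum>\<^sub>\<infinity>i\<in>I. f i x) has_integral J) {a..b}"
    "(P \<longlongrightarrow> J) (finite_subsets_at_top I)"
    by (rule uniform_limit_integral[OF ul]) (auto intro!: continuous_on_sum assms)
  have "P X = (\<Sum>i\<in>X. integral {a..b} (f i))" for X
  proof -
    have fi: "f i integrable_on {a..b}" for i
      by (rule integrable_continuous_real) (rule assms)
    have "P X = integral {a..b} (\<lambda>y. \<Sum>i\<in>X. f i y)"
      by (rule integral_unique[symmetric], rule PJ(1))
    also have "\<dots> = (\<Sum>i\<in>X. integral {a..b} (f i))"
    proof (cases "finite X")
      case True
      then show ?thesis by (rule integral_sum) (use fi in auto)
    qed auto
    finally show ?thesis .
  qed
  then have "P = sum (\<lambda>i. integral {a..b} (f i))" by auto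
  then show ?thesis
    using PJ(2,3) by (simp add: has_sum_def integral_unique)
qed

text \<open>
  Termwise differentiation reduces to termwise integration, by the fundamental theorem of calculus
  on an interval around the point.
\<close>

lemma has_vector_derivative_infsum:
  fixes f :: "'i \<Rightarrow> real \<Rightarrow> complex"
  assumes der: "\<And>i x. (f i has_vector_derivative f' i x) (at x)"
    and cont: "\<And>i. continuous_on UNIV (f' i)"
    and bf: "\<And>i x. norm (f i x) \<le> B i" and B: "B summable_on I"
    and bf': "\<And>i x. norm (f' i x) \<le> B' i" and B': "B' summable_on I"
  shows "((\<lambda>x. \<Sum>\<^sub>\<infinity>i\<in>I. f i x) has_vector_derivative (\<Sum>\<^sub>\<infinity>i\<in>I. f' i x)) (at x)"
proof -
  let ?g = "\<lambda>x. \<Sum>\<^sub>\<infinity>i\<in>I. f i x" and ?h = "\<lambda>x. \<Sum>\<^sub>\<infinity>i\<in>I. f' i x"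
  define a b where "a = x - 1" and "b = x + 1"
  have ch: "continuous_on {a..b} ?h"
    by (rule continuous_on_infsum[where b = B'])
      (use assms in \<open>auto intro: continuous_on_subset\<close>)
  have summ: "(\<lambda>i. f i y) summable_on I" for y
    by (rule dominated_summable(2)[OF B]) (rule bf)
  have eq: "?g y = ?g a + integral {a..y} ?h" if y: "y \<in> {a..b}" for y
  proof -
    have ft: "integral {a..y} (f' i) = f i y - f i a" for i
      by (rule integral_unique, rule fundamental_theorem_of_calculus)
        (use y in \<open>auto intro: has_vector_derivative_at_within der\<close>)
    have "((\<lambda>i. integral {a..y} (f' i)) has_sum integral {a..y} ?h) I"
      by (rule integral_infsum_interval[where B = B'])
        (use assms in \<open>auto intro: continuous_on_subset\<close>)
    then have "((\<lambda>i. f i y - f i a) has_sum integral {a..y} ?h) I" by (simp add: ft)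
    moreover have "((\<lambda>i. f i y - f i a) has_sum (?g y - ?g a)) I"
      using has_sum_add[OF has_sum_infsum[OF summ[of y]] has_sum_uminusI[OF has_sum_infsum[OF summ[of a]]]]
      by simp
    ultimately show ?thesis using has_sum_unique by fastforce
  qed
  have "((\<lambda>y. ?g a + integral {a..y} ?h) has_vector_derivative ?h x) (at x within {a..b})"
    using integral_has_vector_derivative[OF ch, of x]
    by (auto intro!: derivative_eq_intros simp: a_def b_def)
  then have "(?g has_vector_derivative ?h x) (at x within {a..b})"
    by (rule has_vector_derivative_transform[rotated 2, where f = "\<lambda>y. ?g a + integral {a..y} ?h"])
      (simp_all only: eq, simp_all add: a_def b_def)
  then show ?thesis
    by (subst (asm) at_within_interior) (auto simp: a_def b_def)
qed

text \<open>
  The majorant is a product of a summable sequence and an integrable function, which makes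
  both hypotheses of the theorem on integrating series immediate. The index type is enumerated to reach
  the version for sequences.
\<close>

lemma integral_infsum:
  fixes f :: "'i::countable \<Rightarrow> real \<Rightarrow> complex"
  assumes f: "\<And>i. f i \<in> borel_measurable lborel"
    and le: "\<And>i x. norm (f i x) \<le> B i * D x" and B: "B summable_on UNIV"
    and D: "integrable lborel D" and B0: "\<And>i. B i \<ge> 0" and D0: "\<And>x. D x \<ge> 0"
  shows "((\<lambda>i. LINT x|lborel. f i x) has_sum (LINT x|lborel. (\<Sum>\<^sub>\<infinity>i. f i x))) UNIV"
    and "integrable lborel (\<lambda>x. \<Sum>\<^sub>\<infinity>i. f i x)"
proof -
  \<comment> \<open>Indices that are not codes carry the zero function.\<close>
  define g where "g n x = (if n \<in> range (to_nat :: 'i \<Rightarrow> nat) then f (from_nat n) x else 0)" for n x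
  define C where "C n = (if n \<in> range (to_nat :: 'i \<Rightarrow> nat) then B (from_nat n) else 0)" for n
  have ext: "infsum h UNIV = (\<Sum>\<^sub>\<infinity>n. if n \<in> range (to_nat :: 'i \<Rightarrow> nat) then h (from_nat n) else 0)"
     "h summable_on UNIV \<longleftrightarrow> (\<lambda>n. if n \<in> range (to_nat :: 'i \<Rightarrow> nat) then h (from_nat n) else 0) summable_on UNIV"
    for h :: "'i \<Rightarrow> 'b::{comm_monoid_add,t2_space}"
  proof -
    have "infsum h UNIV = infsum (\<lambda>n. h (from_nat n)) (range (to_nat :: 'i \<Rightarrow> nat))"
      by (subst infsum_reindex) (auto simp: o_def)
    also have "\<dots> = (\<Sum>\<^sub>\<infinity>n. if n \<in> range (to_nat :: 'i \<Rightarrow> nat) then h (from_nat n) else 0)"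
      by (rule infsum_cong_neutral) auto
    finally show "infsum h UNIV = (\<Sum>\<^sub>\<infinity>n. if n \<in> range (to_nat :: 'i \<Rightarrow> nat) then h (from_nat n) else 0)" .
    have "h summable_on UNIV \<longleftrightarrow> (\<lambda>n. h (from_nat n)) summable_on (range (to_nat :: 'i \<Rightarrow> nat))"
      by (subst summable_on_reindex) (auto simp: o_def)
    also have "\<dots> \<longleftrightarrow> (\<lambda>n. if n \<in> range (to_nat :: 'i \<Rightarrow> nat) then h (from_nat n) else 0) summable_on UNIV"
      by (rule summable_on_cong_neutral) auto
    finally show "h summable_on UNIV \<longleftrightarrow> (\<lambda>n. if n \<in> range (to_nat :: 'i \<Rightarrow> nat) then h (from_nat n) else 0) summable_on UNIV" .
  qed
  have C: "summable C"
    using B unfolding ext(2)[of B] C_def by (rule summable_on_imp_summable)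
  have gle: "norm (g n x) \<le> C n * D x" for n x
    using le by (auto simp: g_def C_def)
  have gm: "g n \<in> borel_measurable lborel" for n
  proof -
    have "g n = (if n \<in> range (to_nat :: 'i \<Rightarrow> nat) then f (from_nat n) else (\<lambda>_. 0))"
      by (auto simp: g_def)
    then show ?thesis using f by simp
  qed
  have fi: "integrable lborel (f i)" for i
    by (rule Bochner_Integration.integrable_bound[OF integrable_mult_right[OF D, of "B i"]])
      (use f le B0 D0 in auto)
  have gi: "integrable lborel (g n)" for n
    using fi by (cases "n \<in> range (to_nat :: 'i \<Rightarrow> nat)") (simp_all add: g_def[abs_def])
  have sn: "summable (\<lambda>n. norm (g n x))" for x
    by (rule summable_comparison_test[OF _ summable_mult2[OF C, of "D x"]])
      (use gle in auto)
  have si: "summable (\<lambda>n. LINT x|lborel. norm (g n x))"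
  proof (rule summable_comparison_test[OF _ summable_mult2[OF C, of "LINT x|lborel. D x"]], intro exI allI impI)
    fix n :: nat
    have "(LINT x|lborel. norm (g n x)) \<le> (LINT x|lborel. C n * D x)"
      by (rule integral_mono) (use gi D gle in auto)
    then show "norm (LINT x|lborel. norm (g n x)) \<le> C n * (LINT x|lborel. D x)" by simp
  qed
  have ns: "norm (LINT x|lborel. g n x) \<le> (LINT x|lborel. norm (g n x))" for n
    by (rule integral_norm_bound)
  have si': "summable (\<lambda>n. norm (LINT x|lborel. g n x))"
    by (rule summable_comparison_test[OF _ si]) (use ns in auto)
  have inf: "(\<Sum>\<^sub>\<infinity>i. f i x) = (\<Sum>n. g n x)" for x
  proof -
    have "(g n x) = (if n \<in> range (to_nat :: 'i \<Rightarrow> nat) then f (from_nat n) x else 0)" for n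
      by (simp add: g_def)
    then have "(\<Sum>\<^sub>\<infinity>i. f i x) = (\<Sum>\<^sub>\<infinity>n. g n x)"
      by (simp add: ext(1)[of "\<lambda>i. f i x"])
    also have "\<dots> = (\<Sum>n. g n x)"
      by (rule infsumI, rule norm_summable_imp_has_sum[OF sn])
        (rule summable_sums, rule summable_norm_cancel, rule sn)
    finally show ?thesis .
  qed
  show "integrable lborel (\<lambda>x. \<Sum>\<^sub>\<infinity>i. f i x)"
    unfolding inf by (rule integrable_suminf[OF gi]) (use sn si in auto)
  have "((\<lambda>n. LINT x|lborel. g n x) has_sum (LINT x|lborel. (\<Sum>n. g n x))) UNIV"
    by (rule norm_summable_imp_has_sum[OF si'])
      (rule sums_integral[OF gi], use sn si in auto)
  moreover have "(LINT x|lborel. g n x) = 0" if "n \<notin> range (to_nat :: 'i \<Rightarrow> nat)" for n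
    using that by (simp add: g_def[abs_def])
  ultimately have "((\<lambda>n. LINT x|lborel. g n x) has_sum (LINT x|lborel. (\<Sum>n. g n x)))
      (range (to_nat :: 'i \<Rightarrow> nat))"
    by (subst has_sum_cong_neutral[where T = UNIV and g="\<lambda>n. LINT x|lborel. g n x"]) auto
  then have "((\<lambda>i::'i. LINT x|lborel. g (to_nat i) x) has_sum (LINT x|lborel. (\<Sum>n. g n x))) UNIV"
    by (subst (asm) has_sum_reindex) (auto simp: o_def)
  then show "((\<lambda>i. LINT x|lborel. f i x) has_sum (LINT x|lborel. (\<Sum>\<^sub>\<infinity>i. f i x))) UNIV"
    by (simp add: inf g_def)
qed

section \<open>Iterated derivatives on the line\<close>

definition smooth_line :: "(real \<Rightarrow> complex) \<Rightarrow> bool" where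
  "smooth_line f \<longleftrightarrow> (\<forall>l x. nth_deriv l f differentiable (at x))"

lemma nth_deriv_0 [simp]: "nth_deriv 0 f = f"
  by (simp add: nth_deriv_def)

lemma nth_deriv_Suc: "nth_deriv (Suc l) f = (\<lambda>x. vector_derivative (nth_deriv l f) (at x))"
  by (simp add: nth_deriv_def)

lemma nth_deriv_Suc': "nth_deriv (Suc l) f = nth_deriv l (\<lambda>x. vector_derivative f (at x))"
  unfolding nth_deriv_def funpow_Suc_right o_apply by (rule refl)

lemma smooth_line_deriv:
  assumes "smooth_line f"
  shows "(nth_deriv l f has_vector_derivative nth_deriv (Suc l) f x) (at x)"
  using assms unfolding smooth_line_def nth_deriv_Suc
  by (simp add: vector_derivative_works[symmetric])

lemma smooth_line_nth_deriv: "smooth_line f \<Longrightarrow> smooth_line (nth_deriv m f)"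
proof -
  have "nth_deriv l (nth_deriv m f) = nth_deriv (l + m) f" for l
    by (simp add: nth_deriv_def funpow_add)
  then show "smooth_line f \<Longrightarrow> smooth_line (nth_deriv m f)"
    by (simp add: smooth_line_def)
qed

lemma smooth_line_continuous: "smooth_line f \<Longrightarrow> continuous_on S f"
  using smooth_line_deriv[of f 0]
  by (intro continuous_at_imp_continuous_on ballI) (auto intro: has_vector_derivative_continuous)

text \<open>
  Smoothness is verified by guessing all derivatives at once: for series, translates and
  parameter integrals the guess is the termwise derivative.
\<close>

lemma nth_deriv_chain:
  assumes "\<And>l x. (F l has_vector_derivative F (Suc l) x) (at x)"
  shows "smooth_line (F 0)" and "nth_deriv l (F 0) = F l"
proof -
  have *: "nth_deriv l (F 0) = F l" for l
  proof (induction l)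
    case (Suc l)
    then show ?case
      using assms[of l] by (auto simp: nth_deriv_Suc vector_derivative_at)
  qed simp
  show "nth_deriv l (F 0) = F l" by (rule *)
  show "smooth_line (F 0)"
    unfolding smooth_line_def * using assms by (blast intro: differentiableI_vector)
qed

text \<open>
  The derivatives of a product are not of the form of a single expression, but the set of sums of products is
  closed under differentiation. This principle turns such a closure property into smoothness.
\<close>

lemma smooth_line_coinduct:
  assumes "f \<in> S" and "\<And>f. f \<in> S \<Longrightarrow> \<exists>f'\<in>S. \<forall>x. (f has_vector_derivative f' x) (at x)"
  shows "smooth_line f"
proof -
  have "nth_deriv l f \<in> S \<and> (\<forall>x. nth_deriv l f differentiable (at x))" for l
  proof (induction l)
    case 0
    then show ?case using assms by (auto intro: differentiableI_vector)
  next
    case (Suc l)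
    then obtain f' where f': "f' \<in> S" "\<forall>x. (nth_deriv l f has_vector_derivative f' x) (at x)"
      using assms(2) by blast
    then have "nth_deriv (Suc l) f = f'"
      by (auto simp: nth_deriv_Suc vector_derivative_at)
    then show ?case using f' assms(2)[of f'] by (auto intro: differentiableI_vector)
  qed
  then show ?thesis by (simp add: smooth_line_def)
qed

lemma nth_deriv_linear:
  assumes f: "smooth_line f" and g: "smooth_line g"
  shows "smooth_line (\<lambda>x. c * f x + g x)"
    and "nth_deriv l (\<lambda>x. c * f x + g x) = (\<lambda>x. c * nth_deriv l f x + nth_deriv l g x)"
proof -
  have d: "((\<lambda>x. c * nth_deriv l f x + nth_deriv l g x) has_vector_derivative
      c * nth_deriv (Suc l) f x + nth_deriv (Suc l) g x) (at x)" for l x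
    by (intro has_vector_derivative_add has_vector_derivative_mult_right smooth_line_deriv f g)
  from nth_deriv_chain[of "\<lambda>l x. c * nth_deriv l f x + nth_deriv l g x", OF d]
  show "smooth_line (\<lambda>x. c * f x + g x)"
    "nth_deriv l (\<lambda>x. c * f x + g x) = (\<lambda>x. c * nth_deriv l f x + nth_deriv l g x)"
    by simp_all
qed

lemma nth_deriv_add:
  assumes "smooth_line f" "smooth_line g"
  shows "smooth_line (\<lambda>x. f x + g x)"
    and "nth_deriv l (\<lambda>x. f x + g x) = (\<lambda>x. nth_deriv l f x + nth_deriv l g x)"
  using nth_deriv_linear(1)[OF assms, of 1] nth_deriv_linear(2)[OF assms, of l 1] by simp_all

lemma nth_deriv_shift:
  assumes f: "smooth_line f"
  shows "smooth_line (\<lambda>x. f (x + a))"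
    and "nth_deriv l (\<lambda>x. f (x + a)) = (\<lambda>x. nth_deriv l f (x + a))"
proof -
  have d: "((\<lambda>x. nth_deriv l f (x + a)) has_vector_derivative nth_deriv (Suc l) f (x + a)) (at x)"
    for l x
  proof -
    have "((\<lambda>x. x + a) has_vector_derivative 1) (at x)"
      by (auto intro!: derivative_eq_intros)
    from vector_diff_chain_at[OF this smooth_line_deriv[OF f, of l "x + a"]]
    show ?thesis by (simp add: o_def)
  qed
  from nth_deriv_chain[of "\<lambda>l x. nth_deriv l f (x + a)", OF d]
  show "smooth_line (\<lambda>x. f (x + a))"
    "nth_deriv l (\<lambda>x. f (x + a)) = (\<lambda>x. nth_deriv l f (x + a))"
    by simp_all
qed

inductive_set sums_of_products :: "(real \<Rightarrow> complex) set" where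
  "smooth_line f \<Longrightarrow> smooth_line g \<Longrightarrow> (\<lambda>x. f x * g x) \<in> sums_of_products"
| "a \<in> sums_of_products \<Longrightarrow> b \<in> sums_of_products \<Longrightarrow> (\<lambda>x. a x + b x) \<in> sums_of_products"

lemma has_vector_derivative_product:
  fixes f g :: "real \<Rightarrow> complex"
  assumes "smooth_line f" "smooth_line g"
  shows "((\<lambda>x. f x * g x) has_vector_derivative nth_deriv 1 f x * g x + f x * nth_deriv 1 g x) (at x)"
  using has_vector_derivative_mult[OF smooth_line_deriv[OF assms(1), of 0] smooth_line_deriv[OF assms(2), of 0]]
  by (simp add: add.commute)

lemma smooth_line_mult:
  assumes "smooth_line f" "smooth_line g"
  shows "smooth_line (\<lambda>x. f x * g x)"
proof (rule smooth_line_coinduct)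
  show "(\<lambda>x. f x * g x) \<in> sums_of_products" by (rule sums_of_products.intros(1)[OF assms])
  show "\<exists>h'\<in>sums_of_products. \<forall>x. (h has_vector_derivative h' x) (at x)" if "h \<in> sums_of_products" for h
    using that
  proof induction
    case (1 f g)
    have "(\<lambda>x. nth_deriv 1 f x * g x + f x * nth_deriv 1 g x) \<in> sums_of_products"
      by (intro sums_of_products.intros 1 smooth_line_nth_deriv)
    then show ?case by (rule bexI[rotated]) (intro allI has_vector_derivative_product 1)
  next
    case (2 a b)
    then obtain a' b' where ab: "a' \<in> sums_of_products" "\<forall>x. (a has_vector_derivative a' x) (at x)"
       "b' \<in> sums_of_products" "\<forall>x. (b has_vector_derivative b' x) (at x)" by blast
    then have "(\<lambda>x. a' x + b' x) \<in> sums_of_products" by (intro sums_of_products.intros)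
    moreover have "\<forall>x. ((\<lambda>x. a x + b x) has_vector_derivative a' x + b' x) (at x)"
      using ab by (auto intro: has_vector_derivative_add)
    ultimately show ?case by (intro bexI[of _ "\<lambda>x. a' x + b' x"])
  qed
qed

text \<open>A crude form of the Leibniz rule: only the sizes of the derivatives of the factors enter.\<close>

lemma norm_nth_deriv_mult_le:
  assumes "smooth_line f" "smooth_line g"
    and "\<And>i. i \<le> l \<Longrightarrow> norm (nth_deriv i f x) \<le> A" and "\<And>i. i \<le> l \<Longrightarrow> norm (nth_deriv i g x) \<le> B"
  shows "norm (nth_deriv l (\<lambda>x. f x * g x) x) \<le> 2 ^ l * A * B"
  using assms
proof (induction l arbitrary: f g)
  case 0
  have "norm (f x) \<le> A" "norm (g x) \<le> B"
    using "0.prems"(3)[of 0] "0.prems"(4)[of 0] by simp_all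
  then have "norm (f x) * norm (g x) \<le> A * B"
    by (intro mult_mono) (auto intro: order_trans[OF norm_ge_zero])
  then show ?case by (simp add: norm_mult)
next
  case (Suc l)
  let ?f = "nth_deriv 1 f" and ?g = "nth_deriv 1 g"
  have eq: "nth_deriv (Suc l) (\<lambda>x. f x * g x) = (\<lambda>x. nth_deriv l (\<lambda>x. ?f x * g x) x + nth_deriv l (\<lambda>x. f x * ?g x) x)"
  proof -
    have "(\<lambda>x. vector_derivative (\<lambda>x. f x * g x) (at x)) = (\<lambda>x. ?f x * g x + f x * ?g x)"
      by (rule ext, rule vector_derivative_at, rule has_vector_derivative_product) fact+
    then show ?thesis
      by (simp add: nth_deriv_Suc' nth_deriv_add smooth_line_mult smooth_line_nth_deriv Suc.prems(1,2) del: One_nat_def)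
  qed
  have d1: "nth_deriv i ?f = nth_deriv (Suc i) f" "nth_deriv i ?g = nth_deriv (Suc i) g" for i
    by (simp_all add: nth_deriv_Suc')
  have "norm (nth_deriv l (\<lambda>x. ?f x * g x) x) \<le> 2 ^ l * A * B"
    by (rule Suc.IH) (use Suc.prems in \<open>auto simp: d1 smooth_line_nth_deriv simp del: One_nat_def\<close>)
  moreover have "norm (nth_deriv l (\<lambda>x. f x * ?g x) x) \<le> 2 ^ l * A * B"
    by (rule Suc.IH) (use Suc.prems in \<open>auto simp: d1 smooth_line_nth_deriv simp del: One_nat_def\<close>)
  ultimately show ?case unfolding eq
    by (intro order_trans[OF norm_triangle_ineq]) simp
qed

section \<open>Characters\<close>

definition wave :: "real \<Rightarrow> complex" where
  "wave t = cis (2 * pi * t)"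

lemma wave_add: "wave (s + t) = wave s * wave t"
  by (simp add: wave_def cis_mult distrib_left)

lemma wave_minus: "wave (- t) = cnj (wave t)"
  by (simp add: wave_def cis_cnj)

lemma norm_wave [simp]: "norm (wave t) = 1"
  by (simp add: wave_def)

lemma wave_0 [simp]: "wave 0 = 1"
  by (simp add: wave_def)

lemma wave_of_int [simp]: "wave (of_int n) = 1"
  by (simp add: wave_def complex_eq_iff cos_int_2pin sin_int_2pin)

lemma wave_of_nat [simp]: "wave (of_nat n) = 1"
  using wave_of_int[of "int n"] by (simp del: wave_of_int)

lemma wave_diff: "wave (s - t) = wave s * wave (- t)"
  using wave_add[of s "- t"] by simp

lemma wave_eqI: "s - t \<in> \<int> \<Longrightarrow> wave s = wave t"
  using wave_add[of t "s - t"] by (auto elim!: Ints_cases)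

lemma wave_exp: "wave t = exp (\<i> * of_real (2 * pi * t))"
  by (simp add: wave_def cis_conv_exp)

lemma has_vector_derivative_wave:
  "((\<lambda>x. wave (a * x + b)) has_vector_derivative (2 * pi * \<i> * a) * wave (a * x + b)) (at x)"
proof -
  have "((\<lambda>z. exp (2 * pi * \<i> * (a * z + b))) has_field_derivative
      exp (2 * pi * \<i> * (a * of_real x + b)) * (2 * pi * \<i> * a)) (at (of_real x))"
    by (auto intro!: derivative_eq_intros)
  from has_vector_derivative_real_field[OF this]
  show ?thesis by (simp add: wave_exp mult_ac)
qed

lemma nth_deriv_wave:
  "smooth_line (\<lambda>x. wave (a * x + b))"
  "nth_deriv l (\<lambda>x. wave (a * x + b)) = (\<lambda>x. (2 * pi * \<i> * a) ^ l * wave (a * x + b))"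
proof -
  have "((\<lambda>x. (2 * pi * \<i> * a) ^ l * wave (a * x + b)) has_vector_derivative
     (2 * pi * \<i> * a) ^ Suc l * wave (a * x + b)) (at x)" for l x
    using has_vector_derivative_mult_right[OF has_vector_derivative_wave[of a b x], of "(2 * pi * \<i> * a) ^ l"]
    by (simp add: mult_ac)
  from nth_deriv_chain[of "\<lambda>l x. (2 * pi * \<i> * a) ^ l * wave (a * x + b)", OF this]
  show "smooth_line (\<lambda>x. wave (a * x + b))"
    "nth_deriv l (\<lambda>x. wave (a * x + b)) = (\<lambda>x. (2 * pi * \<i> * a) ^ l * wave (a * x + b))"
    by simp_all
qed

lemma continuous_on_wave [continuous_intros]:
  "continuous_on S f \<Longrightarrow> continuous_on S (\<lambda>x. wave (f x))"
  unfolding wave_def cis_conv_exp by (intro continuous_intros)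

lemma wave_measurable [measurable]: "wave \<in> borel_measurable borel"
  by (rule borel_measurable_continuous_onI) (intro continuous_intros)

lemma norm_wave_diff_le: "norm (wave s - wave t) \<le> 2 * pi * \<bar>s - t\<bar>"
proof -
  have "norm (wave s - wave t) = norm (wave ((s - t) / 2) - wave (- ((s - t) / 2)))"
  proof -
    have "wave s - wave t = wave ((s + t) / 2) * (wave ((s - t) / 2) - wave (- ((s - t) / 2)))"
      by (simp add: algebra_simps flip: wave_add) (simp add: field_simps)
    then show ?thesis by (simp add: norm_mult)
  qed
  also have "wave ((s - t) / 2) - wave (- ((s - t) / 2)) = 2 * \<i> * sin (pi * (s - t))"
  proof -
    have "wave ((s - t) / 2) = cis (pi * (s - t))" "wave (- ((s - t) / 2)) = cis (- (pi * (s - t)))"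
      by (simp_all add: wave_def)
    then show ?thesis by (simp add: complex_eq_iff)
  qed
  also have "norm \<dots> = 2 * \<bar>sin (pi * (s - t))\<bar>"
    by (simp add: norm_mult)
  also have "\<dots> \<le> 2 * \<bar>pi * (s - t)\<bar>"
    using abs_sin_x_le_abs_x[of "pi * (s - t)"] by simp
  finally show ?thesis by (simp add: abs_mult)
qed

section \<open>Schwartz functions\<close>

lemma schwartz_smooth: "f \<in> schwartz \<Longrightarrow> smooth_line f"
  by (simp add: schwartz_def smooth_line_def)

lemma schwartzI:
  assumes "smooth_line f"
    and "\<And>j l. \<exists>C. \<forall>x. \<bar>x\<bar> ^ j * norm (nth_deriv l f x) \<le> C"
  shows "f \<in> schwartz"
  using assms by (simp add: schwartz_def smooth_line_def bounded_iff norm_mult power_abs)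

lemma schwartz_bound:
  assumes "f \<in> schwartz"
  obtains C where "\<And>x. \<bar>x\<bar> ^ j * norm (nth_deriv l f x) \<le> C"
  using assms by (fastforce simp: schwartz_def bounded_iff norm_mult power_abs)

lemma one_plus_power_le: "(1 + \<bar>x\<bar>) ^ p \<le> 2 ^ p * (1 + \<bar>x\<bar> ^ p)" for x :: real
proof -
  have "(1 + \<bar>x\<bar>) ^ p \<le> (2 * max 1 \<bar>x\<bar>) ^ p" by (intro power_mono) auto
  also have "\<dots> = 2 ^ p * max 1 \<bar>x\<bar> ^ p" by (simp add: power_mult_distrib)
  also have "max 1 \<bar>x\<bar> ^ p \<le> 1 + \<bar>x\<bar> ^ p" by (simp add: max_def)
  finally show ?thesis by simp
qed

lemma schwartz_decay:
  assumes "f \<in> schwartz"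
  obtains C where "C \<ge> 0" "\<And>i x. i \<le> l \<Longrightarrow> norm (nth_deriv i f x) \<le> C / (1 + \<bar>x\<bar>) ^ p"
proof -
  have "\<exists>C\<ge>0. \<forall>x. (1 + \<bar>x\<bar>) ^ p * norm (nth_deriv i f x) \<le> C" for i
  proof -
    obtain A where A: "\<And>x. \<bar>x\<bar> ^ 0 * norm (nth_deriv i f x) \<le> A" using schwartz_bound[OF assms] by blast
    obtain B where B: "\<And>x. \<bar>x\<bar> ^ p * norm (nth_deriv i f x) \<le> B" using schwartz_bound[OF assms] by blast
    have "(1 + \<bar>x\<bar>) ^ p * norm (nth_deriv i f x) \<le> 2 ^ p * (A + B)" for x
    proof -
      have "(1 + \<bar>x\<bar>) ^ p * norm (nth_deriv i f x) \<le> 2 ^ p * (1 + \<bar>x\<bar> ^ p) * norm (nth_deriv i f x)"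
        by (rule mult_right_mono[OF one_plus_power_le]) auto
      also have "\<dots> = 2 ^ p * (\<bar>x\<bar> ^ 0 * norm (nth_deriv i f x) + \<bar>x\<bar> ^ p * norm (nth_deriv i f x))"
        by (simp add: algebra_simps)
      also have "\<dots> \<le> 2 ^ p * (A + B)" by (intro mult_left_mono add_mono A B) auto
      finally show ?thesis .
    qed
    moreover from this[of 0] have "0 \<le> 2 ^ p * (A + B)" by (rule order_trans[rotated]) auto
    ultimately show ?thesis by blast
  qed
  then obtain C where C: "\<And>i. C i \<ge> 0" "\<And>i x. (1 + \<bar>x\<bar>) ^ p * norm (nth_deriv i f x) \<le> C i" by metis
  show ?thesis
  proof (rule that[of "\<Sum>i\<le>l. C i"])
    fix i x assume "i \<le> l"
    then have "C i \<le> (\<Sum>i\<le>l. C i)" by (intro member_le_sum) (auto simp: C)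
    then have "(1 + \<bar>x\<bar>) ^ p * norm (nth_deriv i f x) \<le> (\<Sum>i\<le>l. C i)" using C(2) order_trans by blast
    then show "norm (nth_deriv i f x) \<le> (\<Sum>i\<le>l. C i) / (1 + \<bar>x\<bar>) ^ p"
      by (simp add: pos_le_divide_eq mult.commute add_pos_nonneg)
  qed (auto intro: sum_nonneg C)
qed

lemma schwartz_decay0:
  assumes "f \<in> schwartz"
  obtains C where "C \<ge> 0" "\<And>x. norm (f x) \<le> C / (1 + \<bar>x\<bar>) ^ p"
  using schwartz_decay[OF assms, of 0 p] by (metis le_zero_eq nth_deriv_0)

lemma schwartz_continuous: "f \<in> schwartz \<Longrightarrow> continuous_on S f"
  by (intro smooth_line_continuous schwartz_smooth)

lemma schwartz_measurable: "f \<in> schwartz \<Longrightarrow> f \<in> borel_measurable borel"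
  by (intro borel_measurable_continuous_onI schwartz_continuous)

lemma schwartz_linear:
  assumes f: "f \<in> schwartz" and g: "g \<in> schwartz"
  shows "(\<lambda>x. c * f x + g x) \<in> schwartz"
proof (rule schwartzI)
  note s = schwartz_smooth[OF f] schwartz_smooth[OF g]
  show "smooth_line (\<lambda>x. c * f x + g x)" by (rule nth_deriv_linear[OF s])
  fix j l
  obtain A where A: "\<And>x. \<bar>x\<bar> ^ j * norm (nth_deriv l f x) \<le> A" using schwartz_bound[OF f] by blast
  obtain B where B: "\<And>x. \<bar>x\<bar> ^ j * norm (nth_deriv l g x) \<le> B" using schwartz_bound[OF g] by blast
  have "\<bar>x\<bar> ^ j * norm (c * nth_deriv l f x + nth_deriv l g x) \<le> norm c * A + B" for x
  proof -
    have "\<bar>x\<bar> ^ j * norm (c * nth_deriv l f x + nth_deriv l g x)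
      \<le> \<bar>x\<bar> ^ j * (norm c * norm (nth_deriv l f x) + norm (nth_deriv l g x))"
      by (intro mult_left_mono) (auto intro!: norm_triangle_le simp: norm_mult)
    also have "\<dots> = norm c * (\<bar>x\<bar> ^ j * norm (nth_deriv l f x)) + \<bar>x\<bar> ^ j * norm (nth_deriv l g x)"
      by (simp add: algebra_simps)
    also have "\<dots> \<le> norm c * A + B" by (intro add_mono mult_left_mono A B) auto
    finally show ?thesis .
  qed
  then show "\<exists>C. \<forall>x. \<bar>x\<bar> ^ j * norm (nth_deriv l (\<lambda>x. c * f x + g x) x) \<le> C"
    by (auto simp: nth_deriv_linear[OF s])
qed

lemma schwartz_0: "(\<lambda>x. 0) \<in> schwartz"
proof (rule schwartzI)
  have d: "((\<lambda>x. 0::complex) has_vector_derivative 0) (at x)" for x by simp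
  note c = nth_deriv_chain[of "\<lambda>_ _. 0", OF d]
  show "smooth_line (\<lambda>x. 0)" using c(1) .
  show "\<exists>C. \<forall>x. \<bar>x\<bar> ^ j * norm (nth_deriv l (\<lambda>x. 0) x) \<le> C" for j l using c(2) by auto
qed

lemma nth_deriv_zero [simp]: "nth_deriv l (\<lambda>x. 0) x = 0"
  using nth_deriv_linear(2)[of "\<lambda>x. 0" "\<lambda>x. 0" l "-1"] schwartz_smooth[OF schwartz_0] by (simp add: fun_eq_iff)

lemma nth_deriv_scale: "f \<in> schwartz \<Longrightarrow> nth_deriv l (\<lambda>x. c * f x) x = c * nth_deriv l f x"
  using nth_deriv_linear(2)[OF schwartz_smooth schwartz_smooth[OF schwartz_0], of f l c] by simp

lemma schwartz_scale: "f \<in> schwartz \<Longrightarrow> (\<lambda>x. c * f x) \<in> schwartz"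
  using schwartz_linear[OF _ schwartz_0, of f c] by simp

lemma schwartz_add: "f \<in> schwartz \<Longrightarrow> g \<in> schwartz \<Longrightarrow> (\<lambda>x. f x + g x) \<in> schwartz"
  using schwartz_linear[of f g 1] by simp

lemma schwartz_sum: "(\<And>i. i \<in> A \<Longrightarrow> f i \<in> schwartz) \<Longrightarrow> (\<lambda>x. \<Sum>i\<in>A. f i x) \<in> schwartz"
  by (induction A rule: infinite_finite_induct) (auto simp: schwartz_0 schwartz_add)

lemma schwartz_nth_deriv: "f \<in> schwartz \<Longrightarrow> nth_deriv m f \<in> schwartz"
proof (rule schwartzI)
  assume f: "f \<in> schwartz"
  show "smooth_line (nth_deriv m f)" by (rule smooth_line_nth_deriv[OF schwartz_smooth[OF f]])
  have eq: "nth_deriv l (nth_deriv m f) = nth_deriv (l + m) f" for l by (simp add: nth_deriv_def funpow_add)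
  show "\<exists>C. \<forall>x. \<bar>x\<bar> ^ j * norm (nth_deriv l (nth_deriv m f) x) \<le> C" for j l
    using schwartz_bound[OF f] unfolding eq by metis
qed

lemma abs_power_mult_decay_le:
  fixes a x C :: real
  assumes "C \<ge> 0"
  shows "\<bar>x\<bar> ^ j * (C / (1 + \<bar>x + a\<bar>) ^ j) \<le> C * (1 + \<bar>a\<bar>) ^ j"
proof -
  have "\<bar>x\<bar> \<le> (1 + \<bar>x + a\<bar>) * (1 + \<bar>a\<bar>)"
  proof -
    have "\<bar>x\<bar> \<le> \<bar>x + a\<bar> + \<bar>a\<bar>" by linarith
    also have "\<dots> \<le> (1 + \<bar>x + a\<bar>) * (1 + \<bar>a\<bar>)"
      using mult_nonneg_nonneg[of "\<bar>x + a\<bar>" "\<bar>a\<bar>"] by (simp add: distrib_right distrib_left)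
    finally show ?thesis .
  qed
  then have "\<bar>x\<bar> ^ j \<le> (1 + \<bar>x + a\<bar>) ^ j * (1 + \<bar>a\<bar>) ^ j"
    by (metis abs_ge_zero power_mono power_mult_distrib)
  then have "\<bar>x\<bar> ^ j * C \<le> (1 + \<bar>x + a\<bar>) ^ j * (1 + \<bar>a\<bar>) ^ j * C"
    by (rule mult_right_mono) (rule assms)
  then show ?thesis by (simp add: divide_le_eq add_pos_nonneg mult_ac)
qed

subsection \<open>Phase space translations\<close>

text \<open>
  The phase space translation that quantizes the character \<open>(x, \<xi>) \<mapsto> exp (2 \<pi> \<i> (a x - b \<xi>))\<close> at
  \<open>h = 1 / (2 \<pi> N)\<close>; the constant phase is the one of the Weyl calculus.
\<close>

definition heisenberg :: "nat \<Rightarrow> real \<Rightarrow> real \<Rightarrow> (real \<Rightarrow> complex) \<Rightarrow> real \<Rightarrow> complex" where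
  "heisenberg N a b \<phi> x = wave (a * x - a * b / (2 * N)) * \<phi> (x - b / N)"

text \<open>
  The growth in the parameters is polynomial, so that series of translations with rapidly
  decreasing coefficients converge in the topology of Schwartz functions.
\<close>

lemma heisenberg_bound:
  assumes f: "\<phi> \<in> schwartz" and N: "N > 0"
  obtains C where "C \<ge> 0"
    "\<And>a b x. \<bar>x\<bar> ^ j * norm (nth_deriv l (heisenberg N a b \<phi>) x) \<le> C * (1 + \<bar>a\<bar> + \<bar>b\<bar>) ^ (l + j)"
proof -
  obtain C where C: "C \<ge> 0" "\<And>i x. i \<le> l \<Longrightarrow> norm (nth_deriv i \<phi> x) \<le> C / (1 + \<bar>x\<bar>) ^ j"
    by (rule schwartz_decay[OF f]) blast
  have "\<bar>x\<bar> ^ j * norm (nth_deriv l (heisenberg N a b \<phi>) x)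
      \<le> (2 ^ l * (2 * pi) ^ l * C) * (1 + \<bar>a\<bar> + \<bar>b\<bar>) ^ (l + j)" for a b x
  proof -
    define w where "w = 1 + \<bar>a\<bar> + \<bar>b\<bar>"
    have w1: "w \<ge> 1" by (simp add: w_def)
    have s: "smooth_line (\<lambda>x. wave (a * x + - (a * b / (2 * N))))" by (rule nth_deriv_wave)
    have t: "smooth_line (\<lambda>x. \<phi> (x + - (b / N)))" by (rule nth_deriv_shift[OF schwartz_smooth[OF f]])
    have n: "norm (nth_deriv l (\<lambda>x. wave (a * x + - (a * b / (2 * N))) * \<phi> (x + - (b / N))) x)
        \<le> 2 ^ l * (2 * pi * w) ^ l * (C / (1 + \<bar>x + - (b / N)\<bar>) ^ j)"
    proof (rule norm_nth_deriv_mult_le[OF s t])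
      fix i assume i: "i \<le> l"
      have "2 * pi * \<bar>a\<bar> \<le> 2 * pi * w" by (simp add: w_def)
      then have "(2 * pi * \<bar>a\<bar>) ^ i \<le> (2 * pi * w) ^ i" by (intro power_mono) auto
      also have "\<dots> \<le> (2 * pi * w) ^ l"
      proof (rule power_increasing[OF i])
        have "1 * 1 \<le> (2 * pi) * w" by (intro mult_mono w1) (use pi_ge_two in auto)
        then show "1 \<le> 2 * pi * w" by simp
      qed
      finally show "norm (nth_deriv i (\<lambda>x. wave (a * x + - (a * b / (2 * N)))) x) \<le> (2 * pi * w) ^ l"
        unfolding nth_deriv_wave(2) by (simp add: norm_mult norm_power)
      show "norm (nth_deriv i (\<lambda>x. \<phi> (x + - (b / N))) x) \<le> C / (1 + \<bar>x + - (b / N)\<bar>) ^ j"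
        unfolding nth_deriv_shift[OF schwartz_smooth[OF f]] by (rule C(2)[OF i])
    qed
    have eq: "heisenberg N a b \<phi> = (\<lambda>x. wave (a * x + - (a * b / (2 * N))) * \<phi> (x + - (b / N)))"
      by (simp add: heisenberg_def fun_eq_iff)
    have bN: "\<bar>- (b / N)\<bar> \<le> \<bar>b\<bar>"
      using N by (simp add: abs_divide divide_le_eq mult_le_cancel_left1)
    have "\<bar>x\<bar> ^ j * norm (nth_deriv l (heisenberg N a b \<phi>) x)
      \<le> \<bar>x\<bar> ^ j * (2 ^ l * (2 * pi * w) ^ l * (C / (1 + \<bar>x + - (b / N)\<bar>) ^ j))"
      unfolding eq by (intro mult_left_mono n) auto
    also have "\<dots> = 2 ^ l * (2 * pi * w) ^ l * (\<bar>x\<bar> ^ j * (C / (1 + \<bar>x + - (b / N)\<bar>) ^ j))"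
      by (simp add: mult_ac)
    also have "\<dots> \<le> 2 ^ l * (2 * pi * w) ^ l * (C * (1 + \<bar>- (b / N)\<bar>) ^ j)"
      by (intro mult_left_mono abs_power_mult_decay_le C) (use w1 in auto)
    also have "\<dots> \<le> 2 ^ l * (2 * pi * w) ^ l * (C * w ^ j)"
    proof (intro mult_left_mono power_mono)
      show "1 + \<bar>- (b / N)\<bar> \<le> w" using bN abs_ge_zero[of a] unfolding w_def by linarith
    qed (use w1 C in auto)
    finally show ?thesis unfolding w_def[symmetric] by (simp add: power_mult_distrib power_add mult_ac)
  qed
  then show ?thesis by (intro that[of "2 ^ l * (2 * pi) ^ l * C"]) (use C in auto)
qed

lemma schwartz_heisenberg:
  assumes f: "\<phi> \<in> schwartz" and N: "N > 0"
  shows "heisenberg N a b \<phi> \<in> schwartz"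
proof (rule schwartzI)
  have "smooth_line (\<lambda>x. wave (a * x + - (a * b / (2 * N))) * \<phi> (x + - (b / N)))"
    by (intro smooth_line_mult nth_deriv_wave nth_deriv_shift schwartz_smooth f)
  then show "smooth_line (heisenberg N a b \<phi>)" by (simp add: heisenberg_def[abs_def])
  show "\<exists>C. \<forall>x. \<bar>x\<bar> ^ j * norm (nth_deriv l (heisenberg N a b \<phi>) x) \<le> C" for j l
  proof -
    obtain C where "C \<ge> 0" "\<And>a b x. \<bar>x\<bar> ^ j * norm (nth_deriv l (heisenberg N a b \<phi>) x) \<le> C * (1 + \<bar>a\<bar> + \<bar>b\<bar>) ^ (l + j)"
      by (rule heisenberg_bound[OF f N, where j = j and l = l]) blast
    then show ?thesis by (intro exI[of _ "C * (1 + \<bar>a\<bar> + \<bar>b\<bar>) ^ (l + j)"] allI)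
  qed
qed

lemma heisenberg_compose:
  assumes "N > 0"
  shows "heisenberg N a b (heisenberg N c d \<phi>) = (\<lambda>x. wave ((a * d - c * b) / (2 * N)) * heisenberg N (a + c) (b + d) \<phi> x)"
proof
  fix x
  have "a * x - a * b / (2 * N) + (c * (x - b / N) - c * d / (2 * N))
      = (a * d - c * b) / (2 * N) + ((a + c) * x - (a + c) * (b + d) / (2 * N))"
    using assms by (simp add: field_simps)
  moreover have "x - b / N - d / N = x - (b + d) / N" by (simp add: diff_divide_distrib add_divide_distrib)
  ultimately show "heisenberg N a b (heisenberg N c d \<phi>) x = wave ((a * d - c * b) / (2 * N)) * heisenberg N (a + c) (b + d) \<phi> x"
    unfolding heisenberg_def by (simp only: mult.assoc[symmetric] wave_add[symmetric])
qed

lemma schwartz_shift: "\<phi> \<in> schwartz \<Longrightarrow> (\<lambda>x. \<phi> (x + a)) \<in> schwartz"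
  using schwartz_heisenberg[of \<phi> 1 0 "- a"] by (simp add: heisenberg_def[abs_def])

lemma schwartz_wave: "\<phi> \<in> schwartz \<Longrightarrow> (\<lambda>x. wave (a * x) * \<phi> x) \<in> schwartz"
  using schwartz_heisenberg[of \<phi> 1 a 0] by (simp add: heisenberg_def[abs_def])

section \<open>The Gaussian\<close>

definition gauss :: "real \<Rightarrow> complex" where
  "gauss x = of_real (exp (- x\<^sup>2))"

lemma gauss_schwartz: "gauss \<in> schwartz"
proof -
  define P where "P l = ((\<lambda>p. pderiv p - [:0, 2:] * p) ^^ l) [:1::real:]" for l
  define G where "G l x = of_real (poly (P l) x) * gauss x" for l x
  have d: "(G l has_vector_derivative G (Suc l) x) (at x)" for l x
  proof -
    have "((\<lambda>x. poly (P l) x * exp (- x\<^sup>2)) has_real_derivative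
        poly (pderiv (P l)) x * exp (- x\<^sup>2) + exp (- x\<^sup>2) * (- 2 * x) * poly (P l) x) (at x)"
      by (auto intro!: derivative_eq_intros)
    then have "((\<lambda>x. of_real (poly (P l) x * exp (- x\<^sup>2)) :: complex) has_vector_derivative
        of_real (poly (pderiv (P l)) x * exp (- x\<^sup>2) + exp (- x\<^sup>2) * (- 2 * x) * poly (P l) x)) (at x)"
      by (intro has_vector_derivative_of_real) (simp add: has_real_derivative_iff_has_vector_derivative)
    moreover have "G (Suc l) x = of_real (poly (pderiv (P l)) x * exp (- x\<^sup>2) + exp (- x\<^sup>2) * (- 2 * x) * poly (P l) x)"
      by (simp add: G_def P_def gauss_def algebra_simps)
    ultimately show ?thesis by (simp add: G_def[abs_def] gauss_def)
  qed
  have G0: "G 0 = gauss" by (simp add: G_def P_def fun_eq_iff)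
  note ch = nth_deriv_chain[of G, OF d, unfolded G0]
  have mono: "\<exists>C. \<forall>x::real. \<bar>x\<bar> ^ j * exp (- x\<^sup>2) \<le> C" for j
  proof -
    have "\<bar>x\<bar> ^ j * exp (- x\<^sup>2) \<le> 1 + fact j" for x :: real
    proof -
      have "\<bar>x\<bar> ^ j \<le> 1 + (x\<^sup>2) ^ j"
      proof (cases "\<bar>x\<bar> \<le> 1")
        case True
        then have "\<bar>x\<bar> ^ j \<le> 1" by (simp add: power_le_one)
        then show ?thesis by (simp add: add_increasing2)
      next
        case False
        then have "\<bar>x\<bar> ^ j \<le> \<bar>x\<bar> ^ (2 * j)" by (intro power_increasing) auto
        then show ?thesis by (simp add: power_mult)
      qed
      also have "(x\<^sup>2) ^ j \<le> fact j * exp (x\<^sup>2)"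
      proof -
        have "(\<lambda>n. (x\<^sup>2) ^ n / fact n) sums exp (x\<^sup>2)"
          using exp_converges[of "x\<^sup>2"] by (simp add: divide_inverse mult.commute)
        then have "sum (\<lambda>n. (x\<^sup>2) ^ n / fact n) {j} \<le> exp (x\<^sup>2)"
          using sum_le_suminf[of "\<lambda>n. (x\<^sup>2) ^ n / fact n" "{j}"] by (simp add: sums_iff)
        then show ?thesis by (simp add: divide_le_eq mult.commute)
      qed
      also have "1 + fact j * exp (x\<^sup>2) \<le> exp (x\<^sup>2) + fact j * exp (x\<^sup>2)" by simp
      finally have "\<bar>x\<bar> ^ j \<le> (1 + fact j) * exp (x\<^sup>2)" by (simp add: algebra_simps)
      then show ?thesis by (simp add: exp_minus field_simps)
    qed
    then show ?thesis by blast
  qed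
  have bd: "\<exists>C. \<forall>x::real. \<bar>x\<bar> ^ j * (\<bar>poly p x\<bar> * exp (- x\<^sup>2)) \<le> C" for j p
  proof (induction p arbitrary: j)
    case 0
    show ?case by (auto intro: exI[of _ 0])
  next
    case (pCons a p)
    obtain C where C: "\<And>x::real. \<bar>x\<bar> ^ j * exp (- x\<^sup>2) \<le> C" using mono by blast
    obtain D where D: "\<And>x. \<bar>x\<bar> ^ Suc j * (\<bar>poly p x\<bar> * exp (- x\<^sup>2)) \<le> D" using pCons.IH by blast
    have "\<bar>x\<bar> ^ j * (\<bar>poly (pCons a p) x\<bar> * exp (- x\<^sup>2)) \<le> \<bar>a\<bar> * C + D" for x
    proof -
      have "\<bar>poly (pCons a p) x\<bar> \<le> \<bar>a\<bar> + \<bar>x\<bar> * \<bar>poly p x\<bar>"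
        using abs_triangle_ineq[of a "x * poly p x"] by (simp add: abs_mult)
      then have "\<bar>x\<bar> ^ j * (\<bar>poly (pCons a p) x\<bar> * exp (- x\<^sup>2)) \<le> \<bar>x\<bar> ^ j * ((\<bar>a\<bar> + \<bar>x\<bar> * \<bar>poly p x\<bar>) * exp (- x\<^sup>2))"
        by (intro mult_left_mono mult_right_mono) auto
      also have "\<dots> = \<bar>a\<bar> * (\<bar>x\<bar> ^ j * exp (- x\<^sup>2)) + \<bar>x\<bar> ^ Suc j * (\<bar>poly p x\<bar> * exp (- x\<^sup>2))"
        by (simp add: algebra_simps)
      also have "\<dots> \<le> \<bar>a\<bar> * C + D" by (intro add_mono mult_left_mono C D) auto
      finally show ?thesis .
    qed
    then show ?case by blast
  qed
  show ?thesis
  proof (rule schwartzI[OF ch(1)])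
    show "\<exists>C. \<forall>x. \<bar>x\<bar> ^ j * norm (nth_deriv l gauss x) \<le> C" for j l
      using bd[of j "P l"] by (simp add: ch(2) G_def gauss_def norm_mult)
  qed
qed

section \<open>Integrals over the line as integrals over the circle\<close>

lemma summable_on_int:
  fixes f :: "int \<Rightarrow> real"
  assumes "summable (\<lambda>n. f (int n))" "summable (\<lambda>n. f (- int n))" "\<And>k. f k \<ge> 0"
  shows "f summable_on UNIV"
proof -
  have "f summable_on range int"
    by (subst summable_on_reindex) (auto simp: o_def summable_on_UNIV_nonneg_real_iff assms)
  moreover have "f summable_on range (\<lambda>n. - int n)"
    by (subst summable_on_reindex) (auto simp: o_def inj_on_def summable_on_UNIV_nonneg_real_iff assms)
  moreover have "UNIV = range int \<union> range (\<lambda>n. - int n)"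
    by (auto simp: image_iff) (metis int_cases2)
  ultimately show ?thesis by (metis summable_on_union)
qed

lemma summable_inverse_square_int: "(\<lambda>k::int. 1 / (1 + (of_int k)\<^sup>2) :: real) summable_on UNIV"
proof -
  have "summable (\<lambda>n. 1 / (1 + (real n)\<^sup>2))"
  proof (rule summable_comparison_test[OF _ inverse_power_summable[of 2, where 'a = real]])
    show "\<exists>N. \<forall>n\<ge>N. norm (1 / (1 + (real n)\<^sup>2)) \<le> inverse ((of_nat n)\<^sup>2)"
      by (intro exI[of _ 1] allI impI)
        (auto simp: inverse_eq_divide intro!: divide_left_mono mult_pos_pos add_pos_nonneg)
  qed auto
  then show ?thesis by (intro summable_on_int) auto
qed

lemma integrable_inverse_square: "integrable lborel (\<lambda>x::real. 1 / (1 + x\<^sup>2))"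
proof -
  have "set_integrable lborel (einterval (- \<infinity>) \<infinity>) (\<lambda>x::real. 1 / (1 + x\<^sup>2))"
  proof (rule interval_integral_FTC_nonneg[where F = arctan and A = "- (pi / 2)" and B = "pi / 2"])
    show "DERIV arctan x :> 1 / (1 + x\<^sup>2)" for x
      using DERIV_arctan[of x] by (simp add: inverse_eq_divide)
    show "isCont (\<lambda>x. 1 / (1 + x\<^sup>2)) x" for x :: real
      by (intro continuous_intros) (metis add_pos_nonneg less_irrefl zero_le_power2 zero_less_one)
    show "((arctan \<circ> real_of_ereal) \<longlongrightarrow> - (pi / 2)) (at_right (- \<infinity>))"
      using tendsto_arctan_at_bot by (simp add: ereal_tendsto_simps)
    show "((arctan \<circ> real_of_ereal) \<longlongrightarrow> pi / 2) (at_left \<infinity>)"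
      using tendsto_arctan_at_top by (simp add: ereal_tendsto_simps)
  qed auto
  then show ?thesis by (simp add: set_integrable_def)
qed

text \<open>
  The square of the integrable majorant \<open>1 / (1 + x\<^sup>2)\<close>: one factor serves the integral, the other the sum
  over unit translates.
\<close>

definition quartic_decay :: "(real \<Rightarrow> complex) \<Rightarrow> bool" where
  "quartic_decay f \<longleftrightarrow> continuous_on UNIV f \<and> (\<exists>C\<ge>0. \<forall>x. norm (f x) \<le> C / (1 + x\<^sup>2)\<^sup>2)"

lemma quartic_decay_bound_shift:
  fixes x a R :: real
  assumes "\<bar>x\<bar> \<le> R"
  shows "1 / (1 + (x + a)\<^sup>2) \<le> (2 + 2 * R\<^sup>2) / (1 + a\<^sup>2)"
proof -
  have "a\<^sup>2 \<le> 2 * (x + a)\<^sup>2 + 2 * x\<^sup>2"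
    using zero_le_power2[of "2 * x + a"] by (simp add: power2_eq_square algebra_simps)
  moreover have "x\<^sup>2 \<le> R\<^sup>2" using assms by (metis abs_ge_zero power2_abs power_mono)
  ultimately have "1 + a\<^sup>2 \<le> 1 + 2 * R\<^sup>2 + 2 * (x + a)\<^sup>2" by simp
  also have "\<dots> \<le> (2 + 2 * R\<^sup>2) * (1 + (x + a)\<^sup>2)"
    using mult_nonneg_nonneg[of "R\<^sup>2" "(x + a)\<^sup>2"] by (simp add: algebra_simps)
  finally have "1 + a\<^sup>2 \<le> (2 + 2 * R\<^sup>2) * (1 + (x + a)\<^sup>2)" .
  moreover have "1 + a\<^sup>2 > 0" "1 + (x + a)\<^sup>2 > 0" by (auto intro: add_pos_nonneg)
  ultimately show ?thesis by (simp add: field_simps)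
qed

lemma quartic_decay_sum_bound:
  assumes "quartic_decay f"
  obtains C where "C \<ge> 0" "\<And>x a. \<bar>x\<bar> \<le> R \<Longrightarrow> norm (f (x + a)) \<le> C * (1 / (1 + a\<^sup>2))"
proof -
  obtain C where C: "C \<ge> 0" "\<And>x. norm (f x) \<le> C / (1 + x\<^sup>2)\<^sup>2"
    using assms by (auto simp: quartic_decay_def)
  have "norm (f (x + a)) \<le> (C * (2 + 2 * R\<^sup>2)) * (1 / (1 + a\<^sup>2))" if "\<bar>x\<bar> \<le> R" for x a
  proof -
    have "norm (f (x + a)) \<le> C / (1 + (x + a)\<^sup>2)\<^sup>2" by (rule C)
    also have "\<dots> = C * ((1 / (1 + (x + a)\<^sup>2)) * (1 / (1 + (x + a)\<^sup>2)))" by (simp add: power2_eq_square)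
    also have "\<dots> \<le> C * (1 * ((2 + 2 * R\<^sup>2) / (1 + a\<^sup>2)))"
      by (intro mult_left_mono mult_mono quartic_decay_bound_shift that C) (auto simp: divide_le_eq add_pos_nonneg)
    finally show ?thesis by simp
  qed
  then show ?thesis by (intro that[of "C * (2 + 2 * R\<^sup>2)"]) (use C in auto)
qed

lemma quartic_decay_integrable:
  assumes "quartic_decay f"
  shows "integrable lborel f"
proof -
  obtain C where C: "C \<ge> 0" "\<And>x. norm (f x) \<le> C / (1 + x\<^sup>2)\<^sup>2"
    using assms by (auto simp: quartic_decay_def)
  have "norm (f x) \<le> C * (1 / (1 + x\<^sup>2))" for x
  proof -
    have "C / (1 + x\<^sup>2)\<^sup>2 \<le> C / (1 + x\<^sup>2)"
    proof (rule divide_left_mono)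
      have p: "0 < 1 + x\<^sup>2" by (rule add_pos_nonneg) auto
      then show "0 < (1 + x\<^sup>2)\<^sup>2 * (1 + x\<^sup>2)" by simp
      show "1 + x\<^sup>2 \<le> (1 + x\<^sup>2)\<^sup>2" using power_increasing[of 1 2 "1 + x\<^sup>2"] by simp
    qed (rule C)
    then show ?thesis using C(2)[of x] by simp
  qed
  moreover have "f \<in> borel_measurable lborel"
    using assms by (auto simp: quartic_decay_def borel_measurable_continuous_onI)
  ultimately show ?thesis
    by (intro Bochner_Integration.integrable_bound[OF integrable_mult_right[OF integrable_inverse_square, of C]])
      (auto intro!: AE_I2 simp: C)
qed

text \<open>
  The line is cut into unit intervals, each of which is translated to \<open>[0, 1]\<close>. All
  passages between the line and the circle go through this identity.
\<close>

lemma quartic_decay_unfold: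
  assumes f: "quartic_decay f"
  shows "((\<lambda>k::int. integral {0..1} (\<lambda>x. f (x + of_int k))) has_sum (LINT x|lborel. f x)) UNIV"
proof -
  define g where "g k x = indicator {of_int k..<of_int k + 1} x *\<^sub>R f x" for k :: int and x :: real
  obtain C where C: "C \<ge> 0" "\<And>x. norm (f x) \<le> C / (1 + x\<^sup>2)\<^sup>2"
    using f by (auto simp: quartic_decay_def)
  have cont: "continuous_on S f" for S
    using f by (auto simp: quartic_decay_def intro: continuous_on_subset)
  have fm: "f \<in> borel_measurable borel"
    using cont by (rule borel_measurable_continuous_onI)
  have bd: "norm (g k x) \<le> (C * 4 * (1 / (1 + (of_int k)\<^sup>2))) * (1 / (1 + x\<^sup>2))" for k x
  proof (cases "x \<in> {of_int k..<of_int k + 1}")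
    case True
    then have "\<bar>x - of_int k\<bar> \<le> 1" by auto
    from quartic_decay_bound_shift[OF this, of "of_int k"]
    have s: "1 / (1 + x\<^sup>2) \<le> 4 / (1 + (of_int k)\<^sup>2)" by simp
    have "norm (g k x) \<le> C / (1 + x\<^sup>2)\<^sup>2" using True C(2)[of x] by (simp add: g_def)
    also have "\<dots> = C * ((1 / (1 + x\<^sup>2)) * (1 / (1 + x\<^sup>2)))" by (simp add: power2_eq_square)
    also have "\<dots> \<le> C * ((4 / (1 + (of_int k)\<^sup>2)) * (1 / (1 + x\<^sup>2)))"
      by (intro mult_left_mono mult_right_mono s C) auto
    finally show ?thesis by simp
  next
    case False
    then show ?thesis using C by (simp add: g_def)
  qed
  have eq: "(\<Sum>\<^sub>\<infinity>k. g k x) = f x" for x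
  proof -
    have "(\<Sum>\<^sub>\<infinity>k. g k x) = (\<Sum>\<^sub>\<infinity>k\<in>{\<lfloor>x\<rfloor>}. g k x)"
      by (rule infsum_cong_neutral) (auto simp: g_def indicator_def dest: floor_unique)
    then show ?thesis by (simp add: g_def indicator_def)
  qed
  have "((\<lambda>k. LINT x|lborel. g k x) has_sum (LINT x|lborel. (\<Sum>\<^sub>\<infinity>k. g k x))) UNIV"
  proof (rule integral_infsum(1)[where D = "\<lambda>x. 1 / (1 + x\<^sup>2)"])
    show "g k \<in> borel_measurable lborel" for k using fm unfolding g_def[abs_def] by measurable
    show "(\<lambda>k::int. C * 4 * (1 / (1 + (of_int k)\<^sup>2))) summable_on UNIV"
      by (intro summable_on_cmult_right summable_inverse_square_int)
  qed (use bd integrable_inverse_square C in auto)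
  moreover have "(LINT x|lborel. g k x) = integral {0..1} (\<lambda>x. f (x + of_int k))" for k
  proof -
    have "(LINT x|lborel. g k x) = (LINT x|lborel. indicator {of_int k..of_int k + 1} x *\<^sub>R f x)"
    proof (rule integral_cong_AE)
      show "g k \<in> borel_measurable lborel" using fm unfolding g_def[abs_def] by measurable
      show "(\<lambda>x. indicator {real_of_int k..real_of_int k + 1} x *\<^sub>R f x) \<in> borel_measurable lborel"
        using fm by measurable
      show "AE x in lborel. g k x = indicator {of_int k..of_int k + 1} x *\<^sub>R f x"
        using AE_lborel_singleton[of "of_int k + 1 :: real"]
        by eventually_elim (auto simp: g_def indicator_def)
    qed
    also have "\<dots> = integral {of_int k..of_int k + 1} f"
      using set_borel_integral_eq_integral(2)[OF borel_integrable_atLeastAtMost'[OF cont]]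
      by (simp add: set_lebesgue_integral_def)
    also have "\<dots> = integral {0..1} (\<lambda>x. f (x + of_int k))"
      using integral_shift[of 0 "of_int k" 1 f] cont by (simp add: o_def add.commute)
    finally show ?thesis .
  qed
  ultimately show ?thesis by (simp add: eq)
qed

lemma quartic_decay_bound_mult:
  assumes f: "quartic_decay f" and g: "continuous_on UNIV g" "\<And>x. norm (g x) \<le> B"
  shows "quartic_decay (\<lambda>x. g x * f x)"
proof -
  obtain C where C: "C \<ge> 0" "\<And>x. norm (f x) \<le> C / (1 + x\<^sup>2)\<^sup>2"
    using f by (auto simp: quartic_decay_def)
  have B: "B \<ge> 0" using g(2)[of 0] norm_ge_zero order_trans by blast
  have "norm (g x * f x) \<le> (B * C) / (1 + x\<^sup>2)\<^sup>2" for x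
    using mult_mono[OF g(2) C(2), of x x] B by (simp add: norm_mult)
  then show ?thesis using f g(1) B C(1)
    by (auto simp: quartic_decay_def intro!: continuous_on_mult exI[of _ "B * C"])
qed

lemma schwartz_quartic_decay:
  assumes "\<phi> \<in> schwartz"
  shows "quartic_decay \<phi>"
proof -
  obtain C where C: "C \<ge> 0" "\<And>x. norm (\<phi> x) \<le> C / (1 + \<bar>x\<bar>) ^ 4"
    by (rule schwartz_decay0[OF assms]) blast
  have "norm (\<phi> x) \<le> C / (1 + x\<^sup>2)\<^sup>2" for x
  proof -
    have "1 + x\<^sup>2 \<le> (1 + \<bar>x\<bar>)\<^sup>2" by (simp add: power2_eq_square algebra_simps)
    then have "(1 + x\<^sup>2)\<^sup>2 \<le> ((1 + \<bar>x\<bar>)\<^sup>2)\<^sup>2" by (intro power_mono) auto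
    then have "(1 + x\<^sup>2)\<^sup>2 \<le> (1 + \<bar>x\<bar>) ^ 4" by (simp flip: power_mult)
    then have "C / (1 + \<bar>x\<bar>) ^ 4 \<le> C / (1 + x\<^sup>2)\<^sup>2"
      by (intro divide_left_mono C) (auto intro!: mult_pos_pos add_pos_nonneg zero_less_power)
    then show ?thesis using C(2)[of x] by simp
  qed
  then show ?thesis using C(1) schwartz_continuous[OF assms] by (auto simp: quartic_decay_def)
qed

text \<open>
  After unfolding, the integrals over unit intervals telescope.
\<close>

lemma integral_deriv_eq_0:
  assumes "\<phi> \<in> schwartz"
  shows "(LINT x|lborel. nth_deriv 1 \<phi> x) = 0"
proof -
  have "integral {0..1} (\<lambda>x. nth_deriv 1 \<phi> (x + of_int k)) = \<phi> (of_int (k + 1)) - \<phi> (of_int k)" for k :: int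
  proof -
    have "((\<lambda>x. \<phi> (x + of_int k)) has_vector_derivative nth_deriv 1 \<phi> (x + of_int k)) (at x)" for x
      using smooth_line_deriv[OF nth_deriv_shift(1)[OF schwartz_smooth[OF assms]], of 0 "of_int k" x]
      by (simp add: nth_deriv_shift(2)[OF schwartz_smooth[OF assms]])
    then have "((\<lambda>x. nth_deriv 1 \<phi> (x + of_int k)) has_integral \<phi> (1 + of_int k) - \<phi> (0 + of_int k)) {0..1}"
      by (intro fundamental_theorem_of_calculus) (auto intro: has_vector_derivative_at_within)
    then show ?thesis by (simp add: integral_unique add.commute)
  qed
  with quartic_decay_unfold[OF schwartz_quartic_decay[OF schwartz_nth_deriv[OF assms, of 1]]]
  have s: "((\<lambda>k::int. \<phi> (of_int (k + 1)) - \<phi> (of_int k)) has_sum (LINT x|lborel. nth_deriv 1 \<phi> x)) UNIV" by simp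
  obtain C where C: "\<And>x a. \<bar>x\<bar> \<le> 0 \<Longrightarrow> norm (\<phi> (x + a)) \<le> C * (1 / (1 + a\<^sup>2))"
    by (rule quartic_decay_sum_bound[OF schwartz_quartic_decay[OF assms]]) blast
  have sm: "(\<lambda>k::int. \<phi> (of_int k)) summable_on UNIV"
    by (rule dominated_summable(2)[OF summable_on_cmult_right[OF summable_inverse_square_int, of C]])
      (use C[of 0] in simp)
  then obtain L where L: "((\<lambda>k::int. \<phi> (of_int k)) has_sum L) UNIV" by (auto simp: summable_on_def)
  then have "((\<lambda>k::int. \<phi> (of_int (k + 1))) has_sum L) UNIV"
    using has_sum_reindex_bij_betw[of "\<lambda>k::int. k + 1" UNIV UNIV "\<lambda>k. \<phi> (of_int k)" L]
    by (auto simp: bij_betw_def surj_def intro!: exI[of _ "_ - 1"]) 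
  from has_sum_add[OF this has_sum_uminusI[OF L]] s show ?thesis
    using has_sum_unique by fastforce
qed

section \<open>The Fourier transform on the line\<close>

definition fourier :: "(real \<Rightarrow> complex) \<Rightarrow> real \<Rightarrow> complex" where
  "fourier \<phi> t = (LINT x|lborel. wave (- (t * x)) * \<phi> x)"

lemma fourier_quartic_integrand:
  assumes "\<phi> \<in> schwartz"
  shows "quartic_decay (\<lambda>x. wave (- (t * x)) * \<phi> x)"
  by (rule quartic_decay_bound_mult[OF schwartz_quartic_decay[OF assms], of _ 1])
    (auto intro!: continuous_intros)

lemma fourier_deriv:
  assumes f: "\<phi> \<in> schwartz"
  shows "fourier (nth_deriv 1 \<phi>) t = (2 * pi * \<i> * t) * fourier \<phi> t"
proof -
  have w: "(\<lambda>x. wave (- (t * x)) * \<phi> x) \<in> schwartz"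
    using schwartz_wave[OF f, of "- t"] by simp
  have d: "nth_deriv 1 (\<lambda>x. wave (- (t * x)) * \<phi> x) x
    = wave (- (t * x)) * nth_deriv 1 \<phi> x - (2 * pi * \<i> * t) * (wave (- (t * x)) * \<phi> x)" for x
  proof -
    have "((\<lambda>x. wave (- (t * x)) * \<phi> x) has_vector_derivative
      wave (- (t * x)) * nth_deriv 1 \<phi> x + (2 * pi * \<i> * of_real (- t)) * wave (- (t * x)) * \<phi> x) (at x)"
      using has_vector_derivative_mult[OF has_vector_derivative_wave[of "- t" 0 x] smooth_line_deriv[OF schwartz_smooth[OF f], of 0 x]]
      by simp
    from vector_derivative_at[OF this] show ?thesis by (simp add: nth_deriv_Suc)
  qed
  have i: "integrable lborel (\<lambda>x. wave (- (t * x)) * nth_deriv 1 \<phi> x)" "integrable lborel (\<lambda>x. wave (- (t * x)) * \<phi> x)"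
    by (intro quartic_decay_integrable fourier_quartic_integrand f schwartz_nth_deriv)+
  have "0 = (LINT x|lborel. nth_deriv 1 (\<lambda>x. wave (- (t * x)) * \<phi> x) x)"
    by (simp only: integral_deriv_eq_0[OF w])
  also have "\<dots> = fourier (nth_deriv 1 \<phi>) t - (2 * pi * \<i> * t) * fourier \<phi> t"
    unfolding d fourier_def by (subst Bochner_Integration.integral_diff) (use i in auto)
  finally show ?thesis by simp
qed

lemma fourier_nth_deriv:
  "\<phi> \<in> schwartz \<Longrightarrow> fourier (nth_deriv l \<phi>) t = (2 * pi * \<i> * t) ^ l * fourier \<phi> t"
proof (induction l)
  case (Suc l)
  have "nth_deriv (Suc l) \<phi> = nth_deriv 1 (nth_deriv l \<phi>)" by (simp add: nth_deriv_def)
  then have "fourier (nth_deriv (Suc l) \<phi>) t = (2 * pi * \<i> * t) * fourier (nth_deriv l \<phi>) t"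
    using fourier_deriv[OF schwartz_nth_deriv[OF Suc.prems]] by simp
  then show ?case using Suc by simp
qed simp

lemma fourier_bound:
  assumes "\<phi> \<in> schwartz"
  shows "norm (fourier \<phi> t) \<le> (LINT x|lborel. norm (\<phi> x))"
  unfolding fourier_def
  by (rule integral_norm_bound[THEN order_trans]) (simp add: norm_mult)

text \<open>
  Decay is bought with four derivatives, continuity with one moment.
\<close>

lemma fourier_quartic_decay:
  assumes f: "\<phi> \<in> schwartz"
  shows "quartic_decay (fourier \<phi>)"
proof -
  define A where "A = (LINT x|lborel. norm (\<phi> x))"
  define B where "B = (LINT x|lborel. norm (nth_deriv 4 \<phi> x))"
  have AB: "A \<ge> 0" "B \<ge> 0" by (simp_all add: A_def B_def)
  have "norm (fourier \<phi> t) \<le> (2 * A + 2 * B) / (1 + t\<^sup>2)\<^sup>2" for t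
  proof -
    have "t ^ 4 * norm (fourier \<phi> t) \<le> (2 * pi) ^ 4 * t ^ 4 * norm (fourier \<phi> t)"
      using power_mono[of 1 "2 * pi" 4] pi_ge_two
      by (intro mult_right_mono) (auto simp: mult_le_cancel_right1)
    also have "\<dots> = norm (fourier (nth_deriv 4 \<phi>) t)"
      by (simp add: fourier_nth_deriv[OF f] norm_mult norm_power power_mult_distrib power_even_abs)
    also have "\<dots> \<le> B" unfolding B_def by (intro fourier_bound schwartz_nth_deriv f)
    finally have b: "t ^ 4 * norm (fourier \<phi> t) \<le> B" .
    have a: "norm (fourier \<phi> t) \<le> A" unfolding A_def by (rule fourier_bound[OF f])
    have "(1 + t\<^sup>2)\<^sup>2 \<le> 2 + 2 * t ^ 4"
      using zero_le_power2[of "1 - t\<^sup>2"] by (simp add: power2_eq_square algebra_simps eval_nat_numeral)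
    then have "(1 + t\<^sup>2)\<^sup>2 * norm (fourier \<phi> t) \<le> (2 + 2 * t ^ 4) * norm (fourier \<phi> t)"
      by (rule mult_right_mono) auto
    also have "\<dots> \<le> 2 * A + 2 * B" using a b by (simp add: algebra_simps)
    finally have e: "norm (fourier \<phi> t) * (1 + t\<^sup>2)\<^sup>2 \<le> 2 * A + 2 * B" by (simp add: mult.commute)
    have p: "0 < (1 + t\<^sup>2)\<^sup>2" by (intro zero_less_power add_pos_nonneg) auto
    show ?thesis using e by (subst pos_le_divide_eq[OF p])
  qed
  moreover have "continuous_on UNIV (fourier \<phi>)"
  proof -
    obtain C where C: "C \<ge> 0" "\<And>x. norm (\<phi> x) \<le> C / (1 + \<bar>x\<bar>) ^ 3"
      by (rule schwartz_decay0[OF f]) blast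
    have xb: "\<bar>x\<bar> * norm (\<phi> x) \<le> C * (1 / (1 + x\<^sup>2))" for x
    proof -
      have "\<bar>x\<bar> * norm (\<phi> x) \<le> (1 + \<bar>x\<bar>) * (C / (1 + \<bar>x\<bar>) ^ 3)" by (intro mult_mono C) auto
      also have "\<dots> = C / (1 + \<bar>x\<bar>)\<^sup>2"
      proof -
        have "p * (C / p ^ 3) = C / p\<^sup>2" if "p > 0" for p :: real
          using that by (simp add: power2_eq_square power3_eq_cube)
        then show ?thesis by (simp add: add_pos_nonneg)
      qed
      also have "\<dots> \<le> C / (1 + x\<^sup>2)"
      proof (rule divide_left_mono[OF _ C(1)])
        show "1 + x\<^sup>2 \<le> (1 + \<bar>x\<bar>)\<^sup>2" by (simp add: power2_eq_square algebra_simps)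
        show "0 < (1 + \<bar>x\<bar>)\<^sup>2 * (1 + x\<^sup>2)"
          by (intro mult_pos_pos zero_less_power add_pos_nonneg) auto
      qed
      finally show ?thesis by simp
    qed
    have ix: "integrable lborel (\<lambda>x. \<bar>x\<bar> * norm (\<phi> x))"
      by (rule Bochner_Integration.integrable_bound[OF integrable_mult_right[OF integrable_inverse_square, of C]])
        (use xb C schwartz_measurable[OF f] in auto)
    define L where "L = 2 * pi * (LINT x|lborel. \<bar>x\<bar> * norm (\<phi> x))"
    have lip: "norm (fourier \<phi> t - fourier \<phi> s) \<le> L * \<bar>t - s\<bar>" for s t
    proof -
      have i: "integrable lborel (\<lambda>x. wave (- (t * x)) * \<phi> x)" for t
        by (intro quartic_decay_integrable fourier_quartic_integrand f)
      have "fourier \<phi> t - fourier \<phi> s = (LINT x|lborel. (wave (- (t * x)) - wave (- (s * x))) * \<phi> x)"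
        unfolding fourier_def using i by (simp add: left_diff_distrib)
      also have "norm \<dots> \<le> (LINT x|lborel. norm ((wave (- (t * x)) - wave (- (s * x))) * \<phi> x))"
        by (rule integral_norm_bound)
      also have "\<dots> \<le> (LINT x|lborel. 2 * pi * \<bar>t - s\<bar> * (\<bar>x\<bar> * norm (\<phi> x)))"
      proof (rule integral_mono)
        show "integrable lborel (\<lambda>x. norm ((wave (- (t * x)) - wave (- (s * x))) * \<phi> x))"
          unfolding left_diff_distrib using i by auto
        show "integrable lborel (\<lambda>x. 2 * pi * \<bar>t - s\<bar> * (\<bar>x\<bar> * norm (\<phi> x)))" using ix by auto
        fix x
        have "norm (wave (- (t * x)) - wave (- (s * x))) \<le> 2 * pi * \<bar>- (t * x) - - (s * x)\<bar>" by (rule norm_wave_diff_le)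
        also have "\<bar>- (t * x) - - (s * x)\<bar> = \<bar>t - s\<bar> * \<bar>x\<bar>"
          by (simp add: abs_mult[symmetric] left_diff_distrib abs_minus_commute)
        finally show "norm ((wave (- (t * x)) - wave (- (s * x))) * \<phi> x) \<le> 2 * pi * \<bar>t - s\<bar> * (\<bar>x\<bar> * norm (\<phi> x))"
          unfolding norm_mult by (metis mult.assoc mult_right_mono norm_ge_zero)
      qed
      also have "\<dots> = L * \<bar>t - s\<bar>" unfolding L_def by (subst integral_mult_right_zero) simp
      finally show ?thesis .
    qed
    have "L \<ge> 0" by (auto simp: L_def)
    then have "L-lipschitz_on UNIV (fourier \<phi>)"
      by (intro lipschitz_onI) (auto simp: dist_norm lip)
    then show ?thesis by (rule lipschitz_on_continuous_on)
  qed
  ultimately show ?thesis using AB by (auto simp: quartic_decay_def intro!: exI[of _ "2 * A + 2 * B"])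
qed

section \<open>Fourier series on the circle\<close>

lemma integral_wave_int:
  "integral {0..1} (\<lambda>x. wave (of_int k * x)) = (if k = 0 then 1 else 0)"
proof (cases "k = 0")
  case False
  let ?c = "1 / (2 * pi * \<i> * of_int k) :: complex"
  have "((\<lambda>x. ?c * wave (of_int k * x)) has_vector_derivative wave (of_int k * x)) (at x)" for x
    using has_vector_derivative_mult_right[OF has_vector_derivative_wave[of "of_int k" 0 x], of ?c] False
    by simp
  then have "((\<lambda>x. wave (of_int k * x)) has_integral
      (?c * wave (of_int k * 1) - ?c * wave (of_int k * 0))) {0..1}"
    by (intro fundamental_theorem_of_calculus) (auto intro: has_vector_derivative_at_within)
  then show ?thesis using False by (simp add: integral_unique)
qed simp

lemma periodic_of_int:
  fixes f :: "real \<Rightarrow> 'a"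
  assumes "\<And>x. f (x + 1) = f x"
  shows "f (x + of_int k) = f x"
proof -
  have n: "f (x + of_nat n) = f x" for n x
  proof (induction n)
    case (Suc n)
    then show ?case using assms[of "x + of_nat n"] by (simp add: ac_simps)
  qed simp
  show ?thesis
  proof (cases k)
    case (neg n)
    then show ?thesis using n[of "x + of_int k" "Suc n"] by simp
  qed (simp add: n)
qed

lemma integral_periodic_shift:
  fixes f :: "real \<Rightarrow> complex"
  assumes c: "continuous_on UNIV f" and p: "\<And>x. f (x + 1) = f x"
  shows "integral {0..1} (\<lambda>x. f (x + a)) = integral {0..1} f"
proof -
  define b where "b = frac a"
  have b: "0 \<le> b" "b \<le> 1" by (simp_all add: b_def frac_ge_0 less_imp_le[OF frac_lt_1])
  have i: "f integrable_on {u..v}" for u v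
    using c by (auto intro: integrable_continuous_real continuous_on_subset)
  have sh: "integral {u..v} (\<lambda>x. f (x + d)) = integral {u + d..v + d} f" for u v d
    using integral_shift[of u d v f] c by (simp add: o_def add.commute continuous_on_subset)
  have "f (x + a) = f (x + b)" for x
    using periodic_of_int[of f "x + b" "\<lfloor>a\<rfloor>", OF p] by (simp add: b_def frac_def)
  then have "integral {0..1} (\<lambda>x. f (x + a)) = integral {b..1 + b} f" using sh[of 0 1 b] by simp
  also have "\<dots> = integral {b..1} f + integral {1..1 + b} f"
    by (rule Henstock_Kurzweil_Integration.integral_combine[symmetric]) (use b i in auto)
  also have "integral {1..1 + b} f = integral {0..b} f"
    using sh[of 0 b 1] p by (simp add: add.commute)
  also have "integral {b..1} f + integral {0..b} f = integral {0..1} f"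
    using Henstock_Kurzweil_Integration.integral_combine[of 0 b 1 f] b i by (simp add: add.commute)
  finally show ?thesis .
qed

text \<open>
  The trigonometric polynomials \<open>(sin (\<pi> x))\<^sup>2\<^sup>n\<close> concentrate at the midpoint of the period,
  so a continuous function orthogonal to all of them vanishes there. In the proof, \<open>q\<close> bounds the base of the
  power away from the midpoint, and \<open>q' > q\<close> bounds it from below on a shorter interval around the midpoint;
  the ratio \<open>(q' / q)\<^sup>n\<close> is unbounded.
\<close>

lemma orthogonal_to_waves_midpoint:
  fixes f :: "real \<Rightarrow> complex"
  assumes c: "continuous_on UNIV f"
    and z: "\<And>m::int. integral {0..1} (\<lambda>x. wave (of_int m * x) * f x) = 0"
  shows "f (1/2) = 0"
proof (rule ccontr)
  assume nz: "f (1/2) \<noteq> 0"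
  define p :: "real \<Rightarrow> real" where "p x = (cos (pi * (x - 1/2)))\<^sup>2" for x
  have pw: "of_real (p x) = (2 - wave x - wave (- x)) / 4" for x
  proof -
    have "p x = (1 + cos (2 * (pi * (x - 1/2)))) / 2" unfolding p_def by (simp only: cos_double_cos) simp
    also have "2 * (pi * (x - 1/2)) = 2 * pi * x - pi" by (simp add: algebra_simps)
    finally have "p x = (1 - cos (2 * pi * x)) / 2" by (simp add: cos_diff)
    then show ?thesis by (simp add: wave_def complex_eq_iff)
  qed
  have cf: "continuous_on S f" for S using c continuous_on_subset by blast
  have cp: "continuous_on S p" for S unfolding p_def by (intro continuous_intros)
  have ig: "(\<lambda>x. wave (of_int m * x) * (of_real (p x) ^ n * f x)) integrable_on {0..1}" for m n
    by (intro integrable_continuous_real continuous_intros cf cp)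
  have zn: "integral {0..1} (\<lambda>x. wave (of_int m * x) * (of_real (p x) ^ n * f x)) = 0" for m n
  proof (induction n arbitrary: m)
    case (Suc n)
    let ?I = "\<lambda>m x. wave (of_int m * x) * (of_real (p x) ^ n * f x)"
    have "wave (of_int m * x) * (of_real (p x) ^ Suc n * f x)
       = (1/2) * ?I m x - (1/4) * ?I (m + 1) x - (1/4) * ?I (m - 1) x" for x
      by (simp add: pw distrib_right left_diff_distrib wave_add wave_diff field_simps)
    then have "integral {0..1} (\<lambda>x. wave (of_int m * x) * (of_real (p x) ^ Suc n * f x))
      = integral {0..1} (\<lambda>x. (1/2) * ?I m x - (1/4) * ?I (m + 1) x - (1/4) * ?I (m - 1) x)" by simp
    also have "\<dots> = (1/2) * integral {0..1} (?I m) - (1/4) * integral {0..1} (?I (m + 1)) - (1/4) * integral {0..1} (?I (m - 1))"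
      by (simp only: Henstock_Kurzweil_Integration.integral_diff integral_cmult
         integrable_diff integrable_on_cmult_left integrable_on_mult_right ig)
    also have "\<dots> = 0" unfolding Suc.IH by simp
    finally show ?case .
  qed (use z in simp)
  define \<epsilon> where "\<epsilon> = norm (f (1/2)) / 2"
  have e: "\<epsilon> > 0" using nz by (simp add: \<epsilon>_def)
  have "isCont f (1/2)" using c by (simp add: continuous_on_eq_continuous_at)
  then obtain d where d: "d > 0" "\<And>x. \<bar>x - 1/2\<bar> < d \<Longrightarrow> norm (f x - f (1/2)) < \<epsilon>"
    using e unfolding continuous_at_eps_delta dist_norm by (metis real_norm_def)
  define \<delta> where "\<delta> = min (d / 2) (1 / 4)"
  have de: "0 < \<delta>" "\<delta> \<le> 1/4" "\<delta> < d" using d(1) by (auto simp: \<delta>_def)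
  define q where "q = (cos (pi * \<delta>))\<^sup>2"
  define q' where "q' = (cos (pi * (\<delta> / 2)))\<^sup>2"
  have cpos: "cos (pi * \<delta>) > 0"
    by (rule cos_gt_zero_pi) (use de pi_gt_zero in \<open>auto simp: field_simps intro: less_le_trans[of _ 0]\<close>)
  then have q0: "q > 0" by (simp add: q_def)
  have qq: "q < q'"
  proof -
    have "cos (pi * \<delta>) < cos (pi * (\<delta> / 2))"
      by (rule cos_monotone_0_pi) (use de in \<open>auto simp: field_simps\<close>)
    then show ?thesis using cpos by (simp add: q_def q'_def power_strict_mono)
  qed
  have cosabs: "cos (pi * y) = cos (pi * \<bar>y\<bar>)" for y by (cases "y \<ge> 0") auto
  have far: "p x \<le> q" if "x \<in> {0..1}" "\<bar>x - 1/2\<bar> \<ge> \<delta>" for x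
  proof -
    have half: "\<bar>x - 1/2\<bar> \<le> 1/2" using that(1) by (simp add: abs_if)
    have "cos (pi * \<bar>x - 1/2\<bar>) \<le> cos (pi * \<delta>)"
    proof (rule cos_monotone_0_pi_le)
      have "\<bar>x - 1/2\<bar> \<le> 1" using that by (auto simp: abs_le_iff)
      then show "pi * \<bar>x - 1/2\<bar> \<le> pi" using mult_left_mono[of "\<bar>x - 1/2\<bar>" 1 pi] by simp
    qed (use that de in auto)
    moreover have "0 \<le> cos (pi * \<bar>x - 1/2\<bar>)"
    proof (rule cos_ge_zero)
      have "pi * \<bar>x - 1/2\<bar> \<le> pi * (1/2)" by (rule mult_left_mono) (use half in simp_all)
      then show "pi * \<bar>x - 1/2\<bar> \<le> pi / 2" by simp
      show "- (pi / 2) \<le> pi * \<bar>x - 1/2\<bar>" by (rule order_trans[of _ 0]) auto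
    qed
    ultimately show ?thesis unfolding p_def q_def cosabs[of "x - 1/2"] by (intro power_mono)
  qed
  have near: "q' \<le> p x" if "\<bar>x - 1/2\<bar> \<le> \<delta> / 2" for x
  proof -
    have "cos (pi * (\<delta> / 2)) \<le> cos (pi * \<bar>x - 1/2\<bar>)"
      by (rule cos_monotone_0_pi_le) (use that de in \<open>auto simp: mult_le_cancel_left1\<close>)
    moreover have "0 \<le> cos (pi * (\<delta> / 2))"
    proof (rule cos_ge_zero)
      have "pi * (\<delta> / 2) \<le> pi * (1/2)" by (rule mult_left_mono) (use de in auto)
      then show "pi * (\<delta> / 2) \<le> pi / 2" by simp
      show "- (pi / 2) \<le> pi * (\<delta> / 2)" by (rule order_trans[of _ 0]) (use de in auto)
    qed
    ultimately show ?thesis unfolding p_def q'_def cosabs[of "x - 1/2"] by (intro power_mono)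
  qed
  obtain B where B: "\<And>x. x \<in> {0..1} \<Longrightarrow> norm (f x) \<le> B"
    using compact_imp_bounded[OF compact_continuous_image[OF cf compact_Icc], of 0 1]
    unfolding bounded_iff by (metis imageI)
  have p0: "p x \<ge> 0" for x by (simp add: p_def)
  have key: "\<epsilon> * (\<delta> * q' ^ n) \<le> 2 * B * q ^ n" for n
  proof -
    have pi': "(\<lambda>x. p x ^ n) integrable_on {u..v}" for u v
      by (intro integrable_continuous_real continuous_intros cp)
    have "f (1/2) * of_real (integral {0..1} (\<lambda>x. p x ^ n))
       = integral {0..1} (\<lambda>x. of_real (p x ^ n) * f (1/2) - of_real (p x) ^ n * f x)"
    proof -
      have "integral {0..1} (\<lambda>x. of_real (p x) ^ n * f x) = 0" using zn[of 0 n] by simp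
      moreover have "((\<lambda>x. of_real (p x ^ n) :: complex) has_integral of_real (integral {0..1} (\<lambda>x. p x ^ n))) {0..1}"
        by (rule has_integral_of_real[OF integrable_integral[OF pi']])
      moreover have "((\<lambda>x. of_real (p x) ^ n * f x) has_integral integral {0..1} (\<lambda>x. of_real (p x) ^ n * f x)) {0..1}"
        using ig[of 0 n] by (simp add: integrable_integral)
      ultimately have "((\<lambda>x. of_real (p x ^ n) * f (1/2) - of_real (p x) ^ n * f x) has_integral
           of_real (integral {0..1} (\<lambda>x. p x ^ n)) * f (1/2) - 0) {0..1}"
        by (intro has_integral_diff has_integral_mult_left) auto
      then show ?thesis by (simp add: integral_unique mult.commute)
    qed
    also have "norm \<dots> \<le> integral {0..1} (\<lambda>x. \<epsilon> * p x ^ n + 2 * B * q ^ n)"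
    proof (rule integral_norm_bound_integral)
      show "(\<lambda>x. of_real (p x ^ n) * f (1/2) - of_real (p x) ^ n * f x) integrable_on {0..1}"
        by (intro integrable_continuous_real continuous_intros cf cp)
      show "(\<lambda>x. \<epsilon> * p x ^ n + 2 * B * q ^ n) integrable_on {0..1}"
        by (intro integrable_continuous_real continuous_intros cf cp)
      fix x :: real assume x: "x \<in> {0..1}"
      have "of_real (p x ^ n) * f (1/2) - of_real (p x) ^ n * f x = of_real (p x ^ n) * (f (1/2) - f x)"
        by (simp add: algebra_simps)
      then have eq: "norm (of_real (p x ^ n) * f (1/2) - of_real (p x) ^ n * f x) = p x ^ n * norm (f (1/2) - f x)"
        using p0[of x] by (simp add: norm_mult norm_power)
      have B0: "0 \<le> B" using B[OF x] norm_ge_zero order_trans by blast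
      show "norm (of_real (p x ^ n) * f (1/2) - of_real (p x) ^ n * f x) \<le> \<epsilon> * p x ^ n + 2 * B * q ^ n"
      proof (cases "\<bar>x - 1/2\<bar> < \<delta>")
        case True
        then have "norm (f (1/2) - f x) \<le> \<epsilon>" using d(2)[of x] de by (simp add: norm_minus_commute)
        then have "p x ^ n * norm (f (1/2) - f x) \<le> p x ^ n * \<epsilon>" by (rule mult_left_mono) (use p0 in auto)
        then show ?thesis unfolding eq using B0 q0 by (simp add: mult.commute add_increasing2)
      next
        case False
        have "p x ^ n \<le> q ^ n" by (rule power_mono[OF far[OF x]]) (use False p0 in auto)
        moreover have "norm (f (1/2) - f x) \<le> 2 * B"
          using norm_triangle_ineq4[of "f (1/2)" "f x"] B[OF x] B[of "1/2"] by simp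
        ultimately have "p x ^ n * norm (f (1/2) - f x) \<le> q ^ n * (2 * B)" by (rule mult_mono) (use q0 in auto)
        then show ?thesis unfolding eq using e p0[of x] by (simp add: mult_ac add_increasing)
      qed
    qed
    also have "\<dots> = \<epsilon> * integral {0..1} (\<lambda>x. p x ^ n) + 2 * B * q ^ n"
    proof (rule integral_unique)
      have k: "((\<lambda>x. 2 * B * q ^ n) has_integral 2 * B * q ^ n) {0..1::real}"
        using has_integral_const_real[of "2 * B * q ^ n" 0 1] by simp
      show "((\<lambda>x. \<epsilon> * p x ^ n + 2 * B * q ^ n) has_integral
          \<epsilon> * integral {0..1} (\<lambda>x. p x ^ n) + 2 * B * q ^ n) {0..1}"
        by (rule has_integral_add[OF has_integral_mult_right[OF integrable_integral[OF pi']] k])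
    qed
    finally have m: "norm (f (1/2)) * integral {0..1} (\<lambda>x. p x ^ n) \<le> \<epsilon> * integral {0..1} (\<lambda>x. p x ^ n) + 2 * B * q ^ n"
      using Henstock_Kurzweil_Integration.integral_nonneg[OF pi'[of 0 1]] p0 by (simp add: norm_mult)
    have "\<delta> * q' ^ n = integral {1/2 - \<delta>/2..1/2 + \<delta>/2} (\<lambda>x. q' ^ n)" using de by simp
    also have "\<dots> \<le> integral {1/2 - \<delta>/2..1/2 + \<delta>/2} (\<lambda>x. p x ^ n)"
    proof (rule integral_le)
      fix x assume "x \<in> {1/2 - \<delta>/2..1/2 + \<delta>/2}"
      then have "\<bar>x - 1/2\<bar> \<le> \<delta> / 2" unfolding atLeastAtMost_iff by arith
      then show "q' ^ n \<le> p x ^ n" by (intro power_mono near) (auto simp: q'_def)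
    qed (auto intro!: pi')
    also have "\<dots> \<le> integral {0..1} (\<lambda>x. p x ^ n)"
      by (rule integral_subset_le) (use de pi' p0 in auto)
    finally have "\<epsilon> * (\<delta> * q' ^ n) \<le> \<epsilon> * integral {0..1} (\<lambda>x. p x ^ n)" using e by simp
    also have "\<dots> \<le> 2 * B * q ^ n" using m by (simp add: \<epsilon>_def)
    finally show ?thesis .
  qed
  have "1 < q' / q" using qq q0 by simp
  then obtain n where n: "2 * B / (\<epsilon> * \<delta>) < (q' / q) ^ n" using real_arch_pow by blast
  then have "2 * B < \<epsilon> * \<delta> * (q' / q) ^ n" using e de by (simp add: divide_less_eq mult_ac)
  also have "\<dots> = \<epsilon> * (\<delta> * q' ^ n) / q ^ n" by (simp add: power_divide)
  also have "\<dots> \<le> 2 * B" using key[of n] q0 by (simp add: divide_le_eq)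
  finally show False by simp
qed

text \<open>
  Any point is the midpoint of a period.
\<close>

lemma orthogonal_to_waves_eq_0:
  fixes f :: "real \<Rightarrow> complex"
  assumes c: "continuous_on UNIV f" and p: "\<And>x. f (x + 1) = f x"
    and z: "\<And>m::int. integral {0..1} (\<lambda>x. wave (of_int m * x) * f x) = 0"
  shows "f y = 0"
proof -
  let ?a = "y - 1/2"
  have "f (1/2 + ?a) = 0"
  proof (rule orthogonal_to_waves_midpoint[where f = "\<lambda>x. f (x + ?a)"])
    show "continuous_on UNIV (\<lambda>x. f (x + ?a))"
      by (rule continuous_on_compose2[OF c]) (auto intro!: continuous_intros)
    fix m :: int
    have "integral {0..1} (\<lambda>x. wave (of_int m * x) * f (x + ?a))
        = integral {0..1} (\<lambda>x. wave (of_int m * (- ?a)) * (wave (of_int m * (x + ?a)) * f (x + ?a)))"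
      by (rule integral_cong) (simp add: algebra_simps flip: wave_add)
    also have "\<dots> = wave (of_int m * (- ?a)) * integral {0..1} (\<lambda>x. wave (of_int m * (x + ?a)) * f (x + ?a))"
      by (rule integral_cmult)
    also have "integral {0..1} (\<lambda>x. wave (of_int m * (x + ?a)) * f (x + ?a)) = integral {0..1} (\<lambda>x. wave (of_int m * x) * f x)"
      by (rule integral_periodic_shift[where f = "\<lambda>x. wave (of_int m * x) * f x"])
        (auto intro!: continuous_intros c simp: p distrib_left wave_add)
    finally show "integral {0..1} (\<lambda>x. wave (of_int m * x) * f (x + ?a)) = 0" by (simp add: z)
  qed
  then show ?thesis by simp
qed

lemma fourier_coefficient_of_series:
  fixes c :: "int \<Rightarrow> complex"
  assumes c: "(\<lambda>m. norm (c m)) summable_on UNIV"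
  shows "integral {0..1} (\<lambda>x. wave (- (of_int n * x)) * (\<Sum>\<^sub>\<infinity>m. c m * wave (of_int m * x))) = c n"
proof -
  let ?f = "\<lambda>m x. c m * wave (of_int (m - n) * x)"
  have "integral {0..1} (\<lambda>x. wave (- (of_int n * x)) * (\<Sum>\<^sub>\<infinity>m. c m * wave (of_int m * x)))
      = integral {0..1} (\<lambda>x. \<Sum>\<^sub>\<infinity>m. ?f m x)"
    by (rule integral_cong)
      (simp add: algebra_simps wave_diff flip: infsum_cmult_right')
  also have "((\<lambda>m. integral {0..1} (?f m)) has_sum integral {0..1} (\<lambda>x. \<Sum>\<^sub>\<infinity>m. ?f m x)) UNIV"
    by (rule integral_infsum_interval[where B = "\<lambda>m. norm (c m)"])
      (use c in \<open>auto intro!: continuous_intros simp: norm_mult\<close>)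
  then have "integral {0..1} (\<lambda>x. \<Sum>\<^sub>\<infinity>m. ?f m x) = (\<Sum>\<^sub>\<infinity>m. integral {0..1} (?f m))"
    by (simp add: infsumI)
  also have "\<dots> = (\<Sum>\<^sub>\<infinity>m\<in>{n}. c m)"
    by (rule infsum_cong_neutral) (simp_all only: integral_cmult integral_wave_int, auto)
  finally show ?thesis by simp
qed

lemma periodization_summable:
  assumes "quartic_decay f"
  shows "(\<lambda>k::int. norm (f (x + of_int k))) summable_on UNIV"
proof -
  obtain C where C: "C \<ge> 0" "\<And>y a. \<bar>y\<bar> \<le> \<bar>x\<bar> \<Longrightarrow> norm (f (y + a)) \<le> C * (1 / (1 + a\<^sup>2))"
    by (rule quartic_decay_sum_bound[OF assms]) blast
  show ?thesis
    by (rule dominated_summable(1)[OF summable_on_cmult_right[OF summable_inverse_square_int, of C]])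
      (use C in simp)
qed

lemma continuous_on_periodization:
  assumes f: "quartic_decay f"
  shows "continuous_on UNIV (\<lambda>x. \<Sum>\<^sub>\<infinity>k::int. f (x + of_int k))"
proof -
  have "continuous_on (ball 0 R) (\<lambda>x. \<Sum>\<^sub>\<infinity>k::int. f (x + of_int k))" for R
  proof -
    obtain C where C: "C \<ge> 0" "\<And>y a. \<bar>y\<bar> \<le> R \<Longrightarrow> norm (f (y + a)) \<le> C * (1 / (1 + a\<^sup>2))"
      by (rule quartic_decay_sum_bound[OF f]) blast
    show ?thesis
    proof (rule continuous_on_infsum[where b = "\<lambda>k::int. C * (1 / (1 + (of_int k)\<^sup>2))"])
      show "continuous_on (ball 0 R) (\<lambda>x. f (x + of_int k))" for k :: int
        using f by (auto simp: quartic_decay_def intro!: continuous_on_compose2[of UNIV f] continuous_intros)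
      show "(\<lambda>k::int. C * (1 / (1 + (of_int k)\<^sup>2))) summable_on UNIV"
        by (intro summable_on_cmult_right summable_inverse_square_int)
    qed (use C in auto)
  qed
  then have "isCont (\<lambda>x. \<Sum>\<^sub>\<infinity>k::int. f (x + of_int k)) x" for x
    by (rule continuous_on_interior[of "ball 0 (\<bar>x\<bar> + 1)"]) (simp add: interior_open)
  then show ?thesis by (simp add: continuous_on_eq_continuous_at)
qed

lemma infsum_shift_int: "(\<Sum>\<^sub>\<infinity>k. f (k + c)) = (\<Sum>\<^sub>\<infinity>k. f k)" for c :: int and f :: "int \<Rightarrow> 'a::{comm_monoid_add,t2_space}"
  by (rule infsum_reindex_bij_witness[where j = "\<lambda>k. k + c" and i = "\<lambda>k. k - c"]) auto

lemma fourier_summable: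
  assumes "\<phi> \<in> schwartz"
  shows "(\<lambda>m::int. norm (fourier \<phi> (of_int m))) summable_on UNIV"
  using periodization_summable[OF fourier_quartic_decay[OF assms], of 0] by simp

text \<open>
  Both sides are continuous and periodic with the same Fourier coefficients.
\<close>

theorem poisson_summation:
  assumes f: "\<phi> \<in> schwartz"
  shows "(\<Sum>\<^sub>\<infinity>k::int. \<phi> (x + of_int k)) = (\<Sum>\<^sub>\<infinity>m::int. fourier \<phi> (of_int m) * wave (of_int m * x))"
proof -
  let ?F = "\<lambda>x. \<Sum>\<^sub>\<infinity>k::int. \<phi> (x + of_int k)"
  let ?G = "\<lambda>x. \<Sum>\<^sub>\<infinity>m::int. fourier \<phi> (of_int m) * wave (of_int m * x)"
  have cF: "continuous_on UNIV ?F" by (rule continuous_on_periodization[OF schwartz_quartic_decay[OF f]])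
  have cG: "continuous_on UNIV ?G"
    by (rule continuous_on_infsum[where b = "\<lambda>m::int. norm (fourier \<phi> (of_int m))"])
      (use fourier_summable[OF f] in \<open>auto intro!: continuous_intros simp: norm_mult\<close>)
  have pF: "?F (x + 1) = ?F x" for x
    using infsum_shift_int[of "\<lambda>k. \<phi> (x + of_int k)" 1] by (simp add: ac_simps)
  have pG: "?G (x + 1) = ?G x" for x by (simp add: distrib_left wave_add)
  have coef: "integral {0..1} (\<lambda>x. wave (- (of_int n * x)) * ?F x) = fourier \<phi> (of_int n)" for n :: int
  proof -
    let ?h = "\<lambda>x. wave (- (of_int n * x)) * \<phi> x"
    have "((\<lambda>k::int. integral {0..1} (\<lambda>x. ?h (x + of_int k))) has_sum fourier \<phi> (of_int n)) UNIV"
      unfolding fourier_def by (rule quartic_decay_unfold[OF fourier_quartic_integrand[OF f]])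
    moreover obtain C where C: "C \<ge> 0" "\<And>y a. \<bar>y\<bar> \<le> 1 \<Longrightarrow> norm (?h (y + a)) \<le> C * (1 / (1 + a\<^sup>2))"
      by (rule quartic_decay_sum_bound[OF fourier_quartic_integrand[OF f]]) blast
    have "((\<lambda>k::int. integral {0..1} (\<lambda>x. ?h (x + of_int k))) has_sum
        integral {0..1} (\<lambda>x. \<Sum>\<^sub>\<infinity>k::int. ?h (x + of_int k))) UNIV"
    proof (rule integral_infsum_interval[where B = "\<lambda>k::int. C * (1 / (1 + (of_int k)\<^sup>2))"])
      show "continuous_on {0..1} (\<lambda>x. ?h (x + of_int k))" for k :: int
        by (intro continuous_intros continuous_on_compose2[OF schwartz_continuous[OF f, of UNIV]]) auto
      show "norm (?h (x + of_int k)) \<le> C * (1 / (1 + (of_int k)\<^sup>2))" if "x \<in> {0..1}" for x and k :: int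
        using C(2)[of x "of_int k"] that by simp
    qed (intro summable_on_cmult_right summable_inverse_square_int)
    moreover have "(\<Sum>\<^sub>\<infinity>k::int. ?h (x + of_int k)) = wave (- (of_int n * x)) * ?F x" for x
    proof -
      have "wave (- (of_int n * (x + of_int k))) = wave (- (of_int n * x))" for k :: int
        by (rule wave_eqI) (simp add: algebra_simps flip: of_int_mult of_int_minus)
      then show ?thesis by (simp add: infsum_cmult_right')
    qed
    ultimately show ?thesis using has_sum_unique by fastforce
  qed
  have i: "(\<lambda>x. wave (of_int m * x) * ?F x) integrable_on {0..1}" "(\<lambda>x. wave (of_int m * x) * ?G x) integrable_on {0..1}" for m :: int
    by (intro integrable_continuous_real continuous_intros continuous_on_subset[OF cF] continuous_on_subset[OF cG]; simp)+
  have "?F x - ?G x = 0"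
  proof (rule orthogonal_to_waves_eq_0[where f = "\<lambda>x. ?F x - ?G x"])
    show "continuous_on UNIV (\<lambda>x. ?F x - ?G x)" by (intro continuous_on_diff cF cG)
    show "?F (x + 1) - ?G (x + 1) = ?F x - ?G x" for x by (simp only: pF pG)
    fix m :: int
    have "integral {0..1} (\<lambda>x. wave (of_int m * x) * (?F x - ?G x))
      = integral {0..1} (\<lambda>x. wave (of_int m * x) * ?F x) - integral {0..1} (\<lambda>x. wave (of_int m * x) * ?G x)"
      unfolding right_diff_distrib by (rule Henstock_Kurzweil_Integration.integral_diff[OF i])
    also have "\<dots> = 0"
      using coef[of "- m"] fourier_coefficient_of_series[OF fourier_summable[OF f], of "- m"] by simp
    finally show "integral {0..1} (\<lambda>x. wave (of_int m * x) * (?F x - ?G x)) = 0" .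
  qed
  then show ?thesis by simp
qed

text \<open>
  Fourier inversion follows from Poisson summation for the modulations of \<open>\<phi>\<close>: integrating
  over the modulation parameter isolates the term \<open>k = 0\<close> of one side and unfolds the other side
  to an integral over the line.
\<close>

theorem fourier_inversion:
  assumes f: "\<phi> \<in> schwartz"
  shows "(LINT t|lborel. wave (t * x) * fourier \<phi> t) = \<phi> x"
proof -
  let ?h = "\<lambda>t. wave (t * x) * fourier \<phi> t"
  have qh: "quartic_decay ?h"
    by (rule quartic_decay_bound_mult[OF fourier_quartic_decay[OF f], of _ 1]) (auto intro!: continuous_intros)
  have key: "(\<Sum>\<^sub>\<infinity>m::int. ?h (\<theta> + of_int m)) = (\<Sum>\<^sub>\<infinity>k::int. \<phi> (x + of_int k) * wave (of_int (- k) * \<theta>))" for \<theta>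
  proof -
    let ?g = "\<lambda>x. wave (- \<theta> * x) * \<phi> x"
    have g: "?g \<in> schwartz" by (rule schwartz_wave[OF f])
    have fg: "fourier ?g t = fourier \<phi> (\<theta> + t)" for t
      unfolding fourier_def by (simp add: algebra_simps wave_add wave_diff)
    have "(\<Sum>\<^sub>\<infinity>m::int. ?h (\<theta> + of_int m)) = wave (\<theta> * x) * (\<Sum>\<^sub>\<infinity>m::int. fourier ?g (of_int m) * wave (of_int m * x))"
      unfolding fg infsum_cmult_right'[symmetric] by (simp add: algebra_simps wave_add)
    also have "\<dots> = wave (\<theta> * x) * (\<Sum>\<^sub>\<infinity>k::int. ?g (x + of_int k))"
      by (simp only: poisson_summation[OF g])
    also have "\<dots> = (\<Sum>\<^sub>\<infinity>k::int. \<phi> (x + of_int k) * wave (of_int (- k) * \<theta>))"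
      unfolding infsum_cmult_right'[symmetric]
      by (rule infsum_cong) (simp add: mult.assoc[symmetric] wave_add[symmetric], simp add: algebra_simps)
    finally show ?thesis .
  qed
  obtain C where C: "C \<ge> 0" "\<And>y a. \<bar>y\<bar> \<le> 1 \<Longrightarrow> norm (?h (y + a)) \<le> C * (1 / (1 + a\<^sup>2))"
    by (rule quartic_decay_sum_bound[OF qh]) blast
  have ch: "continuous_on UNIV ?h" using qh by (simp add: quartic_decay_def)
  have "((\<lambda>k::int. integral {0..1} (\<lambda>\<theta>. ?h (\<theta> + of_int k))) has_sum
      integral {0..1} (\<lambda>\<theta>. \<Sum>\<^sub>\<infinity>k::int. ?h (\<theta> + of_int k))) UNIV"
  proof (rule integral_infsum_interval[where B = "\<lambda>k::int. C * (1 / (1 + (of_int k)\<^sup>2))"])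
    show "continuous_on {0..1} (\<lambda>x. ?h (x + of_int k))" for k :: int
      by (rule continuous_on_compose2[OF ch]) (auto intro!: continuous_intros)
    show "norm (?h (y + of_int k)) \<le> C * (1 / (1 + (of_int k)\<^sup>2))" if "y \<in> {0..1}" for y and k :: int
      using C(2)[of y "of_int k"] that by simp
  qed (intro summable_on_cmult_right summable_inverse_square_int)
  with quartic_decay_unfold[OF qh]
  have "(LINT t|lborel. ?h t) = integral {0..1} (\<lambda>\<theta>. \<Sum>\<^sub>\<infinity>k::int. ?h (\<theta> + of_int k))"
    using has_sum_unique by blast
  also have "\<dots> = integral {0..1} (\<lambda>\<theta>. \<Sum>\<^sub>\<infinity>k::int. \<phi> (x + of_int k) * wave (of_int (- k) * \<theta>))"
    by (simp only: key)
  also have "((\<lambda>k::int. integral {0..1} (\<lambda>\<theta>. \<phi> (x + of_int k) * wave (of_int (- k) * \<theta>))) has_sum \<dots>) UNIV"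
    by (rule integral_infsum_interval[where B = "\<lambda>k::int. norm (\<phi> (x + of_int k))"])
      (auto intro!: continuous_intros periodization_summable schwartz_quartic_decay f simp: norm_mult)
  then have "integral {0..1} (\<lambda>\<theta>. \<Sum>\<^sub>\<infinity>k::int. \<phi> (x + of_int k) * wave (of_int (- k) * \<theta>))
    = (\<Sum>\<^sub>\<infinity>k::int. integral {0..1} (\<lambda>\<theta>. \<phi> (x + of_int k) * wave (of_int (- k) * \<theta>)))"
    by (simp only: infsumI)
  also have "\<dots> = (\<Sum>\<^sub>\<infinity>k\<in>{0::int}. \<phi> (x + of_int k))"
    by (rule infsum_cong_neutral) (simp_all only: integral_cmult integral_wave_int, auto)
  finally show ?thesis by simp
qed

section \<open>Tempered distributions\<close>

lemma schwartz_seminorm_nonneg: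
  assumes "\<phi> \<in> schwartz"
  shows "0 \<le> schwartz_seminorm j l \<phi>"
proof -
  have "bdd_above (range (\<lambda>x. norm (x ^ j *\<^sub>R nth_deriv l \<phi> x)))"
    using assms by (auto simp: schwartz_def bounded_iff bdd_above_def)
  then have "norm (0 ^ j *\<^sub>R nth_deriv l \<phi> 0) \<le> schwartz_seminorm j l \<phi>"
    unfolding schwartz_seminorm_def by (rule cSUP_upper[rotated]) simp
  then show ?thesis using norm_ge_zero order_trans by blast
qed

lemma schwartz_seminorm_le:
  assumes "\<And>x. \<bar>x\<bar> ^ j * norm (nth_deriv l \<phi> x) \<le> b"
  shows "schwartz_seminorm j l \<phi> \<le> b"
  unfolding schwartz_seminorm_def
  by (rule cSUP_least) (use assms in \<open>auto simp: norm_mult power_abs\<close>)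

lemma le_schwartz_seminorm:
  assumes "\<phi> \<in> schwartz"
  shows "\<bar>x\<bar> ^ j * norm (nth_deriv l \<phi> x) \<le> schwartz_seminorm j l \<phi>"
proof -
  have "bdd_above (range (\<lambda>x. norm (x ^ j *\<^sub>R nth_deriv l \<phi> x)))"
    using assms by (auto simp: schwartz_def bounded_iff bdd_above_def)
  then have "norm (x ^ j *\<^sub>R nth_deriv l \<phi> x) \<le> schwartz_seminorm j l \<phi>"
    unfolding schwartz_seminorm_def by (rule cSUP_upper[rotated]) simp
  then show ?thesis by (simp add: power_abs)
qed

text \<open>
  Continuity in the form in which it is used, with bounds for the seminorms instead of the seminorms.
\<close>

lemma tempered_bound:
  assumes "u \<in> tempered"
  obtains C m where "C \<ge> 0" "\<And>\<phi> b. \<phi> \<in> schwartz \<Longrightarrow>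
      (\<And>j l x. \<bar>x\<bar> ^ j * norm (nth_deriv l \<phi> x) \<le> b j l) \<Longrightarrow>
      norm (u \<phi>) \<le> C * (\<Sum>j\<le>m. \<Sum>l\<le>m. b j l)"
proof -
  have "\<exists>C m. \<forall>\<phi>\<in>schwartz. norm (u \<phi>) \<le> C * (\<Sum>j\<le>m. \<Sum>l\<le>m. schwartz_seminorm j l \<phi>)"
    using assms by (simp add: tempered_def)
  then obtain C m where C: "\<And>\<phi>. \<phi> \<in> schwartz \<Longrightarrow> norm (u \<phi>) \<le> C * (\<Sum>j\<le>m. \<Sum>l\<le>m. schwartz_seminorm j l \<phi>)"
    by blast
  have "norm (u \<phi>) \<le> \<bar>C\<bar> * (\<Sum>j\<le>m. \<Sum>l\<le>m. b j l)"
    if p: "\<phi> \<in> schwartz" and b: "\<And>j l x. \<bar>x\<bar> ^ j * norm (nth_deriv l \<phi> x) \<le> b j l" for \<phi> b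
  proof -
    let ?S = "\<Sum>j\<le>m. \<Sum>l\<le>m. schwartz_seminorm j l \<phi>"
    have S: "0 \<le> ?S" by (intro sum_nonneg schwartz_seminorm_nonneg p)
    have "norm (u \<phi>) \<le> \<bar>C\<bar> * ?S" using C[OF p] mult_right_mono[OF abs_ge_self S, of C] by simp
    also have "\<dots> \<le> \<bar>C\<bar> * (\<Sum>j\<le>m. \<Sum>l\<le>m. b j l)"
      by (intro mult_left_mono sum_mono schwartz_seminorm_le b) auto
    finally show ?thesis .
  qed
  then show ?thesis by (intro that[of "\<bar>C\<bar>" m]) auto
qed

lemma tempered_linear:
  "u \<in> tempered \<Longrightarrow> \<phi> \<in> schwartz \<Longrightarrow> \<psi> \<in> schwartz \<Longrightarrow> u (\<lambda>x. c * \<phi> x + \<psi> x) = c * u \<phi> + u \<psi>"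
  by (auto simp: tempered_def)

lemma tempered_not_schwartz: "u \<in> tempered \<Longrightarrow> \<phi> \<notin> schwartz \<Longrightarrow> u \<phi> = 0"
  by (auto simp: tempered_def)

lemma tempered_0: "u \<in> tempered \<Longrightarrow> u (\<lambda>x. 0) = 0"
  using tempered_linear[of u "\<lambda>x. 0" "\<lambda>x. 0" 1] schwartz_0 by simp

lemma tempered_scale: "u \<in> tempered \<Longrightarrow> \<phi> \<in> schwartz \<Longrightarrow> u (\<lambda>x. c * \<phi> x) = c * u \<phi>"
  using tempered_linear[of u \<phi> "\<lambda>x. 0" c] schwartz_0 tempered_0 by simp

lemma tempered_sum:
  assumes u: "u \<in> tempered" and f: "\<And>i. i \<in> A \<Longrightarrow> f i \<in> schwartz"
  shows "u (\<lambda>x. \<Sum>i\<in>A. c i * f i x) = (\<Sum>i\<in>A. c i * u (f i))"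
  using f
proof (induction A rule: infinite_finite_induct)
  case (insert a A)
  then show ?case
    by (simp add: tempered_linear[OF u] schwartz_sum schwartz_scale)
qed (simp_all add: tempered_0[OF u])

lemma schwartz_series:
  fixes f :: "'i \<Rightarrow> real \<Rightarrow> complex"
  assumes f: "\<And>i. f i \<in> schwartz"
    and B: "\<And>j l. B j l summable_on UNIV"
    and le: "\<And>j l i x. \<bar>x\<bar> ^ j * norm (nth_deriv l (f i) x) \<le> B j l i"
  shows "(\<lambda>x. \<Sum>\<^sub>\<infinity>i. f i x) \<in> schwartz"
    and "\<bar>x\<bar> ^ j * norm (nth_deriv l (\<lambda>x. \<Sum>\<^sub>\<infinity>i. f i x) x) \<le> (\<Sum>\<^sub>\<infinity>i. B j l i)"
proof -
  let ?F = "\<lambda>l x. \<Sum>\<^sub>\<infinity>i. nth_deriv l (f i) x"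
  have le0: "norm (nth_deriv l (f i) x) \<le> B 0 l i" for l i x
    using le[of x 0 l i] by simp
  have "(?F l has_vector_derivative ?F (Suc l) x) (at x)" for l x
    by (rule has_vector_derivative_infsum[where B = "B 0 l" and B' = "B 0 (Suc l)"])
      (auto intro!: smooth_line_deriv smooth_line_continuous smooth_line_nth_deriv schwartz_smooth schwartz_nth_deriv f B le0)
  note ch = nth_deriv_chain[of ?F, OF this]
  have bd: "\<bar>x\<bar> ^ j * norm (?F l x) \<le> (\<Sum>\<^sub>\<infinity>i. B j l i)" for j l x
  proof -
    have "norm (\<Sum>\<^sub>\<infinity>i. (\<bar>x\<bar> ^ j) *\<^sub>R nth_deriv l (f i) x) \<le> (\<Sum>\<^sub>\<infinity>i. B j l i)"
      by (rule dominated_summable(3)[OF B]) (simp add: le)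
    then show ?thesis by (simp add: infsum_scaleR_right)
  qed
  show "(\<lambda>x. \<Sum>\<^sub>\<infinity>i. f i x) \<in> schwartz"
  proof (rule schwartzI)
    show "smooth_line (\<lambda>x. \<Sum>\<^sub>\<infinity>i. f i x)" using ch(1) by simp
    show "\<exists>C. \<forall>x. \<bar>x\<bar> ^ j * norm (nth_deriv l (\<lambda>x. \<Sum>\<^sub>\<infinity>i. f i x) x) \<le> C" for j l
      using bd ch(2) by (intro exI[of _ "infsum (B j l) UNIV"]) simp
  qed
  show "\<bar>x\<bar> ^ j * norm (nth_deriv l (\<lambda>x. \<Sum>\<^sub>\<infinity>i. f i x) x) \<le> (\<Sum>\<^sub>\<infinity>i. B j l i)"
    using bd ch(2) by simp
qed

text \<open>
  A tempered distribution may be applied term by term to a series whose Schwartz seminorms are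
  summable, because it is bounded by finitely many of them.
\<close>

lemma tempered_series:
  fixes f :: "'i \<Rightarrow> real \<Rightarrow> complex"
  assumes u: "u \<in> tempered" and f: "\<And>i. f i \<in> schwartz"
    and B: "\<And>j l. B j l summable_on UNIV"
    and le: "\<And>j l i x. \<bar>x\<bar> ^ j * norm (nth_deriv l (f i) x) \<le> B j l i"
  shows "((\<lambda>i. u (f i)) has_sum u (\<lambda>x. \<Sum>\<^sub>\<infinity>i. f i x)) UNIV"
proof -
  obtain C m where C: "C \<ge> 0" "\<And>\<phi> b. \<phi> \<in> schwartz \<Longrightarrow>
      (\<And>j l x. \<bar>x\<bar> ^ j * norm (nth_deriv l \<phi> x) \<le> b j l) \<Longrightarrow>
      norm (u \<phi>) \<le> C * (\<Sum>j\<le>m. \<Sum>l\<le>m. b j l)"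
    by (rule tempered_bound[OF u]) blast
  let ?g = "\<lambda>x. \<Sum>\<^sub>\<infinity>i. f i x"
  have B0: "B j l i \<ge> 0" for j l i
    using le[of 0 j l i] by (rule order_trans[rotated]) auto
  have est: "norm (u ?g - (\<Sum>i\<in>F. u (f i))) \<le> C * (\<Sum>j\<le>m. \<Sum>l\<le>m. infsum (B j l) UNIV - sum (B j l) F)"
    if F: "finite F" for F
  proof -
    let ?f = "\<lambda>i. if i \<in> F then (\<lambda>x. 0) else f i"
    let ?B = "\<lambda>j l i. if i \<in> F then 0 else B j l i"
    have f': "?f i \<in> schwartz" for i by (simp add: f schwartz_0)
    have B': "?B j l summable_on UNIV" for j l
      by (rule Infinite_Sum.summable_on_comparison_test[OF B[of j l]]) (auto simp: B0)
    have le': "\<bar>x\<bar> ^ j * norm (nth_deriv l (?f i) x) \<le> ?B j l i" for j l i x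
      by (simp add: le)
    note t = schwartz_series[of ?f ?B, OF f' B' le']
    have tail: "infsum (?B j l) UNIV = infsum (B j l) UNIV - sum (B j l) F" for j l
    proof -
      have "infsum (?B j l) UNIV = infsum (B j l) (UNIV - F)"
        by (rule infsum_cong_neutral) auto
      also have "\<dots> = infsum (B j l) UNIV - infsum (B j l) F"
        by (rule infsum_Diff) (use B F in auto)
      finally show ?thesis using F by simp
    qed
    have split: "?g x = (\<Sum>i\<in>F. f i x) + (\<Sum>\<^sub>\<infinity>i. ?f i x)" for x
    proof -
      have s: "(\<lambda>i. f i x) summable_on UNIV"
        by (rule dominated_summable(2)[OF B[of 0 0]]) (use le[of x 0 0] in simp)
      have "(\<Sum>\<^sub>\<infinity>i. ?f i x) = infsum (\<lambda>i. f i x) (UNIV - F)"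
        by (rule infsum_cong_neutral) auto
      also have "\<dots> = ?g x - (\<Sum>i\<in>F. f i x)"
        by (subst infsum_Diff) (use s F in auto)
      finally show ?thesis by simp
    qed
    have "u ?g = u (\<lambda>x. 1 * (\<Sum>i\<in>F. 1 * f i x) + (\<Sum>\<^sub>\<infinity>i. ?f i x))"
      unfolding split by simp
    also have "\<dots> = (\<Sum>i\<in>F. u (f i)) + u (\<lambda>x. \<Sum>\<^sub>\<infinity>i. ?f i x)"
      by (subst tempered_linear[OF u]) (use t(1) in \<open>auto intro!: schwartz_sum f simp: tempered_sum[OF u f, where c = "\<lambda>_. 1", simplified]\<close>)
    finally have "u ?g - (\<Sum>i\<in>F. u (f i)) = u (\<lambda>x. \<Sum>\<^sub>\<infinity>i. ?f i x)" by simp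
    also have "norm \<dots> \<le> C * (\<Sum>j\<le>m. \<Sum>l\<le>m. infsum (?B j l) UNIV)"
      by (rule C(2)[OF t(1)]) (rule t(2))
    finally show ?thesis by (simp only: tail)
  qed
  have lim: "((\<lambda>F. C * (\<Sum>j\<le>m. \<Sum>l\<le>m. infsum (B j l) UNIV - sum (B j l) F)) \<longlongrightarrow>
      C * (\<Sum>j\<le>m. \<Sum>l\<le>m. infsum (B j l) UNIV - infsum (B j l) UNIV)) (finite_subsets_at_top UNIV)"
    by (intro tendsto_intros infsum_tendsto B)
  have "((\<lambda>F. u ?g - (\<Sum>i\<in>F. u (f i))) \<longlongrightarrow> 0) (finite_subsets_at_top UNIV)"
    by (rule Lim_null_comparison[OF _ lim[simplified]])
      (use est in \<open>auto simp: eventually_finite_subsets_at_top\<close>)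
  then have "((\<lambda>F. u ?g - (u ?g - (\<Sum>i\<in>F. u (f i)))) \<longlongrightarrow> u ?g - 0) (finite_subsets_at_top UNIV)"
    by (intro tendsto_intros)
  then show ?thesis by (simp add: has_sum_def)
qed

section \<open>Weyl quantization of trigonometric series\<close>

lemma planck_exponent:
  assumes "N > 0"
  shows "exp (\<i> / complex_of_real (planck N) * complex_of_real r) = wave (real N * r)"
  using assms by (simp add: planck_def wave_exp field_simps)

text \<open>
  Each character quantizes to a phase space translation; this is Fourier inversion after
  the substitution \<open>t = N \<xi> - p / 2\<close>.
\<close>

lemma integral_wave_fourier:
  assumes f: "\<phi> \<in> schwartz" and N: "N > 0"
  shows "real N *\<^sub>R (LINT \<xi>|lborel. wave (real N * x * \<xi> + p * x / 2 - q * \<xi>) * fourier \<phi> (real N * \<xi> - p / 2))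
    = heisenberg N p q \<phi> x"
proof -
  define g where "g t = wave (p * x - p * q / (2 * N)) * (wave (t * (x - q / N)) * fourier \<phi> t)" for t
  have "(LINT t|lborel. g t) = \<bar>real N\<bar> *\<^sub>R (LINT \<xi>|lborel. g (- p / 2 + real N * \<xi>))"
    by (rule lborel_integral_real_affine) (use N in auto)
  moreover have "g (- p / 2 + real N * \<xi>) = wave (real N * x * \<xi> + p * x / 2 - q * \<xi>) * fourier \<phi> (real N * \<xi> - p / 2)" for \<xi>
  proof -
    have "p * x - p * q / (2 * N) + (- p / 2 + real N * \<xi>) * (x - q / N) = real N * x * \<xi> + p * x / 2 - q * \<xi>"
      using N by (simp add: field_simps)
    moreover have "- p / 2 + real N * \<xi> = real N * \<xi> - p / 2" by simp
    ultimately show ?thesis unfolding g_def by (metis mult.assoc wave_add)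
  qed
  moreover have "(LINT t|lborel. g t) = heisenberg N p q \<phi> x"
    unfolding g_def heisenberg_def by (simp add: fourier_inversion[OF f])
  ultimately show ?thesis by simp
qed

lemma weyl_trigonometric_series:
  fixes c :: "'i::countable \<Rightarrow> complex" and p q :: "'i \<Rightarrow> real" and a :: "real^2 \<Rightarrow> complex"
  assumes f: "\<phi> \<in> schwartz" and N: "N > 0"
    and c: "(\<lambda>i. norm (c i) * (2 + (p i)\<^sup>2)) summable_on UNIV"
    and a: "\<And>z. a z = (\<Sum>\<^sub>\<infinity>i. c i * wave (p i * z $ 1 + q i * z $ 2))"
  shows "weyl (planck N) (\<lambda>z. a (vector [z $ 1, - (z $ 2)])) \<phi> x = (\<Sum>\<^sub>\<infinity>i. c i * heisenberg N (p i) (q i) \<phi> x)"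
proof -
  have c1: "(\<lambda>i. norm (c i)) summable_on UNIV"
    by (rule Infinite_Sum.summable_on_comparison_test[OF c]) (auto simp: mult_le_cancel_left1)
  have fm: "\<phi> \<in> borel_measurable borel" by (rule schwartz_measurable[OF f])
  have fi: "integrable lborel \<phi>" by (rule quartic_decay_integrable[OF schwartz_quartic_decay[OF f]])
  obtain C where C: "C \<ge> 0" "\<And>t. norm (fourier \<phi> t) \<le> C / (1 + t\<^sup>2)\<^sup>2"
    using fourier_quartic_decay[OF f] by (auto simp: quartic_decay_def)
  have cfo: "continuous_on UNIV (fourier \<phi>)" using fourier_quartic_decay[OF f] by (simp add: quartic_decay_def)
  let ?K = "\<lambda>i \<xi>. wave (real N * x * \<xi> + p i * x / 2 - q i * \<xi>) * fourier \<phi> (real N * \<xi> - p i / 2)"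
  have inner: "(LINT y|lborel. exp (\<i> / complex_of_real (planck N) * complex_of_real ((x - y) * \<xi>)) *
        a (vector [(x + y) / 2, - \<xi>]) * \<phi> y) = (\<Sum>\<^sub>\<infinity>i. c i * ?K i \<xi>)" for \<xi>
  proof -
    let ?g = "\<lambda>i y. c i * wave (real N * x * \<xi> + p i * x / 2 - q i * \<xi>) * (wave (- ((real N * \<xi> - p i / 2) * y)) * \<phi> y)"
    have "exp (\<i> / complex_of_real (planck N) * complex_of_real ((x - y) * \<xi>)) *
        a (vector [(x + y) / 2, - \<xi>]) * \<phi> y = (\<Sum>\<^sub>\<infinity>i. ?g i y)" for y
    proof -
      have "wave (real N * ((x - y) * \<xi>)) * wave (p i * ((x + y) / 2) + q i * (- \<xi>))
          = wave (real N * x * \<xi> + p i * x / 2 - q i * \<xi>) * wave (- ((real N * \<xi> - p i / 2) * y))" for i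
        unfolding wave_add[symmetric] by (rule arg_cong[of _ _ wave]) (simp add: field_simps)
      then have eq: "?g i y = (wave (real N * ((x - y) * \<xi>)) * (c i * wave (p i * ((x + y) / 2) + q i * (- \<xi>)))) * \<phi> y" for i
        by (simp add: mult_ac)
      show ?thesis
        unfolding planck_exponent[OF N] a eq infsum_cmult_left' infsum_cmult_right' by simp
    qed
    then have "(LINT y|lborel. exp (\<i> / complex_of_real (planck N) * complex_of_real ((x - y) * \<xi>)) *
        a (vector [(x + y) / 2, - \<xi>]) * \<phi> y) = (LINT y|lborel. (\<Sum>\<^sub>\<infinity>i. ?g i y))" by simp
    also have "\<dots> = (\<Sum>\<^sub>\<infinity>i. LINT y|lborel. ?g i y)"
      by (rule infsumI[symmetric], rule integral_infsum(1)[where B = "\<lambda>i. norm (c i)" and D = "\<lambda>y. norm (\<phi> y)"])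
        (use c1 fi fm in \<open>auto simp: norm_mult\<close>)
    also have "\<dots> = (\<Sum>\<^sub>\<infinity>i. c i * ?K i \<xi>)"
      unfolding integral_mult_right_zero fourier_def by (simp only: mult.assoc)
    finally show ?thesis .
  qed
  have Kb: "norm (c i * ?K i \<xi>) \<le> (norm (c i) * (2 + (p i)\<^sup>2) * C) * (1 / (1 + \<xi>\<^sup>2))" for i \<xi>
  proof -
    let ?t = "real N * \<xi> - p i / 2"
    have pos: "0 < 1 + ?t\<^sup>2" by (rule add_pos_nonneg) auto
    have "norm (fourier \<phi> ?t) \<le> C / (1 + ?t\<^sup>2)\<^sup>2" by (rule C)
    also have "\<dots> \<le> C / (1 + ?t\<^sup>2)"
      using power_increasing[of 1 2 "1 + ?t\<^sup>2"] pos by (intro divide_left_mono C) auto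
    also have "\<dots> = C * (1 / (1 + (- p i / 2 + real N * \<xi>)\<^sup>2))" by simp
    also have "\<dots> \<le> C * ((2 + 2 * (\<bar>p i\<bar> / 2)\<^sup>2) / (1 + (real N * \<xi>)\<^sup>2))"
      by (intro mult_left_mono quartic_decay_bound_shift C) auto
    also have "\<dots> \<le> C * ((2 + (p i)\<^sup>2) / (1 + \<xi>\<^sup>2))"
    proof (intro mult_left_mono frac_le C)
      have "1 * \<xi>\<^sup>2 \<le> (real N)\<^sup>2 * \<xi>\<^sup>2" using N by (intro mult_right_mono) auto
      then show "1 + \<xi>\<^sup>2 \<le> 1 + (real N * \<xi>)\<^sup>2" by (simp add: power_mult_distrib)
      show "0 < 1 + \<xi>\<^sup>2" by (rule add_pos_nonneg) auto
    qed (auto simp: power_divide)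
    finally have "norm (c i) * norm (fourier \<phi> ?t) \<le> norm (c i) * (C * ((2 + (p i)\<^sup>2) / (1 + \<xi>\<^sup>2)))"
      by (rule mult_left_mono) auto
    then show ?thesis by (simp add: norm_mult mult_ac)
  qed
  have "weyl (planck N) (\<lambda>z. a (vector [z $ 1, - (z $ 2)])) \<phi> x
      = of_real (real N) * (LINT \<xi>|lborel. (\<Sum>\<^sub>\<infinity>i. c i * ?K i \<xi>))"
    unfolding weyl_def vector_2 inner using N by (simp add: planck_def)
  also have "(LINT \<xi>|lborel. (\<Sum>\<^sub>\<infinity>i. c i * ?K i \<xi>)) = (\<Sum>\<^sub>\<infinity>i. LINT \<xi>|lborel. c i * ?K i \<xi>)"
  proof (rule infsumI[symmetric], rule integral_infsum(1)[OF _ Kb])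
    show "(\<lambda>\<xi>. c i * ?K i \<xi>) \<in> borel_measurable lborel" for i
    proof -
      have "continuous_on UNIV (\<lambda>\<xi>. c i * ?K i \<xi>)"
        by (intro continuous_intros continuous_on_compose2[OF cfo]) auto
      then show ?thesis by (simp add: borel_measurable_continuous_onI)
    qed
    show "(\<lambda>i. norm (c i) * (2 + (p i)\<^sup>2) * C) summable_on UNIV" by (intro summable_on_cmult_left c)
    show "integrable lborel (\<lambda>\<xi>::real. 1 / (1 + \<xi>\<^sup>2))" by (rule integrable_inverse_square)
  qed (auto intro!: mult_nonneg_nonneg C)
  also have "of_real (real N) * \<dots> = (\<Sum>\<^sub>\<infinity>i. c i * (real N *\<^sub>R (LINT \<xi>|lborel. ?K i \<xi>)))"
    unfolding infsum_cmult_right'[symmetric] by (simp add: scaleR_conv_of_real mult_ac)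
  finally show ?thesis by (simp only: integral_wave_fourier[OF f N])
qed

text \<open>The transpose of a phase space translation, acting on distributions.\<close>

definition translate :: "nat \<Rightarrow> real \<Rightarrow> real \<Rightarrow> functional \<Rightarrow> functional" where
  "translate N a b u = (\<lambda>\<phi>. if \<phi> \<in> schwartz then u (heisenberg N a b \<phi>) else 0)"

definition plane_wave :: "real \<Rightarrow> real \<Rightarrow> real^2 \<Rightarrow> complex" where
  "plane_wave a b z = wave (a * z $ 1 + b * z $ 2)"

lemma weyl_dist_plane_wave:
  assumes "N > 0"
  shows "weyl_dist (planck N) (plane_wave a b) u = translate N a b u"
proof -
  have "weyl (planck N) (\<lambda>z. plane_wave a b (vector [z $ 1, - (z $ 2)])) \<phi> x = heisenberg N a b \<phi> x"
    if "\<phi> \<in> schwartz" for \<phi> x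
    using weyl_trigonometric_series[OF that assms, of "\<lambda>_::unit. 1" "\<lambda>_. a" "plane_wave a b" "\<lambda>_. b" x]
    by (simp add: plane_wave_def)
  then show ?thesis by (auto simp: weyl_dist_def translate_def fun_eq_iff intro!: arg_cong[of _ _ u])
qed

lemma bounded_symbol_plane_wave: "bounded_symbol (plane_wave a b)"
proof -
  have d: "((\<lambda>z. k * plane_wave a b z) has_derivative (\<lambda>v. (k * (2 * pi * \<i> * (a * v $ 1 + b * v $ 2))) * plane_wave a b z)) (at z)" for k z
  proof -
    have "((\<lambda>z::real^2. a * z $ 1 + b * z $ 2) has_derivative (\<lambda>v. a * v $ 1 + b * v $ 2)) (at z)"
      by (auto intro!: derivative_eq_intros bounded_linear.has_derivative[OF bounded_linear_vec_nth])
    moreover have "(wave has_derivative (\<lambda>t. t *\<^sub>R ((2 * pi * \<i>) * wave r))) (at r)" for r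
      using has_vector_derivative_wave[of 1 0 r] by (simp add: has_vector_derivative_def)
    ultimately have "((\<lambda>z. wave (a * z $ 1 + b * z $ 2)) has_derivative
        (\<lambda>v. (a * v $ 1 + b * v $ 2) *\<^sub>R ((2 * pi * \<i>) * wave (a * z $ 1 + b * z $ 2)))) (at z)"
      using has_derivative_compose by fastforce
    from has_derivative_mult_right[OF this, of k]
    show ?thesis by (simp add: plane_wave_def[abs_def] scaleR_conv_of_real algebra_simps)
  qed
  have "\<exists>k. partials vs (plane_wave a b) = (\<lambda>z. k * plane_wave a b z)" for vs
  proof (induction vs)
    case Nil
    then show ?case by (auto intro!: exI[of _ 1])
  next
    case (Cons v vs)
    then obtain k where k: "partials vs (plane_wave a b) = (\<lambda>z. k * plane_wave a b z)" by blast
    have "partials (v # vs) (plane_wave a b) = (\<lambda>z. (k * (2 * pi * \<i> * (a * v $ 1 + b * v $ 2))) * plane_wave a b z)"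
      by (simp add: k frechet_derivative_at[OF d, symmetric])
    then show ?case by blast
  qed
  then obtain K where K: "\<And>vs. partials vs (plane_wave a b) = (\<lambda>z. K vs * plane_wave a b z)" by metis
  show ?thesis
    unfolding bounded_symbol_def smooth_def
  proof (intro conjI allI impI)
    show "partials vs (plane_wave a b) differentiable (at z)" for vs z
      unfolding K by (rule differentiableI[OF d])
    show "bounded (range (partials vs (plane_wave a b)))" for vs
      unfolding K bounded_iff by (auto simp: norm_mult plane_wave_def)
  qed
qed

section \<open>The space of torus states\<close>

definition state :: "nat \<Rightarrow> (nat \<Rightarrow> complex) \<Rightarrow> functional" where
  "state N c = (\<lambda>\<phi>. \<Sum>n<N. c n * dirac_comb N n \<phi>)"

lemma torus_states_eq: "torus_states N = range (state N)"
  by (auto simp: torus_states_def state_def)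

lemma inverse_square_rescale:
  assumes "N > 0"
  shows "1 / (1 + (r / real N)\<^sup>2) \<le> (real N)\<^sup>2 * (1 / (1 + r\<^sup>2))"
proof -
  have "1 + r\<^sup>2 \<le> (real N)\<^sup>2 * (1 + (r / real N)\<^sup>2)"
    using assms by (simp add: distrib_left power_divide)
  moreover have "0 < 1 + r\<^sup>2" "0 < 1 + (r / real N)\<^sup>2" by (auto intro: add_pos_nonneg)
  ultimately show ?thesis by (simp add: field_simps)
qed

lemma lattice_decay:
  assumes "\<phi> \<in> schwartz" "N > 0"
  obtains C where "C \<ge> 0" "\<And>t r. \<bar>t\<bar> \<le> R \<Longrightarrow> norm (\<phi> (t + r / real N)) \<le> C * (1 / (1 + r\<^sup>2))"
proof -
  obtain C where C: "C \<ge> 0" "\<And>t a. \<bar>t\<bar> \<le> R \<Longrightarrow> norm (\<phi> (t + a)) \<le> C * (1 / (1 + a\<^sup>2))"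
    by (rule quartic_decay_sum_bound[OF schwartz_quartic_decay[OF assms(1)]]) blast
  have "norm (\<phi> (t + r / real N)) \<le> (C * (real N)\<^sup>2) * (1 / (1 + r\<^sup>2))" if "\<bar>t\<bar> \<le> R" for t r
    using C(2)[OF that, of "r / real N"] mult_left_mono[OF inverse_square_rescale[OF assms(2), of r] C(1)]
    by (simp add: mult_ac)
  then show ?thesis using C(1) by (intro that[of "C * (real N)\<^sup>2"]) auto
qed

lemma lattice_summable:
  assumes "\<phi> \<in> schwartz" "N > 0" and a: "\<And>r. norm (a r) \<le> A"
  shows "(\<lambda>r::int. norm (a r * \<phi> (of_int r / real N - t))) summable_on UNIV"
    and "(\<lambda>r::int. a r * \<phi> (of_int r / real N - t)) summable_on UNIV"
proof -
  obtain C where C: "C \<ge> 0" "\<And>s r. \<bar>s\<bar> \<le> \<bar>t\<bar> \<Longrightarrow> norm (\<phi> (s + r / real N)) \<le> C * (1 / (1 + r\<^sup>2))"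
    by (rule lattice_decay[OF assms(1,2)]) blast
  have A: "A \<ge> 0" using a[of 0] norm_ge_zero order_trans by blast
  have le: "norm (a r * \<phi> (of_int r / real N - t)) \<le> A * C * (1 / (1 + (of_int r)\<^sup>2))" for r
    using mult_mono[OF a[of r] C(2)[of "- t" "of_int r"] A] C(1) by (simp add: norm_mult mult_ac)
  show "(\<lambda>r::int. norm (a r * \<phi> (of_int r / real N - t))) summable_on UNIV"
    by (rule dominated_summable(1)[OF summable_on_cmult_right[OF summable_inverse_square_int] le])
  show "(\<lambda>r::int. a r * \<phi> (of_int r / real N - t)) summable_on UNIV"
    by (rule dominated_summable(2)[OF summable_on_cmult_right[OF summable_inverse_square_int] le])
qed

text \<open>
  A measure with bounded weights on a translate of the lattice \<open>(1 / N) \<int>\<close>. Torus states and their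
  translates, also by non-integer parameters, are of this kind.
\<close>

lemma tempered_lattice:
  assumes N: "N > 0" and a: "\<And>r. norm (a r) \<le> A"
  shows "(\<lambda>\<phi>. if \<phi> \<in> schwartz then (\<Sum>\<^sub>\<infinity>r::int. a r * \<phi> (of_int r / real N - t)) else 0) \<in> tempered"
    (is "?u \<in> _")
proof -
  have A: "A \<ge> 0" using a[of 0] norm_ge_zero order_trans by blast
  define K where "K = A * (2 + 2 * \<bar>t\<bar>\<^sup>2) * (real N)\<^sup>2"
  have K: "K \<ge> 0" using A by (simp add: K_def)
  define S where "S = (\<Sum>\<^sub>\<infinity>r::int. 1 / (1 + (of_int r)\<^sup>2) :: real)"
  have lin: "?u (\<lambda>x. c * \<phi> x + \<psi> x) = c * ?u \<phi> + ?u \<psi>" if "\<phi> \<in> schwartz" "\<psi> \<in> schwartz" for c \<phi> \<psi>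
  proof -
    have "(\<Sum>\<^sub>\<infinity>r::int. a r * (c * \<phi> (of_int r / real N - t) + \<psi> (of_int r / real N - t)))
      = (\<Sum>\<^sub>\<infinity>r::int. c * (a r * \<phi> (of_int r / real N - t)) + a r * \<psi> (of_int r / real N - t))"
      by (simp add: algebra_simps)
    also have "\<dots> = c * (\<Sum>\<^sub>\<infinity>r::int. a r * \<phi> (of_int r / real N - t)) + (\<Sum>\<^sub>\<infinity>r::int. a r * \<psi> (of_int r / real N - t))"
      by (subst infsum_add)
        (use that in \<open>auto intro!: summable_on_cmult_right lattice_summable(2)[OF _ N a] simp: infsum_cmult_right'\<close>)
    finally show ?thesis using that by (simp add: schwartz_linear)
  qed
  have bd: "norm (?u \<phi>) \<le> (K * S) * (\<Sum>j\<le>2. \<Sum>l\<le>2. schwartz_seminorm j l \<phi>)" if p: "\<phi> \<in> schwartz" for \<phi>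
  proof -
    define s where "s = schwartz_seminorm 0 0 \<phi> + schwartz_seminorm 2 0 \<phi>"
    have s0: "s \<ge> 0" by (simp add: s_def schwartz_seminorm_nonneg[OF p])
    have ps: "norm (\<phi> x) \<le> s * (1 / (1 + x\<^sup>2))" for x
    proof -
      have "norm (\<phi> x) * (1 + x\<^sup>2) \<le> s"
        using le_schwartz_seminorm[OF p, of x 0 0] le_schwartz_seminorm[OF p, of x 2 0]
        by (simp add: s_def algebra_simps)
      moreover have "0 < 1 + x\<^sup>2" by (rule add_pos_nonneg) auto
      ultimately show ?thesis by (simp add: pos_le_divide_eq)
    qed
    have le: "norm (a r * \<phi> (of_int r / real N - t)) \<le> K * s * (1 / (1 + (of_int r)\<^sup>2))" for r :: int
    proof -
      have "norm (\<phi> (of_int r / real N - t)) \<le> s * (1 / (1 + (- t + of_int r / real N)\<^sup>2))"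
        using ps[of "- t + of_int r / real N"] by simp
      also have "\<dots> \<le> s * ((2 + 2 * \<bar>t\<bar>\<^sup>2) * (1 / (1 + (of_int r / real N)\<^sup>2)))"
        using quartic_decay_bound_shift[of "- t" "\<bar>t\<bar>" "of_int r / real N"] by (intro mult_left_mono s0) simp
      also have "\<dots> \<le> s * ((2 + 2 * \<bar>t\<bar>\<^sup>2) * ((real N)\<^sup>2 * (1 / (1 + (of_int r)\<^sup>2))))"
        by (intro mult_left_mono inverse_square_rescale N s0) auto
      finally have "norm (a r) * norm (\<phi> (of_int r / real N - t)) \<le> A * (s * ((2 + 2 * \<bar>t\<bar>\<^sup>2) * ((real N)\<^sup>2 * (1 / (1 + (of_int r)\<^sup>2)))))"
        by (rule mult_mono[OF a _ A]) auto
      then show ?thesis by (simp add: norm_mult K_def mult_ac)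
    qed
    have "norm (?u \<phi>) \<le> (\<Sum>\<^sub>\<infinity>r::int. K * s * (1 / (1 + (of_int r)\<^sup>2)))"
      using p dominated_summable(3)[OF summable_on_cmult_right[OF summable_inverse_square_int] le] by simp
    also have "\<dots> = K * S * s" unfolding infsum_cmult_right' S_def by simp
    also have "\<dots> \<le> K * S * (\<Sum>j\<le>2. \<Sum>l\<le>2. schwartz_seminorm j l \<phi>)"
    proof (rule mult_left_mono)
      have "{0, 2} \<subseteq> {..2::nat}" by auto
      then have "(\<Sum>j\<in>{0,2}. schwartz_seminorm j 0 \<phi>) \<le> (\<Sum>j\<le>2. schwartz_seminorm j 0 \<phi>)"
        by (intro sum_mono2) (auto intro: schwartz_seminorm_nonneg p)
      also have "\<dots> \<le> (\<Sum>j\<le>2. \<Sum>l\<le>2. schwartz_seminorm j l \<phi>)"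
        by (intro sum_mono member_le_sum) (auto intro: schwartz_seminorm_nonneg p)
      finally show "s \<le> (\<Sum>j\<le>2. \<Sum>l\<le>2. schwartz_seminorm j l \<phi>)" by (simp add: s_def)
      show "0 \<le> K * S" using K by (auto simp: S_def intro!: mult_nonneg_nonneg infsum_nonneg)
    qed
    finally show ?thesis .
  qed
  show ?thesis
    unfolding tempered_def
    by (intro CollectI conjI exI[of _ "K * S"] exI[of _ 2] ballI allI impI lin bd) auto
qed

text \<open>
  Splitting the sum by residues turns a sum over the refined lattice into the sum over the \<open>N\<close> combs.
\<close>

lemma infsum_residues:
  fixes f :: "int \<Rightarrow> complex"
  assumes N: "N > 0" and s: "f summable_on UNIV"
  shows "infsum f UNIV = (\<Sum>n<N. \<Sum>\<^sub>\<infinity>k. f (int N * k + int n))"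
proof -
  let ?g = "\<lambda>(n::nat, k::int). int N * k + int n"
  have bij: "bij_betw ?g ({..<N} \<times> UNIV) UNIV"
  proof (rule bij_betw_byWitness[where f' = "\<lambda>r. (nat (r mod int N), r div int N)"])
    show "\<forall>a\<in>{..<N} \<times> UNIV. (\<lambda>r. (nat (r mod int N), r div int N)) (?g a) = a" by auto
    show "\<forall>a'\<in>UNIV. ?g (nat (a' mod int N), a' div int N) = a'" using N by auto
    show "(\<lambda>r. (nat (r mod int N), r div int N)) ` UNIV \<subseteq> {..<N} \<times> UNIV"
      using N by (auto simp: nat_less_iff)
  qed auto
  have "infsum f UNIV = infsum (\<lambda>x. f (?g x)) ({..<N} \<times> UNIV)"
    by (rule infsum_reindex_bij_betw[OF bij, symmetric])
  also have "\<dots> = (\<Sum>\<^sub>\<infinity>n\<in>{..<N}. \<Sum>\<^sub>\<infinity>k. f (?g (n, k)))"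
    by (rule infsum_Sigma_banach[symmetric]) (use s summable_on_reindex_bij_betw[OF bij, of f] in blast)
  finally show ?thesis by simp
qed

lemma state_coeff_bound:
  assumes "N > 0"
  shows "norm (c (nat (r mod int N))) \<le> (\<Sum>n<N. norm (c n))"
  by (rule member_le_sum) (use assms in \<open>auto simp: nat_less_iff\<close>)

lemma state_lattice:
  assumes p: "\<phi> \<in> schwartz" and N: "N > 0"
  shows "state N c \<phi> = of_real (1 / sqrt N) * (\<Sum>\<^sub>\<infinity>r::int. c (nat (r mod int N)) * \<phi> (of_int r / N))"
proof -
  let ?f = "\<lambda>r::int. c (nat (r mod int N)) * \<phi> (of_int r / N)"
  have "?f summable_on UNIV"
    using lattice_summable(2)[OF p N state_coeff_bound[OF N], where t = 0] by simp
  then have "infsum ?f UNIV = (\<Sum>n<N. \<Sum>\<^sub>\<infinity>k. ?f (int N * k + int n))" by (rule infsum_residues[OF N])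
  also have "\<dots> = (\<Sum>n<N. c n * (\<Sum>\<^sub>\<infinity>k::int. \<phi> (of_int k + real n / N)))"
  proof -
    have "?f (int N * k + int n) = c n * \<phi> (of_int k + real n / N)" if "n < N" for n k
    proof -
      have "of_int (int N * k + int n) / real N = of_int k + real n / N"
        using N by (simp add: field_simps)
      then show ?thesis using that by simp
    qed
    then have "(\<Sum>\<^sub>\<infinity>k. ?f (int N * k + int n)) = c n * (\<Sum>\<^sub>\<infinity>k::int. \<phi> (of_int k + real n / N))" if "n < N" for n
      using that by (simp only: infsum_cmult_right')
    then show ?thesis by simp
  qed
  finally show ?thesis
    using p by (simp add: state_def dirac_comb_def sum_distrib_left mult_ac)
qed

lemma translate_state_lattice:
  assumes p: "\<phi> \<in> schwartz" and N: "N > 0"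
  shows "translate N a b (state N c) \<phi>
    = (\<Sum>\<^sub>\<infinity>r::int. (of_real (1 / sqrt N) * (c (nat (r mod int N)) * wave (a * (of_int r / N) - a * b / (2 * real N)))) * \<phi> (of_int r / N - b / N))"
proof -
  have "translate N a b (state N c) \<phi> = of_real (1 / sqrt N) *
      (\<Sum>\<^sub>\<infinity>r::int. c (nat (r mod int N)) * heisenberg N a b \<phi> (of_int r / N))"
    using p by (simp add: translate_def state_lattice[OF schwartz_heisenberg[OF p N] N])
  also have "\<dots> = (\<Sum>\<^sub>\<infinity>r::int. of_real (1 / sqrt N) * (c (nat (r mod int N)) * heisenberg N a b \<phi> (of_int r / N)))"
    by (simp only: infsum_cmult_right')
  finally show ?thesis by (simp add: heisenberg_def mult_ac)
qed

lemma translate_state_tempered: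
  assumes N: "N > 0"
  shows "translate N a b (state N c) \<in> tempered"
proof -
  let ?a = "\<lambda>r::int. of_real (1 / sqrt N) * (c (nat (r mod int N)) * wave (a * (of_int r / N) - a * b / (2 * real N)))"
  have eq: "translate N a b (state N c) = (\<lambda>\<phi>. if \<phi> \<in> schwartz then (\<Sum>\<^sub>\<infinity>r::int. ?a r * \<phi> (of_int r / real N - b / N)) else 0)"
    by (rule ext) (use translate_state_lattice[OF _ N] in \<open>auto simp: translate_def\<close>)
  have bd: "norm (?a r) \<le> 1 / sqrt N * (\<Sum>n<N. norm (c n))" for r
    using mult_left_mono[OF state_coeff_bound[OF N, of c r], of "1 / sqrt N"] by (simp add: norm_mult norm_divide)
  show ?thesis unfolding eq by (rule tempered_lattice[OF N bd])
qed

lemma translate_0: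
  assumes "\<And>\<phi>. \<phi> \<notin> schwartz \<Longrightarrow> u \<phi> = 0"
  shows "translate N 0 0 u = u"
  using assms by (auto simp: translate_def heisenberg_def[abs_def])

lemma state_not_schwartz: "\<phi> \<notin> schwartz \<Longrightarrow> state N c \<phi> = 0"
  by (simp add: state_def dirac_comb_def)

lemma state_tempered: "N > 0 \<Longrightarrow> state N c \<in> tempered"
  using translate_state_tempered[of N 0 0 c] translate_0[of "state N c" N] state_not_schwartz by simp

text \<open>Integer translations permute the Dirac combs up to phases.\<close>

definition translate_coeff :: "nat \<Rightarrow> int \<Rightarrow> int \<Rightarrow> (nat \<Rightarrow> complex) \<Rightarrow> nat \<Rightarrow> complex" where
  "translate_coeff N a b c n = wave (of_int a * n / N + of_int (a * b) / (2 * real N)) * c (nat ((int n + b) mod int N))"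

lemma translate_state:
  assumes N: "N > 0"
  shows "translate N (of_int a) (of_int b) (state N c) = state N (translate_coeff N a b c)"
proof
  fix \<phi>
  show "translate N (of_int a) (of_int b) (state N c) \<phi> = state N (translate_coeff N a b c) \<phi>"
  proof (cases "\<phi> \<in> schwartz")
    case p: True
    let ?g = "\<lambda>r::int. (c (nat (r mod int N)) * wave (of_int a * (of_int r / N) - of_int a * of_int b / (2 * real N))) * \<phi> (of_int r / N - of_int b / N)"
    have "translate N (of_int a) (of_int b) (state N c) \<phi> = of_real (1 / sqrt N) * (\<Sum>\<^sub>\<infinity>r. ?g r)"
      unfolding translate_state_lattice[OF p N] infsum_cmult_right'[symmetric] by (simp only: mult.assoc)
    also have "(\<Sum>\<^sub>\<infinity>r. ?g r) = (\<Sum>\<^sub>\<infinity>r. ?g (r + b))" by (rule infsum_shift_int[symmetric])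
    also have "\<dots> = (\<Sum>\<^sub>\<infinity>r::int. translate_coeff N a b c (nat (r mod int N)) * \<phi> (of_int r / N))"
    proof (rule infsum_cong)
      fix r :: int
      define s where "s = r mod int N"
      have s: "0 \<le> s" "r = s + int N * (r div int N)" using N by (simp_all add: s_def)
      have "wave (of_int a * (of_int (r + b) / N) - of_int a * of_int b / (2 * real N)) = wave (of_int a * of_int s / N + of_int (a * b) / (2 * real N))"
      proof (rule wave_eqI)
        have "of_int a * (of_int (r + b) / N) - of_int a * of_int b / (2 * real N) - (of_int a * of_int s / N + of_int (a * b) / (2 * real N))
            = of_int a * (of_int r - of_int s) / real N"
          using N by (simp add: field_simps)
        also have "of_int r - of_int s = real N * of_int (r div int N)"
          using s(2) by (metis add_diff_cancel_left' of_int_add of_int_mult of_int_of_nat_eq)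
        also have "of_int a * (real N * of_int (r div int N)) / real N = of_int (a * (r div int N))"
          using N by simp
        finally show "of_int a * (of_int (r + b) / N) - of_int a * of_int b / (2 * real N) - (of_int a * of_int s / N + of_int (a * b) / (2 * real N)) \<in> \<int>"
          by simp
      qed
      moreover have "(r + b) mod int N = (s + b) mod int N" by (simp add: s_def mod_add_left_eq)
      moreover have "of_int (r + b) / N - of_int b / N = (of_int r / N :: real)" by (simp add: add_divide_distrib)
      ultimately show "?g (r + b) = translate_coeff N a b c (nat (r mod int N)) * \<phi> (of_int r / N)"
        using s(1) by (simp add: translate_coeff_def s_def[symmetric] mult_ac)
    qed
    finally show ?thesis by (simp add: state_lattice[OF p N])
  qed (simp add: translate_def state_not_schwartz)
qed

lemma state_cong: "(\<And>n. n < N \<Longrightarrow> c n = d n) \<Longrightarrow> state N c = state N d"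
  by (simp add: state_def)

text \<open>
  The constant phase of the translation by the period is \<open>exp (\<pi> \<i> N a b)\<close>, which is one for even \<open>N\<close>.
\<close>

lemma translate_state_period:
  assumes N: "N > 0" "even N"
  shows "translate N (real N * of_int a) (real N * of_int b) (state N c) = state N c"
proof -
  obtain m where m: "N = 2 * m" using N(2) by (auto elim: evenE)
  have "translate_coeff N (int N * a) (int N * b) c n = c n" if "n < N" for n
  proof -
    have "of_int (int N * a) * n / N + of_int ((int N * a) * (int N * b)) / (2 * real N) = (of_int (a * int n + a * b * int m) :: real)"
      using N(1) by (simp add: m field_simps)
    then have "wave (of_int (int N * a) * n / N + of_int ((int N * a) * (int N * b)) / (2 * real N)) = 1"
      by (simp only: wave_of_int)
    moreover have "nat ((int n + int N * b) mod int N) = n" using that by simp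
    ultimately show ?thesis by (simp add: translate_coeff_def)
  qed
  then have "state N (translate_coeff N (int N * a) (int N * b) c) = state N c" by (intro state_cong)
  then show ?thesis using translate_state[OF N(1), of "int N * a" "int N * b" c] by simp
qed

subsection \<open>Finite Fourier sums and dual test functions\<close>

lemma wave_power: "wave t ^ n = wave (real n * t)"
  by (induction n) (simp_all add: distrib_right wave_add)

lemma wave_eq_1: "wave t = 1 \<Longrightarrow> t \<in> \<int>"
proof -
  assume "wave t = 1"
  then have "cos (2 * pi * t) = 1" by (simp add: wave_def complex_eq_iff)
  then obtain n where "2 * pi * t = of_int n * 2 * pi" by (auto simp: cos_one_2pi_int)
  then have "t = of_int n" by simp
  then show ?thesis by simp
qed

lemma sum_roots_of_unity:
  assumes N: "N > 0"
  shows "(\<Sum>s<N. wave (real s * (of_int j / N))) = (if int N dvd j then of_nat N else 0)"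
proof (cases "int N dvd j")
  case True
  then obtain k where "j = int N * k" by (auto elim: dvdE)
  then have "wave (real s * (of_int j / N)) = 1" for s
    using N wave_of_int[of "int s * k"] by simp
  then show ?thesis using True by simp
next
  case False
  let ?z = "wave (of_int j / N)"
  have "?z \<noteq> 1"
  proof
    assume "?z = 1"
    then obtain k where "of_int j / real N = of_int k" using wave_eq_1 by (auto elim: Ints_cases)
    then have "real_of_int j = real_of_int (int N * k)" using N by (simp add: field_simps)
    then have "j = int N * k" by (simp only: of_int_eq_iff)
    then show False using False by simp
  qed
  moreover have "?z ^ N = 1" using N by (simp add: wave_power)
  ultimately have "(\<Sum>s<N. ?z ^ s) = 0" by (simp add: geometric_sum)
  then show ?thesis using False by (simp add: wave_power)
qed

text \<open>
  A Gaussian times the trigonometric polynomial that picks one residue class of the lattice. Evaluation at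
  such a function reads off a coordinate, so the combs are linearly independent.
\<close>

lemma dual_test_function:
  assumes N: "N > 0" and n: "n < N"
  obtains \<phi> where "\<phi> \<in> schwartz" "\<And>c. state N c \<phi> = c n"
proof -
  define K where "K = (\<Sum>\<^sub>\<infinity>k::int. exp (- (of_int k + real n / N)\<^sup>2))"
  have gs: "(\<lambda>k::int. exp (- (of_int k + real n / N)\<^sup>2)) summable_on UNIV"
    using periodization_summable[OF schwartz_quartic_decay[OF gauss_schwartz], of "real n / N"]
    by (simp add: gauss_def add.commute)
  have K: "K > 0"
  proof -
    have "0 < (\<Sum>k\<in>{0::int}. exp (- (of_int k + real n / N)\<^sup>2))" by simp
    also have "\<dots> \<le> K" unfolding K_def by (rule finite_sum_le_infsum[OF gs]) auto
    finally show ?thesis .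
  qed
  define \<psi> where "\<psi> x = (\<Sum>s<N. (wave (- (real s * n / N)) / N) * (wave (real s * x) * gauss x))" for x
  have ps: "\<psi> \<in> schwartz"
    unfolding \<psi>_def by (intro schwartz_sum schwartz_scale schwartz_wave gauss_schwartz)
  have v: "\<psi> (of_int r / N) = (if int N dvd r - int n then gauss (of_int r / N) else 0)" for r :: int
  proof -
    have "\<psi> (of_int r / N) = (\<Sum>s<N. wave (real s * (of_int (r - int n) / N))) / N * gauss (of_int r / N)"
      unfolding \<psi>_def sum_divide_distrib sum_distrib_right
      by (rule sum.cong) (simp_all add: diff_divide_distrib right_diff_distrib wave_diff mult_ac)
    then show ?thesis unfolding sum_roots_of_unity[OF N] using N by simp
  qed
  have db: "dirac_comb N m \<psi> = (if m = n then of_real (K / sqrt N) else 0)" if m: "m < N" for m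
  proof -
    have "\<psi> (of_int k + real m / N) = (if m = n then of_real (exp (- (of_int k + real n / N)\<^sup>2)) else 0)" for k :: int
    proof -
      have pt: "of_int k + real m / N = of_int (int N * k + int m) / N" using N by (simp add: field_simps)
      have dv: "int N dvd int N * k + int m - int n \<longleftrightarrow> m = n"
      proof
        assume "int N dvd int N * k + int m - int n"
        then have "int N dvd int m - int n" by (metis add_diff_eq dvd_add_times_triv_left_iff mult.commute)
        then show "m = n" using m n
          by (metis mod_eq_dvd_iff mod_less nat_int of_nat_eq_iff zmod_int)
      qed simp
      have "\<psi> (of_int k + real m / N) = (if m = n then gauss (of_int k + real m / N) else 0)"
        unfolding pt v dv ..
      then show ?thesis by (simp add: gauss_def)
    qed
    moreover have "(\<Sum>\<^sub>\<infinity>k::int. of_real (exp (- (of_int k + real n / N)\<^sup>2))) = (of_real K :: complex)"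
      unfolding K_def by (rule infsumI, rule has_sum_of_real, rule has_sum_infsum[OF gs])
    ultimately show ?thesis using ps by (simp add: dirac_comb_def)
  qed
  have "state N c (\<lambda>x. of_real (sqrt N / K) * \<psi> x) = c n" for c
  proof -
    have "state N c (\<lambda>x. of_real (sqrt N / K) * \<psi> x) = of_real (sqrt N / K) * state N c \<psi>"
      by (rule tempered_scale[OF state_tempered[OF N] ps])
    also have "state N c \<psi> = (\<Sum>m<N. if m = n then c n * of_real (K / sqrt N) else 0)"
      unfolding state_def by (rule sum.cong) (auto simp: db)
    also have "\<dots> = c n * of_real (K / sqrt N)" using n by simp
    finally show ?thesis using K N by (simp add: field_simps)
  qed
  then show ?thesis using that[OF schwartz_scale[OF ps]] by blast
qed

lemma infsum_finite_sum:
  fixes f :: "'n \<Rightarrow> 'm \<Rightarrow> 'b::real_normed_vector"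
  assumes "\<And>n. f n summable_on I"
  shows "(\<lambda>m. \<Sum>n\<in>A. f n m) summable_on I"
    and "(\<Sum>\<^sub>\<infinity>m\<in>I. \<Sum>n\<in>A. f n m) = (\<Sum>n\<in>A. \<Sum>\<^sub>\<infinity>m\<in>I. f n m)"
proof -
  have "(\<lambda>m. \<Sum>n\<in>A. f n m) summable_on I \<and> (\<Sum>\<^sub>\<infinity>m\<in>I. \<Sum>n\<in>A. f n m) = (\<Sum>n\<in>A. \<Sum>\<^sub>\<infinity>m\<in>I. f n m)"
    by (induction A rule: infinite_finite_induct) (auto simp: infsum_add assms intro: summable_on_add assms)
  then show "(\<lambda>m. \<Sum>n\<in>A. f n m) summable_on I"
    "(\<Sum>\<^sub>\<infinity>m\<in>I. \<Sum>n\<in>A. f n m) = (\<Sum>n\<in>A. \<Sum>\<^sub>\<infinity>m\<in>I. f n m)" by auto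
qed

section \<open>Distributions invariant under the lattice of translations\<close>

subsection \<open>A smooth partition of unity\<close>

text \<open>
  The Gaussian smoothed over a unit interval: its integer translates add up to a constant, namely
  the integral of the Gaussian.
\<close>

definition bump :: "real \<Rightarrow> complex" where
  "bump x = integral {0..1} (\<lambda>t. gauss (x + t))"

lemma bump_schwartz: "bump \<in> schwartz"
proof -
  define F where "F l x = integral {0..1} (\<lambda>t. nth_deriv l gauss (x + t))" for l x
  have s: "smooth_line (nth_deriv l gauss)" for l
    by (intro smooth_line_nth_deriv schwartz_smooth gauss_schwartz)
  have c: "continuous_on S (\<lambda>t. nth_deriv l gauss (x + t))" for l x S
    by (rule continuous_on_compose2[OF smooth_line_continuous[OF s, of UNIV]]) (auto intro!: continuous_intros)
  have "(F l has_vector_derivative F (Suc l) x) (at x within UNIV)" for l x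
    unfolding F_def interval_cbox
  proof (rule leibniz_rule_vector_derivative)
    show "((\<lambda>x. nth_deriv l gauss (x + t)) has_vector_derivative nth_deriv (Suc l) gauss (x + t)) (at x within UNIV)" for x t
      using smooth_line_deriv[OF nth_deriv_shift(1)[OF s[of l]], of 0 t x]
      by (simp add: nth_deriv_shift(2)[OF s[of l]] nth_deriv_Suc)
    show "(\<lambda>t. nth_deriv l gauss (x + t)) integrable_on cbox 0 1" for x
      by (rule integrable_continuous[OF c])
    show "continuous_on (UNIV \<times> cbox 0 1) (\<lambda>(x, t). nth_deriv (Suc l) gauss (x + t))"
      unfolding split_def
      by (rule continuous_on_compose2[OF smooth_line_continuous[OF s, of UNIV]]) (auto intro!: continuous_intros)
  qed auto
  then have d: "(F l has_vector_derivative F (Suc l) x) (at x)" for l x by simp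
  have F0: "F 0 = bump" by (simp add: F_def bump_def fun_eq_iff)
  note ch = nth_deriv_chain[of F, OF d, unfolded F0]
  show ?thesis
  proof (rule schwartzI[OF ch(1)])
    fix j l
    obtain C where C: "C \<ge> 0" "\<And>i x. i \<le> l \<Longrightarrow> norm (nth_deriv i gauss x) \<le> C / (1 + \<bar>x\<bar>) ^ j"
      by (rule schwartz_decay[OF gauss_schwartz]) blast
    have "\<bar>x\<bar> ^ j * norm (F l x) \<le> C * 2 ^ j" for x
    proof -
      have "norm (integral {0..1} (\<lambda>t. (\<bar>x\<bar> ^ j) *\<^sub>R nth_deriv l gauss (x + t))) \<le> integral {0..1} (\<lambda>t::real. C * 2 ^ j)"
      proof (rule integral_norm_bound_integral)
        show "(\<lambda>t. (\<bar>x\<bar> ^ j) *\<^sub>R nth_deriv l gauss (x + t)) integrable_on {0..1}"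
          by (intro integrable_continuous_real continuous_intros c)
        fix t :: real assume t: "t \<in> {0..1}"
        have "\<bar>x\<bar> ^ j * norm (nth_deriv l gauss (x + t)) \<le> \<bar>x\<bar> ^ j * (C / (1 + \<bar>x + t\<bar>) ^ j)"
          by (intro mult_left_mono C) auto
        also have "\<dots> \<le> C * (1 + \<bar>t\<bar>) ^ j" by (rule abs_power_mult_decay_le[OF C(1)])
        also have "\<dots> \<le> C * 2 ^ j" by (intro mult_left_mono power_mono C) (use t in auto)
        finally show "norm ((\<bar>x\<bar> ^ j) *\<^sub>R nth_deriv l gauss (x + t)) \<le> C * 2 ^ j" by simp
      qed auto
      then show ?thesis by (simp add: F_def)
    qed
    then show "\<exists>C. \<forall>x. \<bar>x\<bar> ^ j * norm (nth_deriv l bump x) \<le> C" by (auto simp: ch(2))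
  qed
qed

definition gauss_mass :: complex where
  "gauss_mass = (LINT x|lborel. gauss x)"

lemma lborel_integral_pos:
  fixes f :: "real \<Rightarrow> real"
  assumes "integrable lborel f" "\<And>x. f x > 0"
  shows "(LINT x|lborel. f x) > 0"
proof (rule ccontr)
  have nn: "\<And>x. 0 \<le> f x" using assms(2) by (simp add: less_imp_le)
  assume "\<not> ?thesis"
  then have "(LINT x|lborel. f x) = 0"
    using Bochner_Integration.integral_nonneg[of lborel f, OF nn] by linarith
  then have "AE x in lborel. f x = 0"
    using integral_nonneg_eq_0_iff_AE[OF assms(1)] nn by simp
  then have "AE x::real in lborel. False"
    by eventually_elim (use assms(2) in \<open>metis less_irrefl\<close>)
  then show False by (simp add: eventually_const_iff ae_filter_eq_bot_iff)
qed

lemma gauss_mass_nonzero: "gauss_mass \<noteq> 0"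
proof
  assume z: "gauss_mass = 0"
  have i: "integrable lborel gauss" by (rule quartic_decay_integrable[OF schwartz_quartic_decay[OF gauss_schwartz]])
  then have ir: "integrable lborel (\<lambda>x::real. exp (- x\<^sup>2))"
    using integrable_Re[OF i] by (simp add: gauss_def)
  have "gauss_mass = of_real (LINT x|lborel. exp (- x\<^sup>2))"
    by (simp add: gauss_mass_def gauss_def[abs_def])
  then show False using z lborel_integral_pos[OF ir] by simp
qed

lemma bump_sum: "(\<Sum>\<^sub>\<infinity>k::int. bump (x + of_int k)) = gauss_mass"
proof -
  have "((\<lambda>k::int. integral {0..1} (\<lambda>t. gauss ((t + of_int k) + x))) has_sum (LINT t|lborel. gauss (t + x))) UNIV"
    by (rule quartic_decay_unfold) (intro schwartz_quartic_decay schwartz_shift gauss_schwartz)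
  moreover have "(LINT t|lborel. gauss (t + x)) = gauss_mass"
    using lborel_integral_real_affine[of 1 gauss x] by (simp add: gauss_mass_def add.commute)
  ultimately show ?thesis unfolding bump_def by (simp add: infsumI ac_simps)
qed

lemma one_plus_abs_product: "1 + k\<^sup>2 \<le> ((1 + \<bar>x + k\<bar>) * (1 + \<bar>x\<bar>))\<^sup>2" for x k :: real
proof -
  have "\<bar>k\<bar> \<le> \<bar>x + k\<bar> + \<bar>x\<bar>" by linarith
  then have "1 + \<bar>k\<bar> \<le> (1 + \<bar>x + k\<bar>) * (1 + \<bar>x\<bar>)"
    using mult_nonneg_nonneg[OF abs_ge_zero[of "x + k"] abs_ge_zero[of x]]
    unfolding distrib_left distrib_right by linarith
  then have "(1 + \<bar>k\<bar>)\<^sup>2 \<le> ((1 + \<bar>x + k\<bar>) * (1 + \<bar>x\<bar>))\<^sup>2" by (intro power_mono) auto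
  then show ?thesis by (rule order_trans[rotated]) (simp add: power2_eq_square algebra_simps)
qed

text \<open>
  One of the two factors is small wherever the other is not, so a product with a far translate is small
  in every seminorm.
\<close>

lemma schwartz_product_shift_bound:
  assumes f: "f \<in> schwartz" and g: "g \<in> schwartz"
  obtains C where "\<And>k x. \<bar>x\<bar> ^ j * norm (nth_deriv l (\<lambda>x. f (x + k) * g x) x) \<le> C * (1 / (1 + k\<^sup>2))"
    "\<And>k x. \<bar>x\<bar> ^ j * norm (nth_deriv l (\<lambda>x. g x * f (x + k)) x) \<le> C * (1 / (1 + k\<^sup>2))"
proof -
  obtain A where A: "A \<ge> 0" "\<And>i x. i \<le> l \<Longrightarrow> norm (nth_deriv i f x) \<le> A / (1 + \<bar>x\<bar>) ^ 2"
    by (rule schwartz_decay[OF f]) blast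
  obtain B where B: "B \<ge> 0" "\<And>i x. i \<le> l \<Longrightarrow> norm (nth_deriv i g x) \<le> B / (1 + \<bar>x\<bar>) ^ (j + 2)"
    by (rule schwartz_decay[OF g]) blast
  have *: "\<bar>x\<bar> ^ j * norm (nth_deriv l (\<lambda>x. f (x + k) * g x) x) \<le> (2 ^ l * A * B) * (1 / (1 + k\<^sup>2))" for k x
  proof -
    let ?p = "1 + \<bar>x + k\<bar>" and ?q = "1 + \<bar>x\<bar>"
    have pq: "?p > 0" "?q > 0" by (auto intro: add_pos_nonneg)
    have "norm (nth_deriv l (\<lambda>x. f (x + k) * g x) x) \<le> 2 ^ l * (A / ?p ^ 2) * (B / ?q ^ (j + 2))"
    proof (rule norm_nth_deriv_mult_le)
      show "norm (nth_deriv i (\<lambda>x. f (x + k)) x) \<le> A / ?p ^ 2" if "i \<le> l" for i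
        unfolding nth_deriv_shift(2)[OF schwartz_smooth[OF f]] by (rule A(2)[OF that])
      show "norm (nth_deriv i g x) \<le> B / ?q ^ (j + 2)" if "i \<le> l" for i by (rule B(2)[OF that])
    qed (intro nth_deriv_shift schwartz_smooth f g)+
    then have "\<bar>x\<bar> ^ j * norm (nth_deriv l (\<lambda>x. f (x + k) * g x) x) \<le> ?q ^ j * (2 ^ l * (A / ?p ^ 2) * (B / ?q ^ (j + 2)))"
      by (intro mult_mono power_mono) auto
    also have "\<dots> = (2 ^ l * A * B) * (1 / (?p * ?q)\<^sup>2)"
      using pq by (simp add: power_add power_mult_distrib power2_eq_square mult_ac)
    also have "\<dots> \<le> (2 ^ l * A * B) * (1 / (1 + k\<^sup>2))"
      using A(1) B(1) pq one_plus_abs_product[of k x]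
      by (intro mult_left_mono divide_left_mono mult_nonneg_nonneg mult_pos_pos) (auto intro: add_pos_nonneg)
    finally show ?thesis .
  qed
  show ?thesis by (rule that[OF *]) (use * in \<open>simp add: mult.commute\<close>)
qed

text \<open>
  A tempered distribution fixed by the translation by one and by the multiplication by
  \<open>exp (2 \<pi> \<i> N x)\<close> is a combination of Dirac combs. The partition of unity replaces a test
  function by its periodization, Poisson summation expands the periodization into characters, and
  the second invariance identifies characters modulo \<open>N\<close>.
\<close>

theorem invariant_distribution_is_state:
  assumes u: "u \<in> tempered" and N: "N > 0"
    and shift: "\<And>\<phi>. \<phi> \<in> schwartz \<Longrightarrow> u (\<lambda>x. \<phi> (x - 1)) = u \<phi>"
    and modul: "\<And>\<phi>. \<phi> \<in> schwartz \<Longrightarrow> u (\<lambda>x. wave (N * x) * \<phi> x) = u \<phi>"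
  shows "\<exists>c. u = state N c"
proof -
  define \<eta> where "\<eta> x = bump x / gauss_mass" for x
  have chi: "\<eta> \<in> schwartz"
    unfolding \<eta>_def divide_inverse mult.commute[of _ "inverse _"] by (rule schwartz_scale[OF bump_schwartz])
  have chi_sum: "(\<Sum>\<^sub>\<infinity>k::int. \<eta> (x + of_int k)) = 1" for x
    unfolding \<eta>_def divide_inverse infsum_cmult_left' bump_sum using gauss_mass_nonzero by simp
  have shift_nat: "u (\<lambda>x. \<phi> (x - of_nat n)) = u \<phi>" if "\<phi> \<in> schwartz" for \<phi> n
  proof (induction n)
    case (Suc n)
    have "(\<lambda>x. \<phi> (x - of_nat n)) \<in> schwartz" using schwartz_shift[OF that, of "- of_nat n"] by simp
    from shift[OF this] show ?case using Suc by (simp add: algebra_simps)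
  qed simp
  have shift_int: "u (\<lambda>x. \<phi> (x - of_int k)) = u \<phi>" if p: "\<phi> \<in> schwartz" for \<phi> k
  proof (cases k)
    case (nonneg n)
    then show ?thesis using shift_nat[OF p] by simp
  next
    case (neg n)
    have "(\<lambda>x. \<phi> (x - of_int k)) \<in> schwartz" using schwartz_shift[OF p, of "- of_int k"] by simp
    from shift_nat[OF this, of "Suc n"] show ?thesis using neg by simp
  qed
  define v where "v m = u (\<lambda>x. wave (of_int m * x) * \<eta> x)" for m :: int
  have v_period: "v (m + int N * k) = v m" for m k
  proof -
    have step: "v (m + int N) = v m" for m
      using modul[OF schwartz_wave[OF chi, of "of_int m"]]
      by (simp add: v_def algebra_simps wave_add)
    have n: "v (m + int N * int n) = v m" for m n
    proof (induction n)
      case (Suc n)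
      then show ?case using step[of "m + int N * int n"] by (simp add: algebra_simps)
    qed simp
    show ?thesis
    proof (cases k)
      case (neg j)
      have "m + int N * k + int N * int (Suc j) = m + int N * (k + int (Suc j))" by (simp add: algebra_simps)
      also have "\<dots> = m" using neg by simp
      finally show ?thesis using n[of "m + int N * k" "Suc j"] by (simp only:)
    qed (simp add: n)
  qed
  \<comment> \<open>The finite Fourier transform of the sequence \<open>v\<close>, which has period \<open>N\<close>.\<close>
  define d where "d n = (\<Sum>s<N. v (int s) * wave (- (real s * (real n / N)))) / N" for n
  have v_eq: "v m = (\<Sum>n<N. d n * wave (of_int m * (real n / N)))" for m
  proof -
    define s0 where "s0 = nat (m mod int N)"
    have s0: "s0 < N" "int s0 = m mod int N" using N by (simp_all add: s0_def nat_less_iff)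
    have "(\<Sum>n<N. d n * wave (of_int m * (real n / N)))
      = (\<Sum>n<N. \<Sum>s<N. v (int s) / N * wave (real n * (of_int (m - int s) / N)))"
      unfolding d_def sum_divide_distrib sum_distrib_right
      by (intro sum.cong refl) (simp add: diff_divide_distrib right_diff_distrib wave_diff mult_ac)
    also have "\<dots> = (\<Sum>s<N. v (int s) / N * (\<Sum>n<N. wave (real n * (of_int (m - int s) / N))))"
      by (subst sum.swap) (simp only: sum_distrib_left)
    also have "\<dots> = (\<Sum>s<N. if s = s0 then v (int s) else 0)"
    proof (rule sum.cong[OF refl])
      fix s assume "s \<in> {..<N}"
      then have "int N dvd m - int s \<longleftrightarrow> s = s0"
        using s0 by (simp add: mod_eq_dvd_iff[symmetric]) (metis mod_less nat_int zmod_int)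
      then show "v (int s) / N * (\<Sum>n<N. wave (real n * (of_int (m - int s) / N))) = (if s = s0 then v (int s) else 0)"
        unfolding sum_roots_of_unity[OF N] using N by simp
    qed
    also have "\<dots> = v (int s0)" using s0 by simp
    also have "\<dots> = v m"
      using v_period[of "int s0" "m div int N"] by (simp add: s0(2))
    finally show ?thesis by simp
  qed
  have main: "u \<phi> = (\<Sum>n<N. d n * (\<Sum>\<^sub>\<infinity>k::int. \<phi> (of_int k + real n / N)))" if p: "\<phi> \<in> schwartz" for \<phi>
  proof -
    \<comment> \<open>The two families below are each other's translates, so \<open>u\<close> does not distinguish them.\<close>
    have "\<exists>C. \<forall>k x. \<bar>x\<bar> ^ j * norm (nth_deriv l (\<lambda>x. \<eta> (x + k) * \<phi> x) x) \<le> C * (1 / (1 + k\<^sup>2))" for j l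
      by (rule schwartz_product_shift_bound[OF chi p, where j = j and l = l]) blast
    then obtain C1 where C1: "\<And>j l k x. \<bar>x\<bar> ^ j * norm (nth_deriv l (\<lambda>x. \<eta> (x + k) * \<phi> x) x) \<le> C1 j l * (1 / (1 + k\<^sup>2))"
      by metis
    have "\<exists>C. \<forall>k x. \<bar>x\<bar> ^ j * norm (nth_deriv l (\<lambda>x. \<eta> x * \<phi> (x + k)) x) \<le> C * (1 / (1 + k\<^sup>2))" for j l
      by (rule schwartz_product_shift_bound[OF p chi, where j = j and l = l]) blast
    then obtain C2 where C2: "\<And>j l k x. \<bar>x\<bar> ^ j * norm (nth_deriv l (\<lambda>x. \<eta> x * \<phi> (x + k)) x) \<le> C2 j l * (1 / (1 + k\<^sup>2))"
      by metis
    have prod_schwartz: "(\<lambda>x. f (x + k) * g x) \<in> schwartz" if fg: "f \<in> schwartz" "g \<in> schwartz" for f g and k :: real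
    proof (rule schwartzI)
      show "smooth_line (\<lambda>x. f (x + k) * g x)"
        by (intro smooth_line_mult nth_deriv_shift schwartz_smooth fg)
      fix j l
      obtain C where "\<And>k x. \<bar>x\<bar> ^ j * norm (nth_deriv l (\<lambda>x. f (x + k) * g x) x) \<le> C * (1 / (1 + k\<^sup>2))"
        by (rule schwartz_product_shift_bound[OF fg, where j = j and l = l]) blast
      then show "\<exists>C. \<forall>x. \<bar>x\<bar> ^ j * norm (nth_deriv l (\<lambda>x. f (x + k) * g x) x) \<le> C" by blast
    qed
    have f1: "(\<lambda>x. \<eta> (x + of_int k) * \<phi> x) \<in> schwartz" for k :: int by (rule prod_schwartz[OF chi p])
    have f2: "(\<lambda>x. \<eta> x * \<phi> (x + of_int k)) \<in> schwartz" for k :: int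
      using prod_schwartz[OF p chi, of "of_int k"] by (simp add: mult.commute)
    have sm: "(\<lambda>k::int. C * (1 / (1 + (of_int k)\<^sup>2))) summable_on UNIV" for C :: real
      by (intro summable_on_cmult_right summable_inverse_square_int)
    have "((\<lambda>k::int. u (\<lambda>x. \<eta> (x + of_int k) * \<phi> x)) has_sum u (\<lambda>x. \<Sum>\<^sub>\<infinity>k::int. \<eta> (x + of_int k) * \<phi> x)) UNIV"
      by (rule tempered_series[OF u f1 sm C1])
    then have "((\<lambda>k::int. u (\<lambda>x. \<eta> (x + of_int k) * \<phi> x)) has_sum u \<phi>) UNIV"
      unfolding infsum_cmult_left' chi_sum by simp
    moreover have "((\<lambda>k::int. u (\<lambda>x. \<eta> x * \<phi> (x + of_int k))) has_sum u (\<lambda>x. \<Sum>\<^sub>\<infinity>k::int. \<eta> x * \<phi> (x + of_int k))) UNIV"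
      by (rule tempered_series[OF u f2 sm C2])
    then have "((\<lambda>k::int. u (\<lambda>x. \<eta> x * \<phi> (x + of_int (- k)))) has_sum u (\<lambda>x. \<eta> x * (\<Sum>\<^sub>\<infinity>k::int. \<phi> (x + of_int k)))) UNIV"
      unfolding infsum_cmult_right'
      by (subst has_sum_reindex_bij_witness[where i = uminus and j = uminus and T = UNIV]) auto
    moreover have "u (\<lambda>x. \<eta> (x + of_int k) * \<phi> x) = u (\<lambda>x. \<eta> x * \<phi> (x + of_int (- k)))" for k :: int
      using shift_int[OF f1[of k], of k] by simp
    ultimately have "u \<phi> = u (\<lambda>x. \<eta> x * (\<Sum>\<^sub>\<infinity>k::int. \<phi> (x + of_int k)))"
      using has_sum_unique by (simp cong: has_sum_cong) blast
    also have "\<dots> = u (\<lambda>x. \<Sum>\<^sub>\<infinity>m::int. fourier \<phi> (of_int m) * (wave (of_int m * x) * \<eta> x))"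
      unfolding poisson_summation[OF p] infsum_cmult_right'[symmetric] by (simp only: mult_ac)
    also have "((\<lambda>m::int. u (\<lambda>x. fourier \<phi> (of_int m) * (wave (of_int m * x) * \<eta> x))) has_sum \<dots>) UNIV"
    proof -
      have f3: "(\<lambda>x. fourier \<phi> (of_int m) * (wave (of_int m * x) * \<eta> x)) \<in> schwartz" for m :: int
        by (intro schwartz_scale schwartz_wave chi)
      have "\<exists>C\<ge>0. \<forall>a b x. \<bar>x\<bar> ^ j * norm (nth_deriv l (heisenberg 1 a b \<eta>) x) \<le> C * (1 + \<bar>a\<bar> + \<bar>b\<bar>) ^ (l + j)" for j l
        by (rule heisenberg_bound[OF chi, of 1 j l]) auto
      then obtain D where D: "\<And>j l. D j l \<ge> 0"
        "\<And>j l a b x. \<bar>x\<bar> ^ j * norm (nth_deriv l (heisenberg 1 a b \<eta>) x) \<le> D j l * (1 + \<bar>a\<bar> + \<bar>b\<bar>) ^ (l + j)"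
        by metis
      let ?B = "\<lambda>j l (m::int). D j l * (norm (fourier \<phi> (of_int m)) * (1 + \<bar>of_int m\<bar>) ^ (l + j))"
      have le: "\<bar>x\<bar> ^ j * norm (nth_deriv l (\<lambda>x. fourier \<phi> (of_int m) * (wave (of_int m * x) * \<eta> x)) x) \<le> ?B j l m" for j l m x
      proof -
        have h: "heisenberg 1 (of_int m) 0 \<eta> = (\<lambda>x. wave (of_int m * x) * \<eta> x)" by (simp add: heisenberg_def fun_eq_iff)
        have "\<bar>x\<bar> ^ j * norm (nth_deriv l (\<lambda>x. fourier \<phi> (of_int m) * (wave (of_int m * x) * \<eta> x)) x)
           = norm (fourier \<phi> (of_int m)) * (\<bar>x\<bar> ^ j * norm (nth_deriv l (heisenberg 1 (of_int m) 0 \<eta>) x))"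
          unfolding h by (simp add: nth_deriv_scale[OF schwartz_wave[OF chi]] norm_mult)
        also have "\<dots> \<le> norm (fourier \<phi> (of_int m)) * (D j l * (1 + \<bar>of_int m\<bar>) ^ (l + j))"
          using D(2)[of x j l "of_int m" 0] by (intro mult_left_mono) auto
        finally show ?thesis by (simp add: mult_ac)
      qed
      have B: "?B j l summable_on UNIV" for j l
      proof -
        let ?q = "l + j"
        have "(\<lambda>m::int. 2 ^ ?q * (norm (fourier \<phi> (of_int m)) + norm (fourier (nth_deriv ?q \<phi>) (of_int m)))) summable_on UNIV"
          by (intro summable_on_cmult_right summable_on_add fourier_summable schwartz_nth_deriv p)
        then have "(\<lambda>m::int. norm (fourier \<phi> (of_int m)) * (1 + \<bar>of_int m\<bar>) ^ ?q) summable_on UNIV"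
        proof (rule Infinite_Sum.summable_on_comparison_test)
          fix m :: int
          have "\<bar>of_int m\<bar> ^ ?q \<le> (2 * pi * \<bar>of_int m\<bar>) ^ ?q"
            using pi_ge_two by (intro power_mono) (auto simp: mult_le_cancel_right1)
          then have "1 + \<bar>of_int m\<bar> ^ ?q \<le> 1 + (2 * pi * \<bar>of_int m\<bar>) ^ ?q" by simp
          then have "(1 + \<bar>of_int m\<bar>) ^ ?q \<le> 2 ^ ?q * (1 + (2 * pi * \<bar>of_int m\<bar>) ^ ?q)"
            using one_plus_power_le[of "of_int m" ?q] by (meson mult_left_mono order_trans zero_le_numeral zero_le_power)
          then have "norm (fourier \<phi> (of_int m)) * (1 + \<bar>of_int m\<bar>) ^ ?q
              \<le> norm (fourier \<phi> (of_int m)) * (2 ^ ?q * (1 + (2 * pi * \<bar>of_int m\<bar>) ^ ?q))"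
            by (rule mult_left_mono) auto
          then show "norm (fourier \<phi> (of_int m)) * (1 + \<bar>of_int m\<bar>) ^ ?q
              \<le> 2 ^ ?q * (norm (fourier \<phi> (of_int m)) + norm (fourier (nth_deriv ?q \<phi>) (of_int m)))"
            by (simp add: fourier_nth_deriv[OF p] norm_mult norm_power algebra_simps)
        qed auto
        then show ?thesis by (rule summable_on_cmult_right)
      qed
      show ?thesis by (rule tempered_series[OF u f3 B le])
    qed
    then have "u (\<lambda>x. \<Sum>\<^sub>\<infinity>m::int. fourier \<phi> (of_int m) * (wave (of_int m * x) * \<eta> x))
        = (\<Sum>\<^sub>\<infinity>m::int. fourier \<phi> (of_int m) * v m)"
      by (simp add: tempered_scale[OF u schwartz_wave[OF chi]] v_def infsumI)
    also have "\<dots> = (\<Sum>\<^sub>\<infinity>m::int. \<Sum>n<N. d n * (fourier \<phi> (of_int m) * wave (of_int m * (real n / N))))"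
      unfolding v_eq sum_distrib_left by (simp only: mult_ac)
    also have "\<dots> = (\<Sum>n<N. \<Sum>\<^sub>\<infinity>m::int. d n * (fourier \<phi> (of_int m) * wave (of_int m * (real n / N))))"
      by (rule infsum_finite_sum(2))
        (intro summable_on_cmult_right dominated_summable(2)[OF fourier_summable[OF p]], simp add: norm_mult)
    also have "\<dots> = (\<Sum>n<N. d n * (\<Sum>\<^sub>\<infinity>k::int. \<phi> (of_int k + real n / N)))"
      unfolding infsum_cmult_right' poisson_summation[OF p, symmetric] by (simp only: add.commute)
    finally show ?thesis .
  qed
  have "u = state N (\<lambda>n. d n * of_real (sqrt N))"
  proof
    fix \<phi>
    show "u \<phi> = state N (\<lambda>n. d n * of_real (sqrt N)) \<phi>"
      using main[of \<phi>] tempered_not_schwartz[OF u, of \<phi>] N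
      by (cases "\<phi> \<in> schwartz") (simp_all add: state_def dirac_comb_def)
  qed
  then show ?thesis by blast
qed

section \<open>Weak-* continuous operators have a transpose\<close>

text \<open>
  Induction on the set of evaluations: if some vector is detected by the new evaluation alone, subtract the
  appropriate multiple of that evaluation from the functional; otherwise the new evaluation may be
  dropped.
\<close>

lemma functional_in_span:
  fixes V :: "('x \<Rightarrow> complex) set" and F :: "('x \<Rightarrow> complex) \<Rightarrow> complex"
  assumes V: "\<And>u v c. u \<in> V \<Longrightarrow> v \<in> V \<Longrightarrow> (\<lambda>x. c * u x + v x) \<in> V"
    and "finite X"
    and F: "\<And>u v c. u \<in> V \<Longrightarrow> v \<in> V \<Longrightarrow> F (\<lambda>x. c * u x + v x) = c * F u + F v"
    and kill: "\<And>u. u \<in> V \<Longrightarrow> (\<And>x. x \<in> X \<Longrightarrow> u x = 0) \<Longrightarrow> F u = 0"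
  shows "\<exists>a. \<forall>u\<in>V. F u = (\<Sum>x\<in>X. a x * u x)"
  using assms(2-)
proof (induction X arbitrary: F rule: finite_induct)
  case empty
  then show ?case by auto
next
  case (insert x X)
  show ?case
  proof (cases "\<exists>w\<in>V. (\<forall>y\<in>X. w y = 0) \<and> w x \<noteq> 0")
    case True
    then obtain w where w: "w \<in> V" "\<And>y. y \<in> X \<Longrightarrow> w y = 0" "w x \<noteq> 0" by blast
    define F' where "F' u = F u - F w / w x * u x" for u
    have "\<exists>a. \<forall>u\<in>V. F' u = (\<Sum>y\<in>X. a y * u y)"
    proof (rule insert.IH)
      show "F' (\<lambda>x. c * u x + v x) = c * F' u + F' v" if "u \<in> V" "v \<in> V" for u v c
        using insert.prems(1)[OF that, of c] by (simp add: F'_def algebra_simps)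
      fix u assume u: "u \<in> V" "\<And>y. y \<in> X \<Longrightarrow> u y = 0"
      let ?c = "- (u x / w x)"
      have "(\<lambda>y. ?c * w y + u y) \<in> V" by (rule V[OF w(1) u(1)])
      moreover have "?c * w y + u y = 0" if "y \<in> insert x X" for y
        using that w u by auto
      ultimately have "F (\<lambda>y. ?c * w y + u y) = 0" by (rule insert.prems(2))
      then show "F' u = 0" using insert.prems(1)[OF w(1) u(1), of ?c] by (simp add: F'_def)
    qed
    then obtain a where a: "\<And>u. u \<in> V \<Longrightarrow> F' u = (\<Sum>y\<in>X. a y * u y)" by blast
    have "F u = (\<Sum>y\<in>insert x X. (a(x := F w / w x)) y * u y)" if "u \<in> V" for u
    proof -
      have "(\<Sum>y\<in>X. (a(x := F w / w x)) y * u y) = (\<Sum>y\<in>X. a y * u y)"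
        using insert.hyps by (intro sum.cong) auto
      then show ?thesis using a[OF that] insert.hyps by (simp add: F'_def algebra_simps)
    qed
    then show ?thesis by blast
  next
    case False
    have "\<exists>a. \<forall>u\<in>V. F u = (\<Sum>y\<in>X. a y * u y)"
      by (rule insert.IH[OF insert.prems(1)]) (use False insert.prems(2) in blast)+
    then obtain a where a: "\<forall>u\<in>V. F u = (\<Sum>y\<in>X. a y * u y)" by blast
    have "(\<Sum>y\<in>X. (a(x := 0)) y * u y) = (\<Sum>y\<in>X. a y * u y)" for u
      using insert.hyps by (intro sum.cong) auto
    then have "\<forall>u\<in>V. F u = (\<Sum>y\<in>insert x X. (a(x := 0)) y * u y)"
      using a insert.hyps by simp
    then show ?thesis by blast
  qed
qed

lemma tempered_combination:
  assumes u: "u \<in> tempered" and v: "v \<in> tempered"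
  shows "(\<lambda>\<phi>. c * u \<phi> + v \<phi>) \<in> tempered"
proof -
  obtain A m where A: "A \<ge> 0" "\<And>\<phi> b. \<phi> \<in> schwartz \<Longrightarrow>
      (\<And>j l x. \<bar>x\<bar> ^ j * norm (nth_deriv l \<phi> x) \<le> b j l) \<Longrightarrow>
      norm (u \<phi>) \<le> A * (\<Sum>j\<le>m. \<Sum>l\<le>m. b j l)"
    by (rule tempered_bound[OF u]) blast
  obtain B k where B: "B \<ge> 0" "\<And>\<phi> b. \<phi> \<in> schwartz \<Longrightarrow>
      (\<And>j l x. \<bar>x\<bar> ^ j * norm (nth_deriv l \<phi> x) \<le> b j l) \<Longrightarrow>
      norm (v \<phi>) \<le> B * (\<Sum>j\<le>k. \<Sum>l\<le>k. b j l)"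
    by (rule tempered_bound[OF v]) blast
  have "norm (c * u \<phi> + v \<phi>) \<le> (norm c * A + B) * (\<Sum>j\<le>max m k. \<Sum>l\<le>max m k. schwartz_seminorm j l \<phi>)"
    if p: "\<phi> \<in> schwartz" for \<phi>
  proof -
    let ?S = "\<lambda>m. \<Sum>j\<le>m. \<Sum>l\<le>m. schwartz_seminorm j l \<phi>"
    have mono: "?S m' \<le> ?S (max m k)" if "m' \<le> max m k" for m'
      by (intro order_trans[OF sum_mono sum_mono2] sum_mono2 sum_nonneg schwartz_seminorm_nonneg p)
        (use that in auto)
    have "norm (u \<phi>) \<le> A * ?S m" by (rule A(2)[OF p le_schwartz_seminorm[OF p]])
    also have "\<dots> \<le> A * ?S (max m k)" by (intro mult_left_mono mono A) auto
    finally have 1: "norm (u \<phi>) \<le> A * ?S (max m k)" .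
    have "norm (v \<phi>) \<le> B * ?S k" by (rule B(2)[OF p le_schwartz_seminorm[OF p]])
    also have "\<dots> \<le> B * ?S (max m k)" by (intro mult_left_mono mono B) auto
    finally have 2: "norm (v \<phi>) \<le> B * ?S (max m k)" .
    have "norm (c * u \<phi> + v \<phi>) \<le> norm c * norm (u \<phi>) + norm (v \<phi>)"
      by (rule norm_triangle_le) (simp add: norm_mult)
    also have "\<dots> \<le> norm c * (A * ?S (max m k)) + B * ?S (max m k)"
      by (intro add_mono mult_left_mono 1 2) auto
    finally show ?thesis by (simp add: algebra_simps)
  qed
  moreover have "c * u (\<lambda>x. d * \<phi> x + \<psi> x) + v (\<lambda>x. d * \<phi> x + \<psi> x) = d * (c * u \<phi> + v \<phi>) + (c * u \<psi> + v \<psi>)"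
    if "\<phi> \<in> schwartz" "\<psi> \<in> schwartz" for \<phi> \<psi> d
    using tempered_linear[OF u that] tempered_linear[OF v that] by (simp add: algebra_simps)
  ultimately show ?thesis
    unfolding tempered_def
    by (intro CollectI conjI exI ballI allI impI) (auto simp: tempered_not_schwartz[OF u] tempered_not_schwartz[OF v])
qed

lemma tempered_zero: "(\<lambda>\<phi>. 0) \<in> tempered"
  using tempered_combination[OF state_tempered[of 1 "\<lambda>_. 0"] state_tempered[of 1 "\<lambda>_. 0"], of 0]
  by (simp add: state_def)

text \<open>
  A weak-* neighbourhood of \<open>0\<close> constrains finitely many values only. A functional bounded on it
  therefore vanishes where these values vanish, and is evaluation at a combination of the
  corresponding test functions.
\<close>

lemma weak_continuous_transpose:
  assumes lin: "\<And>u v c. u \<in> tempered \<Longrightarrow> v \<in> tempered \<Longrightarrow>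
      W (\<lambda>\<phi>. c * u \<phi> + v \<phi>) = (\<lambda>\<phi>. c * W u \<phi> + W v \<phi>)"
    and cont: "continuous_on tempered (W :: functional \<Rightarrow> functional)"
  shows "\<exists>\<psi>\<in>schwartz. \<forall>u\<in>tempered. W u \<phi> = u \<psi>"
proof -
  have W0: "W (\<lambda>\<phi>. 0) = (\<lambda>\<phi>. 0)"
    using lin[OF tempered_zero tempered_zero, of "- 1"] by simp
  have scale: "W (\<lambda>\<phi>. c * u \<phi>) \<phi> = c * W u \<phi>" if "u \<in> tempered" for u c
    using lin[OF that tempered_zero, of c] W0 by simp
  have c: "continuous_on tempered (\<lambda>u. W u \<phi>)"
    by (rule continuous_on_product_then_coordinatewise[OF cont])
  have "open (ball (0::complex) 1)" by simp
  with c obtain T where T: "open T" "T \<inter> tempered = (\<lambda>u. W u \<phi>) -` ball 0 1 \<inter> tempered"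
    unfolding continuous_on_open_invariant by meson
  have "(\<lambda>\<phi>. 0) \<in> T" using T(2) tempered_zero W0 by auto
  then obtain X where X: "(\<lambda>\<phi>. 0) \<in> (\<Pi>\<^sub>E i\<in>UNIV. X i)" "finite {i. X i \<noteq> UNIV}" "(\<Pi>\<^sub>E i\<in>UNIV. X i) \<subseteq> T"
    using product_topology_open_contains_basis[of "\<lambda>_. euclidean" UNIV T "\<lambda>\<phi>. 0"] T(1)
    by (auto simp: open_fun_def)
  define I where "I = {i. X i \<noteq> UNIV}"
  have "\<exists>a. \<forall>u\<in>tempered. W u \<phi> = (\<Sum>x\<in>I. a x * u x)"
  proof (rule functional_in_span[where F = "\<lambda>u. W u \<phi>"])
    fix u assume u: "u \<in> tempered" "\<And>i. i \<in> I \<Longrightarrow> u i = 0"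
    have small: "norm (c * W u \<phi>) < 1" for c
    proof -
      have "(\<lambda>\<phi>. c * u \<phi>) \<in> (\<Pi>\<^sub>E i\<in>UNIV. X i)"
        using X(1) u(2) by (auto simp: I_def PiE_iff) (metis UNIV_I mult_zero_right)
      moreover have "(\<lambda>\<phi>. c * u \<phi>) \<in> tempered"
        using tempered_combination[OF u(1) tempered_zero, of c] by simp
      ultimately have "(\<lambda>\<phi>. c * u \<phi>) \<in> (\<lambda>u. W u \<phi>) -` ball 0 1" using X(3) T(2) by blast
      then show ?thesis using scale[OF u(1), of c] by simp
    qed
    \<comment> \<open>All multiples of \<open>u\<close> lie in the neighbourhood, so a bounded value is zero.\<close>
    show "W u \<phi> = 0"
    proof (rule ccontr)
      assume "W u \<phi> \<noteq> 0"
      then show False using small[of "1 / W u \<phi>"] by simp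
    qed
  qed (use X(2) in \<open>auto simp: I_def lin intro: tempered_combination\<close>)
  then obtain a where a: "\<And>u. u \<in> tempered \<Longrightarrow> W u \<phi> = (\<Sum>x\<in>I. a x * u x)" by blast
  define \<psi> where "\<psi> = (\<lambda>t. \<Sum>x\<in>I \<inter> schwartz. a x * x t)"
  have "\<psi> \<in> schwartz" unfolding \<psi>_def by (intro schwartz_sum schwartz_scale) auto
  moreover have "W u \<phi> = u \<psi>" if u: "u \<in> tempered" for u
  proof -
    have "u \<psi> = (\<Sum>x\<in>I \<inter> schwartz. a x * u x)"
      unfolding \<psi>_def by (rule tempered_sum[OF u]) auto
    also have "\<dots> = (\<Sum>x\<in>I. a x * u x)"
      by (rule sum.mono_neutral_left) (use X(2) tempered_not_schwartz[OF u] in \<open>auto simp: I_def\<close>)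
    finally show ?thesis using a[OF u] by simp
  qed
  ultimately show ?thesis by blast
qed

lemma regular_tempered:
  assumes f: "f \<in> borel_measurable borel" and i: "integrable lborel (\<lambda>x. norm (f x))"
  shows "regular f \<in> tempered"
proof -
  have ip: "integrable lborel (\<lambda>x. f x * \<phi> x)" and
    bd: "norm (LINT x|lborel. f x * \<phi> x) \<le> (LINT x|lborel. norm (f x)) * schwartz_seminorm 0 0 \<phi>" if p: "\<phi> \<in> schwartz" for \<phi>
  proof -
    have le: "norm (\<phi> x) \<le> schwartz_seminorm 0 0 \<phi>" for x
      using le_schwartz_seminorm[OF p, of x 0 0] by simp
    have le': "norm (f x * \<phi> x) \<le> norm (f x) * schwartz_seminorm 0 0 \<phi>" for x
      by (simp add: norm_mult mult_left_mono le)
    show i1: "integrable lborel (\<lambda>x. f x * \<phi> x)"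
      by (rule Bochner_Integration.integrable_bound[OF integrable_mult_left[OF i, of "schwartz_seminorm 0 0 \<phi>"]])
        (use f schwartz_measurable[OF p] le' schwartz_seminorm_nonneg[OF p] in \<open>auto simp: abs_mult\<close>)
    have "norm (LINT x|lborel. f x * \<phi> x) \<le> (LINT x|lborel. norm (f x * \<phi> x))" by (rule integral_norm_bound)
    also have "\<dots> \<le> (LINT x|lborel. norm (f x) * schwartz_seminorm 0 0 \<phi>)"
      by (rule integral_mono) (use i1 i le' in auto)
    finally show "norm (LINT x|lborel. f x * \<phi> x) \<le> (LINT x|lborel. norm (f x)) * schwartz_seminorm 0 0 \<phi>" by simp
  qed
  have lin: "regular f (\<lambda>x. c * \<phi> x + \<psi> x) = c * regular f \<phi> + regular f \<psi>" if p: "\<phi> \<in> schwartz" "\<psi> \<in> schwartz" for c \<phi> \<psi>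
  proof -
    have "(LINT x|lborel. f x * (c * \<phi> x + \<psi> x)) = (LINT x|lborel. c * (f x * \<phi> x) + f x * \<psi> x)"
      by (simp add: algebra_simps)
    also have "\<dots> = c * (LINT x|lborel. f x * \<phi> x) + (LINT x|lborel. f x * \<psi> x)"
      using ip[OF p(1)] ip[OF p(2)] by simp
    finally show ?thesis using p by (simp add: regular_def schwartz_linear)
  qed
  show ?thesis
    unfolding tempered_def
  proof (intro CollectI conjI exI ballI allI impI lin)
    fix \<phi> assume p: "\<phi> \<in> schwartz"
    show "cmod (regular f \<phi>) \<le> (LINT x|lborel. norm (f x)) * (\<Sum>j\<le>0. \<Sum>l\<le>0. schwartz_seminorm j l \<phi>)"
      using bd[OF p] p by (simp add: regular_def)
  qed (auto simp: regular_def)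
qed

lemma schwartz_square_decay:
  assumes p: "\<phi> \<in> schwartz"
  shows "quartic_decay (\<lambda>x. of_real ((norm (\<phi> x))\<^sup>2))"
proof -
  obtain B where "B \<ge> 0" "\<And>x. norm (\<phi> x) \<le> B / (1 + \<bar>x\<bar>) ^ 0"
    by (rule schwartz_decay0[OF p]) blast
  then have "quartic_decay (\<lambda>x. cnj (\<phi> x) * \<phi> x)"
    by (intro quartic_decay_bound_mult[OF schwartz_quartic_decay[OF p], of _ B])
      (auto intro: continuous_on_cnj[OF schwartz_continuous[OF p]])
  moreover have "cnj (\<phi> x) * \<phi> x = of_real ((norm (\<phi> x))\<^sup>2)" for x
    using complex_norm_square[of "\<phi> x"] by (simp add: mult.commute)
  ultimately show ?thesis by (simp only:)
qed

lemma schwartz_square_integrable: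
  assumes p: "\<phi> \<in> schwartz"
  shows "integrable lborel (\<lambda>x. (norm (\<phi> x))\<^sup>2)"
  using integrable_Re[OF quartic_decay_integrable[OF schwartz_square_decay[OF p]]] by simp

text \<open>
  The transpose does not increase the \<open>L\<^sup>2\<close> norm: pair it with its own conjugate, move the operator back,
  and use that the operator preserves the norm of the conjugate. The inequality
  \<open>2 s t \<le> s\<^sup>2 + t\<^sup>2\<close> suffices in place of the Cauchy-Schwarz inequality because one of the two norms is the one to be estimated.
\<close>

lemma metaplectic_transpose:
  assumes W: "metaplectic h M W" and p: "\<phi> \<in> schwartz"
  obtains \<psi> where "\<psi> \<in> schwartz" "\<And>u. u \<in> tempered \<Longrightarrow> W u \<phi> = u \<psi>"
    "(LINT x|lborel. (norm (\<psi> x))\<^sup>2) \<le> (LINT x|lborel. (norm (\<phi> x))\<^sup>2)"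
proof -
  have "\<exists>\<psi>\<in>schwartz. \<forall>u\<in>tempered. W u \<phi> = u \<psi>"
    by (rule weak_continuous_transpose) (use W in \<open>auto simp: metaplectic_def\<close>)
  then obtain \<psi> where \<psi>: "\<psi> \<in> schwartz" "\<And>u. u \<in> tempered \<Longrightarrow> W u \<phi> = u \<psi>" by blast
  let ?f = "\<lambda>x. cnj (\<psi> x)"
  have mf: "?f \<in> borel_measurable borel" using schwartz_measurable[OF \<psi>(1)] by (intro borel_measurable_continuous_onI continuous_on_cnj schwartz_continuous \<psi>)
  have isq: "integrable lborel (\<lambda>x. (norm (\<psi> x))\<^sup>2)" by (rule schwartz_square_integrable[OF \<psi>(1)])
  have f: "?f \<in> square_integrable" using mf isq by (simp add: square_integrable_def)
  have t: "regular ?f \<in> tempered"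
    by (rule regular_tempered[OF mf]) (simp add: quartic_decay_integrable[OF schwartz_quartic_decay[OF \<psi>(1)]])
  have "W (regular ?f) \<in> regular ` square_integrable" using W f by (auto simp: metaplectic_def)
  then obtain g where g: "g \<in> square_integrable" "W (regular ?f) = regular g" by blast
  have ig: "integrable lborel (\<lambda>x. (norm (g x))\<^sup>2)" and mg: "g \<in> borel_measurable borel"
    using g(1) by (auto simp: square_integrable_def)
  have "l2_inner g g = l2_inner ?f ?f" using W f g by (auto simp: metaplectic_def)
  moreover have "l2_inner k k = of_real (LINT x|lborel. (norm (k x))\<^sup>2)" for k
    unfolding l2_inner_def complex_norm_square[symmetric]
    by (simp only: of_real_power[symmetric] integral_complex_of_real)
  ultimately have eq: "(LINT x|lborel. (norm (g x))\<^sup>2) = (LINT x|lborel. (norm (\<psi> x))\<^sup>2)"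
    by (simp only: of_real_eq_iff) simp
  have "of_real (LINT x|lborel. (norm (\<psi> x))\<^sup>2) = regular ?f \<psi>"
  proof -
    have "cnj (\<psi> x) * \<psi> x = of_real ((norm (\<psi> x))\<^sup>2)" for x
      using complex_norm_square[of "\<psi> x"] by (simp add: mult.commute)
    then show ?thesis using \<psi>(1) by (simp only: regular_def if_True integral_complex_of_real)
  qed
  also have "\<dots> = W (regular ?f) \<phi>" by (rule \<psi>(2)[OF t, symmetric])
  also have "\<dots> = (LINT x|lborel. g x * \<phi> x)" using g(2) p by (simp add: regular_def)
  finally have "norm (of_real (LINT x|lborel. (norm (\<psi> x))\<^sup>2) :: complex) = norm (LINT x|lborel. g x * \<phi> x)" by simp
  also have "\<dots> \<le> (LINT x|lborel. norm (g x * \<phi> x))" by (rule integral_norm_bound)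
  also have "\<dots> \<le> (LINT x|lborel. ((norm (g x))\<^sup>2 + (norm (\<phi> x))\<^sup>2) / 2)"
  proof (rule integral_mono)
    have le: "norm (g x * \<phi> x) \<le> ((norm (g x))\<^sup>2 + (norm (\<phi> x))\<^sup>2) / 2" for x
      using sum_squares_bound[of "norm (g x)" "norm (\<phi> x)"] by (simp add: norm_mult)
    show i2: "integrable lborel (\<lambda>x. ((norm (g x))\<^sup>2 + (norm (\<phi> x))\<^sup>2) / 2)"
      using ig schwartz_square_integrable[OF p] by simp
    show "integrable lborel (\<lambda>x. norm (g x * \<phi> x))"
      by (rule Bochner_Integration.integrable_bound[OF i2]) (use mg schwartz_measurable[OF p] le in auto)
    show "norm (g x * \<phi> x) \<le> ((norm (g x))\<^sup>2 + (norm (\<phi> x))\<^sup>2) / 2" for x by (rule le)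
  qed
  also have "\<dots> = ((LINT x|lborel. (norm (\<psi> x))\<^sup>2) + (LINT x|lborel. (norm (\<phi> x))\<^sup>2)) / 2"
    using ig schwartz_square_integrable[OF p] eq by simp
  finally have "(LINT x|lborel. (norm (\<psi> x))\<^sup>2) \<le> (LINT x|lborel. (norm (\<phi> x))\<^sup>2)" by simp
  then show ?thesis using that \<psi> by blast
qed

section \<open>Means over the torus\<close>

definition mean_torus :: "(real \<Rightarrow> real \<Rightarrow> complex) \<Rightarrow> complex" where
  "mean_torus G = integral {0..1} (\<lambda>x. integral {0..1} (G x))"

text \<open>
  Functions on the torus are given as doubly periodic functions of two real variables.
\<close>

definition torus_continuous :: "(real \<Rightarrow> real \<Rightarrow> complex) \<Rightarrow> bool" where
  "torus_continuous G \<longleftrightarrow> continuous_on UNIV (\<lambda>z. G (fst z) (snd z)) \<and>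
     (\<forall>x y. G (x + 1) y = G x y) \<and> (\<forall>x y. G x (y + 1) = G x y)"

lemma torus_continuousD:
  assumes "torus_continuous G"
  shows "continuous_on S f \<Longrightarrow> continuous_on S g \<Longrightarrow> continuous_on S (\<lambda>z. G (f z) (g z))"
    and "G (x + 1) y = G x y" and "G x (y + 1) = G x y"
proof -
  assume fg: "continuous_on S f" "continuous_on S g"
  have "continuous_on S (\<lambda>z. (\<lambda>z. G (fst z) (snd z)) (f z, g z))"
    by (rule continuous_on_compose2[where t = UNIV])
      (use assms fg in \<open>auto simp: torus_continuous_def intro: continuous_on_Pair\<close>)
  then show "continuous_on S (\<lambda>z. G (f z) (g z))" by simp
qed (use assms in \<open>auto simp: torus_continuous_def\<close>)

lemma mean_torus_swap:
  assumes "torus_continuous G"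
  shows "mean_torus G = integral {0..1} (\<lambda>y. integral {0..1} (\<lambda>x. G x y))"
proof -
  have "continuous_on (cbox (0,0) (1,1)) (\<lambda>(x, y). G x y)"
    unfolding split_def by (intro torus_continuousD(1)[OF assms] continuous_intros)
  from integral_swap_continuous[OF this] show ?thesis by (simp add: mean_torus_def)
qed

lemma torus_continuous_int:
  assumes "torus_continuous G"
  shows "G (x + of_int k) (y + of_int m) = G x y"
proof -
  have "G (x + of_int k) (y + of_int m) = G (x + of_int k) y"
    by (rule periodic_of_int) (rule torus_continuousD(3)[OF assms])
  also have "\<dots> = G x y"
    by (rule periodic_of_int[where f = "\<lambda>x. G x y"]) (rule torus_continuousD(2)[OF assms])
  finally show ?thesis .
qed

lemma torus_continuous_linear:
  assumes "torus_continuous G"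
  shows "torus_continuous (\<lambda>x y. G (of_int a * x + of_int b * y) (of_int c * x + of_int d * y))"
  unfolding torus_continuous_def
proof (intro conjI allI)
  show "continuous_on UNIV (\<lambda>z. G (of_int a * fst z + of_int b * snd z) (of_int c * fst z + of_int d * snd z))"
    by (intro torus_continuousD(1)[OF assms] continuous_intros)
  fix x y
  show "G (of_int a * (x + 1) + of_int b * y) (of_int c * (x + 1) + of_int d * y) = G (of_int a * x + of_int b * y) (of_int c * x + of_int d * y)"
    using torus_continuous_int[OF assms, of "of_int a * x + of_int b * y" a "of_int c * x + of_int d * y" c]
    by (simp add: algebra_simps)
  show "G (of_int a * x + of_int b * (y + 1)) (of_int c * x + of_int d * (y + 1)) = G (of_int a * x + of_int b * y) (of_int c * x + of_int d * y)"
    using torus_continuous_int[OF assms, of "of_int a * x + of_int b * y" b "of_int c * x + of_int d * y" d]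
    by (simp add: algebra_simps)
qed

definition preserves_mean :: "int \<Rightarrow> int \<Rightarrow> int \<Rightarrow> int \<Rightarrow> bool" where
  "preserves_mean a b c d \<longleftrightarrow> (\<forall>G. torus_continuous G \<longrightarrow>
     mean_torus (\<lambda>x y. G (of_int a * x + of_int b * y) (of_int c * x + of_int d * y)) = mean_torus G)"

lemma mean_torus_shear1:
  assumes "torus_continuous G"
  shows "mean_torus (\<lambda>x y. G (x + of_int t * y) y) = mean_torus G"
proof -
  have g: "torus_continuous (\<lambda>x y. G (x + of_int t * y) y)"
    using torus_continuous_linear[OF assms, of 1 t 0 1] by simp
  have "integral {0..1} (\<lambda>x. G (x + of_int t * y) y) = integral {0..1} (\<lambda>x. G x y)" for y
    by (rule integral_periodic_shift[where f = "\<lambda>x. G x y"])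
      (intro torus_continuousD[OF assms] continuous_intros)+
  then show ?thesis unfolding mean_torus_swap[OF assms] mean_torus_swap[OF g] by simp
qed

lemma mean_torus_shear2:
  assumes "torus_continuous G"
  shows "mean_torus (\<lambda>x y. G x (y + of_int t * x)) = mean_torus G"
proof -
  have "integral {0..1} (\<lambda>y. G x (y + of_int t * x)) = integral {0..1} (G x)" for x
    by (rule integral_periodic_shift[where f = "G x"])
      (intro torus_continuousD[OF assms] continuous_intros)+
  then show ?thesis unfolding mean_torus_def by simp
qed

lemma preserves_mean_row1:
  assumes "preserves_mean a b c d"
  shows "preserves_mean (a + t * c) (b + t * d) c d"
  unfolding preserves_mean_def
proof (intro allI impI)
  fix G assume G: "torus_continuous G"
  have g: "torus_continuous (\<lambda>x y. G (x + of_int t * y) y)"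
    using torus_continuous_linear[OF G, of 1 t 0 1] by simp
  have "mean_torus (\<lambda>x y. G (of_int (a + t * c) * x + of_int (b + t * d) * y) (of_int c * x + of_int d * y))
     = mean_torus (\<lambda>x y. (\<lambda>x y. G (x + of_int t * y) y) (of_int a * x + of_int b * y) (of_int c * x + of_int d * y))"
    by (simp add: algebra_simps)
  also have "\<dots> = mean_torus (\<lambda>x y. G (x + of_int t * y) y)"
    using assms g by (auto simp: preserves_mean_def)
  also have "\<dots> = mean_torus G" by (rule mean_torus_shear1[OF G])
  finally show "mean_torus (\<lambda>x y. G (of_int (a + t * c) * x + of_int (b + t * d) * y) (of_int c * x + of_int d * y)) = mean_torus G" .
qed

lemma preserves_mean_row2:
  assumes "preserves_mean a b c d"
  shows "preserves_mean a b (c + t * a) (d + t * b)"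
  unfolding preserves_mean_def
proof (intro allI impI)
  fix G assume G: "torus_continuous G"
  have g: "torus_continuous (\<lambda>x y. G x (y + of_int t * x))"
    using torus_continuous_linear[OF G, of 1 0 t 1] by (simp add: add.commute)
  have "mean_torus (\<lambda>x y. G (of_int a * x + of_int b * y) (of_int (c + t * a) * x + of_int (d + t * b) * y))
     = mean_torus (\<lambda>x y. (\<lambda>x y. G x (y + of_int t * x)) (of_int a * x + of_int b * y) (of_int c * x + of_int d * y))"
    by (simp add: algebra_simps)
  also have "\<dots> = mean_torus (\<lambda>x y. G x (y + of_int t * x))"
    using assms g by (auto simp: preserves_mean_def)
  also have "\<dots> = mean_torus G" by (rule mean_torus_shear2[OF G])
  finally show "mean_torus (\<lambda>x y. G (of_int a * x + of_int b * y) (of_int (c + t * a) * x + of_int (d + t * b) * y)) = mean_torus G" .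
qed

text \<open>Row operations with integer factors generate the integer matrices of determinant one.\<close>

lemma preserves_mean_unimodular:
  assumes "a * d - b * c = 1"
  shows "preserves_mean a b c d"
  using assms
proof (induction "nat (\<bar>a\<bar> + \<bar>c\<bar>)" arbitrary: a b c d rule: less_induct)
  case less
  have id: "preserves_mean 1 0 0 1" by (simp add: preserves_mean_def)
  \<comment> \<open>Minus the identity is the square of the rotation by a right angle, a product of three shears.\<close>
  have neg: "preserves_mean (- 1) 0 0 (- 1)"
  proof -
    note s1 = preserves_mean_row1[OF id, of "- 1", simplified]
    note s2 = preserves_mean_row2[OF s1, of 1, simplified]
    note s3 = preserves_mean_row1[OF s2, of "- 1", simplified]
    note s4 = preserves_mean_row1[OF s3, of "- 1", simplified]
    note s5 = preserves_mean_row2[OF s4, of 1, simplified]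
    note s6 = preserves_mean_row1[OF s5, of "- 1", simplified]
    show ?thesis by (rule s6)
  qed
  have c0: "preserves_mean a b c d" if "a * d - b * c = 1" "c = 0" for a b c d :: int
  proof -
    have ad: "a * d = 1" using that by simp
    then have "a = 1 \<and> d = 1 \<or> a = - 1 \<and> d = - 1"
      using zmult_eq_1_iff by blast
    then show ?thesis
      using preserves_mean_row1[OF id, of b] preserves_mean_row1[OF neg, of "- b"] that(2) by auto
  qed
  consider "c = 0" | "a = 0" | "c \<noteq> 0" "a \<noteq> 0" "\<bar>c\<bar> \<le> \<bar>a\<bar>" | "c \<noteq> 0" "a \<noteq> 0" "\<bar>a\<bar> < \<bar>c\<bar>" by linarith
  then show ?case
  proof cases
    case 1
    then show ?thesis using c0 less.prems by blast
  next
    case 2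
    have "preserves_mean c (b + d) 0 (- b)"
      by (rule c0) (use less.prems 2 in \<open>auto simp: algebra_simps\<close>)
    from preserves_mean_row2[OF this, of 1] have "preserves_mean c (b + d) c d" by simp
    from preserves_mean_row1[OF this, of "- 1"] show ?thesis using 2 by simp
  next
    case 3
    define t where "t = - (sgn a * sgn c)"
    have "\<bar>a + t * c\<bar> < \<bar>a\<bar>" using 3 by (auto simp: t_def sgn_if abs_if split: if_splits)
    then have "preserves_mean (a + t * c) (b + t * d) c d"
      by (intro less.hyps) (use less.prems in \<open>auto simp: algebra_simps\<close>)
    from preserves_mean_row1[OF this, of "- t"] show ?thesis by (simp add: algebra_simps)
  next
    case 4
    define t where "t = - (sgn a * sgn c)"
    have "\<bar>c + t * a\<bar> < \<bar>c\<bar>" using 4 by (auto simp: t_def sgn_if abs_if split: if_splits)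
    then have "preserves_mean a b (c + t * a) (d + t * b)"
      by (intro less.hyps) (use less.prems in \<open>auto simp: algebra_simps\<close>)
    from preserves_mean_row2[OF this, of "- t"] show ?thesis by (simp add: algebra_simps)
  qed
qed

section \<open>The norm of a torus state as a mean of its matrix coefficients\<close>

text \<open>
  One factor of the square is expanded and integrated term by term; the other integrates to its Fourier
  coefficient.
\<close>

lemma parseval:
  fixes \<alpha> :: "int \<Rightarrow> complex"
  assumes a: "(\<lambda>r. norm (\<alpha> r)) summable_on UNIV"
  shows "((\<lambda>r. complex_of_real ((norm (\<alpha> r))\<^sup>2)) has_sum
      integral {0..1} (\<lambda>x. of_real ((norm (\<Sum>\<^sub>\<infinity>r. \<alpha> r * wave (of_int r * x)))\<^sup>2))) UNIV"
proof -
  let ?g = "\<lambda>x. \<Sum>\<^sub>\<infinity>r. \<alpha> r * wave (of_int r * x)"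
  define A where "A = (\<Sum>\<^sub>\<infinity>r. norm (\<alpha> r))"
  have gA: "norm (?g x) \<le> A" for x
    unfolding A_def by (rule dominated_summable(3)[OF a]) (simp add: norm_mult)
  have cg: "continuous_on S ?g" for S
    by (rule continuous_on_infsum[where b = "\<lambda>r. norm (\<alpha> r)"])
      (use a in \<open>auto intro!: continuous_intros simp: norm_mult\<close>)
  let ?f = "\<lambda>r x. cnj (\<alpha> r) * (wave (- (of_int r * x)) * ?g x)"
  have eq: "of_real ((norm (?g x))\<^sup>2) = (\<Sum>\<^sub>\<infinity>r. ?f r x)" for x
  proof -
    have "of_real ((norm (?g x))\<^sup>2) = cnj (?g x) * ?g x"
      by (simp only: complex_norm_square mult.commute)
    also have "cnj (?g x) = (\<Sum>\<^sub>\<infinity>r. cnj (\<alpha> r) * wave (- (of_int r * x)))"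
      by (simp add: wave_minus flip: infsum_cnj)
    also have "\<dots> * ?g x = (\<Sum>\<^sub>\<infinity>r. (cnj (\<alpha> r) * wave (- (of_int r * x))) * ?g x)"
      by (rule infsum_cmult_left'[symmetric])
    finally show ?thesis by (simp only: mult.assoc)
  qed
  have "((\<lambda>r. integral {0..1} (?f r)) has_sum integral {0..1} (\<lambda>x. \<Sum>\<^sub>\<infinity>r. ?f r x)) UNIV"
  proof (rule integral_infsum_interval[where B = "\<lambda>r. norm (\<alpha> r) * A"])
    show "continuous_on {0..1} (?f r)" for r by (intro continuous_intros cg)
    show "norm (?f r x) \<le> norm (\<alpha> r) * A" for r x
      using mult_left_mono[OF gA[of x], of "norm (\<alpha> r)"] by (simp add: norm_mult)
    show "(\<lambda>r. norm (\<alpha> r) * A) summable_on UNIV" by (rule summable_on_cmult_left[OF a])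
  qed
  moreover have "integral {0..1} (?f r) = of_real ((norm (\<alpha> r))\<^sup>2)" for r
  proof -
    have "integral {0..1} (?f r) = cnj (\<alpha> r) * \<alpha> r"
      by (subst integral_cmult) (simp only: fourier_coefficient_of_series[OF a])
    then show ?thesis by (simp only: complex_norm_square mult.commute)
  qed
  ultimately show ?thesis by (simp only: eq)
qed

text \<open>
  The Zak transform of \<open>\<phi>\<close> for the lattice \<open>(1 / N) \<int>\<close>, weighted with the coordinates of a torus state. Up to
  a phase and \<open>\<surd>N\<close> it is the pairing of the state with a translate of \<open>\<phi>\<close>.
\<close>

definition zak :: "nat \<Rightarrow> (nat \<Rightarrow> complex) \<Rightarrow> (real \<Rightarrow> complex) \<Rightarrow> real \<Rightarrow> real \<Rightarrow> complex" where
  "zak N c \<phi> x y = (\<Sum>\<^sub>\<infinity>r::int. (c (nat (r mod int N)) * \<phi> (of_int r / N - y)) * wave (of_int r * x))"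

lemma norm_translate_state:
  assumes p: "\<phi> \<in> schwartz" and N: "N > 0"
  shows "norm (translate N (real N * x) (real N * y) (state N c) \<phi>) = norm (zak N c \<phi> x y) / sqrt N"
proof -
  have "translate N (real N * x) (real N * y) (state N c) \<phi>
      = (of_real (1 / sqrt N) * wave (- (real N * x * y / 2))) * zak N c \<phi> x y"
  proof -
    have e: "real N * y / real N = y" "real N * x * (of_int r / N) - real N * x * (real N * y) / (2 * real N) = - (real N * x * y / 2) + of_int r * x" for r :: int
      using N by (simp_all add: field_simps)
    show ?thesis
      unfolding translate_state_lattice[OF p N] zak_def infsum_cmult_right'[symmetric] e wave_add
      by (simp only: mult_ac)
  qed
  then show ?thesis by (simp add: norm_mult norm_divide)
qed

lemma torus_continuous_zak:
  assumes p: "\<phi> \<in> schwartz" and N: "N > 0"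
  shows "torus_continuous (\<lambda>x y. of_real ((norm (zak N c \<phi> x y))\<^sup>2))"
  unfolding torus_continuous_def
proof (intro conjI allI)
  define A where "A = (\<Sum>n<N. norm (c n))"
  have A: "norm (c (nat (r mod int N))) \<le> A" for r unfolding A_def by (rule state_coeff_bound[OF N])
  have A0: "A \<ge> 0" by (auto simp: A_def intro: sum_nonneg)
  have "continuous_on (ball 0 R) (\<lambda>z. zak N c \<phi> (fst z) (snd z))" for R
  proof -
    obtain C where C: "C \<ge> 0" "\<And>t r. \<bar>t\<bar> \<le> R \<Longrightarrow> norm (\<phi> (t + r / real N)) \<le> C * (1 / (1 + r\<^sup>2))"
      by (rule lattice_decay[OF p N]) blast
    show ?thesis
      unfolding zak_def
    proof (rule continuous_on_infsum[where b = "\<lambda>r::int. A * C * (1 / (1 + (of_int r)\<^sup>2))"])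
      show "continuous_on (ball 0 R) (\<lambda>z. (c (nat (r mod int N)) * \<phi> (of_int r / N - snd z)) * wave (of_int r * fst z))" for r :: int
        by (intro continuous_intros continuous_on_compose2[OF schwartz_continuous[OF p, of UNIV]]) auto
      show "(\<lambda>r::int. A * C * (1 / (1 + (of_int r)\<^sup>2))) summable_on UNIV"
        by (intro summable_on_cmult_right summable_inverse_square_int)
      fix r :: int and z :: "real \<times> real" assume z: "z \<in> ball 0 R"
      then have "\<bar>- snd z\<bar> \<le> R" using norm_snd_le[of "snd z" "fst z"] by simp
      from mult_mono[OF A C(2)[OF this, of "of_int r"] A0 norm_ge_zero, of r]
      show "norm ((c (nat (r mod int N)) * \<phi> (of_int r / N - snd z)) * wave (of_int r * fst z)) \<le> A * C * (1 / (1 + (of_int r)\<^sup>2))"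
        by (simp add: norm_mult)
    qed
  qed
  then have "isCont (\<lambda>z. zak N c \<phi> (fst z) (snd z)) z" for z
    by (rule continuous_on_interior[of "ball 0 (norm z + 1)"]) (simp add: interior_open)
  then have "continuous_on UNIV (\<lambda>z. zak N c \<phi> (fst z) (snd z))"
    by (simp add: continuous_on_eq_continuous_at)
  then show "continuous_on UNIV (\<lambda>z. complex_of_real ((norm (zak N c \<phi> (fst z) (snd z)))\<^sup>2))"
    by (intro continuous_intros)
  fix x y
  show "complex_of_real ((norm (zak N c \<phi> (x + 1) y))\<^sup>2) = of_real ((norm (zak N c \<phi> x y))\<^sup>2)"
    by (simp add: zak_def distrib_left wave_add)
  have "zak N c \<phi> x (y + 1) = (\<Sum>\<^sub>\<infinity>r::int. (c (nat ((r + int N) mod int N)) * \<phi> (of_int (r + int N) / N - (y + 1))) * wave (of_int (r + int N) * x))"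
    unfolding zak_def by (rule infsum_shift_int[symmetric])
  also have "\<dots> = (\<Sum>\<^sub>\<infinity>r::int. wave (real N * x) * ((c (nat (r mod int N)) * \<phi> (of_int r / N - y)) * wave (of_int r * x)))"
    using N by (intro infsum_cong) (simp add: add_divide_distrib algebra_simps wave_add)
  also have "\<dots> = wave (real N * x) * zak N c \<phi> x y"
    unfolding zak_def by (rule infsum_cmult_right')
  finally show "complex_of_real ((norm (zak N c \<phi> x (y + 1)))\<^sup>2) = of_real ((norm (zak N c \<phi> x y))\<^sup>2)"
    by (simp add: norm_mult)
qed

text \<open>
  Averaging over the modulation parameter removes the interaction of different lattice points, by
  Parseval. Averaging over the position parameter then unfolds the sum over each residue class to the
  integral of \<open>\<bar>\<phi>\<bar>\<^sup>2\<close> over the line.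
\<close>

lemma mean_zak:
  assumes p: "\<phi> \<in> schwartz" and N: "N > 0"
  shows "mean_torus (\<lambda>x y. of_real ((norm (zak N c \<phi> x y))\<^sup>2))
    = of_real ((\<Sum>n<N. (norm (c n))\<^sup>2) * (LINT x|lborel. (norm (\<phi> x))\<^sup>2))"
proof -
  define I where "I = (LINT x|lborel. (norm (\<phi> x))\<^sup>2)"
  define A where "A = (\<Sum>n<N. norm (c n))"
  have A: "norm (c (nat (r mod int N))) \<le> A" for r unfolding A_def by (rule state_coeff_bound[OF N])
  have A0: "A \<ge> 0" by (auto simp: A_def intro: sum_nonneg)
  let ?\<alpha> = "\<lambda>y r. c (nat (r mod int N)) * \<phi> (of_int r / N - y)"
  have sa: "(\<lambda>r. norm (?\<alpha> y r)) summable_on UNIV" for y by (rule lattice_summable(1)[OF p N A])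
  let ?F = "\<lambda>r y. complex_of_real ((norm (?\<alpha> y r))\<^sup>2)"
  have ps: "integral {0..1} (\<lambda>x. of_real ((norm (zak N c \<phi> x y))\<^sup>2)) = (\<Sum>\<^sub>\<infinity>r. ?F r y)" for y
    unfolding zak_def by (rule infsumI[OF parseval[OF sa], symmetric])
  obtain C where C: "C \<ge> 0" "\<And>t r. \<bar>t\<bar> \<le> 1 \<Longrightarrow> norm (\<phi> (t + r / real N)) \<le> C * (1 / (1 + r\<^sup>2))"
    by (rule lattice_decay[OF p N]) blast
  have hs: "((\<lambda>r. integral {0..1} (?F r)) has_sum integral {0..1} (\<lambda>y. \<Sum>\<^sub>\<infinity>r. ?F r y)) UNIV"
  proof (rule integral_infsum_interval[where B = "\<lambda>r::int. (A * C)\<^sup>2 * (1 / (1 + (of_int r)\<^sup>2))"])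
    show "continuous_on {0..1} (?F r)" for r
      by (intro continuous_intros continuous_on_compose2[OF schwartz_continuous[OF p, of UNIV]]) auto
    show "(\<lambda>r::int. (A * C)\<^sup>2 * (1 / (1 + (of_int r)\<^sup>2))) summable_on UNIV"
      by (intro summable_on_cmult_right summable_inverse_square_int)
    fix r :: int and y :: real assume "y \<in> {0..1}"
    then have y: "\<bar>- y\<bar> \<le> 1" by simp
    let ?q = "1 / (1 + (of_int r)\<^sup>2) :: real"
    have q: "0 \<le> ?q" "?q \<le> 1" by (auto simp: divide_le_eq add_pos_nonneg)
    have "norm (?\<alpha> y r) \<le> A * C * ?q"
      using mult_mono[OF A C(2)[OF y, of "of_int r"] A0 norm_ge_zero, of r] by (simp add: norm_mult)
    then have "(norm (?\<alpha> y r))\<^sup>2 \<le> (A * C * ?q)\<^sup>2" by (intro power_mono) auto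
    also have "\<dots> = (A * C)\<^sup>2 * (?q * ?q)" by (simp only: power2_eq_square mult_ac)
    also have "\<dots> \<le> (A * C)\<^sup>2 * (1 * ?q)" by (intro mult_left_mono mult_right_mono q) auto
    finally show "norm (?F r y) \<le> (A * C)\<^sup>2 * ?q" by (simp only: norm_of_real abs_power2 mult_1)
  qed
  have per: "(\<Sum>\<^sub>\<infinity>k. integral {0..1} (?F (int N * k + int n))) = of_real ((norm (c n))\<^sup>2 * I)" if n: "n < N" for n
  proof -
    let ?q = "\<lambda>t. complex_of_real ((norm (\<phi> (real n / N - t)))\<^sup>2)"
    have "quartic_decay ?q"
    proof -
      have "quartic_decay (\<lambda>x. of_real ((norm (\<phi> x))\<^sup>2))" by (rule schwartz_square_decay[OF p])
      then obtain D where D: "D \<ge> 0" "\<And>x. (norm (\<phi> x))\<^sup>2 \<le> D / (1 + x\<^sup>2)\<^sup>2"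
        by (auto simp: quartic_decay_def norm_power)
      let ?K = "2 + 2 * (real n / N)\<^sup>2"
      have "(norm (\<phi> (real n / N - t)))\<^sup>2 \<le> (D * ?K\<^sup>2) / (1 + t\<^sup>2)\<^sup>2" for t
      proof -
        have "1 / (1 + (real n / N - t)\<^sup>2) \<le> ?K / (1 + t\<^sup>2)"
          using quartic_decay_bound_shift[of "real n / N" "real n / N" "- t"] by simp
        then have "(1 / (1 + (real n / N - t)\<^sup>2))\<^sup>2 \<le> (?K / (1 + t\<^sup>2))\<^sup>2" by (intro power_mono) auto
        from mult_left_mono[OF this D(1)] D(2)[of "real n / N - t"]
        show ?thesis by (simp add: power_divide)
      qed
      moreover have "continuous_on UNIV ?q"
        by (intro continuous_intros continuous_on_compose2[OF schwartz_continuous[OF p, of UNIV]]) auto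
      ultimately show ?thesis
        using D(1) unfolding quartic_decay_def by (intro conjI exI[of _ "D * ?K\<^sup>2"]) (auto simp: norm_power)
    qed
    from quartic_decay_unfold[OF this]
    have "(\<Sum>\<^sub>\<infinity>k::int. integral {0..1} (\<lambda>t. ?q (t + of_int k))) = (LINT t|lborel. ?q t)" by (rule infsumI)
    also have "(LINT t|lborel. ?q t) = of_real I"
    proof -
      have "(LINT t|lborel. (norm (\<phi> t))\<^sup>2) = (LINT t|lborel. (norm (\<phi> (real n / N - t)))\<^sup>2)"
        using lborel_integral_real_affine[of "- 1" "\<lambda>t. (norm (\<phi> t))\<^sup>2" "real n / N"] by simp
      then show ?thesis unfolding I_def by (simp only: integral_complex_of_real)
    qed
    finally have u: "(\<Sum>\<^sub>\<infinity>k::int. integral {0..1} (\<lambda>t. ?q (t + of_int k))) = of_real I" .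
    have "integral {0..1} (?F (int N * (- k) + int n)) = of_real ((norm (c n))\<^sup>2) * integral {0..1} (\<lambda>t. ?q (t + of_int k))" for k
    proof -
      have "of_int (int N * (- k) + int n) / N - y = real n / N - (y + of_int k)" for y
        using N by (simp add: field_simps)
      moreover have "nat ((int N * (- k) + int n) mod int N) = n"
      proof -
        have "(int N * (- k) + int n) mod int N = int n mod int N" by (rule mod_mult_self4)
        then show ?thesis using n by simp
      qed
      ultimately have "?F (int N * (- k) + int n) y = of_real ((norm (c n))\<^sup>2) * ?q (y + of_int k)" for y
        by (simp only: norm_mult power_mult_distrib of_real_mult)
      then show ?thesis by (simp only: integral_cmult)
    qed
    then have "(\<Sum>\<^sub>\<infinity>k. integral {0..1} (?F (int N * (- k) + int n))) = of_real ((norm (c n))\<^sup>2) * of_real I"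
      by (simp only: infsum_cmult_right' u)
    moreover have "(\<Sum>\<^sub>\<infinity>k. integral {0..1} (?F (int N * (- k) + int n))) = (\<Sum>\<^sub>\<infinity>k. integral {0..1} (?F (int N * k + int n)))"
      by (rule infsum_reindex_bij_witness[where i = uminus and j = uminus]) auto
    ultimately show ?thesis by simp
  qed
  have "mean_torus (\<lambda>x y. of_real ((norm (zak N c \<phi> x y))\<^sup>2)) = (\<Sum>\<^sub>\<infinity>r. integral {0..1} (?F r))"
    unfolding mean_torus_swap[OF torus_continuous_zak[OF p N]] ps by (rule infsumI[OF hs, symmetric])
  also have "\<dots> = (\<Sum>n<N. \<Sum>\<^sub>\<infinity>k. integral {0..1} (?F (int N * k + int n)))"
    by (rule infsum_residues[OF N]) (use hs in \<open>auto simp: summable_on_def\<close>)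
  also have "\<dots> = (\<Sum>n<N. of_real ((norm (c n))\<^sup>2 * I))" by (intro sum.cong refl per) simp
  also have "\<dots> = of_real ((\<Sum>n<N. (norm (c n))\<^sup>2) * I)" by (simp add: sum_distrib_right)
  finally show ?thesis by (simp only: I_def)
qed

section \<open>Quantum maps on torus states\<close>

lemma plane_wave_matrix:
  "(\<lambda>p. plane_wave a b (A *v p)) = plane_wave (a * A $ 1 $ 1 + b * A $ 2 $ 1) (a * A $ 1 $ 2 + b * A $ 2 $ 2)"
  by (rule ext) (simp add: plane_wave_def matrix_vector_mult_def sum_2 algebra_simps)

text \<open>
  The commutation relation for symbols, applied to a character.
\<close>

lemma metaplectic_translate:
  assumes W: "metaplectic (planck N) A W" and N: "N > 0" and u: "u \<in> tempered"
  shows "translate N a b (W u) = W (translate N (a * A $ 1 $ 1 + b * A $ 2 $ 1) (a * A $ 1 $ 2 + b * A $ 2 $ 2) u)"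
proof -
  have "weyl_dist (planck N) (plane_wave a b) (W u) = W (weyl_dist (planck N) (\<lambda>p. plane_wave a b (A *v p)) u)"
  proof -
    have "\<forall>a. bounded_symbol a \<longrightarrow> (\<forall>u\<in>tempered. weyl_dist (planck N) a (W u) = W (weyl_dist (planck N) (\<lambda>p. a (A *v p)) u))"
      using W unfolding metaplectic_def by (elim conjE)
    from this[rule_format, OF bounded_symbol_plane_wave u] show ?thesis .
  qed
  then show ?thesis unfolding plane_wave_matrix weyl_dist_plane_wave[OF N] .
qed

lemma metaplectic_tempered: "metaplectic h A W \<Longrightarrow> u \<in> tempered \<Longrightarrow> W u \<in> tempered"
  by (auto simp: metaplectic_def)

lemma metaplectic_linear:
  assumes "metaplectic h A W" "u \<in> tempered" "v \<in> tempered"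
  shows "W (\<lambda>\<phi>. c * u \<phi> + v \<phi>) = (\<lambda>\<phi>. c * W u \<phi> + W v \<phi>)"
proof -
  have "\<forall>u\<in>tempered. \<forall>v\<in>tempered. \<forall>c. W (\<lambda>\<phi>. c * u \<phi> + v \<phi>) = (\<lambda>\<phi>. c * W u \<phi> + W v \<phi>)"
    using assms(1) unfolding metaplectic_def by (elim conjE)
  from this[rule_format, OF assms(2,3)] show ?thesis .
qed

text \<open>
  The integer matrix maps the period lattice to itself, so invariance under it passes from a state to its image.
\<close>

lemma metaplectic_state:
  fixes M :: "int^2^2"
  assumes W: "metaplectic (planck N) (real_matrix M) W" and N: "N > 0" "even N"
  shows "\<exists>d. W (state N c) = state N d"
proof (rule invariant_distribution_is_state)
  let ?v = "W (state N c)"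
  have t: "?v \<in> tempered" by (rule metaplectic_tempered[OF W state_tempered[OF N(1)]])
  show "?v \<in> tempered" by (rule t)
  have inv: "translate N (real N * of_int a) (real N * of_int b) ?v = ?v" for a b :: int
  proof -
    have "translate N (real N * of_int a) (real N * of_int b) ?v
      = W (translate N (real N * of_int (a * M $ 1 $ 1 + b * M $ 2 $ 1)) (real N * of_int (a * M $ 1 $ 2 + b * M $ 2 $ 2)) (state N c))"
      unfolding metaplectic_translate[OF W N(1) state_tempered[OF N(1)]]
      by (simp add: real_matrix_def algebra_simps)
    then show ?thesis by (simp only: translate_state_period[OF N])
  qed
  fix \<phi> :: "real \<Rightarrow> complex" assume p: "\<phi> \<in> schwartz"
  have "translate N (real N * of_int 0) (real N * of_int 1) ?v \<phi> = ?v (\<lambda>x. \<phi> (x - 1))"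
    using p N by (simp add: translate_def heisenberg_def[abs_def])
  then show "?v (\<lambda>x. \<phi> (x - 1)) = ?v \<phi>" by (simp only: inv)
  have "translate N (real N * of_int 1) (real N * of_int 0) ?v \<phi> = ?v (\<lambda>x. wave (real N * x) * \<phi> x)"
    using p N by (simp add: translate_def heisenberg_def[abs_def])
  then show "?v (\<lambda>x. wave (real N * x) * \<phi> x) = ?v \<phi>" by (simp only: inv)
qed (rule N)

lemma gauss_square_pos: "(LINT x|lborel. (norm (gauss x))\<^sup>2) > 0"
  by (rule lborel_integral_pos[OF schwartz_square_integrable[OF gauss_schwartz]]) (simp add: gauss_def)

text \<open>
  Boundedness on torus states is inherited from unitarity on \<open>L\<^sup>2\<close>: pairing with all phase space
  translates of one Gaussian, taking the mean square, and moving the operator onto the Gaussian by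
  transposition.
\<close>

theorem metaplectic_contraction:
  fixes M :: "int^2^2"
  assumes W: "metaplectic (planck N) (real_matrix M) W" and N: "N > 0" and M: "det M = 1"
    and d: "W (state N c) = state N d"
  shows "(\<Sum>n<N. (norm (d n))\<^sup>2) \<le> (\<Sum>n<N. (norm (c n))\<^sup>2)"
proof -
  obtain \<psi> where \<psi>: "\<psi> \<in> schwartz" "\<And>u. u \<in> tempered \<Longrightarrow> W u gauss = u \<psi>"
    "(LINT x|lborel. (norm (\<psi> x))\<^sup>2) \<le> (LINT x|lborel. (norm (gauss x))\<^sup>2)"
    by (rule metaplectic_transpose[OF W gauss_schwartz]) blast
  let ?G = "\<lambda>x y. complex_of_real ((norm (zak N c \<psi> x y))\<^sup>2)"
  have eq: "complex_of_real ((norm (zak N d gauss x y))\<^sup>2)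
      = ?G (of_int (M $ 1 $ 1) * x + of_int (M $ 2 $ 1) * y) (of_int (M $ 1 $ 2) * x + of_int (M $ 2 $ 2) * y)" for x y
  proof -
    have "translate N (real N * x) (real N * y) (state N d) gauss
      = W (translate N (real N * (of_int (M $ 1 $ 1) * x + of_int (M $ 2 $ 1) * y)) (real N * (of_int (M $ 1 $ 2) * x + of_int (M $ 2 $ 2) * y)) (state N c)) gauss"
      unfolding d[symmetric] metaplectic_translate[OF W N state_tempered[OF N]]
      by (simp add: real_matrix_def algebra_simps)
    also have "\<dots> = translate N (real N * (of_int (M $ 1 $ 1) * x + of_int (M $ 2 $ 1) * y)) (real N * (of_int (M $ 1 $ 2) * x + of_int (M $ 2 $ 2) * y)) (state N c) \<psi>"
      by (rule \<psi>(2)[OF translate_state_tempered[OF N]])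
    finally have "norm (zak N d gauss x y) / sqrt N
      = norm (zak N c \<psi> (of_int (M $ 1 $ 1) * x + of_int (M $ 2 $ 1) * y) (of_int (M $ 1 $ 2) * x + of_int (M $ 2 $ 2) * y)) / sqrt N"
      unfolding norm_translate_state[OF gauss_schwartz N, symmetric] norm_translate_state[OF \<psi>(1) N, symmetric] by simp
    then show ?thesis using N by simp
  qed
  have pm: "preserves_mean (M $ 1 $ 1) (M $ 2 $ 1) (M $ 1 $ 2) (M $ 2 $ 2)"
    by (rule preserves_mean_unimodular) (use M in \<open>simp add: det_2 mult.commute\<close>)
  have "mean_torus (\<lambda>x y. complex_of_real ((norm (zak N d gauss x y))\<^sup>2)) = mean_torus ?G"
    unfolding eq by (rule pm[unfolded preserves_mean_def, rule_format, OF torus_continuous_zak[OF \<psi>(1) N]])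
  then have "(\<Sum>n<N. (norm (d n))\<^sup>2) * (LINT x|lborel. (norm (gauss x))\<^sup>2)
     = (\<Sum>n<N. (norm (c n))\<^sup>2) * (LINT x|lborel. (norm (\<psi> x))\<^sup>2)"
    unfolding mean_zak[OF gauss_schwartz N] mean_zak[OF \<psi>(1) N] of_real_eq_iff .
  also have "\<dots> \<le> (\<Sum>n<N. (norm (c n))\<^sup>2) * (LINT x|lborel. (norm (gauss x))\<^sup>2)"
    by (intro mult_left_mono \<psi>(3) sum_nonneg) auto
  finally show ?thesis using gauss_square_pos by simp
qed

section \<open>Fourier series on the torus\<close>

definition weight :: "int \<times> int \<Rightarrow> real" where
  "weight k = 1 + \<bar>of_int (fst k)\<bar> + \<bar>of_int (snd k)\<bar>"

definition rapid :: "(int \<times> int \<Rightarrow> complex) \<Rightarrow> bool" where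
  "rapid c \<longleftrightarrow> (\<forall>p. (\<lambda>k. weight k ^ p * norm (c k)) summable_on UNIV)"

definition pairing :: "int \<times> int \<Rightarrow> real \<times> real \<Rightarrow> real" where
  "pairing k z = of_int (fst k) * fst z + of_int (snd k) * snd z"

definition trig :: "(int \<times> int \<Rightarrow> complex) \<Rightarrow> real \<times> real \<Rightarrow> complex" where
  "trig c z = (\<Sum>\<^sub>\<infinity>k. c k * wave (pairing k z))"

lemma weight_ge_1: "weight k \<ge> 1"
  by (simp add: weight_def)

lemma rapid_summable: "rapid c \<Longrightarrow> (\<lambda>k. norm (c k)) summable_on UNIV"
  unfolding rapid_def by (drule spec[of _ 0]) simp

lemma summable_inverse_weight: "(\<lambda>k. 1 / weight k ^ 4) summable_on UNIV"
proof -
  let ?h = "\<lambda>k::int. 1 / (1 + (of_int k)\<^sup>2) :: real"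
  have nn: "0 \<le> ?h k" for k by simp
  have s: "(\<lambda>k. norm (?h k)) summable_on UNIV"
    using summable_inverse_square_int by simp
  have "(\<lambda>k. norm ((\<lambda>(a, b). ?h a * ?h b) k)) summable_on (UNIV \<times> UNIV)"
    unfolding Infinite_Sum.abs_summable_on_Sigma_iff
  proof (intro conjI ballI)
    show "(\<lambda>y. norm ((\<lambda>(a, b). ?h a * ?h b) (x, y))) summable_on UNIV" for x
      using summable_on_cmult_right[OF s, of "?h x"] by (simp add: abs_mult)
    have "(\<Sum>\<^sub>\<infinity>y. norm ((\<lambda>(a, b). ?h a * ?h b) (x, y))) = ?h x * (\<Sum>\<^sub>\<infinity>y. ?h y)" for x
      unfolding infsum_cmult_right'[symmetric] by simp
    then show "(\<lambda>x. norm (\<Sum>\<^sub>\<infinity>y. norm ((\<lambda>(a, b). ?h a * ?h b) (x, y)))) summable_on UNIV"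
      using summable_on_cmult_left[OF s, of "\<Sum>\<^sub>\<infinity>y. ?h y"] infsum_nonneg[of UNIV ?h] by (simp add: abs_mult)
  qed
  then have "(\<lambda>k. ?h (fst k) * ?h (snd k)) summable_on UNIV"
    by (simp add: case_prod_beta)
  then show ?thesis
  proof (rule Infinite_Sum.summable_on_comparison_test)
    fix k :: "int \<times> int"
    have w: "1 + (of_int (fst k))\<^sup>2 \<le> (weight k)\<^sup>2" "1 + (of_int (snd k))\<^sup>2 \<le> (weight k)\<^sup>2"
      unfolding weight_def power2_eq_square by (simp_all add: algebra_simps)
    have p: "0 < 1 + (of_int (fst k) :: real)\<^sup>2" "0 < 1 + (of_int (snd k) :: real)\<^sup>2" by (auto intro: add_pos_nonneg)
    have "(1 + (of_int (fst k))\<^sup>2) * (1 + (of_int (snd k))\<^sup>2) \<le> (weight k)\<^sup>2 * (weight k)\<^sup>2"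
      by (intro mult_mono w) (use p in auto)
    also have "\<dots> = weight k ^ 4" by (simp flip: power_add)
    finally show "1 / weight k ^ 4 \<le> ?h (fst k) * ?h (snd k)"
      using p by (simp add: frac_le)
    show "0 \<le> 1 / weight k ^ 4" using weight_ge_1[of k] by simp
  qed
qed

lemma rapidI:
  assumes "\<And>p. \<exists>C. \<forall>k. weight k ^ p * norm (c k) \<le> C"
  shows "rapid c"
  unfolding rapid_def
proof
  fix p
  obtain C where C: "\<And>k. weight k ^ (p + 4) * norm (c k) \<le> C" using assms by blast
  show "(\<lambda>k. weight k ^ p * norm (c k)) summable_on UNIV"
  proof (rule Infinite_Sum.summable_on_comparison_test[OF summable_on_cmult_right[OF summable_inverse_weight, of C]])
    fix k
    have w: "0 < weight k ^ 4" using weight_ge_1[of k] by simp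
    have "weight k ^ p * norm (c k) * weight k ^ 4 \<le> C" using C[of k] by (simp add: power_add mult_ac)
    then show "weight k ^ p * norm (c k) \<le> C * (1 / weight k ^ 4)" using w by (simp add: pos_le_divide_eq)
    show "0 \<le> weight k ^ p * norm (c k)" using weight_ge_1[of k] by simp
  qed
qed

lemma mean_of_trig:
  assumes c: "(\<lambda>k. norm (c k)) summable_on UNIV"
  shows "integral {0..1} (\<lambda>y. integral {0..1} (\<lambda>x. wave (- pairing m (x, y)) * trig c (x, y))) = c m"
proof -
  have c': "(\<lambda>k. norm (c k)) summable_on (UNIV \<times> UNIV)" using c by simp
  have sec: "(\<lambda>b. norm (c (a, b))) summable_on UNIV" for a
    using c' unfolding Infinite_Sum.abs_summable_on_Sigma_iff by auto
  have out: "(\<lambda>a. \<Sum>\<^sub>\<infinity>b. norm (c (a, b))) summable_on UNIV"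
    using c' unfolding Infinite_Sum.abs_summable_on_Sigma_iff
    by (auto intro: Infinite_Sum.abs_summable_summable)
  define d where "d y a = (\<Sum>\<^sub>\<infinity>b. c (a, b) * wave (of_int b * y))" for y a
  have db: "norm (d y a) \<le> (\<Sum>\<^sub>\<infinity>b. norm (c (a, b)))" for y a
    unfolding d_def by (rule dominated_summable(3)[OF sec]) (simp add: norm_mult)
  have ds: "(\<lambda>a. norm (d y a)) summable_on UNIV" for y
    by (rule dominated_summable(1)[OF out]) (rule db)
  have t: "trig c (x, y) = (\<Sum>\<^sub>\<infinity>a. d y a * wave (of_int a * x))" for x y
  proof -
    have "(\<lambda>k. c k * wave (pairing k (x, y))) summable_on (UNIV \<times> UNIV)"
      by (rule dominated_summable(2)[OF c']) (simp add: norm_mult)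
    from infsum_Sigma_banach[OF this]
    have "trig c (x, y) = (\<Sum>\<^sub>\<infinity>a. \<Sum>\<^sub>\<infinity>b. c (a, b) * wave (pairing (a, b) (x, y)))" by (simp add: trig_def)
    also have "\<dots> = (\<Sum>\<^sub>\<infinity>a. \<Sum>\<^sub>\<infinity>b. (c (a, b) * wave (of_int b * y)) * wave (of_int a * x))"
      by (simp add: pairing_def wave_add mult_ac)
    finally show ?thesis by (simp only: infsum_cmult_left' d_def)
  qed
  have "integral {0..1} (\<lambda>x. wave (- pairing m (x, y)) * trig c (x, y)) = wave (- (of_int (snd m) * y)) * d y (fst m)" for y
  proof -
    have "integral {0..1} (\<lambda>x. wave (- pairing m (x, y)) * trig c (x, y))
      = integral {0..1} (\<lambda>x. wave (- (of_int (snd m) * y)) * (wave (- (of_int (fst m) * x)) * (\<Sum>\<^sub>\<infinity>a. d y a * wave (of_int a * x))))"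
      by (simp add: t pairing_def wave_diff mult_ac)
    also have "\<dots> = wave (- (of_int (snd m) * y)) * d y (fst m)"
      by (simp only: integral_cmult fourier_coefficient_of_series[OF ds])
    finally show ?thesis .
  qed
  then show ?thesis
    using fourier_coefficient_of_series[OF sec, of "snd m" "fst m"] by (simp only: d_def prod.collapse)
qed

lemma continuous_on_trig:
  assumes c: "(\<lambda>k. norm (c k)) summable_on UNIV"
  shows "continuous_on S (trig c)"
  unfolding trig_def[abs_def]
  by (rule continuous_on_infsum[OF _ _ c])
    (auto intro!: continuous_intros simp: norm_mult pairing_def)

text \<open>
  The uniqueness theorem on the circle is applied in one variable after the other.
\<close>

lemma eq_0_if_orthogonal_to_characters:
  assumes F: "torus_continuous F"
    and z: "\<And>m. integral {0..1} (\<lambda>y. integral {0..1} (\<lambda>x. wave (- pairing m (x, y)) * F x y)) = 0"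
  shows "F x y = 0"
proof -
  have h: "integral {0..1} (\<lambda>x. wave (of_int a * x) * F x y) = 0" for a :: int and y
  proof (rule orthogonal_to_waves_eq_0[where f = "\<lambda>y. integral {0..1} (\<lambda>x. wave (of_int a * x) * F x y)"])
    have "continuous_on (UNIV \<times> cbox 0 1) (\<lambda>(y, x). wave (of_int a * x) * F x y)"
      unfolding split_def by (intro continuous_intros torus_continuousD(1)[OF F])
    from integral_continuous_on_param[OF this]
    show "continuous_on UNIV (\<lambda>y. integral {0..1} (\<lambda>x. wave (of_int a * x) * F x y))" by simp
    show "integral {0..1} (\<lambda>x. wave (of_int a * x) * F x (y + 1)) = integral {0..1} (\<lambda>x. wave (of_int a * x) * F x y)" for y
      by (simp only: torus_continuousD(3)[OF F])
    fix b :: int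
    have "wave (of_int b * y) * integral {0..1} (\<lambda>x. wave (of_int a * x) * F x y)
        = integral {0..1} (\<lambda>x. wave (- pairing (- a, - b) (x, y)) * F x y)" for y
      unfolding integral_cmult[symmetric]
      by (simp add: pairing_def wave_add mult_ac)
    then show "integral {0..1} (\<lambda>y. wave (of_int b * y) * integral {0..1} (\<lambda>x. wave (of_int a * x) * F x y)) = 0"
      by (simp only: z)
  qed
  show ?thesis
    by (rule orthogonal_to_waves_eq_0[where f = "\<lambda>x. F x y"])
      (use h in \<open>auto intro!: torus_continuousD[OF F] continuous_intros\<close>)
qed

text \<open>
  The boundary terms cancel by periodicity.
\<close>

lemma integral_by_parts_periodic:
  fixes g g' :: "real \<Rightarrow> complex" and k :: int
  assumes d: "\<And>x. (g has_vector_derivative g' x) (at x)" and p: "g 1 = g 0" and c: "continuous_on {0..1} g'"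
  shows "integral {0..1} (\<lambda>x. wave (- (of_int k * x)) * g' x)
    = (2 * pi * \<i> * of_int k) * integral {0..1} (\<lambda>x. wave (- (of_int k * x)) * g x)"
proof -
  let ?w = "\<lambda>x. wave (- (of_int k * x))"
  have cg: "continuous_on {0..1} g"
    by (intro continuous_at_imp_continuous_on ballI has_vector_derivative_continuous[OF d])
  have "((\<lambda>x. ?w x * g x) has_vector_derivative ?w x * g' x + (2 * pi * \<i> * of_int (- k)) * ?w x * g x) (at x)" for x
    using has_vector_derivative_mult[OF has_vector_derivative_wave[of "of_int (- k)" 0 x] d[of x]] by simp
  then have "((\<lambda>x. ?w x * g' x + (2 * pi * \<i> * of_int (- k)) * ?w x * g x) has_integral ?w 1 * g 1 - ?w 0 * g 0) {0..1}"
    by (intro fundamental_theorem_of_calculus) (auto intro: has_vector_derivative_at_within)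
  moreover have "?w 1 = 1" using wave_of_int[of "- k"] by simp
  ultimately have z: "((\<lambda>x. ?w x * g' x - (2 * pi * \<i> * of_int k) * (?w x * g x)) has_integral 0) {0..1}"
    by (simp add: p mult.assoc)
  have "((\<lambda>x. ?w x * g' x - (2 * pi * \<i> * of_int k) * (?w x * g x)) has_integral
      integral {0..1} (\<lambda>x. ?w x * g' x) - (2 * pi * \<i> * of_int k) * integral {0..1} (\<lambda>x. ?w x * g x)) {0..1}"
    by (intro has_integral_diff has_integral_mult_right integrable_integral integrable_continuous_real continuous_intros c cg)
  from has_integral_unique[OF z this] show ?thesis by simp
qed

definition pt :: "real \<Rightarrow> real \<Rightarrow> real^2" where
  "pt x y = x *\<^sub>R axis 1 1 + y *\<^sub>R axis 2 1"

lemma pt_nth [simp]: "pt x y $ 1 = x" "pt x y $ 2 = y"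
  by (simp_all add: pt_def axis_def)

lemma pt_surj: "pt (z $ 1) (z $ 2) = z"
  by (simp add: vec_eq_iff forall_2)

lemma partials_periodic:
  fixes a :: "real^2 \<Rightarrow> complex"
  assumes s: "smooth a" and p: "\<And>z. a (z + e) = a z" and vs: "set vs \<subseteq> Basis"
  shows "partials vs a (z + e) = partials vs a z"
  using vs
proof (induction vs arbitrary: z)
  case (Cons v vs)
  let ?g = "partials vs a"
  have dg: "?g differentiable (at q)" for q using s Cons.prems by (auto simp: smooth_def)
  have g: "(?g has_derivative frechet_derivative ?g (at (z + e))) (at (z + e))"
    using dg frechet_derivative_works by blast
  have "((\<lambda>q. q + e) has_derivative (\<lambda>h. h)) (at z)" by (auto intro!: derivative_eq_intros)
  from has_derivative_compose[OF this g]
  have "((\<lambda>q. ?g (q + e)) has_derivative frechet_derivative ?g (at (z + e))) (at z)" .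
  then have "(?g has_derivative frechet_derivative ?g (at (z + e))) (at z)"
    using Cons by simp
  from frechet_derivative_at[OF this] show ?case by simp
qed (simp add: p)

lemma to_torus_eqI: "(\<And>i. z $ i - w $ i \<in> \<int>) \<Longrightarrow> to_torus z = to_torus w"
  by (simp add: torus.abs_eq_iff lattice_equiv_def)

text \<open>
  Integration by parts in each variable separately gives rapid decay of the coefficients. The series is
  then a continuous function with the same coefficients as the symbol.
\<close>

theorem torus_fourier_series:
  assumes nu: "smooth_torus \<nu>"
  obtains c where "rapid c" "\<And>z. \<nu> (to_torus z) = trig c (z $ 1, z $ 2)"
proof -
  let ?a = "\<nu> \<circ> to_torus"
  have s: "smooth ?a" using nu by (simp add: smooth_torus_def)
  let ?e1 = "axis 1 1 :: real^2" and ?e2 = "axis 2 1 :: real^2"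
  have e: "?e1 \<in> Basis" "?e2 \<in> Basis" by (simp_all add: axis_in_Basis_iff)
  have per: "?a (z + ?e1) = ?a z" "?a (z + ?e2) = ?a z" for z
    by (auto intro!: arg_cong[of _ _ \<nu>] to_torus_eqI simp: axis_def)
  define f where "f vs x y = partials vs ?a (pt x y)" for vs x y
  have tc: "torus_continuous (f vs)" if vs: "set vs \<subseteq> Basis" for vs
    unfolding torus_continuous_def
  proof (intro conjI allI)
    have "continuous_on UNIV (partials vs ?a)"
      using s vs by (intro continuous_at_imp_continuous_on ballI differentiable_imp_continuous_within) (auto simp: smooth_def)
    then show "continuous_on UNIV (\<lambda>z. f vs (fst z) (snd z))"
      unfolding f_def by (rule continuous_on_compose2) (auto simp: pt_def intro!: continuous_intros)
    have pe: "pt (x + 1) y = pt x y + ?e1" "pt x (y + 1) = pt x y + ?e2" for x y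
      by (simp_all add: pt_def scaleR_add_left algebra_simps)
    show "f vs (x + 1) y = f vs x y" "f vs x (y + 1) = f vs x y" for x y
      unfolding f_def pe by (rule partials_periodic[OF s per(1) vs], rule partials_periodic[OF s per(2) vs])
  qed
  have dd: "((\<lambda>t. partials vs ?a (p + t *\<^sub>R v)) has_vector_derivative partials (v # vs) ?a (p + t *\<^sub>R v)) (at t)"
    if vs: "set vs \<subseteq> Basis" for vs p v t
  proof -
    have "(partials vs ?a has_derivative frechet_derivative (partials vs ?a) (at (p + t *\<^sub>R v))) (at (p + t *\<^sub>R v))"
      using s vs by (auto simp: smooth_def frechet_derivative_works[symmetric])
    moreover have "((\<lambda>t. p + t *\<^sub>R v) has_derivative (\<lambda>h. h *\<^sub>R v)) (at t)"
      by (auto intro!: derivative_eq_intros)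
    ultimately have "((\<lambda>t. partials vs ?a (p + t *\<^sub>R v)) has_derivative (\<lambda>h. frechet_derivative (partials vs ?a) (at (p + t *\<^sub>R v)) (h *\<^sub>R v))) (at t)"
      using has_derivative_compose by fastforce
    moreover have "linear (frechet_derivative (partials vs ?a) (at (p + t *\<^sub>R v)))"
      using s vs by (intro linear_frechet_derivative) (auto simp: smooth_def)
    ultimately show ?thesis by (simp add: has_vector_derivative_def linear_cmul)
  qed
  define c where "c vs m = mean_torus (\<lambda>x y. wave (- pairing m (x, y)) * f vs x y)" for vs m
  have ftc: "torus_continuous (\<lambda>x y. wave (- pairing m (x, y)) * f vs x y)" if vs: "set vs \<subseteq> Basis" for vs m
    unfolding torus_continuous_def
  proof (intro conjI allI)
    show "continuous_on UNIV (\<lambda>z. wave (- pairing m (fst z, snd z)) * f vs (fst z) (snd z))"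
      unfolding pairing_def by (intro continuous_intros torus_continuousD(1)[OF tc[OF vs]])
    fix x y
    have "wave (- pairing m (x + 1, y)) = wave (- pairing m (x, y))" "wave (- pairing m (x, y + 1)) = wave (- pairing m (x, y))"
      by (rule wave_eqI, simp add: pairing_def algebra_simps)+
    then show "wave (- pairing m (x + 1, y)) * f vs (x + 1) y = wave (- pairing m (x, y)) * f vs x y"
      "wave (- pairing m (x, y + 1)) * f vs x (y + 1) = wave (- pairing m (x, y)) * f vs x y"
      by (simp_all only: torus_continuousD(2,3)[OF tc[OF vs]])
  qed
  have c_swap: "c vs m = integral {0..1} (\<lambda>y. integral {0..1} (\<lambda>x. wave (- pairing m (x, y)) * f vs x y))"
    if "set vs \<subseteq> Basis" for vs m
    unfolding c_def by (rule mean_torus_swap[OF ftc[OF that]])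
  have c1: "c (?e1 # vs) m = (2 * pi * \<i> * of_int (fst m)) * c vs m" if vs: "set vs \<subseteq> Basis" for vs m
  proof -
    have vs': "set (?e1 # vs) \<subseteq> Basis" using vs e by simp
    have "integral {0..1} (\<lambda>x. wave (- pairing m (x, y)) * f (?e1 # vs) x y)
      = (2 * pi * \<i> * of_int (fst m)) * integral {0..1} (\<lambda>x. wave (- pairing m (x, y)) * f vs x y)" for y
    proof -
      have "integral {0..1} (\<lambda>x. wave (- (of_int (fst m) * x)) * f (?e1 # vs) x y)
        = (2 * pi * \<i> * of_int (fst m)) * integral {0..1} (\<lambda>x. wave (- (of_int (fst m) * x)) * f vs x y)"
      proof (rule integral_by_parts_periodic)
        show "((\<lambda>x. f vs x y) has_vector_derivative f (?e1 # vs) x y) (at x)" for x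
          using dd[OF vs, of "y *\<^sub>R ?e2" ?e1 x] by (simp add: f_def pt_def add.commute)
        show "f vs 1 y = f vs 0 y" using torus_continuousD(2)[OF tc[OF vs], of 0] by simp
        show "continuous_on {0..1} (\<lambda>x. f (?e1 # vs) x y)" by (intro torus_continuousD(1)[OF tc[OF vs']] continuous_intros)
      qed
      moreover have "integral {0..1} (\<lambda>x. wave (- pairing m (x, y)) * g x)
          = wave (- (of_int (snd m) * y)) * integral {0..1} (\<lambda>x. wave (- (of_int (fst m) * x)) * g x)" for g
        unfolding integral_cmult[symmetric]
        by (simp add: pairing_def wave_diff mult_ac)
      ultimately show ?thesis by simp
    qed
    then show ?thesis unfolding c_swap[OF vs] c_swap[OF vs'] by (simp only: integral_cmult)
  qed
  have c2: "c (?e2 # vs) m = (2 * pi * \<i> * of_int (snd m)) * c vs m" if vs: "set vs \<subseteq> Basis" for vs m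
  proof -
    have vs': "set (?e2 # vs) \<subseteq> Basis" using vs e by simp
    have "integral {0..1} (\<lambda>y. wave (- pairing m (x, y)) * f (?e2 # vs) x y)
      = (2 * pi * \<i> * of_int (snd m)) * integral {0..1} (\<lambda>y. wave (- pairing m (x, y)) * f vs x y)" for x
    proof -
      have "integral {0..1} (\<lambda>y. wave (- (of_int (snd m) * y)) * f (?e2 # vs) x y)
        = (2 * pi * \<i> * of_int (snd m)) * integral {0..1} (\<lambda>y. wave (- (of_int (snd m) * y)) * f vs x y)"
      proof (rule integral_by_parts_periodic)
        show "((\<lambda>y. f vs x y) has_vector_derivative f (?e2 # vs) x y) (at y)" for y
          using dd[OF vs, of "x *\<^sub>R ?e1" ?e2 y] by (simp add: f_def pt_def)
        show "f vs x 1 = f vs x 0" using torus_continuousD(3)[OF tc[OF vs], of x 0] by simp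
        show "continuous_on {0..1} (\<lambda>y. f (?e2 # vs) x y)" by (intro torus_continuousD(1)[OF tc[OF vs']] continuous_intros)
      qed
      moreover have "integral {0..1} (\<lambda>y. wave (- pairing m (x, y)) * g y)
          = wave (- (of_int (fst m) * x)) * integral {0..1} (\<lambda>y. wave (- (of_int (snd m) * y)) * g y)" for g
        unfolding integral_cmult[symmetric]
        by (simp add: pairing_def wave_diff mult_ac)
      ultimately show ?thesis by simp
    qed
    then show ?thesis unfolding c_def mean_torus_def by (simp only: integral_cmult)
  qed
  have bound: "\<exists>B. \<forall>m. norm (c vs m) \<le> B" if vs: "set vs \<subseteq> Basis" for vs
  proof -
    have cpt: "compact ((\<lambda>z. f vs (fst z) (snd z)) ` ({0..1} \<times> {0..1}))"
      by (intro compact_continuous_image torus_continuousD(1)[OF tc[OF vs]] continuous_intros compact_Times compact_Icc)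
    obtain B where B: "\<forall>w\<in>(\<lambda>z. f vs (fst z) (snd z)) ` ({0..1} \<times> {0..1}). norm w \<le> B"
      using compact_imp_bounded[OF cpt] unfolding bounded_iff by (elim exE)
    have B': "norm (f vs x y) \<le> B" if "x \<in> {0..1}" "y \<in> {0..1}" for x y
      using B that by force
    have "norm (c vs m) \<le> B" for m
    proof -
      have inner: "norm (integral {0..1} (\<lambda>y. wave (- pairing m (x, y)) * f vs x y)) \<le> B" if x: "x \<in> {0..1}" for x
      proof -
        have "norm (integral {0..1} (\<lambda>y. wave (- pairing m (x, y)) * f vs x y)) \<le> integral {0..1::real} (\<lambda>y. B)"
        proof (rule integral_norm_bound_integral)
          show "(\<lambda>y. wave (- pairing m (x, y)) * f vs x y) integrable_on {0..1}"
            by (intro integrable_continuous_real torus_continuousD(1)[OF ftc[OF vs]] continuous_intros)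
        qed (use B'[OF x] in \<open>auto simp: norm_mult\<close>)
        then show ?thesis by simp
      qed
      have "continuous_on (UNIV \<times> cbox 0 1) (\<lambda>(x, y). wave (- pairing m (x, y)) * f vs x y)"
        unfolding split_def by (intro torus_continuousD(1)[OF ftc[OF vs]] continuous_intros)
      from integral_continuous_on_param[OF this]
      have ci: "continuous_on UNIV (\<lambda>x. integral {0..1} (\<lambda>y. wave (- pairing m (x, y)) * f vs x y))" by simp
      have "norm (c vs m) \<le> integral {0..1::real} (\<lambda>x. B)"
        unfolding c_def mean_torus_def
        by (rule integral_norm_bound_integral)
          (use inner ci in \<open>auto intro!: integrable_continuous_real intro: continuous_on_subset\<close>)
      then show ?thesis by simp
    qed
    then show ?thesis by blast
  qed
  have pow1: "c (replicate p ?e1) m = (2 * pi * \<i> * of_int (fst m)) ^ p * c [] m" for p m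
  proof (induction p)
    case (Suc p)
    have "set (replicate p ?e1) \<subseteq> Basis" using e by (auto simp: set_replicate_conv_if)
    then show ?case using Suc c1 by simp
  qed simp
  have pow2: "c (replicate p ?e2) m = (2 * pi * \<i> * of_int (snd m)) ^ p * c [] m" for p m
  proof (induction p)
    case (Suc p)
    have "set (replicate p ?e2) \<subseteq> Basis" using e by (auto simp: set_replicate_conv_if)
    then show ?case using Suc c2 by simp
  qed simp
  have r: "rapid (c [])"
  proof (rule rapidI)
    fix p
    obtain B0 where B0: "\<And>m. norm (c [] m) \<le> B0" using bound[of "[]"] by auto
    have "set (replicate p ?e1) \<subseteq> Basis" "set (replicate p ?e2) \<subseteq> Basis" using e by (auto simp: set_replicate_conv_if)
    from bound[OF this(1)] bound[OF this(2)]
    obtain B1 B2 where B: "\<And>m. norm (c (replicate p ?e1) m) \<le> B1" "\<And>m. norm (c (replicate p ?e2) m) \<le> B2" by blast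
    have "weight m ^ p * norm (c [] m) \<le> 3 ^ p * (B0 + B1 + B2)" for m
    proof -
      define a b where "a = \<bar>real_of_int (fst m)\<bar>" and "b = \<bar>real_of_int (snd m)\<bar>"
      have ab: "a \<ge> 0" "b \<ge> 0" by (simp_all add: a_def b_def)
      have pa: "t ^ p \<le> (2 * pi * t) ^ p" if "t \<ge> 0" for t
        using that pi_ge_two by (intro power_mono) (auto simp: mult_le_cancel_right1)
      have "weight m ^ p \<le> (3 * max 1 (max a b)) ^ p"
        by (rule power_mono) (auto simp: weight_def a_def b_def)
      also have "\<dots> = 3 ^ p * max 1 (max a b) ^ p" by (simp add: power_mult_distrib)
      also have "max 1 (max a b) ^ p \<le> 1 + a ^ p + b ^ p"
        using ab by (simp add: max_def add_increasing add_increasing2)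
      also have "\<dots> \<le> 1 + (2 * pi * a) ^ p + (2 * pi * b) ^ p" by (intro add_mono pa ab) simp
      finally have "weight m ^ p \<le> 3 ^ p * (1 + (2 * pi * a) ^ p + (2 * pi * b) ^ p)" by simp
      then have "weight m ^ p * norm (c [] m) \<le> 3 ^ p * (1 + (2 * pi * a) ^ p + (2 * pi * b) ^ p) * norm (c [] m)"
        by (rule mult_right_mono) simp
      also have "\<dots> = 3 ^ p * (norm (c [] m) + norm (c (replicate p ?e1) m) + norm (c (replicate p ?e2) m))"
        by (simp add: pow1 pow2 norm_mult norm_power a_def b_def algebra_simps)
      also have "\<dots> \<le> 3 ^ p * (B0 + B1 + B2)" by (intro mult_left_mono add_mono B0 B) simp
      finally show ?thesis .
    qed
    then show "\<exists>C. \<forall>m. weight m ^ p * norm (c [] m) \<le> C" by blast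
  qed
  have rs: "(\<lambda>k. norm (c [] k)) summable_on UNIV" by (rule rapid_summable[OF r])
  have b0: "set [] \<subseteq> Basis" by simp
  have eq: "f [] x y = trig (c []) (x, y)" for x y
  proof -
    have tt: "torus_continuous (\<lambda>x y. trig (c []) (x, y))"
      unfolding torus_continuous_def
    proof (intro conjI allI)
      show "continuous_on UNIV (\<lambda>z. trig (c []) (fst z, snd z))" using continuous_on_trig[OF rs] by simp
      have "wave (pairing k (x + 1, y)) = wave (pairing k (x, y))" "wave (pairing k (x, y + 1)) = wave (pairing k (x, y))" for k x y
        by (rule wave_eqI, simp add: pairing_def algebra_simps)+
      then show "trig (c []) (x + 1, y) = trig (c []) (x, y)" "trig (c []) (x, y + 1) = trig (c []) (x, y)" for x y
        by (simp_all add: trig_def)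
    qed
    have F: "torus_continuous (\<lambda>x y. f [] x y - trig (c []) (x, y))"
      using tc[OF b0] tt unfolding torus_continuous_def by (auto intro!: continuous_on_diff)
    have "f [] x y - trig (c []) (x, y) = 0"
    proof (rule eq_0_if_orthogonal_to_characters[OF F])
      fix m
      have i1: "(\<lambda>x. wave (- pairing m (x, y)) * f [] x y) integrable_on {0..1}" for y
        by (intro integrable_continuous_real torus_continuousD(1)[OF ftc[OF b0]] continuous_intros)
      have i2: "(\<lambda>x. wave (- pairing m (x, y)) * trig (c []) (x, y)) integrable_on {0..1}" for y
        unfolding pairing_def by (intro integrable_continuous_real continuous_intros torus_continuousD(1)[OF tt])
      have p1: "continuous_on (UNIV \<times> cbox 0 1) (\<lambda>(y, x). wave (- pairing m (x, y)) * f [] x y)"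
        unfolding split_def by (intro torus_continuousD(1)[OF ftc[OF b0]] continuous_intros)
      have p2: "continuous_on (UNIV \<times> cbox 0 1) (\<lambda>(y, x). wave (- pairing m (x, y)) * trig (c []) (x, y))"
        unfolding split_def pairing_def by (intro continuous_intros torus_continuousD(1)[OF tt])
      have j1: "(\<lambda>y. integral {0..1} (\<lambda>x. wave (- pairing m (x, y)) * f [] x y)) integrable_on {0..1}"
        using integral_continuous_on_param[OF p1] by (auto intro!: integrable_continuous_real intro: continuous_on_subset)
      have j2: "(\<lambda>y. integral {0..1} (\<lambda>x. wave (- pairing m (x, y)) * trig (c []) (x, y))) integrable_on {0..1}"
        using integral_continuous_on_param[OF p2] by (auto intro!: integrable_continuous_real intro: continuous_on_subset)
      show "integral {0..1} (\<lambda>y. integral {0..1} (\<lambda>x. wave (- pairing m (x, y)) * (f [] x y - trig (c []) (x, y)))) = 0"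
        unfolding right_diff_distrib Henstock_Kurzweil_Integration.integral_diff[OF i1 i2]
          Henstock_Kurzweil_Integration.integral_diff[OF j1 j2] c_swap[OF b0, symmetric] mean_of_trig[OF rs] by simp
    qed
    then show ?thesis by simp
  qed
  show ?thesis
  proof (rule that[OF r])
    show "\<nu> (to_torus z) = trig (c []) (z $ 1, z $ 2)" for z
      using eq[of "z $ 1" "z $ 2"] by (simp add: f_def pt_surj)
  qed
qed

text \<open>
  The identity for test functions passes to distributions because the rapid decay of the coefficients beats
  the polynomial growth of the seminorms of translates.
\<close>

lemma torus_op_series:
  assumes u: "u \<in> tempered" and p: "\<phi> \<in> schwartz" and N: "N > 0"
    and c: "rapid c" and nu: "\<And>z. \<nu> (to_torus z) = trig c (z $ 1, z $ 2)"
  shows "((\<lambda>k. c k * translate N (of_int (fst k)) (of_int (snd k)) u \<phi>) has_sum torus_op N \<nu> u \<phi>) UNIV"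
proof -
  let ?f = "\<lambda>k x. c k * heisenberg N (of_int (fst k)) (of_int (snd k)) \<phi> x"
  have "weyl (planck N) (\<lambda>z. (\<nu> \<circ> to_torus) (vector [z $ 1, - (z $ 2)])) \<phi> x = (\<Sum>\<^sub>\<infinity>k. ?f k x)" for x
  proof (rule weyl_trigonometric_series[OF p N])
    have "(\<lambda>k. 2 * (weight k ^ 2 * norm (c k))) summable_on UNIV"
      using c by (intro summable_on_cmult_right) (simp add: rapid_def)
    then show "(\<lambda>k. norm (c k) * (2 + (of_int (fst k))\<^sup>2)) summable_on UNIV"
    proof (rule Infinite_Sum.summable_on_comparison_test)
      fix k :: "int \<times> int"
      have "2 + (of_int (fst k))\<^sup>2 \<le> 2 * (weight k)\<^sup>2"
        unfolding weight_def power2_eq_square by (simp add: algebra_simps)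
      from mult_left_mono[OF this norm_ge_zero[of "c k"]]
      show "norm (c k) * (2 + (of_int (fst k))\<^sup>2) \<le> 2 * (weight k ^ 2 * norm (c k))" by (simp add: mult_ac)
    qed auto
    show "(\<nu> \<circ> to_torus) z = (\<Sum>\<^sub>\<infinity>k. c k * wave (of_int (fst k) * z $ 1 + of_int (snd k) * z $ 2))" for z
      by (simp add: nu trig_def pairing_def)
  qed
  then have "weyl (planck N) (\<lambda>z. (\<nu> \<circ> to_torus) (vector [z $ 1, - (z $ 2)])) \<phi> = (\<lambda>x. \<Sum>\<^sub>\<infinity>k. ?f k x)"
    by (rule ext)
  then have w: "torus_op N \<nu> u \<phi> = u (\<lambda>x. \<Sum>\<^sub>\<infinity>k. ?f k x)"
    unfolding torus_op_def weyl_dist_def using p by (simp only: if_True)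
  have h: "heisenberg N a b \<phi> \<in> schwartz" for a b by (rule schwartz_heisenberg[OF p N])
  have f: "?f k \<in> schwartz" for k by (intro schwartz_scale h)
  have "\<exists>C\<ge>0. \<forall>a b x. \<bar>x\<bar> ^ j * norm (nth_deriv l (heisenberg N a b \<phi>) x) \<le> C * (1 + \<bar>a\<bar> + \<bar>b\<bar>) ^ (l + j)" for j l
    by (rule heisenberg_bound[OF p N, of j l]) auto
  then obtain D where D: "\<And>j l. D j l \<ge> 0"
    "\<And>j l a b x. \<bar>x\<bar> ^ j * norm (nth_deriv l (heisenberg N a b \<phi>) x) \<le> D j l * (1 + \<bar>a\<bar> + \<bar>b\<bar>) ^ (l + j)"
    by metis
  have B: "(\<lambda>k. D j l * (weight k ^ (l + j) * norm (c k))) summable_on UNIV" for j l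
    using c by (intro summable_on_cmult_right) (simp add: rapid_def)
  have le: "\<bar>x\<bar> ^ j * norm (nth_deriv l (?f k) x) \<le> D j l * (weight k ^ (l + j) * norm (c k))" for j l k x
  proof -
    have "\<bar>x\<bar> ^ j * norm (nth_deriv l (?f k) x) = norm (c k) * (\<bar>x\<bar> ^ j * norm (nth_deriv l (heisenberg N (of_int (fst k)) (of_int (snd k)) \<phi>) x))"
      by (simp add: nth_deriv_scale[OF h] norm_mult)
    also have "\<dots> \<le> norm (c k) * (D j l * weight k ^ (l + j))"
      unfolding weight_def by (intro mult_left_mono D(2)) simp
    finally show ?thesis by (simp add: mult_ac)
  qed
  have "((\<lambda>k. u (?f k)) has_sum u (\<lambda>x. \<Sum>\<^sub>\<infinity>k. ?f k x)) UNIV"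
    by (rule tempered_series[OF u f B le])
  moreover have "u (?f k) = c k * translate N (of_int (fst k)) (of_int (snd k)) u \<phi>" for k
    using tempered_scale[OF u h] p by (simp add: translate_def)
  ultimately show ?thesis by (simp only: w)
qed

section \<open>Tuples of frequencies and vanishing products\<close>

definition tuples :: "nat \<Rightarrow> (nat \<Rightarrow> int \<times> int) set" where
  "tuples K = PiE {..<K} (\<lambda>_. UNIV)"

text \<open>
  The \<open>K\<close> functions with Fourier coefficients \<open>C i\<close> have no common point of support.
\<close>

definition vanishing :: "nat \<Rightarrow> (nat \<Rightarrow> int \<times> int \<Rightarrow> complex) \<Rightarrow> bool" where
  "vanishing K C \<longleftrightarrow> (\<forall>i<K. rapid (C i)) \<and>
     (\<forall>z. \<exists>i<K. \<forall>\<^sub>F w in nhds z. trig (C i) w = 0)"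

lemma rapid_weight:
  assumes c: "rapid c" and h: "\<And>k. norm (h k) \<le> weight k"
  shows "rapid (\<lambda>k. h k * c k)"
  unfolding rapid_def
proof
  fix p
  have "(\<lambda>k. weight k ^ Suc p * norm (c k)) summable_on UNIV" using c unfolding rapid_def by (rule spec)
  then show "(\<lambda>k. weight k ^ p * norm (h k * c k)) summable_on UNIV"
  proof (rule Infinite_Sum.summable_on_comparison_test)
    fix k
    have w: "0 \<le> weight k" using weight_ge_1[of k] by simp
    have "weight k ^ p * (norm (h k) * norm (c k)) \<le> weight k ^ p * (weight k * norm (c k))"
      by (intro mult_left_mono mult_right_mono h) (use w in auto)
    then show "weight k ^ p * norm (h k * c k) \<le> weight k ^ Suc p * norm (c k)" by (simp add: norm_mult mult_ac)
    show "0 \<le> weight k ^ p * norm (h k * c k)" using w by simp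
  qed
qed

lemma eventually_zero_derivative:
  fixes f :: "real \<Rightarrow> complex"
  assumes "(f has_vector_derivative d) (at x)" "\<forall>\<^sub>F t in nhds x. f t = 0"
  shows "d = 0"
proof -
  obtain S where S: "open S" "x \<in> S" "\<And>t. t \<in> S \<Longrightarrow> f t = 0" using assms(2) by (auto simp: eventually_nhds)
  have "((\<lambda>t. 0) has_vector_derivative d) (at x)"
    by (rule has_vector_derivative_transform_within_open[OF assms(1) S(1,2)]) (rule S(3))
  then show ?thesis using vector_derivative_unique_at[of "\<lambda>t. 0" d x 0] by simp
qed

text \<open>
  Multiplying the coefficients by a coordinate of the frequency differentiates the function, which
  does not enlarge its support.
\<close>

lemma trig_line_derivative:
  assumes c: "rapid c" and h: "\<And>k. \<bar>h k\<bar> \<le> weight k"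
    and line: "\<And>k t. pairing k (z t) = h k * t + b k"
  shows "((\<lambda>t. trig c (z t)) has_vector_derivative (2 * pi * \<i>) * trig (\<lambda>k. of_real (h k) * c k) (z t)) (at t)"
proof -
  let ?f' = "\<lambda>k t. c k * ((2 * pi * \<i> * of_real (h k)) * wave (h k * t + b k))"
  have r: "rapid (\<lambda>k. of_real (h k) * c k)" by (rule rapid_weight[OF c]) (simp add: h)
  have "((\<lambda>t. \<Sum>\<^sub>\<infinity>k. c k * wave (h k * t + b k)) has_vector_derivative (\<Sum>\<^sub>\<infinity>k. ?f' k t)) (at t)"
  proof (rule has_vector_derivative_infsum)
    show "((\<lambda>t. c k * wave (h k * t + b k)) has_vector_derivative ?f' k t) (at t)" for k t
      by (intro has_vector_derivative_mult_right has_vector_derivative_wave)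
    show "continuous_on UNIV (?f' k)" for k by (intro continuous_intros)
    show "(\<lambda>k. norm (c k)) summable_on UNIV" by (rule rapid_summable[OF c])
    show "(\<lambda>k. (2 * pi) * norm (of_real (h k) * c k)) summable_on UNIV"
      by (intro summable_on_cmult_right rapid_summable[OF r])
  qed (auto simp: norm_mult)
  moreover have "(\<Sum>\<^sub>\<infinity>k. ?f' k t) = (2 * pi * \<i>) * trig (\<lambda>k. of_real (h k) * c k) (z t)"
    unfolding trig_def infsum_cmult_right'[symmetric] by (simp add: line mult_ac)
  ultimately show ?thesis by (simp add: trig_def line)
qed

lemma trig_multiplier_vanishes:
  assumes c: "rapid c" and h: "\<And>k. \<bar>pairing k e\<bar> \<le> weight k" and z: "\<forall>\<^sub>F w in nhds z. trig c w = 0"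
  shows "\<forall>\<^sub>F w in nhds z. trig (\<lambda>k. of_real (pairing k e) * c k) w = 0"
proof -
  have "\<forall>\<^sub>F w in nhds z. \<forall>\<^sub>F w' in nhds w. trig c w' = 0"
    using z by (simp only: eventually_eventually)
  then show ?thesis
  proof eventually_elim
    case (elim w)
    have "((\<lambda>t. w + t *\<^sub>R e) \<longlongrightarrow> w + 0 *\<^sub>R e) (nhds 0)"
      by (intro tendsto_add tendsto_scaleR tendsto_const filterlim_ident)
    then have "\<forall>\<^sub>F t in nhds 0. trig c (w + t *\<^sub>R e) = 0"
      using elim unfolding filterlim_iff scaleR_zero_left add_0_right by blast
    moreover have "((\<lambda>t. trig c (w + t *\<^sub>R e)) has_vector_derivative
        (2 * pi * \<i>) * trig (\<lambda>k. of_real (pairing k e) * c k) (w + 0 *\<^sub>R e)) (at 0)"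
      by (rule trig_line_derivative[OF c h, where b = "\<lambda>k. pairing k w"])
        (simp add: pairing_def algebra_simps)
    ultimately have "(2 * pi * \<i>) * trig (\<lambda>k. of_real (pairing k e) * c k) (w + 0 *\<^sub>R e) = 0"
      by (intro eventually_zero_derivative)
    then show ?case by simp
  qed
qed

lemma vanishing_update:
  assumes C: "vanishing K C" and i: "i < K" and r: "rapid c'"
    and v: "\<And>z. \<forall>\<^sub>F w in nhds z. trig (C i) w = 0 \<Longrightarrow> \<forall>\<^sub>F w in nhds z. trig c' w = 0"
  shows "vanishing K (C(i := c'))"
  using C i r v unfolding vanishing_def by (auto split: if_splits) metis

text \<open>
  Symbols \<open>q\<close> in the frequencies for which the associated multidifferential operator, applied to \<open>K\<close>
  functions without common point of support and restricted to the diagonal, gives zero. All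
  polynomials are of this kind; only the closure properties that generate them are proved.
\<close>

definition negligible_factor :: "nat \<Rightarrow> ((nat \<Rightarrow> int \<times> int) \<Rightarrow> complex) \<Rightarrow> bool" where
  "negligible_factor K q \<longleftrightarrow> (\<forall>C. vanishing K C \<longrightarrow>
     (\<lambda>k. norm (q k * (\<Prod>i<K. C i (k i)))) summable_on tuples K \<and>
     (\<forall>z. (\<Sum>\<^sub>\<infinity>k\<in>tuples K. (q k * (\<Prod>i<K. C i (k i))) * wave (pairing (\<Sum>i<K. k i) z)) = 0))"

lemma wave_sum: "finite A \<Longrightarrow> wave (\<Sum>i\<in>A. f i) = (\<Prod>i\<in>A. wave (f i))"
  by (induction A rule: finite_induct) (simp_all add: wave_add)

lemma pairing_add: "pairing (k + m) z = pairing k z + pairing m z"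
  by (simp add: pairing_def algebra_simps)

lemma pairing_sum: "finite A \<Longrightarrow> pairing (\<Sum>i\<in>A. k i) z = (\<Sum>i\<in>A. pairing (k i) z)"
  by (induction A rule: finite_induct) (simp_all add: pairing_add, simp add: pairing_def)

lemma tuples_prod_summable:
  assumes "\<And>i. i < K \<Longrightarrow> (\<lambda>k. norm (C i k)) summable_on UNIV"
  shows "(\<lambda>k. norm (\<Prod>i<K. C i (k i) :: complex)) summable_on tuples K"
proof -
  have "Infinite_Set_Sum.abs_summable_on (\<lambda>k. \<Prod>i\<in>{..<K}. C i (k i)) (PiE {..<K} (\<lambda>_. UNIV))"
    by (rule abs_summable_on_prod_PiE) (use assms in \<open>auto simp flip: abs_summable_equivalent\<close>)
  then show ?thesis by (simp add: tuples_def flip: abs_summable_equivalent)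
qed

text \<open>
  The sum factorizes, and at each point one of the factors vanishes.
\<close>

lemma negligible_1: "negligible_factor K (\<lambda>_. 1)"
  unfolding negligible_factor_def
proof (intro allI impI conjI)
  fix C z assume C: "vanishing K C"
  have s: "(\<lambda>k. norm (C i k)) summable_on UNIV" if "i < K" for i
    using C that by (auto simp: vanishing_def intro: rapid_summable)
  show "(\<lambda>k. norm (1 * (\<Prod>i<K. C i (k i)))) summable_on tuples K"
    using tuples_prod_summable[of K C, OF s] by simp
  have "(\<Sum>\<^sub>\<infinity>k\<in>tuples K. (1 * (\<Prod>i<K. C i (k i))) * wave (pairing (\<Sum>i<K. k i) z))
     = (\<Sum>\<^sub>\<infinity>k\<in>PiE {..<K} (\<lambda>_. UNIV). \<Prod>i<K. C i (k i) * wave (pairing (k i) z))"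
    by (simp add: tuples_def pairing_sum wave_sum prod.distrib)
  also have "\<dots> = (\<Prod>i<K. trig (C i) z)"
    unfolding trig_def by (rule infsum_prod_PiE_abs) (use s in \<open>auto simp: norm_mult\<close>)
  also have "\<dots> = 0"
  proof -
    obtain i where i: "i < K" "\<forall>\<^sub>F w in nhds z. trig (C i) w = 0" using C unfolding vanishing_def by blast
    then have "trig (C i) z = 0" by (auto dest: eventually_nhds_x_imp_x)
    then show ?thesis using i(1) by (auto intro: prod_zero)
  qed
  finally show "(\<Sum>\<^sub>\<infinity>k\<in>tuples K. (1 * (\<Prod>i<K. C i (k i))) * wave (pairing (\<Sum>i<K. k i) z)) = 0" .
qed

lemma prod_update:
  fixes i K :: nat
  assumes "i < K"
  shows "(\<Prod>j<K. (C(i := \<lambda>k. h k * C i k)) j (k j)) = h (k i) * (\<Prod>j<K. C j (k j) :: complex)"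
proof -
  have "(\<Prod>j<K. (C(i := \<lambda>k. h k * C i k)) j (k j))
      = (C(i := \<lambda>k. h k * C i k)) i (k i) * (\<Prod>j\<in>{..<K} - {i}. (C(i := \<lambda>k. h k * C i k)) j (k j))"
    by (rule prod.remove) (use assms in auto)
  also have "(\<Prod>j\<in>{..<K} - {i}. (C(i := \<lambda>k. h k * C i k)) j (k j)) = (\<Prod>j\<in>{..<K} - {i}. C j (k j))"
    by (intro prod.cong) auto
  also have "(C(i := \<lambda>k. h k * C i k)) i (k i) * \<dots> = h (k i) * (C i (k i) * (\<Prod>j\<in>{..<K} - {i}. C j (k j)))"
    by simp
  also have "C i (k i) * (\<Prod>j\<in>{..<K} - {i}. C j (k j)) = (\<Prod>j<K. C j (k j))"
    by (rule prod.remove[symmetric]) (use assms in auto)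
  finally show ?thesis .
qed

text \<open>
  A coordinate of the frequency of one factor can be absorbed into the coefficients of that factor, which
  leaves the family without common point of support.
\<close>

lemma negligible_coordinate:
  assumes q: "negligible_factor K q" and i: "i < K"
  shows "negligible_factor K (\<lambda>k. of_int (fst (k i)) * q k)" "negligible_factor K (\<lambda>k. of_int (snd (k i)) * q k)"
proof -
  have gen: "negligible_factor K (\<lambda>k. h (k i) * q k)"
    if "\<And>C. vanishing K C \<Longrightarrow> vanishing K (C(i := \<lambda>k. h k * C i k))" for h :: "int \<times> int \<Rightarrow> complex"
    unfolding negligible_factor_def
  proof (intro allI impI)
    fix C assume "vanishing K C"
    then have "vanishing K (C(i := \<lambda>k. h k * C i k))" by (rule that)
    note qC = q[unfolded negligible_factor_def, rule_format, OF this]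
    have e: "(h (k i) * q k) * (\<Prod>i<K. C i (k i)) = q k * (\<Prod>j<K. (C(i := \<lambda>k. h k * C i k)) j (k j))" for k
      unfolding prod_update[OF i] by (simp only: mult_ac)
    show "(\<lambda>k. norm ((h (k i) * q k) * (\<Prod>i<K. C i (k i)))) summable_on tuples K \<and>
      (\<forall>z. (\<Sum>\<^sub>\<infinity>k\<in>tuples K. ((h (k i) * q k) * (\<Prod>i<K. C i (k i))) * wave (pairing (\<Sum>i<K. k i) z)) = 0)"
      unfolding e by (rule conjI, rule qC[THEN conjunct1], rule qC[THEN conjunct2])
  qed
  have r: "rapid (C i)" if "vanishing K C" for C using that i by (auto simp: vanishing_def)
  have r1: "rapid (\<lambda>k. of_int (fst k) * c k)" "rapid (\<lambda>k. of_int (snd k) * c k)" if "rapid c" for c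
    by (rule rapid_weight[OF that], simp add: weight_def)+
  have v1: "\<forall>\<^sub>F w in nhds z. trig (\<lambda>k. of_int (fst k) * c k) w = 0" "\<forall>\<^sub>F w in nhds z. trig (\<lambda>k. of_int (snd k) * c k) w = 0"
    if "rapid c" "\<forall>\<^sub>F w in nhds z. trig c w = 0" for c z
    using trig_multiplier_vanishes[OF that(1) _ that(2), of "(1, 0)"] trig_multiplier_vanishes[OF that(1) _ that(2), of "(0, 1)"]
    by (simp_all add: pairing_def weight_def)
  show "negligible_factor K (\<lambda>k. of_int (fst (k i)) * q k)"
    by (rule gen, rule vanishing_update[OF _ i]) (auto intro: r r1 v1)
  show "negligible_factor K (\<lambda>k. of_int (snd (k i)) * q k)"
    by (rule gen, rule vanishing_update[OF _ i]) (auto intro: r r1 v1)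
qed

lemma negligible_combination:
  assumes p: "negligible_factor K p" and q: "negligible_factor K q"
  shows "negligible_factor K (\<lambda>k. a * p k + q k)"
  unfolding negligible_factor_def
proof (intro allI impI)
  fix C assume C: "vanishing K C"
  let ?P = "\<lambda>k. p k * (\<Prod>i<K. C i (k i))" and ?Q = "\<lambda>k. q k * (\<Prod>i<K. C i (k i))"
  have P: "(\<lambda>k. norm (?P k)) summable_on tuples K" "\<And>z. (\<Sum>\<^sub>\<infinity>k\<in>tuples K. ?P k * wave (pairing (\<Sum>i<K. k i) z)) = 0"
    using p C by (auto simp: negligible_factor_def)
  have Q: "(\<lambda>k. norm (?Q k)) summable_on tuples K" "\<And>z. (\<Sum>\<^sub>\<infinity>k\<in>tuples K. ?Q k * wave (pairing (\<Sum>i<K. k i) z)) = 0"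
    using q C by (auto simp: negligible_factor_def)
  have e: "(a * p k + q k) * (\<Prod>i<K. C i (k i)) = a * ?P k + ?Q k" for k by (simp add: algebra_simps)
  have sP: "(\<lambda>k. ?P k * wave (pairing (\<Sum>i<K. k i) z)) summable_on tuples K" for z
    by (rule dominated_summable(2)[OF P(1)]) (simp add: norm_mult)
  have sQ: "(\<lambda>k. ?Q k * wave (pairing (\<Sum>i<K. k i) z)) summable_on tuples K" for z
    by (rule dominated_summable(2)[OF Q(1)]) (simp add: norm_mult)
  show "(\<lambda>k. norm ((a * p k + q k) * (\<Prod>i<K. C i (k i)))) summable_on tuples K \<and>
     (\<forall>z. (\<Sum>\<^sub>\<infinity>k\<in>tuples K. ((a * p k + q k) * (\<Prod>i<K. C i (k i))) * wave (pairing (\<Sum>i<K. k i) z)) = 0)"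
  proof (intro conjI allI)
    show "(\<lambda>k. norm ((a * p k + q k) * (\<Prod>i<K. C i (k i)))) summable_on tuples K"
      unfolding e
      by (rule dominated_summable(1)[OF summable_on_add[OF summable_on_cmult_right[OF P(1), of "norm a"] Q(1)]])
        (rule norm_triangle_le, simp add: norm_mult)
    fix z
    have "(\<Sum>\<^sub>\<infinity>k\<in>tuples K. (a * ?P k + ?Q k) * wave (pairing (\<Sum>i<K. k i) z))
      = (\<Sum>\<^sub>\<infinity>k\<in>tuples K. a * (?P k * wave (pairing (\<Sum>i<K. k i) z)) + ?Q k * wave (pairing (\<Sum>i<K. k i) z))"
      by (simp add: algebra_simps)
    also have "\<dots> = a * (\<Sum>\<^sub>\<infinity>k\<in>tuples K. ?P k * wave (pairing (\<Sum>i<K. k i) z)) + (\<Sum>\<^sub>\<infinity>k\<in>tuples K. ?Q k * wave (pairing (\<Sum>i<K. k i) z))"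
      by (simp only: infsum_add[OF summable_on_cmult_right[OF sP] sQ] infsum_cmult_right')
    also have "\<dots> = 0" by (simp only: P(2) Q(2) mult_zero_right add_0)
    finally show "(\<Sum>\<^sub>\<infinity>k\<in>tuples K. ((a * p k + q k) * (\<Prod>i<K. C i (k i))) * wave (pairing (\<Sum>i<K. k i) z)) = 0"
      unfolding e .
  qed
qed

lemma negligible_0: "negligible_factor K (\<lambda>_. 0)"
  using negligible_combination[OF negligible_1 negligible_1, of K "- 1"] by simp

lemma negligible_sum:
  "finite A \<Longrightarrow> (\<And>i. i \<in> A \<Longrightarrow> negligible_factor K (f i)) \<Longrightarrow> negligible_factor K (\<lambda>k. \<Sum>i\<in>A. f i k)"
proof (induction A rule: finite_induct)
  case (insert a A)
  then show ?case using negligible_combination[of K "f a" "\<lambda>k. \<Sum>i\<in>A. f i k" 1] by simp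
qed (simp add: negligible_0)

text \<open>The phases by which products of phase space translations differ from translations.\<close>

definition cocycle :: "int \<times> int \<Rightarrow> int \<times> int \<Rightarrow> int" where
  "cocycle y z = fst z * snd y - fst y * snd z"

definition phase :: "nat \<Rightarrow> (nat \<Rightarrow> int \<times> int) \<Rightarrow> int" where
  "phase K k = (\<Sum>i<K. cocycle (\<Sum>j<i. k j) (k i))"

lemma negligible_phase:
  assumes q: "negligible_factor K q"
  shows "negligible_factor K (\<lambda>k. of_int (phase K k) * q k)"
proof -
  have pair: "negligible_factor K (\<lambda>k. of_int (fst (k i)) * (of_int (snd (k j)) * q k) + (- 1) * (of_int (fst (k j)) * (of_int (snd (k i)) * q k)))"
    if "i < K" "j < K" for i j
    using negligible_combination[OF negligible_coordinate(1)[OF negligible_coordinate(2)[OF q that(1)] that(2)]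
        negligible_coordinate(1)[OF negligible_coordinate(2)[OF q that(2)] that(1)], of "- 1"]
    by (simp only: add.commute)
  have "of_int (phase K k) * q k = (\<Sum>i<K. \<Sum>j<i. of_int (fst (k i)) * (of_int (snd (k j)) * q k) + (- 1) * (of_int (fst (k j)) * (of_int (snd (k i)) * q k)))" for k
  proof -
    have "of_int (cocycle (\<Sum>j<i. k j) (k i)) = (\<Sum>j<i. of_int (fst (k i)) * of_int (snd (k j)) - of_int (fst (k j)) * of_int (snd (k i)) :: complex)" for i
      by (simp add: cocycle_def fst_sum snd_sum sum_distrib_left sum_distrib_right sum_subtractf)
    then show ?thesis
      unfolding phase_def of_int_sum sum_distrib_right
      by (intro sum.cong refl) (simp add: sum_distrib_left algebra_simps)
  qed
  moreover have "negligible_factor K (\<lambda>k. \<Sum>i<K. \<Sum>j<i. of_int (fst (k i)) * (of_int (snd (k j)) * q k) + (- 1) * (of_int (fst (k j)) * (of_int (snd (k i)) * q k)))"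
    by (intro negligible_sum pair) auto
  ultimately show ?thesis by simp
qed

lemma negligible_phase_power: "negligible_factor K (\<lambda>k. of_int (phase K k) ^ j)"
  by (induction j) (use negligible_phase negligible_1 in auto)

lemma infsum_fibres:
  fixes \<alpha> :: "'k \<Rightarrow> complex" and m :: "'k \<Rightarrow> 'm" and g :: "'m \<Rightarrow> complex"
  assumes a: "(\<lambda>k. norm (\<alpha> k)) summable_on A" and g: "\<And>j. norm (g j) \<le> B"
  shows "(\<Sum>\<^sub>\<infinity>k\<in>A. \<alpha> k * g (m k)) = (\<Sum>\<^sub>\<infinity>j. (\<Sum>\<^sub>\<infinity>k\<in>{k \<in> A. m k = j}. \<alpha> k) * g j)"
    and "(\<lambda>j. norm (\<Sum>\<^sub>\<infinity>k\<in>{k \<in> A. m k = j}. \<alpha> k)) summable_on UNIV"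
proof -
  let ?S = "Sigma UNIV (\<lambda>j. {k \<in> A. m k = j})"
  have bij: "bij_betw (\<lambda>k. (m k, k)) A ?S"
    by (rule bij_betw_byWitness[where f' = snd]) auto
  have s: "(\<lambda>x. norm (\<alpha> (snd x))) summable_on ?S"
    using summable_on_reindex_bij_betw[OF bij, of "\<lambda>x. norm (\<alpha> (snd x))"] a by simp
  have "(\<lambda>x. norm (\<alpha> (snd x) * g (fst x))) summable_on ?S"
    by (rule dominated_summable(1)[OF summable_on_cmult_left[OF s, of B]])
      (simp add: norm_mult mult_left_mono g)
  then have s': "(\<lambda>x. \<alpha> (snd x) * g (fst x)) summable_on ?S" by (rule Infinite_Sum.abs_summable_summable)
  have "(\<Sum>\<^sub>\<infinity>k\<in>A. \<alpha> k * g (m k)) = (\<Sum>\<^sub>\<infinity>x\<in>?S. \<alpha> (snd x) * g (fst x))"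
    using infsum_reindex_bij_betw[OF bij, of "\<lambda>x. \<alpha> (snd x) * g (fst x)"] by simp
  also have "\<dots> = (\<Sum>\<^sub>\<infinity>j. \<Sum>\<^sub>\<infinity>k\<in>{k \<in> A. m k = j}. \<alpha> k * g j)"
    using infsum_Sigma_banach[OF s'] by simp
  finally show "(\<Sum>\<^sub>\<infinity>k\<in>A. \<alpha> k * g (m k)) = (\<Sum>\<^sub>\<infinity>j. (\<Sum>\<^sub>\<infinity>k\<in>{k \<in> A. m k = j}. \<alpha> k) * g j)"
    by (simp only: infsum_cmult_left')
  from s have fib: "\<And>j. (\<lambda>k. norm (\<alpha> k)) summable_on {k \<in> A. m k = j}"
    "(\<lambda>j. \<Sum>\<^sub>\<infinity>k\<in>{k \<in> A. m k = j}. norm (\<alpha> k)) summable_on UNIV"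
    unfolding Infinite_Sum.abs_summable_on_Sigma_iff
    by (auto intro: Infinite_Sum.abs_summable_summable)
  show "(\<lambda>j. norm (\<Sum>\<^sub>\<infinity>k\<in>{k \<in> A. m k = j}. \<alpha> k)) summable_on UNIV"
    by (rule dominated_summable(1)[OF fib(2)]) (rule norm_infsum_bound[OF fib(1)])
qed

text \<open>
  A trigonometric series that vanishes identically has vanishing coefficients, so the characters
  in the definition of a negligible factor may be replaced by any bounded function of the total
  frequency.
\<close>

lemma negligible_bounded:
  assumes q: "negligible_factor K q" and C: "vanishing K C" and g: "\<And>j. norm (g j) \<le> B"
  shows "(\<Sum>\<^sub>\<infinity>k\<in>tuples K. (q k * (\<Prod>i<K. C i (k i))) * g (\<Sum>i<K. k i)) = 0"
proof -
  let ?\<alpha> = "\<lambda>k. q k * (\<Prod>i<K. C i (k i))" and ?m = "\<lambda>k::nat \<Rightarrow> int \<times> int. \<Sum>i<K. k i"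
  have a: "(\<lambda>k. norm (?\<alpha> k)) summable_on tuples K"
    and z: "(\<Sum>\<^sub>\<infinity>k\<in>tuples K. ?\<alpha> k * wave (pairing (?m k) z)) = 0" for z
    using q[unfolded negligible_factor_def, rule_format, OF C] by (rule conjunct1, elim conjE allE)
  define \<beta> where "\<beta> j = (\<Sum>\<^sub>\<infinity>k\<in>{k \<in> tuples K. ?m k = j}. ?\<alpha> k)" for j
  have bs: "(\<lambda>j. norm (\<beta> j)) summable_on UNIV"
    unfolding \<beta>_def by (rule infsum_fibres(2)[OF a, where g = "\<lambda>_. 0" and B = 0]) simp
  have "trig \<beta> z = 0" for z
    using infsum_fibres(1)[OF a, where g = "\<lambda>j. wave (pairing j z)" and B = 1 and m = ?m] z[of z]
    by (simp add: trig_def \<beta>_def)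
  then have "\<beta> j = 0" for j using mean_of_trig[OF bs, of j] by simp
  moreover have "(\<Sum>\<^sub>\<infinity>k\<in>tuples K. ?\<alpha> k * g (?m k)) = (\<Sum>\<^sub>\<infinity>j. \<beta> j * g j)"
    unfolding \<beta>_def by (rule infsum_fibres(1)[OF a g])
  ultimately show ?thesis by simp
qed

lemma norm_exp_i_taylor: "norm (exp (\<i> * of_real x) - (\<Sum>j<n. (\<i> * of_real x) ^ j / fact j)) \<le> \<bar>x\<bar> ^ n"
proof (cases n)
  case (Suc m)
  have "norm (exp (\<i> * of_real x) - (\<Sum>j\<le>m. (\<i> * of_real x) ^ j / fact j)) \<le> \<bar>x\<bar> ^ Suc m / fact m"
    using Taylor_exp[of "\<i> * of_real x" m] by (simp add: norm_mult)
  also have "\<dots> \<le> \<bar>x\<bar> ^ Suc m"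
    using divide_left_mono[of 1 "fact m" "\<bar>x\<bar> ^ Suc m"] by simp
  finally show ?thesis by (simp add: Suc lessThan_Suc_atMost)
qed (simp flip: cis_conv_exp)

text \<open>
  Expanding the exponential to order \<open>n\<close> leaves only the remainder, which is of size \<open>t\<^sup>n\<close>.
\<close>

lemma phase_sum_small:
  assumes C: "vanishing K C"
  obtains D where "D \<ge> 0" "\<And>t g B. (\<And>j. norm (g j) \<le> B) \<Longrightarrow>
    norm (\<Sum>\<^sub>\<infinity>k\<in>tuples K. (wave (of_int (phase K k) * t) * (\<Prod>i<K. C i (k i))) * g (\<Sum>i<K. k i)) \<le> D * \<bar>t\<bar> ^ n * B"
proof -
  let ?P = "\<lambda>k. \<Prod>i<K. C i (k i)" and ?m = "\<lambda>k::nat \<Rightarrow> int \<times> int. \<Sum>i<K. k i"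
  define D where "D = (2 * pi) ^ n * (\<Sum>\<^sub>\<infinity>k\<in>tuples K. norm (of_int (phase K k) ^ n * ?P k))"
  have sn: "(\<lambda>k. norm (of_int (phase K k) ^ j * ?P k)) summable_on tuples K" for j
    using negligible_phase_power[of K j] C by (auto simp: negligible_factor_def)
  have est: "norm (\<Sum>\<^sub>\<infinity>k\<in>tuples K. (wave (of_int (phase K k) * t) * ?P k) * g (?m k)) \<le> D * \<bar>t\<bar> ^ n * B"
    if g: "\<And>j. norm (g j) \<le> B" for t g B
  proof -
    let ?x = "\<lambda>k. 2 * pi * (of_int (phase K k) * t)"
    let ?T = "\<lambda>k. \<Sum>j<n. (\<i> * of_real (?x k)) ^ j / fact j"
    have B: "B \<ge> 0" using g[of 0] norm_ge_zero order_trans by blast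
    define b where "b j = (\<i> * of_real (2 * pi * t)) ^ j / fact j" for j
    have T: "?T k = (\<Sum>j<n. b j * of_int (phase K k) ^ j)" for k
      unfolding b_def by (intro sum.cong refl) (simp add: power_mult_distrib mult_ac)
    have main: "(\<Sum>\<^sub>\<infinity>k\<in>tuples K. (?T k * ?P k) * g (?m k)) = 0"
    proof (rule negligible_bounded[OF _ C g])
      have "negligible_factor K (\<lambda>k. b j * of_int (phase K k) ^ j)" for j
        using negligible_combination[OF negligible_phase_power negligible_0, of K "b j" j] by simp
      then show "negligible_factor K ?T" unfolding T by (intro negligible_sum) auto
    qed
    let ?R = "\<lambda>k. ((wave (of_int (phase K k) * t) - ?T k) * ?P k) * g (?m k)"
    have R: "norm (?R k) \<le> ((2 * pi) ^ n * \<bar>t\<bar> ^ n * B) * norm (of_int (phase K k) ^ n * ?P k)" for k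
    proof -
      have "norm (wave (of_int (phase K k) * t) - ?T k) \<le> \<bar>?x k\<bar> ^ n"
        using norm_exp_i_taylor[of "?x k" n] by (simp only: wave_exp)
      then have "norm (wave (of_int (phase K k) * t) - ?T k) * norm (?P k) * norm (g (?m k)) \<le> \<bar>?x k\<bar> ^ n * norm (?P k) * B"
        by (intro mult_mono g) auto
      then show ?thesis by (simp add: norm_mult norm_power abs_mult power_mult_distrib mult_ac)
    qed
    have sT: "(\<lambda>k. (?T k * ?P k) * g (?m k)) summable_on tuples K"
    proof (rule dominated_summable(2))
      show "(\<lambda>k. B * (\<Sum>j<n. norm (b j) * norm (of_int (phase K k) ^ j * ?P k))) summable_on tuples K"
        by (intro summable_on_cmult_right infsum_finite_sum(1) sn)
      fix k
      have "norm (?T k * ?P k) \<le> (\<Sum>j<n. norm (b j) * norm (of_int (phase K k) ^ j * ?P k))"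
        unfolding T sum_distrib_right by (rule norm_sum[THEN order_trans]) (simp add: norm_mult mult_ac)
      then show "norm ((?T k * ?P k) * g (?m k)) \<le> B * (\<Sum>j<n. norm (b j) * norm (of_int (phase K k) ^ j * ?P k))"
        unfolding norm_mult[of "?T k * ?P k" "g (?m k)"] mult.commute[of B]
        by (rule mult_mono[OF _ g]) (auto intro: sum_nonneg)
    qed
    have sR: "?R summable_on tuples K"
      by (rule dominated_summable(2)[OF summable_on_cmult_right[OF sn[of n], of "(2 * pi) ^ n * \<bar>t\<bar> ^ n * B"]]) (rule R)
    have "(\<Sum>\<^sub>\<infinity>k\<in>tuples K. (wave (of_int (phase K k) * t) * ?P k) * g (?m k)) = (\<Sum>\<^sub>\<infinity>k\<in>tuples K. ?R k + (?T k * ?P k) * g (?m k))"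
      by (simp add: algebra_simps)
    also have "\<dots> = (\<Sum>\<^sub>\<infinity>k\<in>tuples K. ?R k)"
      unfolding infsum_add[OF sR sT] main by simp
    also have "norm \<dots> \<le> (\<Sum>\<^sub>\<infinity>k\<in>tuples K. ((2 * pi) ^ n * \<bar>t\<bar> ^ n * B) * norm (of_int (phase K k) ^ n * ?P k))"
      by (rule dominated_summable(3)[OF summable_on_cmult_right[OF sn] R])
    also have "\<dots> = D * \<bar>t\<bar> ^ n * B" unfolding D_def infsum_cmult_right' by (simp only: mult_ac)
    finally show ?thesis .
  qed
  have "D \<ge> 0" by (auto simp: D_def intro!: mult_nonneg_nonneg infsum_nonneg)
  then show ?thesis using that est by blast
qed

section \<open>Hyperbolic dynamics near the fixed point\<close>

definition cross :: "real^2 \<Rightarrow> real^2 \<Rightarrow> real" where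
  "cross p q = p $ 1 * q $ 2 - p $ 2 * q $ 1"

lemma cross_linear:
  "cross (p + q) v = cross p v + cross q v" "cross (p - q) v = cross p v - cross q v"
  "cross v (t *\<^sub>R q) = t * cross v q" "cross (t *\<^sub>R q) v = t * cross q v"
  by (simp_all add: cross_def algebra_simps)

lemma cross_matrix: "cross (A *v p) (A *v q) = det A * cross p q"
  by (simp add: cross_def matrix_vector_mult_def sum_2 det_2 algebra_simps)

lemma det_real_matrix: "det (real_matrix M :: real^2^2) = of_int (det M)" for M :: "int^2^2"
  by (simp add: det_2 real_matrix_def)

lemma matrix_vector_2:
  fixes A :: "real^2^2"
  shows "(A *v p) $ 1 = A $ 1 $ 1 * p $ 1 + A $ 1 $ 2 * p $ 2" "(A *v p) $ 2 = A $ 2 $ 1 * p $ 1 + A $ 2 $ 2 * p $ 2"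
  by (simp_all add: matrix_vector_mult_def sum_2)

lemma eventually_nhds_torus:
  assumes "\<forall>\<^sub>F p in nhds (to_torus z). P p"
  shows "\<forall>\<^sub>F w in nhds z. P (to_torus w)"
proof -
  obtain S where "open S" "to_torus z \<in> S" "\<And>p. p \<in> S \<Longrightarrow> P p"
    using assms by (auto simp: eventually_nhds)
  then show ?thesis
    unfolding eventually_nhds by (intro exI[of _ "to_torus -` S"]) (auto simp: open_torus_def)
qed

text \<open>
  In the coordinates along the two eigenvectors, an orbit that stays for a long time in a small
  neighbourhood of the fixed point is close to it at half time. On the torus the same holds because
  a small neighbourhood and its image overlap in one lattice translate only.
\<close>

theorem orbit_leaves_support:
  fixes M :: "int^2^2" and l :: real
  assumes M: "det M = 1" and l: "l > 1"
    and ev: "matrix_eigenvalue (real_matrix M) l" "matrix_eigenvalue (real_matrix M) (inverse l)"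
  obtains U where "open U" "to_torus 0 \<in> U"
    "\<And>\<nu> :: torus \<Rightarrow> complex. closure {p. \<nu> p \<noteq> 0} \<subseteq> U \<Longrightarrow> (\<forall>\<^sub>F p in nhds (to_torus 0). \<nu> p = 0) \<Longrightarrow>
      \<exists>K>0. \<forall>p. \<exists>i<K. \<forall>\<^sub>F q in nhds (((\<lambda>p. real_matrix M *v p) ^^ i) p). \<nu> (to_torus q) = 0"
proof -
  let ?A = "real_matrix M"
  have dA: "det ?A = 1" by (simp add: det_real_matrix M)
  obtain vp vm where v: "vp \<noteq> 0" "?A *v vp = l *\<^sub>R vp" "vm \<noteq> 0" "?A *v vm = inverse l *\<^sub>R vm"
    using ev by (auto simp: matrix_eigenvalue_def)
  define \<alpha> where "\<alpha> p = cross p vm" for p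
  define \<beta> where "\<beta> p = cross p vp" for p
  have l0: "l \<noteq> 0" "l > 0" using l by auto
  have \<alpha>A: "\<alpha> (?A *v p) = l * \<alpha> p" for p
  proof -
    have "cross p vm = cross (?A *v p) (?A *v vm)" by (simp add: cross_matrix dA)
    then show ?thesis using l0 by (simp add: \<alpha>_def v cross_linear field_simps)
  qed
  have \<beta>A: "\<beta> (?A *v p) = inverse l * \<beta> p" for p
  proof -
    have "cross p vp = cross (?A *v p) (?A *v vp)" by (simp add: cross_matrix dA)
    then show ?thesis using l0 by (simp add: \<beta>_def v cross_linear field_simps)
  qed
  have \<alpha>n: "\<alpha> (((\<lambda>p. ?A *v p) ^^ i) p) = l ^ i * \<alpha> p" and \<beta>n: "\<beta> (((\<lambda>p. ?A *v p) ^^ i) p) = inverse l ^ i * \<beta> p" for i p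
    by (induction i) (simp_all add: \<alpha>A \<beta>A)
  define D where "D = cross vp vm"
  have D: "D \<noteq> 0"
  proof
    assume "D = 0"
    then have par: "vp $ 1 * vm $ 2 = vp $ 2 * vm $ 1" by (simp add: D_def cross_def)
    have "vp $ 1 \<noteq> 0 \<or> vp $ 2 \<noteq> 0" using v(1) by (auto simp: vec_eq_iff forall_2)
    then obtain t where t: "vm = t *\<^sub>R vp"
    proof
      assume "vp $ 1 \<noteq> 0"
      then have "vm = (vm $ 1 / vp $ 1) *\<^sub>R vp" using par by (simp add: vec_eq_iff forall_2 field_simps)
      then show ?thesis by (rule that)
    next
      assume "vp $ 2 \<noteq> 0"
      then have "vm = (vm $ 2 / vp $ 2) *\<^sub>R vp" using par by (simp add: vec_eq_iff forall_2 field_simps)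
      then show ?thesis by (rule that)
    qed
    have "inverse l *\<^sub>R vm = t *\<^sub>R (?A *v vp)" using v(4) by (simp add: t matrix_vector_mult_scaleR)
    also have "\<dots> = l *\<^sub>R vm" by (simp add: v t mult.commute)
    finally have "inverse l = l" using v(3) by simp
    moreover have "inverse l < 1" using l by (simp add: inverse_less_1_iff)
    ultimately show False using l by simp
  qed
  have box: "\<exists>\<delta>>0. \<forall>p. \<bar>\<alpha> p\<bar> < \<delta> \<longrightarrow> \<bar>\<beta> p\<bar> < \<delta> \<longrightarrow> \<bar>p $ 1\<bar> < r \<and> \<bar>p $ 2\<bar> < r" if r: "r > 0" for r
  proof -
    define S where "S = \<bar>vp $ 1\<bar> + \<bar>vp $ 2\<bar> + \<bar>vm $ 1\<bar> + \<bar>vm $ 2\<bar> + 1"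
    have S: "S > 0" by (simp add: S_def add_nonneg_pos)
    define \<delta> where "\<delta> = r * \<bar>D\<bar> / S"
    have \<delta>: "\<delta> > 0" using r D S by (simp add: \<delta>_def)
    have "\<bar>p $ i\<bar> < r" if p: "\<bar>\<alpha> p\<bar> < \<delta>" "\<bar>\<beta> p\<bar> < \<delta>" and i: "i = 1 \<or> i = 2" for p and i :: 2
    proof -
      have "D * p $ i = \<alpha> p * vp $ i - \<beta> p * vm $ i"
        using i by (auto simp: D_def \<alpha>_def \<beta>_def cross_def algebra_simps)
      then have "\<bar>D\<bar> * \<bar>p $ i\<bar> = \<bar>\<alpha> p * vp $ i - \<beta> p * vm $ i\<bar>" by (metis abs_mult)
      also have "\<dots> \<le> \<bar>\<alpha> p\<bar> * \<bar>vp $ i\<bar> + \<bar>\<beta> p\<bar> * \<bar>vm $ i\<bar>"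
        using abs_triangle_ineq4[of "\<alpha> p * vp $ i" "\<beta> p * vm $ i"] by (simp add: abs_mult)
      also have "\<dots> \<le> \<delta> * \<bar>vp $ i\<bar> + \<delta> * \<bar>vm $ i\<bar>"
        using p by (intro add_mono mult_right_mono) auto
      also have "\<dots> < \<delta> * S"
      proof -
        have "\<bar>vp $ i\<bar> + \<bar>vm $ i\<bar> < S" using i by (auto simp: S_def)
        then show ?thesis using \<delta> by (simp flip: distrib_left)
      qed
      also have "\<dots> = \<bar>D\<bar> * r" using S by (simp add: \<delta>_def)
      finally show ?thesis using D by simp
    qed
    then show ?thesis using \<delta> by blast
  qed
  obtain \<delta>0 where \<delta>0: "\<delta>0 > 0" "\<And>p. \<bar>\<alpha> p\<bar> < \<delta>0 \<Longrightarrow> \<bar>\<beta> p\<bar> < \<delta>0 \<Longrightarrow> \<bar>p $ 1\<bar> < 1 \<and> \<bar>p $ 2\<bar> < 1"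
    using box[of 1] by auto
  define \<epsilon> where "\<epsilon> = \<delta>0 / (l + 2)"
  have \<epsilon>: "\<epsilon> > 0" "(l + 1) * \<epsilon> < \<delta>0" using \<delta>0(1) l0 by (simp_all add: \<epsilon>_def field_simps)
  \<comment> \<open>With this choice, a lattice vector that moves a point of the image of \<open>B\<close> into \<open>B\<close> is zero.\<close>
  define B where "B = {p. \<bar>\<alpha> p\<bar> < \<epsilon> \<and> \<bar>\<beta> p\<bar> < \<epsilon>}"
  define U where "U = to_torus ` B"
  have cont: "continuous_on UNIV \<alpha>" "continuous_on UNIV \<beta>"
    unfolding \<alpha>_def \<beta>_def cross_def by (intro continuous_intros)+
  have oB: "open B"
    unfolding B_def by (intro open_Collect_conj open_Collect_less continuous_intros cont)
  have te: "to_torus p = to_torus q \<longleftrightarrow> (\<forall>i. p $ i - q $ i \<in> \<int>)" for p q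
    by (simp add: torus.abs_eq_iff lattice_equiv_def)
  have "open (to_torus -` U)"
  proof -
    have "to_torus -` U = (\<Union>z\<in>{z. \<forall>i. z $ i \<in> \<int>}. (\<lambda>q. z + q) ` B)"
    proof (intro equalityI subsetI)
      fix p assume "p \<in> to_torus -` U"
      then obtain q where q: "q \<in> B" "\<forall>i. p $ i - q $ i \<in> \<int>" by (auto simp: U_def te)
      then have "p - q \<in> {z. \<forall>i. z $ i \<in> \<int>}" "p = (p - q) + q" by auto
      then show "p \<in> (\<Union>z\<in>{z. \<forall>i. z $ i \<in> \<int>}. (\<lambda>q. z + q) ` B)" using q(1) by blast
    next
      fix p assume "p \<in> (\<Union>z\<in>{z. \<forall>i. z $ i \<in> \<int>}. (\<lambda>q. z + q) ` B)"
      then obtain z q where z: "\<forall>i. z $ i \<in> \<int>" "q \<in> B" "p = z + q" by blast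
      then have "to_torus p = to_torus q" by (simp add: te)
      then show "p \<in> to_torus -` U" using z(2) by (auto simp: U_def)
    qed
    then show ?thesis using oB by (auto intro!: open_translation)
  qed
  then have oU: "open U" by (simp add: open_torus_def)
  have U0: "to_torus 0 \<in> U" using \<epsilon> by (auto simp: U_def B_def \<alpha>_def \<beta>_def cross_def)
  have lattice_0: "w = 0" if "\<forall>i. w $ i \<in> \<int>" "\<bar>\<alpha> w\<bar> < \<delta>0" "\<bar>\<beta> w\<bar> < \<delta>0" for w :: "real^2"
    using \<delta>0(2)[OF that(2,3)] that(1) by (auto simp: vec_eq_iff forall_2 elim!: Ints_cases)
  have leave: "\<exists>K>0. \<forall>p. \<exists>i<K. \<forall>\<^sub>F q in nhds (((\<lambda>p. ?A *v p) ^^ i) p). \<nu> (to_torus q) = 0"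
    if supp: "closure {p. \<nu> p \<noteq> 0} \<subseteq> U" and zero: "\<forall>\<^sub>F p in nhds (to_torus 0). \<nu> p = 0" for \<nu> :: "torus \<Rightarrow> complex"
  proof -
    obtain V where V: "open V" "to_torus 0 \<in> V" "\<And>p. p \<in> V \<Longrightarrow> \<nu> p = 0"
      using zero by (auto simp: eventually_nhds)
    have "open (to_torus -` V)" using V(1) by (simp add: open_torus_def)
    then obtain r where r: "r > 0" "ball 0 r \<subseteq> to_torus -` V" using V(2) open_contains_ball by blast
    obtain \<delta>1 where \<delta>1: "\<delta>1 > 0" "\<And>p. \<bar>\<alpha> p\<bar> < \<delta>1 \<Longrightarrow> \<bar>\<beta> p\<bar> < \<delta>1 \<Longrightarrow> \<bar>p $ 1\<bar> < r / 2 \<and> \<bar>p $ 2\<bar> < r / 2"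
      using box[of "r / 2"] r(1) by auto
    have inV: "to_torus p \<in> V" if "\<bar>\<alpha> p\<bar> < \<delta>1" "\<bar>\<beta> p\<bar> < \<delta>1" for p
    proof -
      have "norm p \<le> \<bar>p $ 1\<bar> + \<bar>p $ 2\<bar>" using norm_le_l1_cart[of p] by (simp add: sum_2)
      also have "\<dots> < r" using \<delta>1(2)[OF that] by simp
      finally show ?thesis using r(2) by auto
    qed
    have "inverse l < 1" using l by (simp add: inverse_less_1_iff)
    then obtain m where m: "inverse l ^ m < \<delta>1 / \<epsilon>"
      using real_arch_pow_inv[of "\<delta>1 / \<epsilon>" "inverse l"] \<delta>1(1) \<epsilon>(1) l0 by auto
    then have m': "inverse l ^ m * \<epsilon> < \<delta>1" using \<epsilon>(1) by (simp add: field_simps)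
    \<comment> \<open>The half time is \<open>m\<close>: there, the expanding coordinate is controlled by its value at time \<open>2 m\<close>
      and the contracting one by its value at time \<open>0\<close>.\<close>
    let ?K = "2 * m + 1"
    have "\<exists>i<?K. \<forall>\<^sub>F q in nhds (((\<lambda>p. ?A *v p) ^^ i) p). \<nu> (to_torus q) = 0" for p
    proof (rule ccontr)
      assume "\<not> ?thesis"
      then have no: "\<not> (\<forall>\<^sub>F q in nhds (((\<lambda>p. ?A *v p) ^^ i) p). \<nu> (to_torus q) = 0)" if "i < ?K" for i using that by blast
      have "\<exists>q\<in>B. to_torus (((\<lambda>p. ?A *v p) ^^ i) p) = to_torus q" if i: "i < ?K" for i
      proof -
        let ?t = "to_torus (((\<lambda>p. ?A *v p) ^^ i) p)"
        have "?t \<in> closure {p. \<nu> p \<noteq> 0}"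
        proof (rule ccontr)
          assume "?t \<notin> closure {p. \<nu> p \<noteq> 0}"
          then have "\<forall>\<^sub>F p in nhds ?t. \<nu> p = 0"
            unfolding eventually_nhds using closure_subset[of "{p. \<nu> p \<noteq> 0}"]
            by (intro exI[of _ "- closure {p. \<nu> p \<noteq> 0}"]) auto
          from eventually_nhds_torus[OF this] no[OF i] show False by simp
        qed
        then show ?thesis using supp by (auto simp: U_def)
      qed
      then obtain q where q: "\<And>i. i < ?K \<Longrightarrow> q i \<in> B" "\<And>i. i < ?K \<Longrightarrow> to_torus (((\<lambda>p. ?A *v p) ^^ i) p) = to_torus (q i)" by metis
      have step: "q (Suc i) = ?A *v q i" if i: "Suc i < ?K" for i
      proof -
        let ?P = "((\<lambda>p. ?A *v p) ^^ i) p"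
        have d1: "\<forall>j. ?P $ j - q i $ j \<in> \<int>" using q(2)[of i] i by (simp add: te)
        have d2: "\<forall>j. (?A *v ?P) $ j - q (Suc i) $ j \<in> \<int>" using q(2)[OF i] by (simp add: te)
        have d3: "\<forall>j. (?A *v (?P - q i)) $ j \<in> \<int>"
        proof -
          have "(?A *v (?P - q i)) $ j = (\<Sum>k\<in>UNIV. of_int (M $ j $ k) * (?P $ k - q i $ k))" for j
            by (simp add: matrix_vector_mult_def real_matrix_def)
          then show ?thesis using d1 by (auto intro!: Ints_sum Ints_mult)
        qed
        let ?w = "?A *v q i - q (Suc i)"
        have "?w = 0"
        proof (rule lattice_0)
          show "\<forall>j. ?w $ j \<in> \<int>"
          proof
            fix j
            have "?w $ j = ((?A *v ?P) $ j - q (Suc i) $ j) - (?A *v (?P - q i)) $ j"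
              by (simp add: matrix_vector_mult_diff_distrib)
            then show "?w $ j \<in> \<int>" using d2 d3 by (metis Ints_diff)
          qed
          have b: "\<bar>\<alpha> (q i)\<bar> < \<epsilon>" "\<bar>\<beta> (q i)\<bar> < \<epsilon>" "\<bar>\<alpha> (q (Suc i))\<bar> < \<epsilon>" "\<bar>\<beta> (q (Suc i))\<bar> < \<epsilon>"
            using q(1)[of i] q(1)[OF i] i by (auto simp: B_def)
          have "\<alpha> ?w = l * \<alpha> (q i) - \<alpha> (q (Suc i))" using \<alpha>A[of "q i"] by (simp add: \<alpha>_def cross_linear)
          then have "\<bar>\<alpha> ?w\<bar> \<le> l * \<bar>\<alpha> (q i)\<bar> + \<bar>\<alpha> (q (Suc i))\<bar>"
            using abs_triangle_ineq4[of "l * \<alpha> (q i)" "\<alpha> (q (Suc i))"] l0 by (simp add: abs_mult)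
          also have "\<dots> \<le> l * \<epsilon> + \<epsilon>" using b l0 by (intro add_mono mult_left_mono) auto
          finally show "\<bar>\<alpha> ?w\<bar> < \<delta>0" using \<epsilon>(2) by (simp add: algebra_simps)
          have "\<beta> ?w = inverse l * \<beta> (q i) - \<beta> (q (Suc i))" using \<beta>A[of "q i"] by (simp add: \<beta>_def cross_linear)
          then have "\<bar>\<beta> ?w\<bar> \<le> inverse l * \<bar>\<beta> (q i)\<bar> + \<bar>\<beta> (q (Suc i))\<bar>"
            using abs_triangle_ineq4[of "inverse l * \<beta> (q i)" "\<beta> (q (Suc i))"] l0 by (simp add: abs_mult)
          also have "\<dots> \<le> l * \<epsilon> + \<epsilon>"
          proof (intro add_mono mult_mono)
            show "inverse l \<le> l" using \<open>inverse l < 1\<close> l by simp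
          qed (use b l0 in auto)
          finally show "\<bar>\<beta> ?w\<bar> < \<delta>0" using \<epsilon>(2) by (simp add: algebra_simps)
        qed
        then show ?thesis by simp
      qed
      have orbit: "i < ?K \<Longrightarrow> q i = ((\<lambda>p. ?A *v p) ^^ i) (q 0)" for i
        by (induction i) (simp_all add: step)
      have bq: "\<bar>\<beta> (q m)\<bar> < \<delta>1"
      proof -
        have "\<bar>\<beta> (q m)\<bar> = inverse l ^ m * \<bar>\<beta> (q 0)\<bar>"
          using l0 by (simp add: orbit[of m] \<beta>n abs_mult power_abs)
        also have "\<dots> \<le> inverse l ^ m * \<epsilon>"
          using q(1)[of 0] l0 by (intro mult_left_mono) (auto simp: B_def)
        finally show ?thesis using m' by simp
      qed
      have aq: "\<bar>\<alpha> (q m)\<bar> < \<delta>1"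
      proof -
        have "q (2 * m) = ((\<lambda>p. ?A *v p) ^^ m) (q m)"
        proof -
          have "q (m + m) = ((\<lambda>p. ?A *v p) ^^ (m + m)) (q 0)" by (rule orbit) simp
          then show ?thesis by (simp add: orbit[of m] mult_2 funpow_add)
        qed
        then have "\<bar>\<alpha> (q (2 * m))\<bar> = l ^ m * \<bar>\<alpha> (q m)\<bar>" using l0 by (simp add: \<alpha>n abs_mult power_abs)
        then have "\<bar>\<alpha> (q m)\<bar> = inverse l ^ m * \<bar>\<alpha> (q (2 * m))\<bar>" using l0 by (simp add: power_inverse)
        also have "\<dots> \<le> inverse l ^ m * \<epsilon>"
          using q(1)[of "2 * m"] l0 by (intro mult_left_mono) (auto simp: B_def)
        finally show ?thesis using m' by simp
      qed
      have "to_torus (((\<lambda>p. ?A *v p) ^^ m) p) \<in> V" using inV[OF aq bq] q(2)[of m] by simp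
      then have "\<forall>\<^sub>F p in nhds (to_torus (((\<lambda>p. ?A *v p) ^^ m) p)). \<nu> p = 0"
        unfolding eventually_nhds using V by blast
      from eventually_nhds_torus[OF this] no[of m] show False by simp
    qed
    then show ?thesis by (intro exI[of _ ?K]) auto
  qed
  show ?thesis by (rule that[OF oU U0 leave])
qed

section \<open>The action on frequencies\<close>

text \<open>
  The transpose of the matrix: composing the character of frequency \<open>k\<close> with the matrix gives the character
  of frequency \<open>dual_map M k\<close>.
\<close>

definition dual_map :: "int^2^2 \<Rightarrow> int \<times> int \<Rightarrow> int \<times> int" where
  "dual_map M k = (fst k * M $ 1 $ 1 + snd k * M $ 2 $ 1, fst k * M $ 1 $ 2 + snd k * M $ 2 $ 2)"

definition dual_inv :: "int^2^2 \<Rightarrow> int \<times> int \<Rightarrow> int \<times> int" where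
  "dual_inv M k = (fst k * M $ 2 $ 2 - snd k * M $ 2 $ 1, snd k * M $ 1 $ 1 - fst k * M $ 1 $ 2)"

lemma dual_inverse:
  assumes "det M = 1"
  shows "dual_map M (dual_inv M k) = k" "dual_inv M (dual_map M k) = k"
proof -
  have d: "M $ 1 $ 1 * M $ 2 $ 2 - M $ 1 $ 2 * M $ 2 $ 1 = 1" using assms by (simp add: det_2)
  obtain x y where k: "k = (x, y)" by (cases k)
  have 1: "x * (M $ 1 $ 1 * M $ 2 $ 2 - M $ 1 $ 2 * M $ 2 $ 1) = x" "y * (M $ 1 $ 1 * M $ 2 $ 2 - M $ 1 $ 2 * M $ 2 $ 1) = y"
    by (simp_all add: d)
  show "dual_map M (dual_inv M k) = k" "dual_inv M (dual_map M k) = k"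
    unfolding dual_map_def dual_inv_def k using 1 by (simp_all add: algebra_simps)
qed

lemma bij_dual_map:
  assumes "det M = 1"
  shows "bij_betw (dual_map M) UNIV UNIV" "bij_betw (dual_inv M) UNIV UNIV"
  by (rule bij_betw_byWitness[where f' = "dual_inv M"], use dual_inverse[OF assms] in auto)
    (rule bij_betw_byWitness[where f' = "dual_map M"], use dual_inverse[OF assms] in auto)

text \<open>
  The inverse of a matrix of determinant one, acting on positions.
\<close>

definition inverse_map :: "int^2^2 \<Rightarrow> real \<times> real \<Rightarrow> real \<times> real" where
  "inverse_map M z = (of_int (M $ 2 $ 2) * fst z - of_int (M $ 1 $ 2) * snd z,
     of_int (M $ 1 $ 1) * snd z - of_int (M $ 2 $ 1) * fst z)"

lemma pairing_dual_map:
  assumes "det M = 1"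
  shows "pairing (dual_map M k) (inverse_map M z) = pairing k z"
proof -
  have d: "real_of_int (M $ 1 $ 1) * of_int (M $ 2 $ 2) - of_int (M $ 1 $ 2) * of_int (M $ 2 $ 1) = 1"
    using assms by (simp add: det_2 flip: of_int_mult of_int_diff)
  have "pairing (dual_map M k) (inverse_map M z)
    = (real_of_int (M $ 1 $ 1) * of_int (M $ 2 $ 2) - of_int (M $ 1 $ 2) * of_int (M $ 2 $ 1)) * pairing k z"
    by (simp add: pairing_def dual_map_def inverse_map_def algebra_simps)
  then show ?thesis by (simp add: d)
qed

lemma trig_dual_map:
  assumes "det M = 1"
  shows "trig (\<lambda>k. c (dual_map M k)) z = trig c (inverse_map M z)"
proof -
  have "trig (\<lambda>k. c (dual_map M k)) z = (\<Sum>\<^sub>\<infinity>k. c (dual_map M k) * wave (pairing (dual_map M k) (inverse_map M z)))"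
    by (simp add: trig_def pairing_dual_map[OF assms])
  also have "\<dots> = trig c (inverse_map M z)"
    unfolding trig_def by (rule infsum_reindex_bij_betw[OF bij_dual_map(1)[OF assms]])
  finally show ?thesis .
qed

lemma rapid_dual_map:
  assumes M: "det M = 1" and c: "rapid c"
  shows "rapid (\<lambda>k. c (dual_map M k))"
  unfolding rapid_def
proof
  fix p
  define B :: real where "B = 1 + \<bar>of_int (M $ 1 $ 1)\<bar> + \<bar>of_int (M $ 1 $ 2)\<bar> + \<bar>of_int (M $ 2 $ 1)\<bar> + \<bar>of_int (M $ 2 $ 2)\<bar>"
  have w: "weight (dual_inv M j) \<le> B * weight j" for j
  proof -
    have "\<bar>real_of_int (fst j * M $ 2 $ 2 - snd j * M $ 2 $ 1)\<bar> \<le> \<bar>of_int (fst j)\<bar> * \<bar>of_int (M $ 2 $ 2)\<bar> + \<bar>of_int (snd j)\<bar> * \<bar>of_int (M $ 2 $ 1)\<bar>"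
      unfolding of_int_diff of_int_mult abs_mult[symmetric] by (rule abs_triangle_ineq4)
    moreover have "\<bar>real_of_int (snd j * M $ 1 $ 1 - fst j * M $ 1 $ 2)\<bar> \<le> \<bar>of_int (snd j)\<bar> * \<bar>of_int (M $ 1 $ 1)\<bar> + \<bar>of_int (fst j)\<bar> * \<bar>of_int (M $ 1 $ 2)\<bar>"
      unfolding of_int_diff of_int_mult abs_mult[symmetric] by (rule abs_triangle_ineq4)
    moreover have "1 + (x * d + y * c) + (y * a + x * b) \<le> (1 + a + b + c + d) * (1 + x + y)"
      if "0 \<le> x" "0 \<le> y" "0 \<le> a" "0 \<le> b" "0 \<le> c" "0 \<le> d" for x y a b c d :: real
    proof -
      have "(1 + a + b + c + d) * (1 + x + y) - (1 + (x * d + y * c) + (y * a + x * b))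
          = a + b + c + d + x + y + x * a + x * c + y * b + y * d" by (simp add: algebra_simps)
      moreover have "0 \<le> a + b + c + d + x + y + x * a + x * c + y * b + y * d"
        using that by (intro add_nonneg_nonneg mult_nonneg_nonneg)
      ultimately show ?thesis by linarith
    qed
    from this[of "\<bar>of_int (fst j)\<bar>" "\<bar>of_int (snd j)\<bar>" "\<bar>of_int (M $ 1 $ 1)\<bar>" "\<bar>of_int (M $ 1 $ 2)\<bar>" "\<bar>of_int (M $ 2 $ 1)\<bar>" "\<bar>of_int (M $ 2 $ 2)\<bar>"]
    have "1 + (\<bar>real_of_int (fst j)\<bar> * \<bar>of_int (M $ 2 $ 2)\<bar> + \<bar>of_int (snd j)\<bar> * \<bar>of_int (M $ 2 $ 1)\<bar>)
        + (\<bar>of_int (snd j)\<bar> * \<bar>of_int (M $ 1 $ 1)\<bar> + \<bar>of_int (fst j)\<bar> * \<bar>of_int (M $ 1 $ 2)\<bar>) \<le> B * weight j"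
      by (simp add: B_def weight_def)
    moreover have "weight (dual_inv M j) = 1 + \<bar>real_of_int (fst j * M $ 2 $ 2 - snd j * M $ 2 $ 1)\<bar> + \<bar>real_of_int (snd j * M $ 1 $ 1 - fst j * M $ 1 $ 2)\<bar>"
      by (simp only: weight_def dual_inv_def fst_conv snd_conv)
    ultimately show ?thesis by linarith
  qed
  have B: "B \<ge> 0" by (simp add: B_def)
  have "(\<lambda>k. B ^ p * (weight (dual_map M k) ^ p * norm (c (dual_map M k)))) summable_on UNIV"
    using c summable_on_reindex_bij_betw[OF bij_dual_map(1)[OF M], of "\<lambda>k. weight k ^ p * norm (c k)"]
    by (intro summable_on_cmult_right) (simp add: rapid_def)
  then show "(\<lambda>k. weight k ^ p * norm (c (dual_map M k))) summable_on UNIV"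
  proof (rule Infinite_Sum.summable_on_comparison_test)
    fix k
    have w0: "0 \<le> weight k" using weight_ge_1[of k] by simp
    have "weight k \<le> B * weight (dual_map M k)" using w[of "dual_map M k"] by (simp add: dual_inverse[OF M])
    then have "weight k ^ p \<le> B ^ p * weight (dual_map M k) ^ p"
      unfolding power_mult_distrib[symmetric] by (intro power_mono w0)
    from mult_right_mono[OF this norm_ge_zero]
    show "weight k ^ p * norm (c (dual_map M k)) \<le> B ^ p * (weight (dual_map M k) ^ p * norm (c (dual_map M k)))"
      by (simp add: mult.assoc)
    show "0 \<le> weight k ^ p * norm (c (dual_map M k))" using w0 by simp
  qed
qed

lemma trig_dual_map_funpow:
  assumes M: "det M = 1"
  shows "trig (\<lambda>k. c ((dual_map M ^^ i) k)) z = trig c ((inverse_map M ^^ i) z)"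
proof (induction i arbitrary: z)
  case (Suc i)
  have "trig (\<lambda>k. c ((dual_map M ^^ Suc i) k)) z = trig (\<lambda>k. (\<lambda>k. c ((dual_map M ^^ i) k)) (dual_map M k)) z"
    by (simp add: funpow_swap1)
  also have "\<dots> = trig c ((inverse_map M ^^ i) (inverse_map M z))"
    by (rule trans[OF trig_dual_map[OF M, where c = "\<lambda>k. c ((dual_map M ^^ i) k)"] Suc.IH])
  finally show ?case by (simp add: funpow_swap1)
qed simp

lemma rapid_dual_map_funpow:
  assumes M: "det M = 1" and c: "rapid c"
  shows "rapid (\<lambda>k. c ((dual_map M ^^ i) k))"
proof (induction i)
  case (Suc i)
  then show ?case using rapid_dual_map[OF M Suc] by (simp add: funpow_swap1)
qed (simp add: c)

text \<open>
  The orbit statement concerns \<open>p, M p, \<dots>, M\<^sup>K\<^sup>-\<^sup>1 p\<close>, while the factors are evaluated along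
  the backward orbit of \<open>z\<close>; the two agree, in reverse order, for \<open>p = M\<^sup>1\<^sup>-\<^sup>K z\<close>.
\<close>

lemma vanishing_orbit:
  fixes M :: "int^2^2"
  assumes M: "det M = 1" and c: "rapid c" and K: "K > 0"
    and nu: "\<And>z. \<nu> (to_torus z) = trig c (z $ 1, z $ 2)"
    and leave: "\<And>p. \<exists>i<K. \<forall>\<^sub>F q in nhds (((\<lambda>p. real_matrix M *v p) ^^ i) p). \<nu> (to_torus q) = 0"
  shows "vanishing K (\<lambda>i k. c ((dual_map M ^^ i) k))"
  unfolding vanishing_def
proof (intro conjI allI impI)
  show "rapid (\<lambda>k. c ((dual_map M ^^ i) k))" for i by (rule rapid_dual_map_funpow[OF M c])
  fix z :: "real \<times> real"
  let ?m = "inverse_map M" and ?A = "\<lambda>p. real_matrix M *v p"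
  have inv: "?A (pt (fst (?m w)) (snd (?m w))) = pt (fst w) (snd w)" for w
  proof -
    have d: "real_of_int (M $ 1 $ 1) * of_int (M $ 2 $ 2) - of_int (M $ 1 $ 2) * of_int (M $ 2 $ 1) = 1"
      using M by (simp add: det_2 flip: of_int_mult of_int_diff)
    have "fst w * (real_of_int (M $ 1 $ 1) * of_int (M $ 2 $ 2) - of_int (M $ 1 $ 2) * of_int (M $ 2 $ 1)) = fst w"
      "snd w * (real_of_int (M $ 1 $ 1) * of_int (M $ 2 $ 2) - of_int (M $ 1 $ 2) * of_int (M $ 2 $ 1)) = snd w" by (simp_all add: d)
    then show ?thesis
      by (simp add: vec_eq_iff forall_2 matrix_vector_2 real_matrix_def inverse_map_def algebra_simps)
  qed
  have orb: "(?A ^^ j) (pt (fst ((?m ^^ (j + i)) z)) (snd ((?m ^^ (j + i)) z))) = pt (fst ((?m ^^ i) z)) (snd ((?m ^^ i) z))" for i j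
  proof (induction j)
    case (Suc j)
    have "(?A ^^ Suc j) (pt (fst ((?m ^^ (Suc j + i)) z)) (snd ((?m ^^ (Suc j + i)) z)))
      = (?A ^^ j) (?A (pt (fst (?m ((?m ^^ (j + i)) z))) (snd (?m ((?m ^^ (j + i)) z)))))"
      by (simp add: funpow_swap1)
    then show ?case using Suc by (simp only: inv)
  qed simp
  obtain j where j: "j < K" "\<forall>\<^sub>F q in nhds ((?A ^^ j) (pt (fst ((?m ^^ (K - 1)) z)) (snd ((?m ^^ (K - 1)) z)))). \<nu> (to_torus q) = 0"
    using leave by blast
  define i where "i = K - 1 - j"
  have i: "i < K" "j + i = K - 1" using j(1) K by (auto simp: i_def)
  have ev: "\<forall>\<^sub>F q in nhds (pt (fst ((?m ^^ i) z)) (snd ((?m ^^ i) z))). trig c (q $ 1, q $ 2) = 0"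
    using j(2) unfolding i(2)[symmetric] orb nu .
  have cm: "continuous_on UNIV (?m ^^ i)"
  proof (induction i)
    case (Suc i)
    have "continuous_on UNIV ?m" unfolding inverse_map_def[abs_def] by (intro continuous_intros)
    from continuous_on_compose2[OF this Suc.IH] show ?case by (simp add: o_def)
  qed (simp add: id_def)
  then have cp: "continuous_on UNIV (\<lambda>w. pt (fst ((?m ^^ i) w)) (snd ((?m ^^ i) w)))"
    unfolding pt_def by (intro continuous_intros)
  have "isCont (\<lambda>w. pt (fst ((?m ^^ i) w)) (snd ((?m ^^ i) w))) z"
    by (rule continuous_on_eq_continuous_at[OF open_UNIV, THEN iffD1, OF cp, rule_format]) simp
  then have "filterlim (\<lambda>w. pt (fst ((?m ^^ i) w)) (snd ((?m ^^ i) w))) (nhds (pt (fst ((?m ^^ i) z)) (snd ((?m ^^ i) z)))) (nhds z)"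
    unfolding isCont_def
    by (rule tendsto_at_iff_tendsto_nhds[where g = "\<lambda>w. pt (fst ((?m ^^ i) w)) (snd ((?m ^^ i) w))", THEN iffD1])
  then have "\<forall>\<^sub>F w in nhds z. trig c ((?m ^^ i) w) = 0"
    using ev unfolding filterlim_iff by (auto dest: spec)
  then show "\<exists>i<K. \<forall>\<^sub>F w in nhds z. trig (\<lambda>k. c ((dual_map M ^^ i) k)) w = 0"
    using i(1) unfolding trig_dual_map_funpow[OF M] by blast
qed

section \<open>Spectral values are eigenvalues\<close>

text \<open>
  The image of a basis is independent and has as many elements, so no vector of the span can be independent
  of it.
\<close>

lemma (in vector_space) inj_endomorphism_of_finite_span:
  assumes fin: "finite S" and maps: "F ` span S \<subseteq> span S"
    and add: "\<And>x y. x \<in> span S \<Longrightarrow> y \<in> span S \<Longrightarrow> F (x + y) = F x + F y"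
    and sc: "\<And>c x. x \<in> span S \<Longrightarrow> F (scale c x) = scale c (F x)"
    and inj: "inj_on F (span S)"
  shows "F ` span S = span S"
proof -
  interpret pair: vector_space_pair scale scale by unfold_locales
  obtain B where B: "B \<subseteq> S" "independent B" "S \<subseteq> span B" by (rule maximal_independent_subset[of S])
  have sB: "span B = span S" using B span_mono span_subspace[OF B(1)] by (metis span_minimal subspace_span subset_antisym)
  have finB: "finite B" using B(1) fin by (rule finite_subset)
  obtain g where g: "Vector_Spaces.linear scale scale g" "\<And>x. x \<in> B \<Longrightarrow> g x = F x"
    using pair.linear_independent_extend[OF B(2), of F] by blast
  interpret g: Vector_Spaces.linear scale scale g by (rule g(1))
  have "F x = g x" if "x \<in> span B" for x
  proof -
    have "x \<in> span S \<and> F x = g x"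
      using that
    proof (induction rule: span_induct_alt)
      case base
      have "F 0 = scale 0 (F 0)" using sc[of 0 0] span_zero by simp
      then show ?case by (simp add: span_zero g.zero)
    next
      case (step c b y)
      then have b: "b \<in> span S" using sB span_base by blast
      then show ?case using step by (simp add: add sc g g.add g.scale span_add span_scale)
    qed
    then show ?thesis ..
  qed
  then have Fg: "F x = g x" if "x \<in> span S" for x using that sB by simp
  have injg: "inj_on g (span B)"
    using inj by (simp add: sB Fg inj_on_def)
  have ind: "independent (g ` B)" by (rule pair.linear_independent_injective_image[OF g(1) B(2) injg])
  have gB: "g ` B \<subseteq> span B"
    using maps B(1) span_superset[of S] by (force simp: sB Fg[symmetric])
  have card: "card (g ` B) = card B"
    by (rule card_image) (rule inj_on_subset[OF injg span_superset])
  have "span B \<subseteq> span (g ` B)"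
  proof
    fix w assume w: "w \<in> span B"
    show "w \<in> span (g ` B)"
    proof (rule ccontr)
      assume n: "w \<notin> span (g ` B)"
      then have "independent (insert w (g ` B))" using ind by (rule independent_insertI)
      then have "card (insert w (g ` B)) \<le> card B"
        using independent_span_bound[OF finB, of "insert w (g ` B)"] w gB by auto
      moreover have "w \<notin> g ` B" using n span_base by blast
      ultimately show False using finB by (simp add: card)
    qed
  qed
  moreover have "span (g ` B) = g ` span B" by (rule g.span_image)
  ultimately have "span S \<subseteq> F ` span S" by (force simp: sB Fg)
  then show ?thesis using maps by blast
qed

definition fscale :: "complex \<Rightarrow> functional \<Rightarrow> functional" where
  "fscale c u = (\<lambda>\<phi>. c * u \<phi>)"

interpretation functional: vector_space fscale
  by unfold_locales (auto simp: fscale_def fun_eq_iff algebra_simps)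

lemma torus_states_span: "torus_states N = functional.span (dirac_comb N ` {..<N})"
proof
  have st: "state N c = (\<Sum>n<N. fscale (c n) (dirac_comb N n))" for c
  proof
    have "(\<Sum>n\<in>A. f n) \<phi> = (\<Sum>n\<in>A. f n \<phi>)" for A :: "nat set" and f :: "nat \<Rightarrow> functional" and \<phi>
      by (induction A rule: infinite_finite_induct) auto
    then show "state N c \<phi> = (\<Sum>n<N. fscale (c n) (dirac_comb N n)) \<phi>" for \<phi>
      by (simp add: state_def fscale_def)
  qed
  show "torus_states N \<subseteq> functional.span (dirac_comb N ` {..<N})"
    unfolding torus_states_eq
  proof safe
    show "state N c \<in> functional.span (dirac_comb N ` {..<N})" for c
      unfolding st by (intro functional.span_sum functional.span_scale functional.span_base imageI)
  qed
  have "functional.subspace (torus_states N)"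
    unfolding functional.subspace_def torus_states_eq
  proof (intro conjI ballI allI)
    show "0 \<in> range (state N)" by (rule range_eqI[of _ _ "\<lambda>_. 0"]) (simp add: state_def fun_eq_iff)
    show "x + y \<in> range (state N)" if "x \<in> range (state N)" "y \<in> range (state N)" for x y
    proof -
      from that obtain c d where "x = state N c" "y = state N d" by blast
      then have "x + y = state N (\<lambda>n. c n + d n)" by (simp add: state_def fun_eq_iff sum.distrib distrib_right)
      then show ?thesis by blast
    qed
    show "fscale a x \<in> range (state N)" if "x \<in> range (state N)" for a x
    proof -
      from that obtain c where "x = state N c" by blast
      then have "fscale a x = state N (\<lambda>n. a * c n)" by (simp add: state_def fun_eq_iff fscale_def sum_distrib_left mult.assoc)
      then show ?thesis by blast
    qed
  qed
  moreover have "dirac_comb N ` {..<N} \<subseteq> torus_states N"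
  proof safe
    fix n assume n: "n < N"
    have "dirac_comb N n = state N (\<lambda>m. if m = n then 1 else 0)"
      using n by (simp add: state_def fun_eq_iff if_distrib[of "\<lambda>x. x * _"] sum.delta cong: if_cong)
    then show "dirac_comb N n \<in> torus_states N" unfolding torus_states_eq by blast
  qed
  ultimately show "functional.span (dirac_comb N ` {..<N}) \<subseteq> torus_states N" by (intro functional.span_minimal)
qed

lemma spectrum_eigenvector:
  assumes maps: "\<And>u. u \<in> torus_states N \<Longrightarrow> T u \<in> torus_states N"
    and lin: "\<And>c u v. u \<in> torus_states N \<Longrightarrow> v \<in> torus_states N \<Longrightarrow> T (\<lambda>\<phi>. c * u \<phi> + v \<phi>) = (\<lambda>\<phi>. c * T u \<phi> + T v \<phi>)"
    and mu: "\<mu> \<in> spectrum_on (torus_states N) T"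
  obtains u where "u \<in> torus_states N" "u \<noteq> (\<lambda>\<phi>. 0)" "T u = (\<lambda>\<phi>. \<mu> * u \<phi>)"
proof -
  let ?F = "\<lambda>u \<phi>. T u \<phi> - \<mu> * u \<phi>" and ?S = "dirac_comb N ` {..<N}"
  have H: "torus_states N = functional.span ?S" by (rule torus_states_span)
  have cl: "(\<lambda>\<phi>. c * u \<phi> + v \<phi>) \<in> torus_states N" if "u \<in> torus_states N" "v \<in> torus_states N" for c u v
  proof -
    have "fscale c u + v \<in> torus_states N"
      using that unfolding H by (intro functional.span_add functional.span_scale)
    moreover have "fscale c u + v = (\<lambda>\<phi>. c * u \<phi> + v \<phi>)" by (simp add: fscale_def fun_eq_iff)
    ultimately show ?thesis by simp
  qed
  have maps': "?F u \<in> torus_states N" if "u \<in> torus_states N" for u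
    using cl[OF that maps[OF that], of "- \<mu>"] by (simp add: algebra_simps)
  have linF: "?F (\<lambda>\<phi>. c * u \<phi> + v \<phi>) = (\<lambda>\<phi>. c * ?F u \<phi> + ?F v \<phi>)" if "u \<in> torus_states N" "v \<in> torus_states N" for c u v
    using lin[OF that, of c] by (simp add: fun_eq_iff algebra_simps)
  have z: "(\<lambda>\<phi>. 0) \<in> torus_states N" unfolding torus_states_eq by (rule range_eqI[of _ _ "\<lambda>_. 0"]) (simp add: state_def)
  have F0: "?F (\<lambda>\<phi>. 0) = (\<lambda>\<phi>. 0)" using linF[OF z z, of "- 1"] by simp
  have "\<not> inj_on ?F (torus_states N)"
  proof
    assume inj: "inj_on ?F (torus_states N)"
    have "?F ` functional.span ?S = functional.span ?S"
    proof (rule functional.inj_endomorphism_of_finite_span)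
      show "?F ` functional.span ?S \<subseteq> functional.span ?S" using maps' unfolding H by blast
      show "?F (x + y) = ?F x + ?F y" if "x \<in> functional.span ?S" "y \<in> functional.span ?S" for x y
        using linF[of x y 1] that unfolding H[symmetric] by (simp add: plus_fun_def)
      show "?F (fscale c x) = fscale c (?F x)" if "x \<in> functional.span ?S" for c x
        using linF[of x "\<lambda>\<phi>. 0" c] that z F0 unfolding H[symmetric] by (simp add: fscale_def fun_eq_iff)
      show "inj_on ?F (functional.span ?S)" using inj unfolding H .
    qed simp
    then have "bij_betw ?F (torus_states N) (torus_states N)" using inj by (simp add: bij_betw_def H)
    then show False using mu by (simp add: spectrum_on_def)
  qed
  then obtain x y where xy: "x \<in> torus_states N" "y \<in> torus_states N" "?F x = ?F y" "x \<noteq> y"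
    by (auto simp: inj_on_def)
  let ?u = "\<lambda>\<phi>. - 1 * x \<phi> + y \<phi>"
  have "?F ?u = (\<lambda>\<phi>. - 1 * ?F x \<phi> + ?F y \<phi>)" by (rule linF[OF xy(1,2)])
  also have "\<dots> = (\<lambda>\<phi>. 0)"
  proof
    fix \<phi>
    from fun_cong[OF xy(3), of \<phi>] show "- 1 * ?F x \<phi> + ?F y \<phi> = 0"
      by (simp only: mult_minus1 add.left_inverse)
  qed
  finally have "?F ?u = (\<lambda>\<phi>. 0)" .
  then have "T ?u = (\<lambda>\<phi>. \<mu> * ?u \<phi>)" by (simp add: fun_eq_iff)
  moreover have "?u \<noteq> (\<lambda>\<phi>. 0)"
  proof
    assume z: "?u = (\<lambda>\<phi>. 0)"
    have "x \<phi> = y \<phi>" for \<phi> using fun_cong[OF z, of \<phi>] by simp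
    then show False using xy(4) by blast
  qed
  ultimately show ?thesis using that[OF cl[OF xy(1,2), of "- 1"]] by blast
qed

section \<open>Powers of the quantum map\<close>

lemma translate_bound:
  assumes N: "N > 0"
  obtains B where "\<And>k. norm (translate N (of_int (fst k)) (of_int (snd k)) (state N d) \<phi>) \<le> B"
proof
  fix k
  have "norm (translate_coeff N (fst k) (snd k) d n) \<le> (\<Sum>n<N. norm (d n))" for n
    using state_coeff_bound[OF N, of d "int n + snd k"] by (simp add: translate_coeff_def norm_mult)
  then have "norm (\<Sum>n<N. translate_coeff N (fst k) (snd k) d n * dirac_comb N n \<phi>) \<le> (\<Sum>n<N. (\<Sum>n<N. norm (d n)) * norm (dirac_comb N n \<phi>))"
    by (intro sum_norm_le) (simp add: norm_mult mult_right_mono)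
  then show "norm (translate N (of_int (fst k)) (of_int (snd k)) (state N d) \<phi>) \<le> (\<Sum>n<N. (\<Sum>n<N. norm (d n)) * norm (dirac_comb N n \<phi>))"
    unfolding translate_state[OF N] by (simp add: state_def)
qed

text \<open>
  The order is reversed because \<open>translate\<close> is a transpose.
\<close>

lemma translate_translate:
  assumes p: "\<phi> \<in> schwartz" and N: "N > 0" and u: "u \<in> tempered"
  shows "translate N (of_int (fst k)) (of_int (snd k)) u (heisenberg N (of_int (fst m)) (of_int (snd m)) \<phi>)
    = wave (of_int (cocycle m k) * (1 / (2 * real N))) * translate N (of_int (fst (m + k))) (of_int (snd (m + k))) u \<phi>"
proof -
  have h: "heisenberg N a b \<phi> \<in> schwartz" for a b by (rule schwartz_heisenberg[OF p N])
  have "translate N (of_int (fst k)) (of_int (snd k)) u (heisenberg N (of_int (fst m)) (of_int (snd m)) \<phi>)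
    = u (\<lambda>x. wave ((of_int (fst k) * of_int (snd m) - of_int (fst m) * of_int (snd k)) / (2 * real N)) * heisenberg N (of_int (fst k) + of_int (fst m)) (of_int (snd k) + of_int (snd m)) \<phi> x)"
    using h by (simp add: translate_def heisenberg_compose[OF N])
  also have "\<dots> = wave ((of_int (fst k) * of_int (snd m) - of_int (fst m) * of_int (snd k)) / (2 * real N)) * u (heisenberg N (of_int (fst k) + of_int (fst m)) (of_int (snd k) + of_int (snd m)) \<phi>)"
    by (rule tempered_scale[OF u h])
  finally show ?thesis using p by (simp add: translate_def cocycle_def add.commute)
qed

lemma bij_betw_tuples_Suc:
  "bij_betw (\<lambda>(k, j). k(K := j)) (tuples K \<times> UNIV) (tuples (Suc K))"
proof (rule bij_betw_byWitness[where f' = "\<lambda>k. (restrict k {..<K}, k K)"])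
  show "\<forall>x\<in>tuples K \<times> UNIV. (\<lambda>k. (restrict k {..<K}, k K)) (case x of (k, j) \<Rightarrow> k(K := j)) = x"
    by (auto simp: tuples_def fun_eq_iff restrict_def PiE_iff extensional_def)
  show "\<forall>k\<in>tuples (Suc K). (case (restrict k {..<K}, k K) of (k, j) \<Rightarrow> k(K := j)) = k"
    by (auto simp: tuples_def fun_eq_iff restrict_def PiE_iff extensional_def lessThan_Suc)
  show "(\<lambda>(k, j). k(K := j)) ` (tuples K \<times> UNIV) \<subseteq> tuples (Suc K)"
    by (auto simp: tuples_def PiE_iff extensional_def lessThan_Suc)
  show "(\<lambda>k. (restrict k {..<K}, k K)) ` tuples (Suc K) \<subseteq> tuples K \<times> UNIV"
    by (auto simp: tuples_def)
qed

text \<open>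
  The expansion of a power of the quantum map on an eigenvector. Moving the metaplectic operator to
  the right replaces the coefficients by those of the symbol composed with iterates of the map.
\<close>

lemma eigenvector_expansion:
  fixes M :: "int^2^2"
  assumes W: "metaplectic (planck N) (real_matrix M) W" and N: "N > 0" "even N" and M: "det M = 1"
    and c: "rapid c" and nu: "\<And>z. \<nu> (to_torus z) = trig c (z $ 1, z $ 2)"
    and u: "u \<in> torus_states N" and ev: "torus_op N \<nu> (W u) = (\<lambda>\<phi>. \<mu> * u \<phi>)" and p: "\<phi> \<in> schwartz"
  shows "\<mu> ^ K * u \<phi> = (\<Sum>\<^sub>\<infinity>k\<in>tuples K. (wave (of_int (phase K k) * (1 / (2 * real N))) * (\<Prod>i<K. c ((dual_map M ^^ i) (k i)))) *
      translate N (of_int (fst (\<Sum>i<K. k i))) (of_int (snd (\<Sum>i<K. k i))) ((W ^^ K) u) \<phi>)"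
proof -
  define T where "T k = translate N (of_int (fst k)) (of_int (snd k))" for k
  define v where "v i = (W ^^ i) u" for i
  define C where "C i k = c ((dual_map M ^^ i) k)" for i k
  have vs: "\<exists>d. v i = state N d" for i
  proof (induction i)
    case 0
    then show ?case using u by (auto simp: v_def torus_states_eq)
  next
    case (Suc i)
    then obtain d where "v i = state N d" ..
    then show ?case using metaplectic_state[OF W N, of d] by (simp add: v_def)
  qed
  have vt: "v i \<in> tempered" for i using vs[of i] state_tempered[OF N(1)] by auto
  have Tt: "T k (v i) \<in> tempered" for k i
    using vs[of i] translate_state_tempered[OF N(1)] by (auto simp: T_def)
  have Cs: "(\<lambda>k. norm (C i k)) summable_on UNIV" for i
    unfolding C_def by (rule rapid_summable[OF rapid_dual_map_funpow[OF M c]])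
  have WT: "W (T (dual_map M k) (v i)) = T k (v (Suc i))" for k i
    using metaplectic_translate[OF W N(1) vt[of i], of "of_int (fst k)" "of_int (snd k)"]
    by (simp add: T_def v_def dual_map_def real_matrix_def)
  have step: "((\<lambda>k. C i k * T k (v (Suc i)) \<psi>) has_sum \<mu> * v i \<psi>) UNIV" if "\<psi> \<in> schwartz" for i \<psi>
    using that
  proof (induction i arbitrary: \<psi>)
    case 0
    have "W u \<in> tempered" using vt[of 1] by (simp add: v_def)
    from torus_op_series[where \<nu> = \<nu>, OF this 0 N(1) c nu]
    show ?case by (simp add: ev C_def v_def T_def)
  next
    case (Suc i)
    obtain \<eta> where \<eta>: "\<eta> \<in> schwartz" "\<And>w. w \<in> tempered \<Longrightarrow> W w \<psi> = w \<eta>"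
      by (rule metaplectic_transpose[OF W Suc.prems]) blast
    have "((\<lambda>k. C i k * T k (v (Suc i)) \<eta>) has_sum \<mu> * v i \<eta>) UNIV" by (rule Suc.IH[OF \<eta>(1)])
    then have "((\<lambda>k. C i (dual_map M k) * T (dual_map M k) (v (Suc i)) \<eta>) has_sum \<mu> * v i \<eta>) UNIV"
      using has_sum_reindex_bij_betw[OF bij_dual_map(1)[OF M], of "\<lambda>k. C i k * T k (v (Suc i)) \<eta>"] by simp
    moreover have "T (dual_map M k) (v (Suc i)) \<eta> = T k (v (Suc (Suc i))) \<psi>" for k
      using \<eta>(2)[OF Tt] WT by metis
    moreover have "v i \<eta> = v (Suc i) \<psi>" using \<eta>(2)[OF vt[of i]] by (simp add: v_def)
    moreover have "C i (dual_map M k) = C (Suc i) k" for k by (simp add: C_def funpow_swap1)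
    ultimately show ?case by simp
  qed
  have "\<mu> ^ K * u \<phi> = (\<Sum>\<^sub>\<infinity>k\<in>tuples K. (wave (of_int (phase K k) * (1 / (2 * real N))) * (\<Prod>i<K. C i (k i))) * T (\<Sum>i<K. k i) (v K) \<phi>)"
  proof (induction K)
    case 0
    have "T 0 (v 0) \<phi> = u \<phi>"
      using p by (simp add: T_def v_def translate_def heisenberg_def[abs_def])
    then show ?case by (simp add: tuples_def phase_def)
  next
    case (Suc K)
    let ?h = "1 / (2 * real N)"
    define a where "a k = wave (of_int (phase K k) * ?h) * (\<Prod>i<K. C i (k i))" for k
    define b where "b k = wave (of_int (phase (Suc K) k) * ?h) * (\<Prod>i<Suc K. C i (k i)) * T (\<Sum>i<Suc K. k i) (v (Suc K)) \<phi>" for k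
    obtain d where d: "v (Suc K) = state N d" using vs by blast
    obtain B where B: "\<And>k. norm (T k (v (Suc K)) \<phi>) \<le> B"
      unfolding T_def d by (rule translate_bound[OF N(1), of d \<phi>]) blast
    have sb: "b summable_on tuples (Suc K)"
    proof (rule dominated_summable(2))
      show "(\<lambda>k. norm (\<Prod>i<Suc K. C i (k i)) * B) summable_on tuples (Suc K)"
        by (intro summable_on_cmult_left tuples_prod_summable Cs)
      show "norm (b k) \<le> norm (\<Prod>i<Suc K. C i (k i)) * B" for k
        unfolding b_def norm_mult norm_wave by (simp only: mult_1) (intro mult_left_mono B norm_ge_zero)
    qed
    have ext: "phase (Suc K) (k(K := j)) = phase K k + cocycle (\<Sum>i<K. k i) j"
      "(\<Sum>i<Suc K. (k(K := j)) i) = (\<Sum>i<K. k i) + j"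
      "(\<Prod>i<Suc K. C i ((k(K := j)) i)) = (\<Prod>i<K. C i (k i)) * C K j" for k j
    proof -
      have s: "(\<Sum>i<m. (k(K := j)) i) = (\<Sum>i<m. k i)" if "m \<le> K" for m
        using that by (intro sum.cong) auto
      have "(\<Sum>i<K. cocycle (\<Sum>l<i. (k(K := j)) l) ((k(K := j)) i)) = (\<Sum>i<K. cocycle (\<Sum>l<i. k l) (k i))"
        by (intro sum.cong refl) (simp add: s)
      then show "phase (Suc K) (k(K := j)) = phase K k + cocycle (\<Sum>i<K. k i) j"
        using s[of K] by (simp add: phase_def)
      show "(\<Sum>i<Suc K. (k(K := j)) i) = (\<Sum>i<K. k i) + j" using s[of K] by simp
      have "(\<Prod>i<K. C i ((k(K := j)) i)) = (\<Prod>i<K. C i (k i))" by (intro prod.cong) auto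
      then show "(\<Prod>i<Suc K. C i ((k(K := j)) i)) = (\<Prod>i<K. C i (k i)) * C K j" by simp
    qed
    have "\<mu> ^ Suc K * u \<phi> = \<mu> * (\<Sum>\<^sub>\<infinity>k\<in>tuples K. a k * T (\<Sum>i<K. k i) (v K) \<phi>)"
      unfolding a_def Suc.IH[symmetric] by (simp add: mult.assoc)
    also have "\<dots> = (\<Sum>\<^sub>\<infinity>k\<in>tuples K. a k * (\<mu> * T (\<Sum>i<K. k i) (v K) \<phi>))"
      unfolding infsum_cmult_right'[symmetric] by (simp only: mult.left_commute)
    also have "\<dots> = (\<Sum>\<^sub>\<infinity>k\<in>tuples K. \<Sum>\<^sub>\<infinity>j. b (k(K := j)))"
    proof (rule infsum_cong)
      fix k :: "nat \<Rightarrow> int \<times> int"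
      let ?m = "\<Sum>i<K. k i"
      have "\<mu> * T ?m (v K) \<phi> = \<mu> * v K (heisenberg N (of_int (fst ?m)) (of_int (snd ?m)) \<phi>)"
        using p by (simp add: T_def translate_def)
      also have "\<dots> = (\<Sum>\<^sub>\<infinity>j. C K j * T j (v (Suc K)) (heisenberg N (of_int (fst ?m)) (of_int (snd ?m)) \<phi>))"
        by (rule infsumI[OF step[OF schwartz_heisenberg[OF p N(1)]], symmetric])
      also have "\<dots> = (\<Sum>\<^sub>\<infinity>j. C K j * (wave (of_int (cocycle ?m j) * ?h) * T (?m + j) (v (Suc K)) \<phi>))"
        unfolding T_def translate_translate[OF p N(1) vt] ..
      finally have "a k * (\<mu> * T ?m (v K) \<phi>) = (\<Sum>\<^sub>\<infinity>j. a k * (C K j * (wave (of_int (cocycle ?m j) * ?h) * T (?m + j) (v (Suc K)) \<phi>)))"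
        by (simp only: infsum_cmult_right')
      also have "\<dots> = (\<Sum>\<^sub>\<infinity>j. b (k(K := j)))"
        unfolding b_def ext a_def of_int_add distrib_right wave_add by (simp only: mult_ac)
      finally show "a k * (\<mu> * T ?m (v K) \<phi>) = (\<Sum>\<^sub>\<infinity>j. b (k(K := j)))" .
    qed
    also have "\<dots> = (\<Sum>\<^sub>\<infinity>x\<in>tuples K \<times> UNIV. b (case x of (k, j) \<Rightarrow> k(K := j)))"
    proof -
      have "(\<lambda>x. b (case x of (k, j) \<Rightarrow> k(K := j))) summable_on tuples K \<times> UNIV"
        using sb summable_on_reindex_bij_betw[OF bij_betw_tuples_Suc, of b K] by simp
      from infsum_Sigma_banach[OF this] show ?thesis by simp
    qed
    also have "\<dots> = (\<Sum>\<^sub>\<infinity>k\<in>tuples (Suc K). b k)"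
      by (rule infsum_reindex_bij_betw[OF bij_betw_tuples_Suc])
    finally show ?case unfolding b_def .
  qed
  then show ?thesis unfolding C_def T_def v_def .
qed

lemma torus_op_state:
  assumes N: "N > 0" and c: "rapid c" and nu: "\<And>z. \<nu> (to_torus z) = trig c (z $ 1, z $ 2)"
  shows "torus_op N \<nu> (state N d) \<in> torus_states N"
proof -
  define e where "e n = (\<Sum>\<^sub>\<infinity>k. c k * translate_coeff N (fst k) (snd k) d n)" for n
  have le: "norm (translate_coeff N (fst k) (snd k) d n) \<le> (\<Sum>n<N. norm (d n))" for k n
    using state_coeff_bound[OF N, of d "int n + snd k"] by (simp add: translate_coeff_def norm_mult)
  have s: "(\<lambda>k. c k * translate_coeff N (fst k) (snd k) d n) summable_on UNIV" for n
    by (rule dominated_summable(2)[OF summable_on_cmult_left[OF rapid_summable[OF c], of "\<Sum>n<N. norm (d n)"]])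
      (simp add: norm_mult mult_left_mono le)
  have "torus_op N \<nu> (state N d) \<phi> = state N e \<phi>" for \<phi>
  proof (cases "\<phi> \<in> schwartz")
    case p: True
    have "torus_op N \<nu> (state N d) \<phi> = (\<Sum>\<^sub>\<infinity>k. c k * translate N (of_int (fst k)) (of_int (snd k)) (state N d) \<phi>)"
      by (rule infsumI[symmetric], rule torus_op_series[where \<nu> = \<nu>, OF state_tempered[OF N] p N c nu])
    also have "\<dots> = (\<Sum>\<^sub>\<infinity>k. \<Sum>n<N. (c k * translate_coeff N (fst k) (snd k) d n) * dirac_comb N n \<phi>)"
      unfolding translate_state[OF N] by (simp add: state_def sum_distrib_left mult.assoc)
    also have "\<dots> = (\<Sum>n<N. \<Sum>\<^sub>\<infinity>k. (c k * translate_coeff N (fst k) (snd k) d n) * dirac_comb N n \<phi>)"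
      by (rule infsum_finite_sum(2)) (intro summable_on_cmult_left s)
    also have "\<dots> = state N e \<phi>" by (simp add: state_def e_def infsum_cmult_left')
    finally show ?thesis .
  qed (simp add: torus_op_def weyl_dist_def state_not_schwartz)
  then have "torus_op N \<nu> (state N d) = state N e" by (rule ext)
  then show ?thesis by (simp add: torus_states_eq)
qed

lemma metaplectic_power_contraction:
  fixes M :: "int^2^2"
  assumes W: "metaplectic (planck N) (real_matrix M) W" and N: "N > 0" "even N" and M: "det M = 1"
  shows "\<exists>d. (W ^^ K) (state N e) = state N d \<and> (\<Sum>n<N. (norm (d n))\<^sup>2) \<le> (\<Sum>n<N. (norm (e n))\<^sup>2)"
proof (induction K)
  case (Suc K)
  then obtain d where d: "(W ^^ K) (state N e) = state N d" "(\<Sum>n<N. (norm (d n))\<^sup>2) \<le> (\<Sum>n<N. (norm (e n))\<^sup>2)" by blast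
  obtain d' where d': "W (state N d) = state N d'" using metaplectic_state[OF W N] by blast
  show ?case
    using d d' metaplectic_contraction[OF W N(1) M d'] by (intro exI[of _ d']) simp
qed auto

text \<open>
  The supremum norm of the coordinates is compared with the \<open>l\<^sup>2\<close> norm, on which the metaplectic
  operator is a contraction; the loss of \<open>\<surd>N\<close> is immaterial.
\<close>

lemma eigenvalue_bound:
  fixes M :: "int^2^2"
  assumes W: "metaplectic (planck N) (real_matrix M) W" and N: "N > 0" "even N" and M: "det M = 1"
    and c: "rapid c" and nu: "\<And>z. \<nu> (to_torus z) = trig c (z $ 1, z $ 2)"
    and mu: "\<mu> \<in> spectrum_on (torus_states N) (torus_op N \<nu> \<circ> W)"
    and D: "D \<ge> 0" "\<And>t g B. (\<And>j. norm (g j) \<le> B) \<Longrightarrow>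
      norm (\<Sum>\<^sub>\<infinity>k\<in>tuples K. (wave (of_int (phase K k) * t) * (\<Prod>i<K. c ((dual_map M ^^ i) (k i)))) * g (\<Sum>i<K. k i)) \<le> D * \<bar>t\<bar> ^ n * B"
  shows "norm \<mu> ^ K \<le> D * (1 / real N) ^ n * real N"
proof -
  let ?T = "torus_op N \<nu> \<circ> W"
  have H: "torus_states N = range (state N)" by (rule torus_states_eq)
  have tH: "u \<in> torus_states N \<Longrightarrow> u \<in> tempered" for u using state_tempered[OF N(1)] by (auto simp: H)
  obtain u where u: "u \<in> torus_states N" "u \<noteq> (\<lambda>\<phi>. 0)" "?T u = (\<lambda>\<phi>. \<mu> * u \<phi>)"
  proof (rule spectrum_eigenvector[OF _ _ mu])
    show "?T u \<in> torus_states N" if "u \<in> torus_states N" for u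
    proof -
      obtain d where "u = state N d" using \<open>u \<in> torus_states N\<close> by (auto simp: H)
      moreover obtain d' where "W (state N d) = state N d'" using metaplectic_state[OF W N] by blast
      ultimately show ?thesis using torus_op_state[where \<nu> = \<nu>, OF N(1) c nu, of d'] by simp
    qed
    show "?T (\<lambda>\<phi>. a * u \<phi> + v \<phi>) = (\<lambda>\<phi>. a * ?T u \<phi> + ?T v \<phi>)" if "u \<in> torus_states N" "v \<in> torus_states N" for a u v
      using metaplectic_linear[OF W tH tH, OF that, of a] by (auto simp: torus_op_def weyl_dist_def fun_eq_iff)
  qed blast
  obtain e where e: "u = state N e" using u(1) by (auto simp: H)
  obtain m where m: "m < N" "\<And>j. j < N \<Longrightarrow> norm (e j) \<le> norm (e m)"
  proof -
    have "Max ((\<lambda>j. norm (e j)) ` {..<N}) \<in> (\<lambda>j. norm (e j)) ` {..<N}" using N(1) by (intro Max_in) auto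
    then obtain m where "m < N" "Max ((\<lambda>j. norm (e j)) ` {..<N}) = norm (e m)" by auto
    moreover have "norm (e j) \<le> Max ((\<lambda>j. norm (e j)) ` {..<N})" if "j < N" for j using that by (intro Max_ge) auto
    ultimately show ?thesis using that by metis
  qed
  have em: "norm (e m) > 0"
  proof (rule ccontr)
    assume "\<not> norm (e m) > 0"
    then have "e j = 0" if "j < N" for j using m(2)[OF that] by simp
    then have "u = (\<lambda>\<phi>. 0)" by (simp add: e state_def)
    then show False using u(2) by simp
  qed
  obtain d where d: "(W ^^ K) u = state N d" "(\<Sum>n<N. (norm (d n))\<^sup>2) \<le> (\<Sum>n<N. (norm (e n))\<^sup>2)"
    using metaplectic_power_contraction[OF W N M, of K e] e by blast
  have dj: "norm (d j) \<le> sqrt N * norm (e m)" if "j < N" for j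
  proof -
    have "(norm (d j))\<^sup>2 \<le> (\<Sum>n<N. (norm (d n))\<^sup>2)" by (rule member_le_sum) (use that in auto)
    also have "\<dots> \<le> (\<Sum>n<N. (norm (e n))\<^sup>2)" by (rule d(2))
    also have "\<dots> \<le> (\<Sum>n<N. (norm (e m))\<^sup>2)" by (intro sum_mono power_mono m(2)) auto
    also have "\<dots> = (sqrt N * norm (e m))\<^sup>2" by (simp add: power_mult_distrib)
    finally show ?thesis by (rule power2_le_imp_le) simp
  qed
  obtain \<phi> where \<phi>: "\<phi> \<in> schwartz" "\<And>c. state N c \<phi> = c m" by (rule dual_test_function[OF N(1) m(1)]) blast
  let ?g = "\<lambda>k. translate N (of_int (fst k)) (of_int (snd k)) ((W ^^ K) u) \<phi>"
  have g: "norm (?g k) \<le> sqrt N * norm (e m)" for k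
  proof -
    have "?g k = translate_coeff N (fst k) (snd k) d m" unfolding d(1) translate_state[OF N(1)] \<phi>(2) ..
    moreover have "nat ((int m + snd k) mod int N) < N" using N(1) by (simp add: nat_less_iff)
    ultimately show ?thesis using dj by (simp add: translate_coeff_def norm_mult)
  qed
  have ex: "\<mu> ^ K * u \<phi> = (\<Sum>\<^sub>\<infinity>k\<in>tuples K. (wave (of_int (phase K k) * (1 / (2 * real N))) * (\<Prod>i<K. c ((dual_map M ^^ i) (k i)))) * ?g (\<Sum>i<K. k i))"
    by (rule eigenvector_expansion[where \<nu> = \<nu>, OF W N M c nu u(1) _ \<phi>(1)]) (use u(3) in simp)
  have "norm (\<mu> ^ K * u \<phi>) \<le> D * \<bar>1 / (2 * real N)\<bar> ^ n * (sqrt N * norm (e m))"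
    unfolding ex by (rule D(2)[of ?g, OF g])
  then have "norm \<mu> ^ K * norm (e m) \<le> D * \<bar>1 / (2 * real N)\<bar> ^ n * sqrt N * norm (e m)"
    by (simp add: e \<phi>(2) norm_mult norm_power mult.assoc)
  then have "norm \<mu> ^ K \<le> D * \<bar>1 / (2 * real N)\<bar> ^ n * sqrt N" using em by simp
  also have "\<dots> \<le> D * (1 / real N) ^ n * real N"
  proof (intro mult_mono mult_left_mono power_mono)
    show "\<bar>1 / (2 * real N)\<bar> \<le> 1 / real N" using N(1) by (simp add: field_simps)
    have "sqrt N \<le> sqrt ((real N)\<^sup>2)" using N(1) by (intro real_sqrt_le_mono) (simp add: power2_eq_square)
    then show "sqrt N \<le> real N" by simp
  qed (use D(1) in auto)
  finally show ?thesis .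
qed

theorem theorem3:
  fixes M :: "int^2^2" and l :: real
  assumes "det M = 1"
    and "l > 1"
    and "matrix_eigenvalue (real_matrix M) l"
    and "matrix_eigenvalue (real_matrix M) (inverse l)"
  shows "\<exists>U. open U \<and> to_torus 0 \<in> U \<and>
    (\<forall>\<nu>. smooth_torus \<nu> \<longrightarrow> closure {p. \<nu> p \<noteq> 0} \<subseteq> U \<longrightarrow>
         (\<forall>\<^sub>F p in nhds (to_torus 0). \<nu> p = 0) \<longrightarrow>
      (\<forall>n::nat. \<exists>C::real. \<forall>N W. N > 0 \<longrightarrow> even N \<longrightarrow>
         metaplectic (planck N) (real_matrix M) W \<longrightarrow>
         (SUP \<mu>\<in>spectrum_on (torus_states N) (torus_op N \<nu> \<circ> W). ereal (cmod \<mu>))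
           \<le> ereal (C * planck N ^ n)))"
proof -
  obtain U where U: "open U" "to_torus 0 \<in> U"
    "\<And>\<nu> :: torus \<Rightarrow> complex. closure {p. \<nu> p \<noteq> 0} \<subseteq> U \<Longrightarrow> (\<forall>\<^sub>F p in nhds (to_torus 0). \<nu> p = 0) \<Longrightarrow>
      \<exists>K>0. \<forall>p. \<exists>i<K. \<forall>\<^sub>F q in nhds (((\<lambda>p. real_matrix M *v p) ^^ i) p). \<nu> (to_torus q) = 0"
    by (rule orbit_leaves_support[OF assms]) blast
  have "\<exists>C::real. \<forall>N W. N > 0 \<longrightarrow> even N \<longrightarrow> metaplectic (planck N) (real_matrix M) W \<longrightarrow>
         (SUP \<mu>\<in>spectrum_on (torus_states N) (torus_op N \<nu> \<circ> W). ereal (cmod \<mu>)) \<le> ereal (C * planck N ^ n)"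
    if nu: "smooth_torus \<nu>" and supp: "closure {p. \<nu> p \<noteq> 0} \<subseteq> U" and zero: "\<forall>\<^sub>F p in nhds (to_torus 0). \<nu> p = 0"
    for \<nu> and n :: nat
  proof -
    obtain K where K: "K > 0"
      "\<And>p. \<exists>i<K. \<forall>\<^sub>F q in nhds (((\<lambda>p. real_matrix M *v p) ^^ i) p). \<nu> (to_torus q) = 0"
      using U(3)[OF supp zero] by blast
    obtain c where c: "rapid c" "\<And>z. \<nu> (to_torus z) = trig c (z $ 1, z $ 2)"
      by (rule torus_fourier_series[OF nu]) blast
    have van: "vanishing K (\<lambda>i k. c ((dual_map M ^^ i) k))"
      by (rule vanishing_orbit[where \<nu> = \<nu>, OF assms(1) c(1) K(1) c(2) K(2)])
    obtain D where D: "D \<ge> 0" "\<And>t g B. (\<And>j. norm (g j) \<le> B) \<Longrightarrow>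
      norm (\<Sum>\<^sub>\<infinity>k\<in>tuples K. (wave (of_int (phase K k) * t) * (\<Prod>i<K. c ((dual_map M ^^ i) (k i)))) * g (\<Sum>i<K. k i)) \<le> D * \<bar>t\<bar> ^ (K * n + 1) * B"
      \<comment> \<open>The additional power absorbs the factor \<open>N\<close> lost between the norms.\<close>
      by (rule phase_sum_small[OF van, where n = "K * n + 1"]) blast
    \<comment> \<open>Replacing \<open>D\<close> by \<open>E \<ge> 1\<close> lets the \<open>K\<close>-th root be taken without roots of constants.\<close>
    define E where "E = max 1 D"
    show ?thesis
    proof (intro exI allI impI)
      fix N W assume N: "N > 0" "even N" and W: "metaplectic (planck N) (real_matrix M) W"
      show "(SUP \<mu>\<in>spectrum_on (torus_states N) (torus_op N \<nu> \<circ> W). ereal (cmod \<mu>)) \<le> ereal (E * (2 * pi) ^ n * planck N ^ n)"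
      proof (rule SUP_least)
        fix \<mu> assume mu: "\<mu> \<in> spectrum_on (torus_states N) (torus_op N \<nu> \<circ> W)"
        have "norm \<mu> ^ K \<le> D * (1 / real N) ^ (K * n + 1) * real N"
          by (rule eigenvalue_bound[where \<nu> = \<nu>, OF W N assms(1) c mu D])
        also have "\<dots> = D * (1 / real N) ^ (K * n)" using N(1) by simp
        also have "\<dots> \<le> E ^ K * (1 / real N) ^ (K * n)"
        proof (intro mult_right_mono)
          have "D \<le> E ^ 1" by (simp add: E_def)
          also have "\<dots> \<le> E ^ K" using K(1) by (intro power_increasing) (auto simp: E_def)
          finally show "D \<le> E ^ K" .
        qed simp
        also have "\<dots> = (E * (1 / real N) ^ n) ^ K"
          by (simp only: power_mult_distrib power_mult[symmetric] mult.commute[of n K])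
        finally have "norm \<mu> ^ K \<le> (E * (1 / real N) ^ n) ^ K" .
        then have "norm \<mu> \<le> E * (1 / real N) ^ n"
          by (rule power_le_imp_le_base[of _ "K - 1", unfolded Suc_diff_1[OF K(1)]]) (simp add: E_def)
        also have "\<dots> = E * (2 * pi) ^ n * planck N ^ n"
          by (simp add: planck_def power_divide power_mult_distrib field_simps)
        finally show "ereal (cmod \<mu>) \<le> ereal (E * (2 * pi) ^ n * planck N ^ n)" by simp
      qed
    qed
  qed
  then show ?thesis using U(1,2) by (intro exI[of _ U]) blast
qed

end
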